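(* Let $k$ be a field, let $C$ be a $k$-coalgebra, let $A/B$ be a $C$-Galois extension of $k$-algebras, and let $(A,C,\psi)$ be the corresponding canonical entwining structure. Then $H_\psi^0(A,-)\cong H^0(B,-)$ as functors on the category of $A$-bimodules. Moreover, if $A$ is flat as a left $B$-module or flat as a right $B$-module, then $H_\psi^\bullet(A,-)\cong H^\bullet(B,-)$ as $\partial$-functors on the category of $A$-bimodules. Here $H_\psi^\bullet(A,-)$ is the entwined cohomology of $(A,C,\psi)$ and $H^\bullet(B,-)$ is the Hochschild cohomology of $B$, evaluated on an $A$-bimodule by regarding it as a $B$-bimodule by restriction.
   Context: Fix a field $k$. All spaces, algebras and coalgebras are over $k$; algebras are associative and unital, coalgebras are coassociative and counital; unadorned tensor products are over $k$. For an algebra $R$, $R^e=R\otimes R^{\mathrm{op}}$, and $R$-bimodules (with the two actions of $k$ agreeing) are identified with $R^e$-modules. Write $\Delta(c)=c_1\otimes c_2$ and $\varepsilon$ for the comultiplication and counit of a coalgebra $C$, and $a\mapsto a_0\otimes a_1$ for a right $C$-coaction $A\to A\otimes C$ (implicit sums). **Entwining structure.** A triple $(A,C,\psi)$ with $A$ an algebra, $C$ a coalgebra and $\psi:C\otimes A\to A\otimes C$ a linear map, written $\psi(c\otimes a)=a_\alpha\otimes c^\alpha$ (implicit sum; different Greek indices denote successive applications of $\psi$), such that for all $a,a'\in A$, $c\in C$: $(aa')_\alpha\otimes c^\alpha=a_\alpha a'_\beta\otimes c^{\alpha\beta}$; $\ 1_\alpha\otimes c^\alpha=1\otimes c$; $\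 a_\alpha\otimes (c^\alpha)_1\otimes (c^\alpha)_2=a_{\beta\alpha}\otimes (c_1)^\alpha\otimes (c_2)^\beta$; $\ a_\alpha\varepsilon(c^\alpha)=a\,\varepsilon(c)$. **$C$-Galois extension.** Let $C$ be a coalgebra and let $A$ be an algebra which is a right $C$-comodule. Put $B=\{b\in A:(ba)_0\otimes(ba)_1=ba_0\otimes a_1\text{ for all }a\in A\}$, a subalgebra of $A$. There is a linear map $\beta:A\otimes_BA\to A\otimes C$ with $\beta(a\otimes a')=aa'_0\otimes a'_1$. One says that $A/B$ is a $C$-Galois extension if $\beta$ is bijective. **Canonical entwining structure.** If $A/B$ is a $C$-Galois extension, let $\gamma:C\to A\otimes_BA$ be the unique linear map with $\beta(\gamma(c))=1\otimes c$ for all $c\in C$, and write $\gamma(c)=l(c)\otimes r(c)$ (implicit sum). The corresponding entwining structure is $(A,C,\psi)$ with $\psi(c\otimes a)=\beta(\gamma(c)a)=l(c)(r(c)a)_0\otimes(r(c)a)_1$. **Bimodule structure on $A\otimes C$.** For an entwining structure $(A,C,\psi)$, the space $A\otimes C$ is an $A$-bimodule with left action $\lambda\cdot(a\otimes c)=\lambda a\otimes c$ and right action $(a\otimes c)\cdot\rho=a\cdot\psi(c\otimes\rho)=a\rho_\alpha\otimes c^\alpha$, for $a,\lambda,\rho\in A$, $c\in C$. **Entwined cohomology.** Let $\mathrm{Bar}_\bullet(A)$ be the usual Hochschild (bar) resolution of $A$ as an $A$-bimodule, with $\mathrm{Bar}_n(A)=A^{\otimes(n+2)}$, and let $\mathrm{Bar}^\psi_\bullet(A)=(A\otimes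 C)\otimes_A\mathrm{Bar}_\bullet(A)$, a complex of $A$-bimodules. For an $A$-bimodule $M$, $H_\psi^\bullet(A,M)$ is the cohomology of the cochain complex $\mathrm{Hom}_{A^e}(\mathrm{Bar}^\psi_\bullet(A),M)$. **Hochschild cohomology.** For a $B$-bimodule $M$, $H^\bullet(B,M)=\mathrm{Ext}^\bullet_{B^e}(B,M)$. An isomorphism of $\partial$-functors is a family of natural isomorphisms, one in each degree, compatible with the connecting homomorphisms of the long exact sequences associated to short exact sequences of $A$-bimodules. *)

theory Defs
  imports "HOL-Algebra.Free_Abelian_Groups" "HOL-Algebra.Generated_Groups"
    "HOL-Algebra.AbelCoset" "HOL-Algebra.Module"
begin

section \<open>Algebras, modules and bimodules over a field\<close>

text \<open>
  A \<open>k\<close>-vector space is a record \<open>V\<close> with \<open>module K V\<close>; the fields \<open>mult\<close> and \<open>one\<close> of \<open>V\<close> play no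
  role. An associative unital \<open>k\<close>-algebra uses the same record type, with \<open>mult\<close> and \<open>one\<close>
  (the library's locale \<open>algebra\<close> is restricted to commutative algebras).
\<close>

definition k_algebra :: "('k, 'z) ring_scheme \<Rightarrow> ('k, 'a, 'y) module_scheme \<Rightarrow> bool" where
  "k_algebra K A \<longleftrightarrow> module K A \<and> ring A \<and>
     (\<forall>c\<in>carrier K. \<forall>x\<in>carrier A. \<forall>y\<in>carrier A.
        c \<odot>\<^bsub>A\<^esub> (x \<otimes>\<^bsub>A\<^esub> y) = (c \<odot>\<^bsub>A\<^esub> x) \<otimes>\<^bsub>A\<^esub> y \<and>
        c \<odot>\<^bsub>A\<^esub> (x \<otimes>\<^bsub>A\<^esub> y) = x \<otimes>\<^bsub>A\<^esub> (c \<odot>\<^bsub>A\<^esub> y))"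

definition k_linear ::
  "('k, 'z) ring_scheme \<Rightarrow> ('k, 'v, 'x) module_scheme \<Rightarrow> ('k, 'w, 'y) module_scheme \<Rightarrow> ('v \<Rightarrow> 'w) set"
where
  "k_linear K V W = {f \<in> carrier V \<rightarrow> carrier W.
     (\<forall>x\<in>carrier V. \<forall>y\<in>carrier V. f (x \<oplus>\<^bsub>V\<^esub> y) = f x \<oplus>\<^bsub>W\<^esub> f y) \<and>
     (\<forall>c\<in>carrier K. \<forall>x\<in>carrier V. f (c \<odot>\<^bsub>V\<^esub> x) = c \<odot>\<^bsub>W\<^esub> f x)}"

text \<open>
  A bimodule carries a left action of an algebra with elements of type \<open>'r\<close> and a right action of
  an algebra with elements of type \<open>'s\<close>. The acting algebras are not stored in the record, so
  restriction along a subalgebra leaves the record unchanged. One-sided modules use the same record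
  type and ignore the other action.
\<close>

record ('k, 'r, 's, 'm) bimod = "('k, 'm) module" +
  lact :: "'r \<Rightarrow> 'm \<Rightarrow> 'm"
  ract :: "'m \<Rightarrow> 's \<Rightarrow> 'm"

definition left_module ::
  "('k, 'z) ring_scheme \<Rightarrow> ('k, 'r, 'y) module_scheme \<Rightarrow> ('k, 'r, 's, 'm) bimod \<Rightarrow> bool"
where
  "left_module K R M \<longleftrightarrow> module K M \<and>
     (\<forall>r\<in>carrier R. \<forall>x\<in>carrier M. lact M r x \<in> carrier M) \<and>
     (\<forall>r\<in>carrier R. \<forall>x\<in>carrier M. \<forall>y\<in>carrier M.
        lact M r (x \<oplus>\<^bsub>M\<^esub> y) = lact M r x \<oplus>\<^bsub>M\<^esub> lact M r y) \<and>
     (\<forall>r\<in>carrier R. \<forall>s\<in>carrier R. \<forall>x\<in>carrier M.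
        lact M (r \<oplus>\<^bsub>R\<^esub> s) x = lact M r x \<oplus>\<^bsub>M\<^esub> lact M s x) \<and>
     (\<forall>r\<in>carrier R. \<forall>s\<in>carrier R. \<forall>x\<in>carrier M.
        lact M (r \<otimes>\<^bsub>R\<^esub> s) x = lact M r (lact M s x)) \<and>
     (\<forall>x\<in>carrier M. lact M \<one>\<^bsub>R\<^esub> x = x) \<and>
     (\<forall>c\<in>carrier K. \<forall>x\<in>carrier M. lact M (c \<odot>\<^bsub>R\<^esub> \<one>\<^bsub>R\<^esub>) x = c \<odot>\<^bsub>M\<^esub> x)"

definition right_module ::
  "('k, 'z) ring_scheme \<Rightarrow> ('k, 's, 'y) module_scheme \<Rightarrow> ('k, 'r, 's, 'm) bimod \<Rightarrow> bool"
where
  "right_module K S M \<longleftrightarrow> module K M \<and>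
     (\<forall>s\<in>carrier S. \<forall>x\<in>carrier M. ract M x s \<in> carrier M) \<and>
     (\<forall>s\<in>carrier S. \<forall>x\<in>carrier M. \<forall>y\<in>carrier M.
        ract M (x \<oplus>\<^bsub>M\<^esub> y) s = ract M x s \<oplus>\<^bsub>M\<^esub> ract M y s) \<and>
     (\<forall>r\<in>carrier S. \<forall>s\<in>carrier S. \<forall>x\<in>carrier M.
        ract M x (r \<oplus>\<^bsub>S\<^esub> s) = ract M x r \<oplus>\<^bsub>M\<^esub> ract M x s) \<and>
     (\<forall>r\<in>carrier S. \<forall>s\<in>carrier S. \<forall>x\<in>carrier M.
        ract M x (r \<otimes>\<^bsub>S\<^esub> s) = ract M (ract M x r) s) \<and>
     (\<forall>x\<in>carrier M. ract M x \<one>\<^bsub>S\<^esub> = x) \<and>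
     (\<forall>c\<in>carrier K. \<forall>x\<in>carrier M. ract M x (c \<odot>\<^bsub>S\<^esub> \<one>\<^bsub>S\<^esub>) = c \<odot>\<^bsub>M\<^esub> x)"

definition bimodule ::
  "('k, 'z) ring_scheme \<Rightarrow> ('k, 'a, 'y) module_scheme \<Rightarrow> ('k, 'a, 'a, 'm) bimod \<Rightarrow> bool"
where
  "bimodule K R M \<longleftrightarrow> left_module K R M \<and> right_module K R M \<and>
     (\<forall>r\<in>carrier R. \<forall>s\<in>carrier R. \<forall>x\<in>carrier M.
        ract M (lact M r x) s = lact M r (ract M x s))"

definition left_hom ::
  "('k, 'r, 'y) module_scheme \<Rightarrow> ('k, 'r, 's, 'm) bimod \<Rightarrow> ('k, 'r, 't, 'n) bimod \<Rightarrow> ('m \<Rightarrow> 'n) set"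
where
  "left_hom R M N = {f \<in> carrier M \<rightarrow> carrier N.
     (\<forall>x\<in>carrier M. \<forall>y\<in>carrier M. f (x \<oplus>\<^bsub>M\<^esub> y) = f x \<oplus>\<^bsub>N\<^esub> f y) \<and>
     (\<forall>r\<in>carrier R. \<forall>x\<in>carrier M. f (lact M r x) = lact N r (f x))}"

definition right_hom ::
  "('k, 's, 'y) module_scheme \<Rightarrow> ('k, 'r, 's, 'm) bimod \<Rightarrow> ('k, 't, 's, 'n) bimod \<Rightarrow> ('m \<Rightarrow> 'n) set"
where
  "right_hom S M N = {f \<in> carrier M \<rightarrow> carrier N.
     (\<forall>x\<in>carrier M. \<forall>y\<in>carrier M. f (x \<oplus>\<^bsub>M\<^esub> y) = f x \<oplus>\<^bsub>N\<^esub> f y) \<and>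
     (\<forall>s\<in>carrier S. \<forall>x\<in>carrier M. f (ract M x s) = ract N (f x) s)}"

definition bimod_hom ::
  "('k, 'a, 'y) module_scheme \<Rightarrow> ('k, 'a, 'a, 'm) bimod \<Rightarrow> ('k, 'a, 'a, 'n) bimod \<Rightarrow> ('m \<Rightarrow> 'n) set"
where
  "bimod_hom R M N = left_hom R M N \<inter> right_hom R M N"

definition short_exact ::
  "('k, 'a, 'y) module_scheme \<Rightarrow> ('k, 'a, 'a, 'l) bimod \<Rightarrow> ('l \<Rightarrow> 'm) \<Rightarrow>
   ('k, 'a, 'a, 'm) bimod \<Rightarrow> ('m \<Rightarrow> 'n) \<Rightarrow> ('k, 'a, 'a, 'n) bimod \<Rightarrow> bool"
where
  "short_exact R L f M g N \<longleftrightarrow> f \<in> bimod_hom R L M \<and> g \<in> bimod_hom R M N \<and>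
     inj_on f (carrier L) \<and> f ` carrier L = {x \<in> carrier M. g x = \<zero>\<^bsub>N\<^esub>} \<and>
     g ` carrier M = carrier N"

definition make_bimod ::
  "('m, 'z) ring_scheme \<Rightarrow> ('k \<Rightarrow> 'm \<Rightarrow> 'm) \<Rightarrow> ('r \<Rightarrow> 'm \<Rightarrow> 'm) \<Rightarrow> ('m \<Rightarrow> 's \<Rightarrow> 'm) \<Rightarrow> ('k, 'r, 's, 'm) bimod"
where
  "make_bimod G sm l r =
     \<lparr>carrier = carrier G, mult = mult G, one = one G, zero = zero G, add = add G,
      smult = sm, lact = l, ract = r\<rparr>"

text \<open>An algebra as a bimodule over itself, an algebra \<open>A\<close> as an \<open>A\<close>-\<open>k\<close>-bimodule, and a vector
  space as a \<open>k\<close>-\<open>k\<close>-bimodule.\<close>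

definition regular :: "('k, 'a, 'y) module_scheme \<Rightarrow> ('k, 'a, 'a, 'a) bimod" where
  "regular A = make_bimod A (smult A) (mult A) (mult A)"

definition left_regular :: "('k, 'a, 'y) module_scheme \<Rightarrow> ('k, 'a, 'k, 'a) bimod" where
  "left_regular A = make_bimod A (smult A) (mult A) (\<lambda>x c. c \<odot>\<^bsub>A\<^esub> x)"

definition k_bimod :: "('k, 'v, 'y) module_scheme \<Rightarrow> ('k, 'k, 'k, 'v) bimod" where
  "k_bimod V = make_bimod V (smult V) (smult V) (\<lambda>x c. c \<odot>\<^bsub>V\<^esub> x)"


section \<open>Tensor products\<close>

text \<open>
  The abelian group with generators \<open>S\<close> and relators \<open>R\<close>, written additively; \<open>gen S R g\<close> is the
  class of the generator \<open>g\<close>, and \<open>lift_hom H \<phi>\<close> is the homomorphism to \<open>H\<close> with \<open>gen S R g \<mapsto> \<phi> g\<close>,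
  evaluated on a representative (so it is meaningful when \<open>\<phi>\<close> respects the relators).
\<close>

definition presented_group :: "'g set \<Rightarrow> ('g \<Rightarrow>\<^sub>0 int) set \<Rightarrow> ('g \<Rightarrow>\<^sub>0 int) set ring" where
  "presented_group S R =
     (let Q = free_Abelian_group S Mod generate (free_Abelian_group S) R
      in \<lparr>carrier = carrier Q, mult = undefined, one = undefined, zero = \<one>\<^bsub>Q\<^esub>, add = mult Q\<rparr>)"

definition gen :: "'g set \<Rightarrow> ('g \<Rightarrow>\<^sub>0 int) set \<Rightarrow> 'g \<Rightarrow> ('g \<Rightarrow>\<^sub>0 int) set" where
  "gen S R g = generate (free_Abelian_group S) R #>\<^bsub>free_Abelian_group S\<^esub> frag_of g"

definition lift_hom :: "('h, 'z) ring_scheme \<Rightarrow> ('g \<Rightarrow> 'h) \<Rightarrow> ('g \<Rightarrow>\<^sub>0 int) set \<Rightarrow> 'h" where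
  "lift_hom H \<phi> t = (let p = (SOME p. p \<in> t)
     in finsum H (\<lambda>g. add_pow H (Poly_Mapping.lookup p g) (\<phi> g)) (Poly_Mapping.keys p))"

text \<open>The tensor product \<open>X \<otimes>\<^sub>S Y\<close> over an algebra with carrier \<open>S\<close>; it keeps the left action on \<open>X\<close>
  and the right action on \<open>Y\<close>. Here \<open>S = carrier K\<close> gives \<open>X \<otimes>\<^sub>k Y\<close>.\<close>

definition tensor_rels ::
  "'s set \<Rightarrow> ('k, 'r, 's, 'x) bimod \<Rightarrow> ('k, 's, 't, 'y) bimod \<Rightarrow> ('x \<times> 'y \<Rightarrow>\<^sub>0 int) set"
where
  "tensor_rels S X Y =
     {frag_of (x \<oplus>\<^bsub>X\<^esub> x', y) - frag_of (x, y) - frag_of (x', y) | x x' y.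
        x \<in> carrier X \<and> x' \<in> carrier X \<and> y \<in> carrier Y} \<union>
     {frag_of (x, y \<oplus>\<^bsub>Y\<^esub> y') - frag_of (x, y) - frag_of (x, y') | x y y'.
        x \<in> carrier X \<and> y \<in> carrier Y \<and> y' \<in> carrier Y} \<union>
     {frag_of (ract X x s, y) - frag_of (x, lact Y s y) | x s y.
        x \<in> carrier X \<and> s \<in> S \<and> y \<in> carrier Y}"

definition ptens ::
  "'s set \<Rightarrow> ('k, 'r, 's, 'x) bimod \<Rightarrow> ('k, 's, 't, 'y) bimod \<Rightarrow> 'x \<Rightarrow> 'y \<Rightarrow> ('x \<times> 'y \<Rightarrow>\<^sub>0 int) set"
where
  "ptens S X Y x y = gen (carrier X \<times> carrier Y) (tensor_rels S X Y) (x, y)"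

definition tensor ::
  "'s set \<Rightarrow> ('k, 'r, 's, 'x) bimod \<Rightarrow> ('k, 's, 't, 'y) bimod \<Rightarrow>
   ('k, 'r, 't, ('x \<times> 'y \<Rightarrow>\<^sub>0 int) set) bimod"
where
  "tensor S X Y =
     (let G = presented_group (carrier X \<times> carrier Y) (tensor_rels S X Y)
      in make_bimod G
        (\<lambda>c. lift_hom G (\<lambda>(x, y). ptens S X Y (c \<odot>\<^bsub>X\<^esub> x) y))
        (\<lambda>r. lift_hom G (\<lambda>(x, y). ptens S X Y (lact X r x) y))
        (\<lambda>t r. lift_hom G (\<lambda>(x, y). ptens S X Y x (ract Y y r)) t))"

definition tensor_map ::
  "'s set \<Rightarrow> ('k, 'r, 's, 'x) bimod \<Rightarrow> ('k, 's, 't, 'y) bimod \<Rightarrow> ('u \<Rightarrow> 'x) \<Rightarrow> ('v \<Rightarrow> 'y) \<Rightarrow>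
   ('u \<times> 'v \<Rightarrow>\<^sub>0 int) set \<Rightarrow> ('x \<times> 'y \<Rightarrow>\<^sub>0 int) set"
where
  "tensor_map S X Y f g = lift_hom (tensor S X Y) (\<lambda>(u, v). ptens S X Y (f u) (g v))"

text \<open>\<open>X \<otimes>\<^sub>k (Y \<otimes>\<^sub>k Z) \<rightarrow> (X \<otimes>\<^sub>k Y) \<otimes>\<^sub>k Z\<close>\<close>

definition tensor_assoc ::
  "('k, 'z) ring_scheme \<Rightarrow> ('k, 'r, 'k, 'x) bimod \<Rightarrow> ('k, 'k, 'k, 'y) bimod \<Rightarrow> ('k, 'k, 't, 'w) bimod \<Rightarrow>
   ('x \<times> ('y \<times> 'w \<Rightarrow>\<^sub>0 int) set \<Rightarrow>\<^sub>0 int) set \<Rightarrow> (('x \<times> 'y \<Rightarrow>\<^sub>0 int) set \<times> 'w \<Rightarrow>\<^sub>0 int) set"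
where
  "tensor_assoc K X Y Z =
     (let XY = tensor (carrier K) X Y; T = tensor (carrier K) XY Z
      in lift_hom T (\<lambda>(x, u). lift_hom T (\<lambda>(y, z).
           ptens (carrier K) XY Z (ptens (carrier K) X Y x y) z) u))"


section \<open>Flat modules\<close>

text \<open>
  HOL does not quantify over types inside a definition, so the test modules are those carried by
  subsets of the type \<open>'n\<close>. If every left (resp. right) ideal of \<open>R\<close> is isomorphic to a module
  carried by such a subset, then by the ideal criterion this is flatness with respect to all modules.
\<close>

definition right_flat ::
  "'n itself \<Rightarrow> ('k, 'z) ring_scheme \<Rightarrow> ('k, 'r) module \<Rightarrow> ('k, 'l, 'r, 'x) bimod \<Rightarrow> bool"
where
  "right_flat _ K R X \<longleftrightarrow> right_module K R X \<and>
     (\<forall>(N :: ('k, 'r, 'r, 'n) bimod) (N' :: ('k, 'r, 'r, 'n) bimod) f.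
        left_module K R N \<and> left_module K R N' \<and> f \<in> left_hom R N N' \<and> inj_on f (carrier N) \<longrightarrow>
        inj_on (tensor_map (carrier R) X N' id f) (carrier (tensor (carrier R) X N)))"

definition left_flat ::
  "'n itself \<Rightarrow> ('k, 'z) ring_scheme \<Rightarrow> ('k, 'r) module \<Rightarrow> ('k, 'r, 'l, 'x) bimod \<Rightarrow> bool"
where
  "left_flat _ K R X \<longleftrightarrow> left_module K R X \<and>
     (\<forall>(N :: ('k, 'r, 'r, 'n) bimod) (N' :: ('k, 'r, 'r, 'n) bimod) f.
        right_module K R N \<and> right_module K R N' \<and> f \<in> right_hom R N N' \<and> inj_on f (carrier N) \<longrightarrow>
        inj_on (tensor_map (carrier R) N' X f id) (carrier (tensor (carrier R) N X)))"


section \<open>Galois extensions by a coalgebra\<close>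

record ('k, 'c) coalg = "('k, 'c) module" +
  comult :: "'c \<Rightarrow> ('c \<times> 'c \<Rightarrow>\<^sub>0 int) set"
  counit :: "'c \<Rightarrow> 'k"

definition coalgebra :: "('k, 'z) ring_scheme \<Rightarrow> ('k, 'c) coalg \<Rightarrow> bool" where
  "coalgebra K C \<longleftrightarrow>
     (let V = k_bimod C; VV = tensor (carrier K) V V
      in module K C \<and>
         comult C \<in> k_linear K C VV \<and>
         counit C \<in> carrier C \<rightarrow> carrier K \<and>
         (\<forall>x\<in>carrier C. \<forall>y\<in>carrier C. counit C (x \<oplus>\<^bsub>C\<^esub> y) = counit C x \<oplus>\<^bsub>K\<^esub> counit C y) \<and>
         (\<forall>a\<in>carrier K. \<forall>x\<in>carrier C. counit C (a \<odot>\<^bsub>C\<^esub> x) = a \<otimes>\<^bsub>K\<^esub> counit C x) \<and>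
         (\<forall>x\<in>carrier C.
            tensor_map (carrier K) VV V (comult C) id (comult C x) =
            tensor_assoc K V V V (tensor_map (carrier K) V VV id (comult C) (comult C x))) \<and>
         (\<forall>x\<in>carrier C.
            lift_hom C (\<lambda>(u, v). counit C u \<odot>\<^bsub>C\<^esub> v) (comult C x) = x \<and>
            lift_hom C (\<lambda>(u, v). counit C v \<odot>\<^bsub>C\<^esub> u) (comult C x) = x))"

text \<open>\<open>A \<otimes>\<^sub>k C\<close> with its left \<open>A\<close>-action, for an algebra \<open>A\<close>.\<close>

definition algcoalg ::
  "('k, 'z) ring_scheme \<Rightarrow> ('k, 'a) module \<Rightarrow> ('k, 'c) coalg \<Rightarrow> ('k, 'a, 'k, ('a \<times> 'c \<Rightarrow>\<^sub>0 int) set) bimod"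
where
  "algcoalg K A C = tensor (carrier K) (left_regular A) (k_bimod C)"

abbreviation algcoalg_ptens ::
  "('k, 'z) ring_scheme \<Rightarrow> ('k, 'a) module \<Rightarrow> ('k, 'c) coalg \<Rightarrow> 'a \<Rightarrow> 'c \<Rightarrow> ('a \<times> 'c \<Rightarrow>\<^sub>0 int) set"
where
  "algcoalg_ptens K A C \<equiv> ptens (carrier K) (left_regular A) (k_bimod C)"

definition right_comodule ::
  "('k, 'z) ring_scheme \<Rightarrow> ('k, 'c) coalg \<Rightarrow> ('k, 'a) module \<Rightarrow> ('a \<Rightarrow> ('a \<times> 'c \<Rightarrow>\<^sub>0 int) set) \<Rightarrow> bool"
where
  "right_comodule K C A \<rho> \<longleftrightarrow>
     (let V = k_bimod C
      in module K A \<and>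
         \<rho> \<in> k_linear K A (algcoalg K A C) \<and>
         (\<forall>a\<in>carrier A.
            tensor_map (carrier K) (algcoalg K A C) V \<rho> id (\<rho> a) =
            tensor_assoc K (left_regular A) V V
              (tensor_map (carrier K) (left_regular A) (tensor (carrier K) V V) id (comult C) (\<rho> a))) \<and>
         (\<forall>a\<in>carrier A. lift_hom A (\<lambda>(x, c). counit C c \<odot>\<^bsub>A\<^esub> x) (\<rho> a) = a))"

definition coinvariants ::
  "('k, 'z) ring_scheme \<Rightarrow> ('k, 'c) coalg \<Rightarrow> ('k, 'a) module \<Rightarrow> ('a \<Rightarrow> ('a \<times> 'c \<Rightarrow>\<^sub>0 int) set) \<Rightarrow>
   ('k, 'a) module"
where
  "coinvariants K C A \<rho> = A\<lparr>carrier :=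
     {b \<in> carrier A. \<forall>a\<in>carrier A. \<rho> (b \<otimes>\<^bsub>A\<^esub> a) = lact (algcoalg K A C) b (\<rho> a)}\<rparr>"

text \<open>The map \<open>A \<otimes>\<^sub>B A \<rightarrow> A \<otimes> C\<close>, \<open>a \<otimes> a' \<mapsto> a a'\<^sub>0 \<otimes> a'\<^sub>1\<close>; it does not mention \<open>B\<close>,
  which only enters through the domain.\<close>

definition galois_map ::
  "('k, 'z) ring_scheme \<Rightarrow> ('k, 'c) coalg \<Rightarrow> ('k, 'a) module \<Rightarrow> ('a \<Rightarrow> ('a \<times> 'c \<Rightarrow>\<^sub>0 int) set) \<Rightarrow>
   ('a \<times> 'a \<Rightarrow>\<^sub>0 int) set \<Rightarrow> ('a \<times> 'c \<Rightarrow>\<^sub>0 int) set"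
where
  "galois_map K C A \<rho> = lift_hom (algcoalg K A C) (\<lambda>(a, a'). lact (algcoalg K A C) a (\<rho> a'))"

definition galois_extension ::
  "('k, 'z) ring_scheme \<Rightarrow> ('k, 'c) coalg \<Rightarrow> ('k, 'a) module \<Rightarrow> ('a \<Rightarrow> ('a \<times> 'c \<Rightarrow>\<^sub>0 int) set) \<Rightarrow>
   ('k, 'a) module \<Rightarrow> bool"
where
  "galois_extension K C A \<rho> B \<longleftrightarrow> k_algebra K A \<and> right_comodule K C A \<rho> \<and>
     B = coinvariants K C A \<rho> \<and>
     bij_betw (galois_map K C A \<rho>)
       (carrier (tensor (carrier B) (regular A) (regular A))) (carrier (algcoalg K A C))"

definition translation_map ::
  "('k, 'z) ring_scheme \<Rightarrow> ('k, 'c) coalg \<Rightarrow> ('k, 'a) module \<Rightarrow> ('a \<Rightarrow> ('a \<times> 'c \<Rightarrow>\<^sub>0 int) set) \<Rightarrow>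
   ('k, 'a) module \<Rightarrow> 'c \<Rightarrow> ('a \<times> 'a \<Rightarrow>\<^sub>0 int) set"
where
  "translation_map K C A \<rho> B c =
     (THE t. t \<in> carrier (tensor (carrier B) (regular A) (regular A)) \<and>
        galois_map K C A \<rho> t = algcoalg_ptens K A C \<one>\<^bsub>A\<^esub> c)"

definition canonical_entwining ::
  "('k, 'z) ring_scheme \<Rightarrow> ('k, 'c) coalg \<Rightarrow> ('k, 'a) module \<Rightarrow> ('a \<Rightarrow> ('a \<times> 'c \<Rightarrow>\<^sub>0 int) set) \<Rightarrow>
   ('k, 'a) module \<Rightarrow> ('c \<times> 'a \<Rightarrow>\<^sub>0 int) set \<Rightarrow> ('a \<times> 'c \<Rightarrow>\<^sub>0 int) set"
where
  "canonical_entwining K C A \<rho> B = lift_hom (algcoalg K A C)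
     (\<lambda>(c, a). galois_map K C A \<rho>
        (ract (tensor (carrier B) (regular A) (regular A)) (translation_map K C A \<rho> B c) a))"


section \<open>Cohomology of Hom complexes\<close>

text \<open>
  \<open>X\<close> with differentials \<open>d n\<close> from \<open>X (Suc n)\<close> to \<open>X n\<close> is a complex of \<open>R\<close>-bimodules. Cochains
  with values in \<open>M\<close> are \<open>R\<close>-bimodule homomorphisms, made extensional so that equal maps are equal
  functions.
\<close>

definition cochains ::
  "('k, 'a) module \<Rightarrow> (nat \<Rightarrow> ('k, 'a, 'a, 'x) bimod) \<Rightarrow> ('k, 'a, 'a, 'm) bimod \<Rightarrow> nat \<Rightarrow>
   ('k, 'x \<Rightarrow> 'm) module"
where
  "cochains R X M n =
     \<lparr>carrier = bimod_hom R (X n) M \<inter> extensional (carrier (X n)),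
      mult = undefined, one = undefined,
      zero = (\<lambda>x\<in>carrier (X n). \<zero>\<^bsub>M\<^esub>),
      add = (\<lambda>f g. \<lambda>x\<in>carrier (X n). f x \<oplus>\<^bsub>M\<^esub> g x),
      smult = (\<lambda>c f. \<lambda>x\<in>carrier (X n). c \<odot>\<^bsub>M\<^esub> f x)\<rparr>"

definition codiff ::
  "(nat \<Rightarrow> ('k, 'a, 'a, 'x) bimod) \<Rightarrow> (nat \<Rightarrow> 'x \<Rightarrow> 'x) \<Rightarrow> nat \<Rightarrow> ('x \<Rightarrow> 'm) \<Rightarrow> ('x \<Rightarrow> 'm)"
where
  "codiff X d n f = compose (carrier (X (Suc n))) f (d n)"

definition cocycles ::
  "('k, 'a) module \<Rightarrow> (nat \<Rightarrow> ('k, 'a, 'a, 'x) bimod) \<Rightarrow> (nat \<Rightarrow> 'x \<Rightarrow> 'x) \<Rightarrow>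
   ('k, 'a, 'a, 'm) bimod \<Rightarrow> nat \<Rightarrow> ('k, 'x \<Rightarrow> 'm) module"
where
  "cocycles R X d M n = (cochains R X M n)\<lparr>carrier :=
     {f \<in> carrier (cochains R X M n). codiff X d n f = \<zero>\<^bsub>cochains R X M (Suc n)\<^esub>}\<rparr>"

definition coboundaries ::
  "('k, 'a) module \<Rightarrow> (nat \<Rightarrow> ('k, 'a, 'a, 'x) bimod) \<Rightarrow> (nat \<Rightarrow> 'x \<Rightarrow> 'x) \<Rightarrow>
   ('k, 'a, 'a, 'm) bimod \<Rightarrow> nat \<Rightarrow> ('x \<Rightarrow> 'm) set"
where
  "coboundaries R X d M n = (case n of
     0 \<Rightarrow> {\<zero>\<^bsub>cochains R X M 0\<^esub>}
   | Suc m \<Rightarrow> codiff X d m ` carrier (cochains R X M m))"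

definition cohomology ::
  "('k, 'a) module \<Rightarrow> (nat \<Rightarrow> ('k, 'a, 'a, 'x) bimod) \<Rightarrow> (nat \<Rightarrow> 'x \<Rightarrow> 'x) \<Rightarrow> nat \<Rightarrow>
   ('k, 'a, 'a, 'm) bimod \<Rightarrow> ('k, ('x \<Rightarrow> 'm) set) module"
where
  "cohomology R X d n M =
     (let Z = cocycles R X d M n; D = coboundaries R X d M n
      in \<lparr>carrier = a_rcosets\<^bsub>Z\<^esub> D, mult = undefined, one = undefined, zero = D, add = set_add Z,
          smult = (\<lambda>c \<xi>. \<Union>z\<in>\<xi>. D +>\<^bsub>Z\<^esub> (c \<odot>\<^bsub>Z\<^esub> z))\<rparr>)"

definition cohomology_map ::
  "('k, 'a) module \<Rightarrow> (nat \<Rightarrow> ('k, 'a, 'a, 'x) bimod) \<Rightarrow> (nat \<Rightarrow> 'x \<Rightarrow> 'x) \<Rightarrow> nat \<Rightarrow>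
   ('k, 'a, 'a, 'm) bimod \<Rightarrow> ('k, 'a, 'a, 'n) bimod \<Rightarrow> ('m \<Rightarrow> 'n) \<Rightarrow> ('x \<Rightarrow> 'm) set \<Rightarrow> ('x \<Rightarrow> 'n) set"
where
  "cohomology_map R X d n M N f \<xi> =
     (\<Union>z\<in>\<xi>. coboundaries R X d N n +>\<^bsub>cocycles R X d N n\<^esub> compose (carrier (X n)) f z)"

text \<open>
  The connecting map \<open>H\<^sup>n(N) \<rightarrow> H\<^sup>n\<^sup>+\<^sup>1(L)\<close> of \<open>0 \<rightarrow> L \<rightarrow> M \<rightarrow> N \<rightarrow> 0\<close>: the set of all cocycles \<open>w\<close> produced by
  some lift \<open>u\<close> of some representative of \<open>\<xi>\<close>. When the rows \<open>Hom(X\<^sub>n, -)\<close> are exact, this set is exactly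
  one cohomology class.
\<close>

definition connecting ::
  "('k, 'a) module \<Rightarrow> (nat \<Rightarrow> ('k, 'a, 'a, 'x) bimod) \<Rightarrow> (nat \<Rightarrow> 'x \<Rightarrow> 'x) \<Rightarrow> nat \<Rightarrow>
   ('k, 'a, 'a, 'l) bimod \<Rightarrow> ('l \<Rightarrow> 'm) \<Rightarrow> ('k, 'a, 'a, 'm) bimod \<Rightarrow> ('m \<Rightarrow> 'n) \<Rightarrow>
   ('k, 'a, 'a, 'n) bimod \<Rightarrow> ('x \<Rightarrow> 'n) set \<Rightarrow> ('x \<Rightarrow> 'l) set"
where
  "connecting R X d n L f M g N \<xi> =
     {w \<in> carrier (cocycles R X d L (Suc n)).
        \<exists>u\<in>carrier (cochains R X M n). compose (carrier (X n)) g u \<in> \<xi> \<and>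
          compose (carrier (X (Suc n))) f w = codiff X d n u}"


section \<open>Ext of bimodules\<close>

text \<open>An element of \<open>B\<^sup>e = B \<otimes> B\<^sup>o\<^sup>p\<close> acts on a \<open>B\<close>-bimodule by \<open>(b \<otimes> b')m = b m b'\<close>.\<close>

definition env_act :: "('k, 'a, 'a, 'm) bimod \<Rightarrow> ('a \<times> 'a \<Rightarrow>\<^sub>0 int) set \<Rightarrow> 'm \<Rightarrow> 'm" where
  "env_act M t x = lift_hom M (\<lambda>(b, b'). ract M (lact M b x) b') t"

definition free_bimodule_on ::
  "('k, 'z) ring_scheme \<Rightarrow> ('k, 'a) module \<Rightarrow> ('k, 'a, 'a, 'm) bimod \<Rightarrow> 'm set \<Rightarrow> bool"
where
  "free_bimodule_on K B F X \<longleftrightarrow>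
     (let E = tensor (carrier K) (k_bimod B) (k_bimod B)
      in bimodule K B F \<and> X \<subseteq> carrier F \<and>
         (\<forall>m\<in>carrier F. \<exists>!t. t \<in> X \<rightarrow>\<^sub>E carrier E \<and> finite {x \<in> X. t x \<noteq> \<zero>\<^bsub>E\<^esub>} \<and>
            m = finsum F (\<lambda>x. env_act F (t x) x) {x \<in> X. t x \<noteq> \<zero>\<^bsub>E\<^esub>}))"

text \<open>Projective as a direct summand of a free bimodule; \<open>'f\<close> is the type carrying the latter.\<close>

definition projective_bimodule ::
  "'f itself \<Rightarrow> ('k, 'z) ring_scheme \<Rightarrow> ('k, 'a) module \<Rightarrow> ('k, 'a, 'a, 'p) bimod \<Rightarrow> bool"
where
  "projective_bimodule _ K B P \<longleftrightarrow> bimodule K B P \<and>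
     (\<exists>(F :: ('k, 'a, 'a, 'f) bimod) X i p.
        free_bimodule_on K B F X \<and> i \<in> bimod_hom B P F \<and> p \<in> bimod_hom B F P \<and>
        (\<forall>x\<in>carrier P. p (i x) = x))"

text \<open>
  The cohomology of \<open>Hom(P, -)\<close> for such a resolution \<open>P\<close> of \<open>N\<close> is \<open>Ext\<close> over \<open>B\<^sup>e\<close>.
\<close>

definition projective_resolution ::
  "'f itself \<Rightarrow> ('k, 'z) ring_scheme \<Rightarrow> ('k, 'a) module \<Rightarrow> ('k, 'a, 'a, 'm) bimod \<Rightarrow>
   (nat \<Rightarrow> ('k, 'a, 'a, 'p) bimod) \<Rightarrow> (nat \<Rightarrow> 'p \<Rightarrow> 'p) \<Rightarrow> ('p \<Rightarrow> 'm) \<Rightarrow> bool"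
where
  "projective_resolution F K B N P d \<epsilon> \<longleftrightarrow>
     (\<forall>n. projective_bimodule F K B (P n)) \<and>
     (\<forall>n. d n \<in> bimod_hom B (P (Suc n)) (P n)) \<and>
     \<epsilon> \<in> bimod_hom B (P 0) N \<and>
     \<epsilon> ` carrier (P 0) = carrier N \<and>
     d 0 ` carrier (P 1) = {x \<in> carrier (P 0). \<epsilon> x = \<zero>\<^bsub>N\<^esub>} \<and>
     (\<forall>n. d (Suc n) ` carrier (P (Suc (Suc n))) = {x \<in> carrier (P (Suc n)). d n x = \<zero>\<^bsub>P n\<^esub>})"


section \<open>Entwined cohomology\<close>

text \<open>\<open>Bar\<^sub>n(A) = A\<^sup>\<otimes>\<^sup>(\<^sup>n\<^sup>+\<^sup>2\<^sup>)\<close> is generated by the lists of length \<open>n + 2\<close>, modulo multilinearity.\<close>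

definition bar_gens :: "('k, 'a) module \<Rightarrow> nat \<Rightarrow> 'a list set" where
  "bar_gens A n = {xs. length xs = n + 2 \<and> set xs \<subseteq> carrier A}"

definition bar_rels :: "('k, 'z) ring_scheme \<Rightarrow> ('k, 'a) module \<Rightarrow> nat \<Rightarrow> ('a list \<Rightarrow>\<^sub>0 int) set" where
  "bar_rels K A n =
     {frag_of (us @ (x \<oplus>\<^bsub>A\<^esub> y) # vs) - frag_of (us @ x # vs) - frag_of (us @ y # vs) | us x y vs.
        us @ x # vs \<in> bar_gens A n \<and> us @ y # vs \<in> bar_gens A n} \<union>
     {frag_of (us @ (c \<odot>\<^bsub>A\<^esub> x) # vs @ y # ws) - frag_of (us @ x # vs @ (c \<odot>\<^bsub>A\<^esub> y) # ws) | us c x vs y ws.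
        c \<in> carrier K \<and> us @ x # vs @ y # ws \<in> bar_gens A n}"

definition bar_ptens ::
  "('k, 'z) ring_scheme \<Rightarrow> ('k, 'a) module \<Rightarrow> nat \<Rightarrow> 'a list \<Rightarrow> ('a list \<Rightarrow>\<^sub>0 int) set"
where
  "bar_ptens K A n = gen (bar_gens A n) (bar_rels K A n)"

definition bar ::
  "('k, 'z) ring_scheme \<Rightarrow> ('k, 'a) module \<Rightarrow> nat \<Rightarrow> ('k, 'a, 'a, ('a list \<Rightarrow>\<^sub>0 int) set) bimod"
where
  "bar K A n =
     (let G = presented_group (bar_gens A n) (bar_rels K A n)
      in make_bimod G
        (\<lambda>c. lift_hom G (\<lambda>xs. bar_ptens K A n ((c \<odot>\<^bsub>A\<^esub> hd xs) # tl xs)))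
        (\<lambda>a. lift_hom G (\<lambda>xs. bar_ptens K A n ((a \<otimes>\<^bsub>A\<^esub> hd xs) # tl xs)))
        (\<lambda>t a. lift_hom G (\<lambda>xs. bar_ptens K A n (butlast xs @ [last xs \<otimes>\<^bsub>A\<^esub> a])) t))"

definition merge_at :: "('k, 'a) module \<Rightarrow> nat \<Rightarrow> 'a list \<Rightarrow> 'a list" where
  "merge_at A i xs = take i xs @ (xs ! i \<otimes>\<^bsub>A\<^esub> xs ! Suc i) # drop (i + 2) xs"

definition bar_diff ::
  "('k, 'z) ring_scheme \<Rightarrow> ('k, 'a) module \<Rightarrow> nat \<Rightarrow> ('a list \<Rightarrow>\<^sub>0 int) set \<Rightarrow> ('a list \<Rightarrow>\<^sub>0 int) set"
where
  "bar_diff K A n = lift_hom (bar K A n)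
     (\<lambda>xs. finsum (bar K A n)
        (\<lambda>i. add_pow (bar K A n) ((-1) ^ i :: int) (bar_ptens K A n (merge_at A i xs))) {0..Suc n})"

text \<open>\<open>A \<otimes> C\<close> with \<open>(a \<otimes> c) \<cdot> \<rho> = a \<cdot> \<psi>(c \<otimes> \<rho>)\<close>.\<close>

definition entwined_bimod ::
  "('k, 'z) ring_scheme \<Rightarrow> ('k, 'a) module \<Rightarrow> ('k, 'c) coalg \<Rightarrow>
   (('c \<times> 'a \<Rightarrow>\<^sub>0 int) set \<Rightarrow> ('a \<times> 'c \<Rightarrow>\<^sub>0 int) set) \<Rightarrow>
   ('k, 'a, 'a, ('a \<times> 'c \<Rightarrow>\<^sub>0 int) set) bimod"
where
  "entwined_bimod K A C \<psi> =
     (let T = algcoalg K A C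
      in make_bimod T (smult T) (lact T)
        (\<lambda>t r. lift_hom T
          (\<lambda>(a, c). lact T a (\<psi> (ptens (carrier K) (k_bimod C) (k_bimod A) c r))) t))"

definition entwined_bar ::
  "('k, 'z) ring_scheme \<Rightarrow> ('k, 'a) module \<Rightarrow> ('k, 'c) coalg \<Rightarrow>
   (('c \<times> 'a \<Rightarrow>\<^sub>0 int) set \<Rightarrow> ('a \<times> 'c \<Rightarrow>\<^sub>0 int) set) \<Rightarrow> nat \<Rightarrow>
   ('k, 'a, 'a, (('a \<times> 'c \<Rightarrow>\<^sub>0 int) set \<times> ('a list \<Rightarrow>\<^sub>0 int) set \<Rightarrow>\<^sub>0 int) set) bimod"
where
  "entwined_bar K A C \<psi> n = tensor (carrier A) (entwined_bimod K A C \<psi>) (bar K A n)"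

definition entwined_bar_diff ::
  "('k, 'z) ring_scheme \<Rightarrow> ('k, 'a) module \<Rightarrow> ('k, 'c) coalg \<Rightarrow>
   (('c \<times> 'a \<Rightarrow>\<^sub>0 int) set \<Rightarrow> ('a \<times> 'c \<Rightarrow>\<^sub>0 int) set) \<Rightarrow> nat \<Rightarrow>
   (('a \<times> 'c \<Rightarrow>\<^sub>0 int) set \<times> ('a list \<Rightarrow>\<^sub>0 int) set \<Rightarrow>\<^sub>0 int) set \<Rightarrow>
   (('a \<times> 'c \<Rightarrow>\<^sub>0 int) set \<times> ('a list \<Rightarrow>\<^sub>0 int) set \<Rightarrow>\<^sub>0 int) set"
where
  "entwined_bar_diff K A C \<psi> n =
     tensor_map (carrier A) (entwined_bimod K A C \<psi>) (bar K A n) id (bar_diff K A n)"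


section \<open>Isomorphisms of functors on bimodules\<close>

text \<open>
  Functors from the category of \<open>A\<close>-bimodules carried by subsets of \<open>'m\<close> to \<open>k\<close>-vector spaces are given by
  their object parts and their morphism parts, which take source and target as arguments.
\<close>

definition natural_iso ::
  "('k, 'z) ring_scheme \<Rightarrow> ('k, 'a) module \<Rightarrow>
   (('k, 'a, 'a, 'm) bimod \<Rightarrow> ('k, 'u) module) \<Rightarrow>
   (('k, 'a, 'a, 'm) bimod \<Rightarrow> ('k, 'a, 'a, 'm) bimod \<Rightarrow> ('m \<Rightarrow> 'm) \<Rightarrow> 'u \<Rightarrow> 'u) \<Rightarrow>
   (('k, 'a, 'a, 'm) bimod \<Rightarrow> ('k, 'v) module) \<Rightarrow>
   (('k, 'a, 'a, 'm) bimod \<Rightarrow> ('k, 'a, 'a, 'm) bimod \<Rightarrow> ('m \<Rightarrow> 'm) \<Rightarrow> 'v \<Rightarrow> 'v) \<Rightarrow>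
   (('k, 'a, 'a, 'm) bimod \<Rightarrow> 'u \<Rightarrow> 'v) \<Rightarrow> bool"
where
  "natural_iso K A H Hm G Gm \<Phi> \<longleftrightarrow>
     (\<forall>M. bimodule K A M \<longrightarrow>
        \<Phi> M \<in> k_linear K (H M) (G M) \<and> bij_betw (\<Phi> M) (carrier (H M)) (carrier (G M))) \<and>
     (\<forall>M N f. bimodule K A M \<and> bimodule K A N \<and> f \<in> bimod_hom A M N \<longrightarrow>
        (\<forall>\<xi>\<in>carrier (H M). \<Phi> N (Hm M N f \<xi>) = Gm M N f (\<Phi> M \<xi>)))"

definition delta_functor_iso ::
  "('k, 'z) ring_scheme \<Rightarrow> ('k, 'a) module \<Rightarrow>
   (nat \<Rightarrow> ('k, 'a, 'a, 'm) bimod \<Rightarrow> ('k, 'u) module) \<Rightarrow>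
   (nat \<Rightarrow> ('k, 'a, 'a, 'm) bimod \<Rightarrow> ('k, 'a, 'a, 'm) bimod \<Rightarrow> ('m \<Rightarrow> 'm) \<Rightarrow> 'u \<Rightarrow> 'u) \<Rightarrow>
   (nat \<Rightarrow> ('k, 'a, 'a, 'm) bimod \<Rightarrow> ('m \<Rightarrow> 'm) \<Rightarrow> ('k, 'a, 'a, 'm) bimod \<Rightarrow> ('m \<Rightarrow> 'm) \<Rightarrow>
      ('k, 'a, 'a, 'm) bimod \<Rightarrow> 'u \<Rightarrow> 'u) \<Rightarrow>
   (nat \<Rightarrow> ('k, 'a, 'a, 'm) bimod \<Rightarrow> ('k, 'v) module) \<Rightarrow>
   (nat \<Rightarrow> ('k, 'a, 'a, 'm) bimod \<Rightarrow> ('k, 'a, 'a, 'm) bimod \<Rightarrow> ('m \<Rightarrow> 'm) \<Rightarrow> 'v \<Rightarrow> 'v) \<Rightarrow>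
   (nat \<Rightarrow> ('k, 'a, 'a, 'm) bimod \<Rightarrow> ('m \<Rightarrow> 'm) \<Rightarrow> ('k, 'a, 'a, 'm) bimod \<Rightarrow> ('m \<Rightarrow> 'm) \<Rightarrow>
      ('k, 'a, 'a, 'm) bimod \<Rightarrow> 'v \<Rightarrow> 'v) \<Rightarrow>
   (nat \<Rightarrow> ('k, 'a, 'a, 'm) bimod \<Rightarrow> 'u \<Rightarrow> 'v) \<Rightarrow> bool"
where
  "delta_functor_iso K A H Hm Hd G Gm Gd \<Phi> \<longleftrightarrow>
     (\<forall>n. natural_iso K A (H n) (Hm n) (G n) (Gm n) (\<Phi> n)) \<and>
     (\<forall>n L f M g N. bimodule K A L \<and> bimodule K A M \<and> bimodule K A N \<and> short_exact A L f M g N \<longrightarrow>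
        (\<forall>\<xi>\<in>carrier (H n N).
           \<Phi> (Suc n) L (Hd n L f M g N \<xi>) = Gd n L f M g N (\<Phi> n N \<xi>)))"

end

theory Submission
  imports Defs
begin

text \<open>
  The coaction of the unit is an element \<open>e\<close> of \<open>T = A \<otimes> C\<close> commuting with \<open>B\<close>, and the Galois condition
  says that \<open>a \<otimes> a' \<mapsto> a e a'\<close> is an isomorphism \<open>A \<otimes>\<^sub>B A \<cong> T\<close> of \<open>A\<close>-bimodules. The entwined bar complex
  is a resolution of \<open>T\<close> by \<open>A\<close>-bimodules that lift against surjections. Hence there is a \<open>B\<close>-bilinear
  chain map from \<open>P\<close> to it with \<open>x \<mapsto> \<epsilon>(x) e\<close> on augmentations, and pulling cochains back along it is the
  comparison map. In degree \<open>0\<close> both sides are the elements of \<open>M\<close> commuting with \<open>B\<close>.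

  If \<open>A\<close> is flat on the left, \<open>A \<otimes>\<^sub>B P \<otimes>\<^sub>B A\<close> is another resolution of \<open>T\<close>: as a complex of left modules
  \<open>P \<rightarrow> B\<close> is contractible, so \<open>A \<otimes>\<^sub>B -\<close> keeps it exact, and \<open>- \<otimes>\<^sub>B A\<close> does so by flatness. Bimodule maps from
  \<open>A \<otimes>\<^sub>B P \<otimes>\<^sub>B A\<close> to \<open>M\<close> are \<open>B\<close>-bimodule maps from \<open>P\<close> to \<open>M\<close>, and the homotopies between the two resolutions
  show that the comparison map is bijective. Flatness on the right reduces to this by passing to opposite algebras.
\<close>

text \<open>Both lifting claims rest on k being a field. A linear map has a k-linear section over
  its image; since the degree n term of the entwined bar complex is A \<otimes> (C \<otimes> A^n)
  \<otimes> A, such a section on the middle factor already yields a bilinear lift, without choosing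
  a basis. In the same way a free B-bimodule has the lifting property as a one-sided module, which
  is what makes P contractible on one side, so that flatness is spent on the other side only.

  The obstacle is that flatness is assumed for test modules carried by one fixed type, while it has
  to be applied to A \<otimes>_B P_n, which lives in another type. The vanishing of a tensor is
  witnessed by finitely many relators, so it can be studied on finitely generated submodules; each
  of their elements is named by a list of coefficients, and such lists embed into the test type.

  The A-bimodule structure of T is not derived from identities for \<psi>: the Galois map transports
  it from A \<otimes>_B A.\<close>

type_synonym ('x, 'y) tens = "('x \<times> 'y \<Rightarrow>\<^sub>0 int) set"
type_synonym 'x chain = "('x list \<Rightarrow>\<^sub>0 int) set"

section \<open>Additive maps\<close>

text \<open>Additivity alone; in abelian groups it brings zero, negatives and finite sums with it.
  As no action is mentioned, a map can be compared across several bimodule structures on one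
  group.\<close>

definition add_hom :: "('a, 'y) ring_scheme \<Rightarrow> ('b, 'z) ring_scheme \<Rightarrow> ('a \<Rightarrow> 'b) set" where
  "add_hom G H = {f \<in> carrier G \<rightarrow> carrier H.
     \<forall>x\<in>carrier G. \<forall>y\<in>carrier G. f (x \<oplus>\<^bsub>G\<^esub> y) = f x \<oplus>\<^bsub>H\<^esub> f y}"

lemma add_homI:
  assumes "\<And>x. x \<in> carrier G ==> f x \<in> carrier H"
    and "\<And>x y. x \<in> carrier G ==> y \<in> carrier G ==> f (x \<oplus>\<^bsub>G\<^esub> y) = f x \<oplus>\<^bsub>H\<^esub> f y"
  shows "f \<in> add_hom G H"
  using assms by (auto simp: add_hom_def)

lemma add_hom_closed: "f \<in> add_hom G H ==> x \<in> carrier G ==> f x \<in> carrier H"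
  by (auto simp: add_hom_def)

lemma add_hom_add:
  "f \<in> add_hom G H ==> x \<in> carrier G ==> y \<in> carrier G ==> f (x \<oplus>\<^bsub>G\<^esub> y) = f x \<oplus>\<^bsub>H\<^esub> f y"
  by (auto simp: add_hom_def)

lemma abelian_group_hom_add_hom:
  assumes "f \<in> add_hom G H" "abelian_group G" "abelian_group H"
  shows "abelian_group_hom G H f"
proof (rule abelian_group_homI[OF assms(2,3)])
  show "group_hom (add_monoid G) (add_monoid H) f"
    using assms by (auto simp: group_hom_def group_hom_axioms_def hom_def add_hom_def
        intro: abelian_group.a_group)
qed

lemma add_hom_zero:
  assumes "f \<in> add_hom G H" "abelian_group G" "abelian_group H"
  shows "f \<zero>\<^bsub>G\<^esub> = \<zero>\<^bsub>H\<^esub>"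
  by (rule abelian_group_hom.hom_zero[OF abelian_group_hom_add_hom[OF assms]])

lemma add_hom_neg:
  assumes "f \<in> add_hom G H" "abelian_group G" "abelian_group H" "x \<in> carrier G"
  shows "f (\<ominus>\<^bsub>G\<^esub> x) = \<ominus>\<^bsub>H\<^esub> f x"
  using abelian_group_hom.hom_a_inv[OF abelian_group_hom_add_hom[OF assms(1-3)]] assms(4) by simp

lemma add_hom_minus:
  assumes "f \<in> add_hom G H" "abelian_group G" "abelian_group H" "x \<in> carrier G" "y \<in> carrier G"
  shows "f (x \<ominus>\<^bsub>G\<^esub> y) = f x \<ominus>\<^bsub>H\<^esub> f y"
  using assms by (simp add: a_minus_def add_hom_add add_hom_neg abelian_group.a_inv_closed)

lemma add_hom_compose:
  assumes "f \<in> add_hom G H" "g \<in> add_hom H L"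
  shows "(\<lambda>x. g (f x)) \<in> add_hom G L"
  using assms by (auto simp: add_hom_def Pi_iff)

lemma add_hom_plus:
  assumes "f \<in> add_hom G H" "g \<in> add_hom G H" "abelian_group H"
  shows "(\<lambda>x. f x \<oplus>\<^bsub>H\<^esub> g x) \<in> add_hom G H"
proof -
  interpret H: abelian_group H by fact
  show ?thesis using assms(1,2) by (auto simp: add_hom_def Pi_iff H.a_ac)
qed

lemma (in abelian_group) minus_add_minus:
  "[|a \<in> carrier G; b \<in> carrier G; c \<in> carrier G; d \<in> carrier G|]
   ==> (a \<oplus> b) \<ominus> (c \<oplus> d) = (a \<ominus> c) \<oplus> (b \<ominus> d)"
  by (simp add: a_minus_def minus_add a_ac)

lemma add_hom_sub:
  assumes "f \<in> add_hom G H" "g \<in> add_hom G H" "abelian_group H"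
  shows "(\<lambda>x. f x \<ominus>\<^bsub>H\<^esub> g x) \<in> add_hom G H"
proof -
  interpret H: abelian_group H by fact
  show ?thesis using assms(1,2) by (auto simp: add_hom_def Pi_iff H.minus_add_minus)
qed

lemma add_hom_id: "(\<lambda>x. x) \<in> add_hom G G"
  by (auto simp: add_hom_def)

lemma add_hom_null: "abelian_group H ==> (\<lambda>x. \<zero>\<^bsub>H\<^esub>) \<in> add_hom G H"
  by (auto simp: add_hom_def abelian_group.axioms abelian_monoid.zero_closed abelian_monoid.l_zero)

lemma add_hom_finsum:
  assumes "abelian_group H" "finite I" "\<And>i. i \<in> I ==> f i \<in> add_hom G H"
  shows "(\<lambda>x. finsum H (\<lambda>i. f i x) I) \<in> add_hom G H"
proof -
  interpret H: abelian_group H by fact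
  have cl: "(\<lambda>i. f i x) \<in> I \<rightarrow> carrier H" if "x \<in> carrier G" for x
    using assms(3) that by (auto simp: add_hom_def)
  show ?thesis
  proof (rule add_homI)
    fix x y assume xy: "x \<in> carrier G" "y \<in> carrier G"
    have "finsum H (\<lambda>i. f i (x \<oplus>\<^bsub>G\<^esub> y)) I = finsum H (\<lambda>i. f i x \<oplus>\<^bsub>H\<^esub> f i y) I"
      by (rule H.finsum_cong') (use assms(3) xy in \<open>auto simp: add_hom_def Pi_iff\<close>)
    then show "finsum H (\<lambda>i. f i (x \<oplus>\<^bsub>G\<^esub> y)) I =
        finsum H (\<lambda>i. f i x) I \<oplus>\<^bsub>H\<^esub> finsum H (\<lambda>i. f i y) I"
      using cl xy by (simp add: H.finsum_addf)
  qed (use cl in \<open>simp add: H.finsum_closed\<close>)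
qed

lemma add_hom_finsum_arg:
  assumes "f \<in> add_hom G H" "abelian_group G" "abelian_group H" "g \<in> I \<rightarrow> carrier G"
  shows "f (finsum G g I) = finsum H (\<lambda>i. f (g i)) I"
proof -
  interpret G: abelian_group G by fact
  interpret H: abelian_group H by fact
  show ?thesis
    using assms(4)
  proof (induction I rule: infinite_finite_induct)
    case (insert x F)
    then have "(\<lambda>i. f (g i)) \<in> F \<rightarrow> carrier H" "f (g x) \<in> carrier H"
      using assms(1) by (auto simp: add_hom_def)
    with insert show ?case
      by (simp add: add_hom_add[OF assms(1)] G.finsum_closed Pi_iff)
  qed (simp_all add: add_hom_zero[OF assms(1-3)] G.finsum_infinite H.finsum_infinite)
qed

section \<open>Presented abelian groups\<close>

text \<open>The additive form of the subgroup generated by the relators. It does not mention the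
  generators \<open>S\<close>, and closure under differences gives an induction with three
  cases.\<close>

inductive_set gspan :: "('g \<Rightarrow>\<^sub>0 int) set \<Rightarrow> ('g \<Rightarrow>\<^sub>0 int) set" for R where
  zero: "0 \<in> gspan R"
| base: "r \<in> R ==> r \<in> gspan R"
| diff: "a \<in> gspan R ==> b \<in> gspan R ==> a - b \<in> gspan R"

lemma gspan_neg: "a \<in> gspan R ==> - a \<in> gspan R"
  using gspan.diff[OF gspan.zero] by fastforce

lemma gspan_add: "a \<in> gspan R ==> b \<in> gspan R ==> a + b \<in> gspan R"
  using gspan.diff[OF _ gspan_neg] by fastforce

lemma gspan_subset:
  assumes "R \<subseteq> carrier (free_Abelian_group S)" "a \<in> gspan R"
  shows "a \<in> carrier (free_Abelian_group S)"
  using assms(2)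
proof induction
  case (base r)
  then show ?case using assms(1) by blast
next
  case (diff a b)
  then show ?case using keys_diff[of a b] by auto
qed simp

lemma gspan_generate:
  assumes "R \<subseteq> carrier (free_Abelian_group S)"
  shows "generate (free_Abelian_group S) R = gspan R"
proof
  interpret F: group "free_Abelian_group S" by simp
  show "generate (free_Abelian_group S) R \<subseteq> gspan R"
  proof
    fix a assume "a \<in> generate (free_Abelian_group S) R"
    then show "a \<in> gspan R"
    proof induction
      case (inv h)
      then have "Poly_Mapping.keys h \<subseteq> S" using gspan_subset[OF assms gspan.base] by simp
      then show ?case using inv by (simp add: gspan_neg gspan.base)
    qed (auto intro: gspan.intros gspan_add)
  qed
  show "gspan R \<subseteq> generate (free_Abelian_group S) R"
  proof
    fix a assume "a \<in> gspan R"
    then show "a \<in> generate (free_Abelian_group S) R"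
    proof induction
      case zero
      show ?case using generate.one[of "free_Abelian_group S" R] by simp
    next
      case (diff a b)
      have sb: "Poly_Mapping.keys b \<subseteq> S"
        using gspan_subset[OF assms diff.hyps(2)] by simp
      have "- b \<in> generate (free_Abelian_group S) R"
        using F.generate_m_inv_closed[OF assms diff.IH(2)] sb by simp
      then show ?case
        using generate.eng[OF diff.IH(1)] by fastforce
    qed (rule generate.incl)
  qed
qed

text \<open>A coset written through a representative: every element of a presented group has this
  form, and equality of two of them is membership of a difference in \<open>gspan R\<close>.\<close>

definition gcls :: "('g \<Rightarrow>\<^sub>0 int) set \<Rightarrow> ('g \<Rightarrow>\<^sub>0 int) \<Rightarrow> ('g \<Rightarrow>\<^sub>0 int) set" where
  "gcls R p = (\<lambda>r. r + p) ` gspan R"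

lemma gcls_self: "p \<in> gcls R p"
  unfolding gcls_def by (rule image_eqI[OF _ gspan.zero]) simp

lemma gcls_eq_iff: "gcls R p = gcls R q \<longleftrightarrow> p - q \<in> gspan R"
proof
  assume "gcls R p = gcls R q"
  moreover have "p \<in> gcls R p" by (rule gcls_self)
  ultimately obtain r where "r \<in> gspan R" "p = r + q" by (auto simp: gcls_def)
  then show "p - q \<in> gspan R" by simp
next
  assume *: "p - q \<in> gspan R"
  show "gcls R p = gcls R q"
    unfolding gcls_def
  proof (intro subset_antisym subsetI)
    fix x assume "x \<in> (\<lambda>r. r + p) ` gspan R"
    then obtain r where "r \<in> gspan R" "x = r + p" by auto
    then show "x \<in> (\<lambda>r. r + q) ` gspan R" using gspan_add[OF _ *] by (intro image_eqI[of _ _ "r + (p - q)"]) auto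
  next
    fix x assume "x \<in> (\<lambda>r. r + q) ` gspan R"
    then obtain r where "r \<in> gspan R" "x = r + q" by auto
    then show "x \<in> (\<lambda>r. r + p) ` gspan R" using gspan.diff[OF _ *] by (intro image_eqI[of _ _ "r - (p - q)"]) auto
  qed
qed

text \<open>Only carrier, zero and addition of \<open>G\<close> are tied to the presented group, so
  that the locale also applies to the bimodule records \<open>tensor\<close> and \<open>bar\<close>,
  which carry actions on top of it.\<close>

locale presented =
  fixes S :: "'g set" and R :: "('g \<Rightarrow>\<^sub>0 int) set" and G :: "(('g \<Rightarrow>\<^sub>0 int) set, 'z) ring_scheme" (structure)
  assumes rels: "R \<subseteq> carrier (free_Abelian_group S)"
    and carrier_G: "carrier G = carrier (presented_group S R)"
    and zero_G: "\<zero> = \<zero>\<^bsub>presented_group S R\<^esub>"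
    and add_G: "add G = add (presented_group S R)"
begin

lemma gen_eq: "gen S R g = gcls R (frag_of g)"
  by (auto simp: gen_def r_coset_def gspan_generate[OF rels] gcls_def)

lemma carrier_eq: "carrier G = gcls R ` {p. Poly_Mapping.keys p \<subseteq> S}"
proof -
  have "gspan R #>\<^bsub>free_Abelian_group S\<^esub> p = gcls R p" for p
    by (auto simp: r_coset_def gcls_def)
  then show ?thesis
    by (auto simp: carrier_G presented_group_def Let_def FactGroup_def RCOSETS_def
      gspan_generate[OF rels])
qed

lemma zero_eq: "\<zero> = gcls R 0"
  by (simp add: zero_G presented_group_def Let_def FactGroup_def gspan_generate[OF rels] gcls_def)

lemma add_eq: "gcls R p \<oplus> gcls R q = gcls R (p + q)"
proof -
  have "gcls R p \<oplus> gcls R q = (\<Union>h\<in>gcls R p. \<Union>k\<in>gcls R q. {h + k})"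
    by (simp add: add_G presented_group_def Let_def FactGroup_def set_mult_def)
  also have "\<dots> = gcls R (p + q)"
  proof (intro subset_antisym subsetI)
    fix x assume "x \<in> (\<Union>h\<in>gcls R p. \<Union>k\<in>gcls R q. {h + k})"
    then obtain a b where "a \<in> gspan R" "b \<in> gspan R" "x = (a + p) + (b + q)" by (auto simp: gcls_def)
    then show "x \<in> gcls R (p + q)"
      using gspan_add[of a R b] by (auto simp: algebra_simps gcls_def intro!: image_eqI[of _ _ "a + b"])
  next
    fix x assume "x \<in> gcls R (p + q)"
    then obtain a where "a \<in> gspan R" "x = (a + p) + (0 + q)" by (auto simp: algebra_simps gcls_def)
    then show "x \<in> (\<Union>h\<in>gcls R p. \<Union>k\<in>gcls R q. {h + k})"
      using gspan.zero unfolding gcls_def by blast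
  qed
  finally show ?thesis .
qed

lemma abelian_group: "abelian_group G"
proof (rule abelian_groupI)
  fix x assume "x \<in> carrier G"
  then obtain p where p: "x = gcls R p" "Poly_Mapping.keys p \<subseteq> S" by (auto simp: carrier_eq)
  then have "gcls R (- p) \<in> carrier G" "gcls R (- p) \<oplus> x = \<zero>"
    by (auto simp: carrier_eq add_eq zero_eq)
  then show "\<exists>y\<in>carrier G. y \<oplus> x = \<zero>" by blast
qed (auto simp: carrier_eq zero_eq add_eq algebra_simps intro!: imageI order_trans[OF keys_add])

sublocale abelian_group G by (rule abelian_group)

lemma gen_closed: "g \<in> S ==> gen S R g \<in> carrier G"
  by (auto simp: gen_eq carrier_eq)

lemma gcls_closed: "Poly_Mapping.keys p \<subseteq> S ==> gcls R p \<in> carrier G"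
  by (auto simp: carrier_eq)

lemma neg_eq: "Poly_Mapping.keys p \<subseteq> S ==> \<ominus> gcls R p = gcls R (- p)"
  by (rule minus_equality) (auto simp: gcls_closed add_eq zero_eq)

lemma diff_eq:
  "Poly_Mapping.keys p \<subseteq> S ==> Poly_Mapping.keys q \<subseteq> S ==> gcls R p \<ominus> gcls R q = gcls R (p - q)"
  by (simp add: a_minus_def neg_eq add_eq)

lemma induct [consumes 1, case_names gen diff zero]:
  assumes "t \<in> carrier G"
    and "\<And>g. g \<in> S ==> P (gen S R g)"
    and "\<And>s t. s \<in> carrier G ==> t \<in> carrier G ==> P s ==> P t ==> P (s \<ominus> t)"
    and "P \<zero>"
  shows "P t"
proof -
  obtain p where p: "t = gcls R p" "Poly_Mapping.keys p \<subseteq> S" using assms(1) by (auto simp: carrier_eq)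
  from p(2) have "P (gcls R p)"
  proof (induction p rule: free_Abelian_group_induct[consumes 1])
    show "P (gcls R 0)" using assms(4) by (simp add: zero_eq)
  next
    fix x y :: "'g \<Rightarrow>\<^sub>0 int"
    assume "Poly_Mapping.keys x \<subseteq> S" "Poly_Mapping.keys y \<subseteq> S" "P (gcls R x)" "P (gcls R y)"
    then show "P (gcls R (x - y))" using assms(3)[OF gcls_closed gcls_closed] by (simp add: diff_eq)
  next
    fix a assume "a \<in> S"
    then show "P (gcls R (frag_of a))" using assms(2) gen_eq by simp
  qed
  with p show ?thesis by simp
qed

lemma hom_eq:
  assumes "f \<in> add_hom G H" "f' \<in> add_hom G H" "abelian_group H"
    and "\<And>g. g \<in> S ==> f (gen S R g) = f' (gen S R g)" "t \<in> carrier G"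
  shows "f t = f' t"
  using assms(5)
proof (induction rule: induct)
  case (diff s t)
  then show ?case using assms by (simp add: add_hom_minus abelian_group)
qed (use assms in \<open>auto simp: add_hom_zero abelian_group\<close>)

end

section \<open>Evaluation of formal sums and the universal property of a presented group\<close>

definition feval :: "('h, 'z) ring_scheme \<Rightarrow> ('g \<Rightarrow> 'h) \<Rightarrow> ('g \<Rightarrow>\<^sub>0 int) \<Rightarrow> 'h" where
  "feval H \<phi> p = finsum H (\<lambda>g. add_pow H (Poly_Mapping.lookup p g) (\<phi> g)) (Poly_Mapping.keys p)"

context abelian_group
begin

lemma feval_superset:
  assumes "\<phi> \<in> S \<rightarrow> carrier G" "finite I" "Poly_Mapping.keys p \<subseteq> I" "I \<subseteq> S"
  shows "feval G \<phi> p = finsum G (\<lambda>g. add_pow G (Poly_Mapping.lookup p g) (\<phi> g)) I"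
proof -
  have z: "add_pow G (0 :: int) x = \<zero>" for x by (simp add: add_pow_def)
  show ?thesis
    unfolding feval_def
    by (rule add.finprod_mono_neutral_cong_left)
       (use assms z in \<open>auto simp: in_keys_iff add.int_pow_closed subset_iff Pi_iff\<close>)
qed

lemma feval_closed:
  assumes "\<phi> \<in> S \<rightarrow> carrier G" "Poly_Mapping.keys p \<subseteq> S"
  shows "feval G \<phi> p \<in> carrier G"
  unfolding feval_def using assms by (intro finsum_closed) (auto simp: Pi_iff subset_iff)

lemma feval_diff:
  assumes "\<phi> \<in> S \<rightarrow> carrier G" "Poly_Mapping.keys p \<subseteq> S" "Poly_Mapping.keys q \<subseteq> S"
  shows "feval G \<phi> (p - q) = feval G \<phi> p \<ominus> feval G \<phi> q"
proof -
  let ?I = "Poly_Mapping.keys p \<union> Poly_Mapping.keys q"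
  have cl: "\<phi> g \<in> carrier G" if "g \<in> ?I" for g using that assms by auto
  have I: "finite ?I" "?I \<subseteq> S" "Poly_Mapping.keys (p - q) \<subseteq> ?I"
    using assms keys_diff[of p q] by auto
  have "feval G \<phi> (p - q) =
      finsum G (\<lambda>g. add_pow G (Poly_Mapping.lookup p g) (\<phi> g) \<ominus> add_pow G (Poly_Mapping.lookup q g) (\<phi> g)) ?I"
    unfolding feval_superset[OF assms(1) I(1) I(3) I(2)]
    by (rule finsum_cong') (use cl in \<open>auto simp: lookup_minus a_minus_def add.int_pow_diff\<close>)
  also have "\<dots> = finsum G (\<lambda>g. add_pow G (Poly_Mapping.lookup p g) (\<phi> g)) ?I
      \<ominus> finsum G (\<lambda>g. add_pow G (Poly_Mapping.lookup q g) (\<phi> g)) ?I"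
    (is "finsum G (\<lambda>g. ?a g \<ominus> ?b g) ?I = _")
  proof -
    have ab: "?a g \<in> carrier G" "?b g \<in> carrier G" if "g \<in> ?I" for g
      using cl[OF that] by (simp_all add: add.int_pow_closed)
    have "finsum G (\<lambda>g. ?a g \<ominus> ?b g) ?I \<oplus> finsum G ?b ?I = finsum G (\<lambda>g. (?a g \<ominus> ?b g) \<oplus> ?b g) ?I"
      by (rule finsum_addf[symmetric]) (use ab in auto)
    also have "\<dots> = finsum G ?a ?I"
      by (rule finsum_cong') (use ab in \<open>auto simp: a_minus_def a_assoc l_neg\<close>)
    finally have "finsum G (\<lambda>g. ?a g \<ominus> ?b g) ?I \<oplus> finsum G ?b ?I = finsum G ?a ?I" .
    then show ?thesis
      using cl by (metis (no_types, lifting) Pi_I a_minus_def add.int_pow_closed add.inv_solve_right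
          finsum_closed minus_closed)
  qed
  finally show ?thesis
    using feval_superset[OF assms(1) I(1) _ I(2)] by simp
qed

lemma feval_frag_of: "\<phi> g \<in> carrier G ==> feval G \<phi> (frag_of g) = \<phi> g"
  by (simp add: feval_def keys_frag_of)

lemma feval_gspan:
  assumes "R \<subseteq> carrier (free_Abelian_group S)" "\<phi> \<in> S \<rightarrow> carrier G" "\<And>r. r \<in> R ==> feval G \<phi> r = \<zero>"
    and "r \<in> gspan R"
  shows "feval G \<phi> r = \<zero>"
  using assms(4)
proof induction
  case zero
  show ?case by (simp add: feval_def)
next
  case (diff a b)
  then show ?case
    using feval_diff[OF assms(2)] gspan_subset[OF assms(1)] by (simp add: a_minus_def)
qed (use assms in auto)

end

lemma lift_hom_feval: "lift_hom H \<phi> t = feval H \<phi> (SOME p. p \<in> t)"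
  by (simp add: lift_hom_def feval_def Let_def)

text \<open>The actions of \<open>tensor\<close> and \<open>bar\<close> are defined by lifting into
  the bare presented group, before the bimodule record exists; this turns those lifts into lifts to
  the finished record.\<close>

lemma lift_hom_cong:
  assumes "carrier H = carrier H'" "add H = add H'" "zero H = zero H'"
  shows "lift_hom H = lift_hom H'"
  using assms by (intro ext) (simp add: lift_hom_def finsum_def add_pow_def Let_def finprod_def int_pow_def
      nat_pow_def m_inv_def cong: if_cong)

context presented
begin

text \<open>The representative picked by \<open>SOME\<close> differs from \<open>p\<close> by an
  element of \<open>gspan R\<close>, and there \<open>feval\<close> vanishes because it is additive
  and kills every relator.\<close>

lemma lift_hom_gcls:
  assumes "abelian_group H" "\<phi> \<in> S \<rightarrow> carrier H" "\<And>r. r \<in> R ==> feval H \<phi> r = \<zero>\<^bsub>H\<^esub>"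
    and "Poly_Mapping.keys p \<subseteq> S"
  shows "lift_hom H \<phi> (gcls R p) = feval H \<phi> p"
proof -
  interpret H: abelian_group H by fact
  have "p \<in> gcls R p" by (rule gcls_self)
  then have "(SOME q. q \<in> gcls R p) \<in> gcls R p" by (rule someI)
  then obtain r where r: "r \<in> gspan R" "(SOME q. q \<in> gcls R p) = r + p" by (auto simp: gcls_def)
  have kr: "Poly_Mapping.keys r \<subseteq> S" using gspan_subset[OF rels r(1)] by simp
  have "feval H \<phi> p = feval H \<phi> ((r + p) - r)" by simp
  also have "\<dots> = feval H \<phi> (r + p) \<ominus>\<^bsub>H\<^esub> feval H \<phi> r"
    by (rule H.feval_diff[OF assms(2)]) (use kr assms(4) keys_add[of r p] in auto)
  also have "\<dots> = feval H \<phi> (r + p)"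
    using H.feval_gspan[OF rels assms(2,3) r(1)] H.feval_closed[OF assms(2), of "r + p"]
      kr assms(4) keys_add[of r p]
    by (simp add: a_minus_def H.r_zero order_trans[OF keys_add])
  finally show ?thesis by (simp add: lift_hom_feval r(2))
qed

lemma lift_hom:
  assumes "abelian_group H" "\<And>g. g \<in> S ==> \<phi> g \<in> carrier H" "\<And>r. r \<in> R ==> feval H \<phi> r = \<zero>\<^bsub>H\<^esub>"
  shows "lift_hom H \<phi> \<in> add_hom G H" "\<And>g. g \<in> S ==> lift_hom H \<phi> (gen S R g) = \<phi> g"
proof -
  interpret H: abelian_group H by fact
  have \<phi>: "\<phi> \<in> S \<rightarrow> carrier H" using assms(2) by auto
  note * = lift_hom_gcls[OF assms(1) \<phi> assms(3)]
  have add: "feval H \<phi> (p + q) = feval H \<phi> p \<oplus>\<^bsub>H\<^esub> feval H \<phi> q"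
    if "Poly_Mapping.keys p \<subseteq> S" "Poly_Mapping.keys q \<subseteq> S" for p q
  proof -
    have "feval H \<phi> p = feval H \<phi> ((p + q) - q)" by simp
    also have "\<dots> = feval H \<phi> (p + q) \<ominus>\<^bsub>H\<^esub> feval H \<phi> q"
      by (rule H.feval_diff[OF \<phi>]) (use that keys_add[of p q] in auto)
    finally show ?thesis
      using that H.feval_closed[OF \<phi>] H.feval_closed[OF \<phi> order_trans[OF keys_add[of p q]]]
      by (simp add: a_minus_def H.a_assoc H.l_neg)
  qed
  show "lift_hom H \<phi> \<in> add_hom G H"
  proof (rule add_homI)
    fix x y assume "x \<in> carrier G" "y \<in> carrier G"
    then obtain p q where "x = gcls R p" "Poly_Mapping.keys p \<subseteq> S" "y = gcls R q" "Poly_Mapping.keys q \<subseteq> S"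
      by (auto simp: carrier_eq)
    moreover have "Poly_Mapping.keys (p + q) \<subseteq> S" using calculation keys_add[of p q] by auto
    ultimately show "lift_hom H \<phi> (x \<oplus> y) = lift_hom H \<phi> x \<oplus>\<^bsub>H\<^esub> lift_hom H \<phi> y"
      by (simp add: add_eq * add)
  qed (use * H.feval_closed[OF \<phi>] in \<open>auto simp: carrier_eq\<close>)
  show "lift_hom H \<phi> (gen S R g) = \<phi> g" if "g \<in> S" for g
    using that assms(2) by (simp add: gen_eq * H.feval_frag_of)
qed

end

section \<open>Bimodules over two algebras\<close>

text \<open>Two different acting algebras are needed as soon as tensor products are iterated: A
  \<otimes>_B P_n is an A-B-bimodule and A \<otimes> C starts as an A-k-bimodule.\<close>

definition bim ::
  "('k, 'z) ring_scheme \<Rightarrow> ('k, 'r, 'x) module_scheme \<Rightarrow> ('k, 's, 'y) module_scheme \<Rightarrow>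
   ('k, 'r, 's, 'm) bimod \<Rightarrow> bool"
where
  "bim K R S M \<longleftrightarrow> left_module K R M \<and> right_module K S M \<and>
     (\<forall>r\<in>carrier R. \<forall>s\<in>carrier S. \<forall>x\<in>carrier M.
        ract M (lact M r x) s = lact M r (ract M x s))"

lemma bimodule_bim: "bimodule K R M \<longleftrightarrow> bim K R R M"
  by (simp add: bimodule_def bim_def)

lemma module_abelian_group: "module K M ==> abelian_group M"
  by (simp add: module_def)

lemma left_moduleD:
  assumes "left_module K R M"
  shows left_module_module: "module K M"
    and left_module_abelian_group: "abelian_group M"
    and lact_closed: "\<And>r x. r \<in> carrier R ==> x \<in> carrier M ==> lact M r x \<in> carrier M"
    and lact_add: "\<And>r x y. r \<in> carrier R ==> x \<in> carrier M ==> y \<in> carrier M ==>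
      lact M r (x \<oplus>\<^bsub>M\<^esub> y) = lact M r x \<oplus>\<^bsub>M\<^esub> lact M r y"
    and lact_add_left: "\<And>r s x. r \<in> carrier R ==> s \<in> carrier R ==> x \<in> carrier M ==>
      lact M (r \<oplus>\<^bsub>R\<^esub> s) x = lact M r x \<oplus>\<^bsub>M\<^esub> lact M s x"
    and lact_mult: "\<And>r s x. r \<in> carrier R ==> s \<in> carrier R ==> x \<in> carrier M ==>
      lact M (r \<otimes>\<^bsub>R\<^esub> s) x = lact M r (lact M s x)"
    and lact_one: "\<And>x. x \<in> carrier M ==> lact M \<one>\<^bsub>R\<^esub> x = x"
    and lact_scalar: "\<And>c x. c \<in> carrier K ==> x \<in> carrier M ==>
      lact M (c \<odot>\<^bsub>R\<^esub> \<one>\<^bsub>R\<^esub>) x = c \<odot>\<^bsub>M\<^esub> x"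
    and lact_add_hom: "\<And>r. r \<in> carrier R ==> lact M r \<in> add_hom M M"
  using assms by (auto simp: left_module_def module_abelian_group intro!: add_homI)

lemma right_moduleD:
  assumes "right_module K S M"
  shows right_module_module: "module K M"
    and right_module_abelian_group: "abelian_group M"
    and ract_closed: "\<And>s x. s \<in> carrier S ==> x \<in> carrier M ==> ract M x s \<in> carrier M"
    and ract_add: "\<And>s x y. s \<in> carrier S ==> x \<in> carrier M ==> y \<in> carrier M ==>
      ract M (x \<oplus>\<^bsub>M\<^esub> y) s = ract M x s \<oplus>\<^bsub>M\<^esub> ract M y s"
    and ract_add_right: "\<And>r s x. r \<in> carrier S ==> s \<in> carrier S ==> x \<in> carrier M ==>
      ract M x (r \<oplus>\<^bsub>S\<^esub> s) = ract M x r \<oplus>\<^bsub>M\<^esub> ract M x s"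
    and ract_mult: "\<And>r s x. r \<in> carrier S ==> s \<in> carrier S ==> x \<in> carrier M ==>
      ract M x (r \<otimes>\<^bsub>S\<^esub> s) = ract M (ract M x r) s"
    and ract_one: "\<And>x. x \<in> carrier M ==> ract M x \<one>\<^bsub>S\<^esub> = x"
    and ract_scalar: "\<And>c x. c \<in> carrier K ==> x \<in> carrier M ==>
      ract M x (c \<odot>\<^bsub>S\<^esub> \<one>\<^bsub>S\<^esub>) = c \<odot>\<^bsub>M\<^esub> x"
    and ract_add_hom: "\<And>s. s \<in> carrier S ==> (\<lambda>x. ract M x s) \<in> add_hom M M"
  using assms by (auto simp: right_module_def module_abelian_group intro!: add_homI)

lemma bimD:
  assumes "bim K R S M"
  shows bim_left: "left_module K R M" and bim_right: "right_module K S M"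
    and bim_comm: "\<And>r s x. r \<in> carrier R ==> s \<in> carrier S ==> x \<in> carrier M ==>
      ract M (lact M r x) s = lact M r (ract M x s)"
    and bim_abelian_group: "abelian_group M"
    and bim_module: "module K M"
  using assms by (auto simp: bim_def left_module_abelian_group left_module_module)

lemma k_algebraD:
  assumes "k_algebra K A"
  shows k_algebra_module: "module K A" and k_algebra_ring: "ring A"
    and k_algebra_scalar_closed: "\<And>c. c \<in> carrier K ==> c \<odot>\<^bsub>A\<^esub> \<one>\<^bsub>A\<^esub> \<in> carrier A"
    and k_algebra_smult_left: "\<And>c x y. c \<in> carrier K ==> x \<in> carrier A ==> y \<in> carrier A ==>
       (c \<odot>\<^bsub>A\<^esub> x) \<otimes>\<^bsub>A\<^esub> y = c \<odot>\<^bsub>A\<^esub> (x \<otimes>\<^bsub>A\<^esub> y)"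
    and k_algebra_smult_right: "\<And>c x y. c \<in> carrier K ==> x \<in> carrier A ==> y \<in> carrier A ==>
       x \<otimes>\<^bsub>A\<^esub> (c \<odot>\<^bsub>A\<^esub> y) = c \<odot>\<^bsub>A\<^esub> (x \<otimes>\<^bsub>A\<^esub> y)"
proof -
  show m: "module K A" and r: "ring A" using assms by (simp_all add: k_algebra_def)
  show "c \<odot>\<^bsub>A\<^esub> \<one>\<^bsub>A\<^esub> \<in> carrier A" if "c \<in> carrier K" for c
    by (rule module.smult_closed[OF m that]) (rule monoid.one_closed[OF ring.is_monoid[OF r]])
  have *: "\<forall>c\<in>carrier K. \<forall>x\<in>carrier A. \<forall>y\<in>carrier A.
      c \<odot>\<^bsub>A\<^esub> (x \<otimes>\<^bsub>A\<^esub> y) = (c \<odot>\<^bsub>A\<^esub> x) \<otimes>\<^bsub>A\<^esub> y \<and> c \<odot>\<^bsub>A\<^esub> (x \<otimes>\<^bsub>A\<^esub> y) = x \<otimes>\<^bsub>A\<^esub> (c \<odot>\<^bsub>A\<^esub> y)"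
    by (rule assms[unfolded k_algebra_def, THEN conjunct2, THEN conjunct2])
  show "(c \<odot>\<^bsub>A\<^esub> x) \<otimes>\<^bsub>A\<^esub> y = c \<odot>\<^bsub>A\<^esub> (x \<otimes>\<^bsub>A\<^esub> y)" "x \<otimes>\<^bsub>A\<^esub> (c \<odot>\<^bsub>A\<^esub> y) = c \<odot>\<^bsub>A\<^esub> (x \<otimes>\<^bsub>A\<^esub> y)"
    if "c \<in> carrier K" "x \<in> carrier A" "y \<in> carrier A" for c x y
    using *[rule_format, OF that] by (metis, metis)
qed

lemma k_algebra_scalar_central:
  assumes "k_algebra K A" "c \<in> carrier K" "x \<in> carrier A"
  shows "(c \<odot>\<^bsub>A\<^esub> \<one>\<^bsub>A\<^esub>) \<otimes>\<^bsub>A\<^esub> x = c \<odot>\<^bsub>A\<^esub> x" "x \<otimes>\<^bsub>A\<^esub> (c \<odot>\<^bsub>A\<^esub> \<one>\<^bsub>A\<^esub>) = c \<odot>\<^bsub>A\<^esub> x"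
proof -
  interpret A: ring A using assms(1) by (rule k_algebra_ring)
  show "(c \<odot>\<^bsub>A\<^esub> \<one>\<^bsub>A\<^esub>) \<otimes>\<^bsub>A\<^esub> x = c \<odot>\<^bsub>A\<^esub> x" "x \<otimes>\<^bsub>A\<^esub> (c \<odot>\<^bsub>A\<^esub> \<one>\<^bsub>A\<^esub>) = c \<odot>\<^bsub>A\<^esub> x"
    using assms by (simp_all add: k_algebra_smult_left k_algebra_smult_right)
qed

lemma smult_lact:
  assumes "k_algebra K R" "left_module K R M" "c \<in> carrier K" "r \<in> carrier R" "x \<in> carrier M"
  shows "lact M r (c \<odot>\<^bsub>M\<^esub> x) = c \<odot>\<^bsub>M\<^esub> lact M r x" "lact M (c \<odot>\<^bsub>R\<^esub> r) x = c \<odot>\<^bsub>M\<^esub> lact M r x"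
proof -
  have s: "c \<odot>\<^bsub>R\<^esub> \<one>\<^bsub>R\<^esub> \<in> carrier R" using assms by (simp add: k_algebra_scalar_closed)
  have "lact M (c \<odot>\<^bsub>R\<^esub> r) x = lact M ((c \<odot>\<^bsub>R\<^esub> \<one>\<^bsub>R\<^esub>) \<otimes>\<^bsub>R\<^esub> r) x"
    using k_algebra_scalar_central(1)[OF assms(1,3,4)] by simp
  also have "\<dots> = c \<odot>\<^bsub>M\<^esub> lact M r x"
    using assms(3-) s by (simp only: lact_mult[OF assms(2)] lact_scalar[OF assms(2)] lact_closed[OF assms(2)])
  finally show *: "lact M (c \<odot>\<^bsub>R\<^esub> r) x = c \<odot>\<^bsub>M\<^esub> lact M r x" .
  have "lact M r (c \<odot>\<^bsub>M\<^esub> x) = lact M (r \<otimes>\<^bsub>R\<^esub> (c \<odot>\<^bsub>R\<^esub> \<one>\<^bsub>R\<^esub>)) x"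
    using assms(3-) s by (simp only: lact_mult[OF assms(2)] lact_scalar[OF assms(2)])
  also have "\<dots> = lact M (c \<odot>\<^bsub>R\<^esub> r) x"
    using k_algebra_scalar_central(2)[OF assms(1,3,4)] by simp
  finally show "lact M r (c \<odot>\<^bsub>M\<^esub> x) = c \<odot>\<^bsub>M\<^esub> lact M r x" using * by simp
qed

lemma smult_ract:
  assumes "k_algebra K S" "right_module K S M" "c \<in> carrier K" "s \<in> carrier S" "x \<in> carrier M"
  shows "ract M (c \<odot>\<^bsub>M\<^esub> x) s = c \<odot>\<^bsub>M\<^esub> ract M x s" "ract M x (c \<odot>\<^bsub>S\<^esub> s) = c \<odot>\<^bsub>M\<^esub> ract M x s"
proof -
  have cl: "c \<odot>\<^bsub>S\<^esub> \<one>\<^bsub>S\<^esub> \<in> carrier S" using assms by (simp add: k_algebra_scalar_closed)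
  have "ract M x (c \<odot>\<^bsub>S\<^esub> s) = ract M x (s \<otimes>\<^bsub>S\<^esub> (c \<odot>\<^bsub>S\<^esub> \<one>\<^bsub>S\<^esub>))"
    using k_algebra_scalar_central(2)[OF assms(1,3,4)] by simp
  also have "\<dots> = c \<odot>\<^bsub>M\<^esub> ract M x s"
    using assms(3-) cl by (simp only: ract_mult[OF assms(2)] ract_scalar[OF assms(2)] ract_closed[OF assms(2)])
  finally show *: "ract M x (c \<odot>\<^bsub>S\<^esub> s) = c \<odot>\<^bsub>M\<^esub> ract M x s" .
  have "ract M (c \<odot>\<^bsub>M\<^esub> x) s = ract M x ((c \<odot>\<^bsub>S\<^esub> \<one>\<^bsub>S\<^esub>) \<otimes>\<^bsub>S\<^esub> s)"
    using assms(3-) cl by (simp only: ract_mult[OF assms(2)] ract_scalar[OF assms(2)])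
  also have "\<dots> = ract M x (c \<odot>\<^bsub>S\<^esub> s)"
    using k_algebra_scalar_central(1)[OF assms(1,3,4)] by simp
  finally show "ract M (c \<odot>\<^bsub>M\<^esub> x) s = c \<odot>\<^bsub>M\<^esub> ract M x s" using * by simp
qed

lemma make_bimod_simps [simp]:
  "carrier (make_bimod G sm l r) = carrier G" "zero (make_bimod G sm l r) = zero G"
  "add (make_bimod G sm l r) = add G" "smult (make_bimod G sm l r) = sm"
  "lact (make_bimod G sm l r) = l" "ract (make_bimod G sm l r) = r"
  by (simp_all add: make_bimod_def)

section \<open>Tensor products\<close>

text \<open>The weakest condition under which the relators lie in the free group on the pairs.
  \<open>S\<close> is a bare set of operators, so the universal property can be used before any
  bimodule axiom is known.\<close>

definition tens_ok :: "'s set \<Rightarrow> ('k, 'r, 's, 'x) bimod \<Rightarrow> ('k, 's, 't, 'y) bimod \<Rightarrow> bool" where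
  "tens_ok S X Y \<longleftrightarrow> abelian_group X \<and> abelian_group Y \<and>
     (\<forall>x\<in>carrier X. \<forall>s\<in>S. ract X x s \<in> carrier X) \<and>
     (\<forall>y\<in>carrier Y. \<forall>s\<in>S. lact Y s y \<in> carrier Y)"

lemma tens_ok_modules:
  "right_module K S X ==> left_module K S Y ==> tens_ok (carrier S) X Y"
  by (simp add: tens_ok_def right_module_abelian_group left_module_abelian_group lact_closed ract_closed)

lemma keys_frag_diff2:
  "a \<in> S ==> b \<in> S ==> Poly_Mapping.keys (frag_of a - frag_of b) \<subseteq> S"
  using keys_diff[of "frag_of a" "frag_of b"] by (auto simp: keys_frag_of)

lemma keys_frag_diff3:
  "a \<in> S ==> b \<in> S ==> c \<in> S ==> Poly_Mapping.keys (frag_of a - frag_of b - frag_of c) \<subseteq> S"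
  using keys_diff[of "frag_of a - frag_of b" "frag_of c"] keys_frag_diff2[of a S b]
  by (auto simp: keys_frag_of)

lemma (in abelian_group) feval_frag_diff2:
  assumes "\<phi> \<in> S \<rightarrow> carrier G" "a \<in> S" "b \<in> S"
  shows "feval G \<phi> (frag_of a - frag_of b) = \<phi> a \<ominus> \<phi> b"
  using assms by (subst feval_diff[OF assms(1)]) (auto simp: keys_frag_of feval_frag_of Pi_iff)

lemma (in abelian_group) feval_frag_diff3:
  assumes "\<phi> \<in> S \<rightarrow> carrier G" "a \<in> S" "b \<in> S" "c \<in> S"
  shows "feval G \<phi> (frag_of a - frag_of b - frag_of c) = \<phi> a \<ominus> \<phi> b \<ominus> \<phi> c"
  using assms keys_frag_diff2[of a S b]
  by (subst feval_diff[OF assms(1)]) (auto simp: keys_frag_of feval_frag_of feval_frag_diff2 Pi_iff)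

lemma (in abelian_group) minus_self: "x \<in> carrier G ==> x \<ominus> x = \<zero>"
  by (simp add: a_minus_def r_neg)

lemma (in abelian_group) minus_minus_zero:
  "[|b \<in> carrier G; c \<in> carrier G; a = b \<oplus> c|] ==> a \<ominus> b \<ominus> c = \<zero>"
proof -
  assume *: "b \<in> carrier G" "c \<in> carrier G" "a = b \<oplus> c"
  have "a \<ominus> b \<ominus> c = (b \<ominus> b) \<oplus> (c \<ominus> c)"
    using * by (simp add: a_minus_def a_ac)
  then show ?thesis using * by (simp add: minus_self)
qed

lemma tensor_presented:
  assumes "tens_ok S X Y"
  shows "presented (carrier X \<times> carrier Y) (tensor_rels S X Y) (tensor S X Y)"
proof
  interpret X: abelian_group X using assms by (simp add: tens_ok_def)
  interpret Y: abelian_group Y using assms by (simp add: tens_ok_def)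
  show "tensor_rels S X Y \<subseteq> carrier (free_Abelian_group (carrier X \<times> carrier Y))"
  proof
    fix r assume "r \<in> tensor_rels S X Y"
    then have "Poly_Mapping.keys r \<subseteq> carrier X \<times> carrier Y"
      unfolding tensor_rels_def using assms
      by (elim UnE CollectE exE conjE; hypsubst) (rule keys_frag_diff2 keys_frag_diff3; simp add: tens_ok_def)+
    then show "r \<in> carrier (free_Abelian_group (carrier X \<times> carrier Y))" by simp
  qed
qed (simp_all add: tensor_def Let_def)

definition balanced ::
  "'s set \<Rightarrow> ('k, 'r, 's, 'x) bimod \<Rightarrow> ('k, 's, 't, 'y) bimod \<Rightarrow> ('h, 'z) ring_scheme \<Rightarrow>
   ('x \<Rightarrow> 'y \<Rightarrow> 'h) \<Rightarrow> bool"
where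
  "balanced S X Y H \<phi> \<longleftrightarrow>
     (\<forall>x\<in>carrier X. \<forall>y\<in>carrier Y. \<phi> x y \<in> carrier H) \<and>
     (\<forall>x\<in>carrier X. \<forall>x'\<in>carrier X. \<forall>y\<in>carrier Y. \<phi> (x \<oplus>\<^bsub>X\<^esub> x') y = \<phi> x y \<oplus>\<^bsub>H\<^esub> \<phi> x' y) \<and>
     (\<forall>x\<in>carrier X. \<forall>y\<in>carrier Y. \<forall>y'\<in>carrier Y. \<phi> x (y \<oplus>\<^bsub>Y\<^esub> y') = \<phi> x y \<oplus>\<^bsub>H\<^esub> \<phi> x y') \<and>
     (\<forall>x\<in>carrier X. \<forall>s\<in>S. \<forall>y\<in>carrier Y. \<phi> (ract X x s) y = \<phi> x (lact Y s y))"

lemma balancedI: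
  assumes "\<And>x y. x \<in> carrier X ==> y \<in> carrier Y ==> \<phi> x y \<in> carrier H"
    and "\<And>x x' y. x \<in> carrier X ==> x' \<in> carrier X ==> y \<in> carrier Y ==>
      \<phi> (x \<oplus>\<^bsub>X\<^esub> x') y = \<phi> x y \<oplus>\<^bsub>H\<^esub> \<phi> x' y"
    and "\<And>x y y'. x \<in> carrier X ==> y \<in> carrier Y ==> y' \<in> carrier Y ==>
      \<phi> x (y \<oplus>\<^bsub>Y\<^esub> y') = \<phi> x y \<oplus>\<^bsub>H\<^esub> \<phi> x y'"
    and "\<And>x s y. x \<in> carrier X ==> s \<in> S ==> y \<in> carrier Y ==> \<phi> (ract X x s) y = \<phi> x (lact Y s y)"
  shows "balanced S X Y H \<phi>"
  using assms by (simp add: balanced_def)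

locale tens =
  fixes S :: "'s set" and X :: "('k, 'r, 's, 'x) bimod" and Y :: "('k, 's, 't, 'y) bimod"
  assumes ok: "tens_ok S X Y"
begin

abbreviation "Z \<equiv> tensor S X Y"
abbreviation pt (infixl "\<bullet>" 75) where "pt \<equiv> ptens S X Y"

sublocale P: presented "carrier X \<times> carrier Y" "tensor_rels S X Y" Z
  by (rule tensor_presented[OF ok])

sublocale X: abelian_group X using ok by (simp add: tens_ok_def)
sublocale Y: abelian_group Y using ok by (simp add: tens_ok_def)

lemma ract_X: "x \<in> carrier X ==> s \<in> S ==> ract X x s \<in> carrier X"
  using ok by (simp add: tens_ok_def)

lemma lact_Y: "y \<in> carrier Y ==> s \<in> S ==> lact Y s y \<in> carrier Y"
  using ok by (simp add: tens_ok_def)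

lemma ptens_closed: "x \<in> carrier X ==> y \<in> carrier Y ==> x \<bullet> y \<in> carrier Z"
  by (simp add: ptens_def P.gen_closed)

lemma ptens_balanced: "balanced S X Y Z pt"
proof (rule balancedI)
  fix x x' y assume *: "x \<in> carrier X" "x' \<in> carrier X" "y \<in> carrier Y"
  have "frag_of (x \<oplus>\<^bsub>X\<^esub> x', y) - frag_of (x, y) - frag_of (x', y) \<in> tensor_rels S X Y"
    using * unfolding tensor_rels_def by blast
  then have "frag_of (x \<oplus>\<^bsub>X\<^esub> x', y) - (frag_of (x, y) + frag_of (x', y)) \<in> gspan (tensor_rels S X Y)"
    by (simp add: gspan.base diff_diff_eq)
  then show "(x \<oplus>\<^bsub>X\<^esub> x') \<bullet> y = x \<bullet> y \<oplus>\<^bsub>Z\<^esub> x' \<bullet> y"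
    using * by (simp add: ptens_def P.gen_eq P.add_eq gcls_eq_iff)
next
  fix x y y' assume *: "x \<in> carrier X" "y \<in> carrier Y" "y' \<in> carrier Y"
  have "frag_of (x, y \<oplus>\<^bsub>Y\<^esub> y') - frag_of (x, y) - frag_of (x, y') \<in> tensor_rels S X Y"
    using * unfolding tensor_rels_def by blast
  then have "frag_of (x, y \<oplus>\<^bsub>Y\<^esub> y') - (frag_of (x, y) + frag_of (x, y')) \<in> gspan (tensor_rels S X Y)"
    by (simp add: gspan.base diff_diff_eq)
  then show "x \<bullet> (y \<oplus>\<^bsub>Y\<^esub> y') = x \<bullet> y \<oplus>\<^bsub>Z\<^esub> x \<bullet> y'"
    using * by (simp add: ptens_def P.gen_eq P.add_eq gcls_eq_iff)
next
  fix x s y assume *: "x \<in> carrier X" "s \<in> S" "y \<in> carrier Y"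
  have "frag_of (ract X x s, y) - frag_of (x, lact Y s y) \<in> tensor_rels S X Y"
    using * unfolding tensor_rels_def by blast
  then show "ract X x s \<bullet> y = x \<bullet> lact Y s y"
    using * by (simp add: ptens_def P.gen_eq gcls_eq_iff gspan.base)
qed (rule ptens_closed)

lemma ptens_add_left: "x \<in> carrier X ==> x' \<in> carrier X ==> y \<in> carrier Y ==>
    (x \<oplus>\<^bsub>X\<^esub> x') \<bullet> y = x \<bullet> y \<oplus>\<^bsub>Z\<^esub> x' \<bullet> y"
  and ptens_add_right: "x \<in> carrier X ==> y \<in> carrier Y ==> y' \<in> carrier Y ==>
    x \<bullet> (y \<oplus>\<^bsub>Y\<^esub> y') = x \<bullet> y \<oplus>\<^bsub>Z\<^esub> x \<bullet> y'"
  and ptens_swap: "x \<in> carrier X ==> s \<in> S ==> y \<in> carrier Y ==> ract X x s \<bullet> y = x \<bullet> lact Y s y"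
  using ptens_balanced by (auto simp: balanced_def)

lemma ptens_left_hom: "y \<in> carrier Y ==> (\<lambda>x. x \<bullet> y) \<in> add_hom X Z"
  by (rule add_homI) (simp_all add: ptens_closed ptens_add_left)

lemma ptens_right_hom: "x \<in> carrier X ==> (\<lambda>y. x \<bullet> y) \<in> add_hom Y Z"
  by (rule add_homI) (simp_all add: ptens_closed ptens_add_right)

lemma lift:
  assumes "abelian_group H" "balanced S X Y H \<phi>"
  shows lift_add_hom: "lift_hom H (\<lambda>(x, y). \<phi> x y) \<in> add_hom Z H"
    and lift_ptens: "\<And>x y. x \<in> carrier X ==> y \<in> carrier Y ==> lift_hom H (\<lambda>(x, y). \<phi> x y) (x \<bullet> y) = \<phi> x y"
proof -
  interpret H: abelian_group H by fact
  let ?f = "\<lambda>(x, y). \<phi> x y"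
  have cl: "?f \<in> carrier X \<times> carrier Y \<rightarrow> carrier H"
    using assms(2) by (auto simp: balanced_def)
  have "feval H ?f r = \<zero>\<^bsub>H\<^esub>" if "r \<in> tensor_rels S X Y" for r
    using that assms(2) unfolding tensor_rels_def balanced_def
    by (auto simp: H.feval_frag_diff3[OF cl] H.feval_frag_diff2[OF cl] ract_X lact_Y
        H.minus_minus_zero H.minus_self)
  note * = P.lift_hom[OF assms(1) _ this]
  show "lift_hom H ?f \<in> add_hom Z H"
    by (rule *(1)) (use cl in blast)
  show "lift_hom H ?f (x \<bullet> y) = \<phi> x y" if "x \<in> carrier X" "y \<in> carrier Y" for x y
  proof -
    have "lift_hom H ?f (gen (carrier X \<times> carrier Y) (tensor_rels S X Y) (x, y)) = ?f (x, y)"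
      by (rule *(2)) (use cl that in blast)+
    then show ?thesis by (simp add: ptens_def)
  qed
qed

lemma tensor_ext:
  assumes "f \<in> add_hom Z H" "g \<in> add_hom Z H" "abelian_group H"
    and "\<And>x y. x \<in> carrier X ==> y \<in> carrier Y ==> f (x \<bullet> y) = g (x \<bullet> y)" "t \<in> carrier Z"
  shows "f t = g t"
  by (rule P.hom_eq[OF assms(1-3) _ assms(5)]) (use assms(4) in \<open>auto simp: ptens_def\<close>)

lemma neg_ptens: "x \<in> carrier X ==> y \<in> carrier Y ==> \<ominus>\<^bsub>Z\<^esub> (x \<bullet> y) = (\<ominus>\<^bsub>X\<^esub> x) \<bullet> y"
  by (rule add_hom_neg[OF ptens_left_hom, symmetric]) (auto intro: X.abelian_group_axioms P.abelian_group)

lemma zero_ptens: "y \<in> carrier Y ==> \<zero>\<^bsub>X\<^esub> \<bullet> y = \<zero>\<^bsub>Z\<^esub>"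
  by (rule add_hom_zero[OF ptens_left_hom]) (auto intro: X.abelian_group_axioms P.abelian_group)

lemma ptens_zero: "x \<in> carrier X ==> x \<bullet> \<zero>\<^bsub>Y\<^esub> = \<zero>\<^bsub>Z\<^esub>"
  by (rule add_hom_zero[OF ptens_right_hom]) (auto intro: Y.abelian_group_axioms P.abelian_group)

text \<open>Every element is a sum of pure tensors: a negative is absorbed by the first factor.
  Proving the claim for t and -t together turns the differences of the general induction into
  sums.\<close>

lemma tensor_induct [consumes 1, case_names ptens add]:
  assumes "t \<in> carrier Z"
    and "\<And>x y. x \<in> carrier X ==> y \<in> carrier Y ==> P (x \<bullet> y)"
    and "\<And>s t. s \<in> carrier Z ==> t \<in> carrier Z ==> P s ==> P t ==> P (s \<oplus>\<^bsub>Z\<^esub> t)"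
  shows "P t"
proof -
  have "P t \<and> P (\<ominus>\<^bsub>Z\<^esub> t)"
    using assms(1)
  proof (induction rule: P.induct)
    case (gen g)
    then obtain x y where g: "g = (x, y)" "x \<in> carrier X" "y \<in> carrier Y" by auto
    have "P ((\<ominus>\<^bsub>X\<^esub> x) \<bullet> y)" using g assms(2) by simp
    then show ?case
      using g assms(2) neg_ptens[OF g(2,3)] by (simp add: ptens_def)
  next
    case (diff s t)
    then have "P (s \<oplus>\<^bsub>Z\<^esub> \<ominus>\<^bsub>Z\<^esub> t)" "P (t \<oplus>\<^bsub>Z\<^esub> \<ominus>\<^bsub>Z\<^esub> s)"
      by (auto intro!: assms(3))
    moreover have "\<ominus>\<^bsub>Z\<^esub> (s \<oplus>\<^bsub>Z\<^esub> \<ominus>\<^bsub>Z\<^esub> t) = t \<oplus>\<^bsub>Z\<^esub> \<ominus>\<^bsub>Z\<^esub> s"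
      using diff by (simp add: P.minus_add P.a_comm)
    ultimately show ?case by (simp add: a_minus_def)
  next
    case zero
    have "P (\<zero>\<^bsub>X\<^esub> \<bullet> \<zero>\<^bsub>Y\<^esub>)" by (rule assms(2)) auto
    then have "P \<zero>\<^bsub>Z\<^esub>" by (simp add: zero_ptens)
    moreover have "\<ominus>\<^bsub>Z\<^esub> \<zero>\<^bsub>Z\<^esub> = \<zero>\<^bsub>Z\<^esub>" by (rule P.minus_equality) auto
    ultimately show ?case by metis
  qed
  then show ?thesis ..
qed

end

section \<open>Functoriality of the tensor product and its bimodule structure\<close>

locale tens_map = T: tens S X Y + T': tens S X' Y'
  for S :: "'s set" and X :: "('k, 'r, 's, 'x) bimod" and Y :: "('k, 's, 't, 'y) bimod"
    and X' :: "('k1, 'r1, 's, 'x1) bimod" and Y' :: "('k1, 's, 't1, 'y1) bimod" +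
  fixes f g
  assumes f: "f \<in> add_hom X X'" and g: "g \<in> add_hom Y Y'"
    and f_ract: "\<And>x s. x \<in> carrier X ==> s \<in> S ==> f (ract X x s) = ract X' (f x) s"
    and g_lact: "\<And>y s. y \<in> carrier Y ==> s \<in> S ==> g (lact Y s y) = lact Y' s (g y)"
begin

lemma balanced: "balanced S X Y (tensor S X' Y') (\<lambda>x y. ptens S X' Y' (f x) (g y))"
  using f g by (auto simp: balanced_def add_hom_closed add_hom_add f_ract g_lact T'.ptens_closed
      T'.ptens_add_left T'.ptens_add_right T'.ptens_swap)

lemma map_hom: "tensor_map S X' Y' f g \<in> add_hom (tensor S X Y) (tensor S X' Y')"
  unfolding tensor_map_def by (rule T.lift_add_hom[OF T'.P.abelian_group balanced])

lemma map_ptens: "x \<in> carrier X ==> y \<in> carrier Y ==>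
    tensor_map S X' Y' f g (ptens S X Y x y) = ptens S X' Y' (f x) (g y)"
  unfolding tensor_map_def by (rule T.lift_ptens[OF T'.P.abelian_group balanced])

end

text \<open>Each action is functoriality applied to one factor. Additivity and the value on pure
  tensors then come from \<open>tens_map\<close>, and the bimodule axioms need checking on pure
  tensors only.\<close>

lemma tensor_actions:
  "smult (tensor S X Y) c = tensor_map S X Y (smult X c) (\<lambda>y. y)"
  "lact (tensor S X Y) r = tensor_map S X Y (lact X r) (\<lambda>y. y)"
  "ract (tensor S X Y) t q = tensor_map S X Y (\<lambda>x. x) (\<lambda>y. ract Y y q) t"
proof -
  let ?G = "presented_group (carrier X \<times> carrier Y) (tensor_rels S X Y)"
  have *: "lift_hom ?G = lift_hom (tensor S X Y)"
    by (rule lift_hom_cong) (simp_all add: tensor_def Let_def)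
  have "smult (tensor S X Y) c = lift_hom ?G (\<lambda>(x, y). ptens S X Y (c \<odot>\<^bsub>X\<^esub> x) y)"
    "lact (tensor S X Y) r = lift_hom ?G (\<lambda>(x, y). ptens S X Y (lact X r x) y)"
    "ract (tensor S X Y) t q = lift_hom ?G (\<lambda>(x, y). ptens S X Y x (ract Y y q)) t"
    by (simp_all add: tensor_def Let_def)
  then show "smult (tensor S X Y) c = tensor_map S X Y (smult X c) (\<lambda>y. y)"
    "lact (tensor S X Y) r = tensor_map S X Y (lact X r) (\<lambda>y. y)"
    "ract (tensor S X Y) t q = tensor_map S X Y (\<lambda>x. x) (\<lambda>y. ract Y y q) t"
    unfolding tensor_map_def by (simp_all only: *)
qed

locale tens_bim = tens "carrier S" X Y
  for K :: "('k, 'z) ring_scheme" and R :: "('k, 'r, 'u) module_scheme"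
    and S :: "('k, 's, 'v) module_scheme" and T :: "('k, 't, 'w) module_scheme"
    and X :: "('k, 'r, 's, 'x) bimod" and Y :: "('k, 's, 't, 'y) bimod" +
  assumes bim_X: "bim K R S X" and bim_Y: "bim K S T Y" 
    and algebra_R: "k_algebra K R" and algebra_S: "k_algebra K S" and algebra_T: "k_algebra K T"
begin

abbreviation "W \<equiv> tensor (carrier S) X Y"
abbreviation pure (infixl "\<bullet>" 75) where "pure \<equiv> ptens (carrier S) X Y"

sublocale X: module K X using bim_X by (rule bim_module)
sublocale Y: module K Y using bim_Y by (rule bim_module)

lemmas left_X = bim_left[OF bim_X] and right_X = bim_right[OF bim_X]
  and left_Y = bim_left[OF bim_Y] and right_Y = bim_right[OF bim_Y]

lemma smult_map: "c \<in> carrier K ==> tens_map (carrier S) X Y X Y (smult X c) (\<lambda>y. y)"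
  by unfold_locales (auto intro!: add_homI simp: X.smult_r_distr smult_ract(1)[OF algebra_S right_X])

lemma lact_map: "r \<in> carrier R ==> tens_map (carrier S) X Y X Y (lact X r) (\<lambda>y. y)"
  by unfold_locales (auto intro!: add_homI simp: lact_closed[OF left_X] lact_add[OF left_X] bim_comm[OF bim_X])

lemma ract_map: "r \<in> carrier T ==> tens_map (carrier S) X Y X Y (\<lambda>x. x) (\<lambda>y. ract Y y r)"
  by unfold_locales (auto intro!: add_homI simp: ract_closed[OF right_Y] ract_add[OF right_Y] bim_comm[OF bim_Y])

lemma smult_hom: "c \<in> carrier K ==> smult W c \<in> add_hom W W"
  unfolding tensor_actions by (rule tens_map.map_hom[OF smult_map])

lemma lact_hom: "r \<in> carrier R ==> lact W r \<in> add_hom W W"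
  unfolding tensor_actions by (rule tens_map.map_hom[OF lact_map])

lemma ract_hom: "r \<in> carrier T ==> (\<lambda>t. ract W t r) \<in> add_hom W W"
  unfolding tensor_actions by (rule tens_map.map_hom[OF ract_map])

lemma smult_ptens: "c \<in> carrier K ==> x \<in> carrier X ==> y \<in> carrier Y ==>
    c \<odot>\<^bsub>W\<^esub> (x \<bullet> y) = (c \<odot>\<^bsub>X\<^esub> x) \<bullet> y"
  unfolding tensor_actions by (rule tens_map.map_ptens[OF smult_map])

lemma lact_ptens: "r \<in> carrier R ==> x \<in> carrier X ==> y \<in> carrier Y ==>
    lact W r (x \<bullet> y) = lact X r x \<bullet> y"
  unfolding tensor_actions by (rule tens_map.map_ptens[OF lact_map])

lemma ract_ptens: "r \<in> carrier T ==> x \<in> carrier X ==> y \<in> carrier Y ==>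
    ract W (x \<bullet> y) r = x \<bullet> ract Y y r"
  unfolding tensor_actions by (rule tens_map.map_ptens[OF ract_map])

text \<open>The scalar action is defined on the left factor. It moves across because c acts on both
  factors as the element c 1 of the algebra over which the tensor product is taken.\<close>

lemma smult_ptens_right:
  assumes "c \<in> carrier K" "x \<in> carrier X" "y \<in> carrier Y"
  shows "c \<odot>\<^bsub>W\<^esub> (x \<bullet> y) = x \<bullet> (c \<odot>\<^bsub>Y\<^esub> y)"
proof -
  have "(c \<odot>\<^bsub>X\<^esub> x) \<bullet> y = ract X x (c \<odot>\<^bsub>S\<^esub> \<one>\<^bsub>S\<^esub>) \<bullet> y"
    using assms by (simp add: ract_scalar[OF right_X])
  also have "\<dots> = x \<bullet> lact Y (c \<odot>\<^bsub>S\<^esub> \<one>\<^bsub>S\<^esub>) y"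
    using assms by (simp add: ptens_swap k_algebra_scalar_closed[OF algebra_S])
  finally show ?thesis using assms by (simp add: smult_ptens lact_scalar[OF left_Y])
qed

sublocale R: ring R using algebra_R by (rule k_algebra_ring)
sublocale T: ring T using algebra_T by (rule k_algebra_ring)

lemmas closed_R = R.add.m_closed R.m_closed R.one_closed k_algebra_scalar_closed[OF algebra_R]
  and closed_T = T.add.m_closed T.m_closed T.one_closed k_algebra_scalar_closed[OF algebra_T]

lemmas ext = tensor_ext[OF _ _ P.abelian_group]

lemma module_tensor: "module K W"
proof (rule moduleI)
  show "cring K" using X.R.cring_axioms by simp
  show "abelian_group W" by (rule P.abelian_group)
  fix a x assume a: "a \<in> carrier K" and x: "x \<in> carrier W"
  show "a \<odot>\<^bsub>W\<^esub> x \<in> carrier W" using smult_hom[OF a] x by (rule add_hom_closed)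
next
  fix a b x assume a: "a \<in> carrier K" "b \<in> carrier K" and x: "x \<in> carrier W"
  show "(a \<oplus>\<^bsub>K\<^esub> b) \<odot>\<^bsub>W\<^esub> x = a \<odot>\<^bsub>W\<^esub> x \<oplus>\<^bsub>W\<^esub> b \<odot>\<^bsub>W\<^esub> x"
    by (rule ext[OF _ _ _ x]) (use a in \<open>auto intro!: smult_hom add_hom_plus P.abelian_group
        simp: smult_ptens X.smult_l_distr ptens_add_left\<close>)
next
  fix a x y assume a: "a \<in> carrier K" and x: "x \<in> carrier W" "y \<in> carrier W"
  show "a \<odot>\<^bsub>W\<^esub> (x \<oplus>\<^bsub>W\<^esub> y) = a \<odot>\<^bsub>W\<^esub> x \<oplus>\<^bsub>W\<^esub> a \<odot>\<^bsub>W\<^esub> y"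
    by (rule add_hom_add[OF smult_hom[OF a] x])
next
  fix a b x assume a: "a \<in> carrier K" "b \<in> carrier K" and x: "x \<in> carrier W"
  show "(a \<otimes>\<^bsub>K\<^esub> b) \<odot>\<^bsub>W\<^esub> x = a \<odot>\<^bsub>W\<^esub> (b \<odot>\<^bsub>W\<^esub> x)"
    by (rule ext[OF _ _ _ x]) (use a in \<open>auto intro!: smult_hom add_hom_compose[of "smult W b" W W "smult W a"]
        simp: smult_ptens X.smult_assoc1\<close>)
next
  fix x assume x: "x \<in> carrier W"
  show "\<one>\<^bsub>K\<^esub> \<odot>\<^bsub>W\<^esub> x = x"
    by (rule ext[OF _ _ _ x]) (auto intro!: smult_hom add_hom_id simp: smult_ptens)
qed

lemma bim_tensor: "bim K R T W"
  unfolding bim_def left_module_def right_module_def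
proof (intro conjI ballI module_tensor)
  fix r s x assume r: "r \<in> carrier R" "s \<in> carrier R" and x: "x \<in> carrier W"
  show "lact W (r \<oplus>\<^bsub>R\<^esub> s) x = lact W r x \<oplus>\<^bsub>W\<^esub> lact W s x"
    by (rule ext[OF _ _ _ x]) (use r in \<open>auto intro!: lact_hom add_hom_plus P.abelian_group closed_R
        simp: lact_ptens lact_add_left[OF left_X] ptens_add_left lact_closed[OF left_X]\<close>)
  show "lact W (r \<otimes>\<^bsub>R\<^esub> s) x = lact W r (lact W s x)"
    by (rule ext[OF _ _ _ x]) (use r in \<open>auto intro!: lact_hom add_hom_compose[of "lact W s" W W "lact W r"] closed_R
        simp: lact_ptens lact_mult[OF left_X] lact_closed[OF left_X]\<close>)
next
  fix r s x assume r: "r \<in> carrier T" "s \<in> carrier T" and x: "x \<in> carrier W"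
  show "ract W x (r \<oplus>\<^bsub>T\<^esub> s) = ract W x r \<oplus>\<^bsub>W\<^esub> ract W x s"
    by (rule ext[OF _ _ _ x]) (use r in \<open>auto intro!: ract_hom add_hom_plus P.abelian_group closed_T
        simp: ract_ptens ract_add_right[OF right_Y] ptens_add_right ract_closed[OF right_Y]\<close>)
  show "ract W x (r \<otimes>\<^bsub>T\<^esub> s) = ract W (ract W x r) s"
    by (rule ext[OF _ _ _ x]) (use r in \<open>auto intro!: ract_hom closed_T
        add_hom_compose[of "\<lambda>x. ract W x r" W W "\<lambda>x. ract W x s"]
        simp: ract_ptens ract_mult[OF right_Y] ract_closed[OF right_Y]\<close>)
next
  fix r s x assume r: "r \<in> carrier R" "s \<in> carrier T" and x: "x \<in> carrier W"
  show "ract W (lact W r x) s = lact W r (ract W x s)"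
    by (rule ext[OF _ _ _ x]) (use r in \<open>auto intro!:
        add_hom_compose[OF lact_hom ract_hom] add_hom_compose[OF ract_hom lact_hom]
        simp: ract_ptens lact_ptens lact_closed[OF left_X] ract_closed[OF right_Y]\<close>)
next
  fix x assume x: "x \<in> carrier W"
  show "lact W \<one>\<^bsub>R\<^esub> x = x"
    by (rule ext[OF _ _ _ x]) (auto intro!: lact_hom add_hom_id closed_R simp: lact_ptens lact_one[OF left_X])
  show "ract W x \<one>\<^bsub>T\<^esub> = x"
    by (rule ext[OF _ _ _ x]) (auto intro!: ract_hom add_hom_id closed_T simp: ract_ptens ract_one[OF right_Y])
next
  fix c x assume c: "c \<in> carrier K" and x: "x \<in> carrier W"
  show "lact W (c \<odot>\<^bsub>R\<^esub> \<one>\<^bsub>R\<^esub>) x = c \<odot>\<^bsub>W\<^esub> x"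
    by (rule ext[OF _ _ _ x])
       (use c in \<open>auto intro!: lact_hom smult_hom closed_R simp: lact_ptens smult_ptens lact_scalar[OF left_X] closed_R\<close>)
  show "ract W x (c \<odot>\<^bsub>T\<^esub> \<one>\<^bsub>T\<^esub>) = c \<odot>\<^bsub>W\<^esub> x"
    by (rule ext[OF _ _ _ x])
       (use c in \<open>auto intro!: ract_hom smult_hom closed_T simp: ract_ptens smult_ptens_right ract_scalar[OF right_Y] closed_T\<close>)
qed (auto simp: add_hom_closed[OF lact_hom] add_hom_closed[OF ract_hom] add_hom_add[OF lact_hom]
    add_hom_add[OF ract_hom])

end

lemma tens_bimI:
  assumes "bim K R S X" "bim K S T Y" "k_algebra K R" "k_algebra K S" "k_algebra K T"
  shows "tens_bim K R S T X Y"
  using assms tens_ok_modules[OF bim_right[OF assms(1)] bim_left[OF assms(2)]]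
  by (simp add: tens_bim_def tens_bim_axioms_def tens_def)

section \<open>Linear sections\<close>

lemma k_linearD:
  assumes "g \<in> k_linear K Y Z"
  shows "\<And>x. x \<in> carrier Y ==> g x \<in> carrier Z"
    and "\<And>x y. x \<in> carrier Y ==> y \<in> carrier Y ==> g (x \<oplus>\<^bsub>Y\<^esub> y) = g x \<oplus>\<^bsub>Z\<^esub> g y"
    and "\<And>c x. c \<in> carrier K ==> x \<in> carrier Y ==> g (c \<odot>\<^bsub>Y\<^esub> x) = c \<odot>\<^bsub>Z\<^esub> g x"
    and "g \<in> add_hom Y Z"
  using assms by (auto simp: k_linear_def intro!: add_homI)

text \<open>The image of the section is a maximal subspace of \<open>Y\<close> meeting the kernel of \<open>g\<close> in \<open>0\<close>.\<close>

lemma linear_section: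
  assumes "field K" "module K Y" "module K Z" "g \<in> k_linear K Y Z"
  obtains \<sigma> where "\<And>z. z \<in> g ` carrier Y ==> \<sigma> z \<in> carrier Y"
    "\<And>z. z \<in> g ` carrier Y ==> g (\<sigma> z) = z"
    "\<And>z w. z \<in> g ` carrier Y ==> w \<in> g ` carrier Y ==> \<sigma> (z \<oplus>\<^bsub>Z\<^esub> w) = \<sigma> z \<oplus>\<^bsub>Y\<^esub> \<sigma> w"
    "\<And>c z. c \<in> carrier K ==> z \<in> g ` carrier Y ==> \<sigma> (c \<odot>\<^bsub>Z\<^esub> z) = c \<odot>\<^bsub>Y\<^esub> \<sigma> z"
proof -
  interpret K: field K by fact
  interpret Y: module K Y by fact
  interpret Z: module K Z by fact
  note g = k_linearD[OF assms(4)]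
  have g0: "g \<zero>\<^bsub>Y\<^esub> = \<zero>\<^bsub>Z\<^esub>" by (rule add_hom_zero[OF g(4)]) unfold_locales
  have gneg: "g (\<ominus>\<^bsub>Y\<^esub> x) = \<ominus>\<^bsub>Z\<^esub> g x" if "x \<in> carrier Y" for x
    by (rule add_hom_neg[OF g(4) _ _ that]) unfold_locales
  define \<A> where "\<A> = {\<Gamma>. \<Gamma> \<subseteq> carrier Y \<and> \<zero>\<^bsub>Y\<^esub> \<in> \<Gamma> \<and> (\<forall>x\<in>\<Gamma>. \<forall>y\<in>\<Gamma>. x \<oplus>\<^bsub>Y\<^esub> y \<in> \<Gamma>) \<and>
    (\<forall>c\<in>carrier K. \<forall>x\<in>\<Gamma>. c \<odot>\<^bsub>Y\<^esub> x \<in> \<Gamma>) \<and> (\<forall>x\<in>\<Gamma>. g x = \<zero>\<^bsub>Z\<^esub> \<longrightarrow> x = \<zero>\<^bsub>Y\<^esub>)}"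
  have "{\<zero>\<^bsub>Y\<^esub>} \<in> \<A>" by (auto simp: \<A>_def)
  moreover have "\<Union>\<C> \<in> \<A>" if "\<C> \<noteq> {}" "subset.chain \<A> \<C>" for \<C>
  proof -
    have sub: "\<C> \<subseteq> \<A>" and ch: "\<And>X Y. X \<in> \<C> ==> Y \<in> \<C> ==> X \<subseteq> Y \<or> Y \<subseteq> X"
      using that(2) by (auto simp: subset_chain_def)
    have "x \<oplus>\<^bsub>Y\<^esub> y \<in> \<Union>\<C>" if xy: "x \<in> \<Union>\<C>" "y \<in> \<Union>\<C>" for x y
    proof -
      obtain X1 X2 where X: "X1 \<in> \<C>" "x \<in> X1" "X2 \<in> \<C>" "y \<in> X2" using xy by blast
      then obtain X where "X \<in> \<C>" "x \<in> X" "y \<in> X" using ch[OF X(1,3)] by blast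
      then have "x \<oplus>\<^bsub>Y\<^esub> y \<in> X" using sub unfolding \<A>_def by blast
      then show ?thesis using \<open>X \<in> \<C>\<close> by blast
    qed
    moreover have "\<zero>\<^bsub>Y\<^esub> \<in> \<Union>\<C>" "\<Union>\<C> \<subseteq> carrier Y"
      using that(1) sub unfolding \<A>_def by blast+
    moreover have "\<forall>c\<in>carrier K. \<forall>x\<in>\<Union>\<C>. c \<odot>\<^bsub>Y\<^esub> x \<in> \<Union>\<C>"
      using sub unfolding \<A>_def by blast
    moreover have "\<forall>x\<in>\<Union>\<C>. g x = \<zero>\<^bsub>Z\<^esub> \<longrightarrow> x = \<zero>\<^bsub>Y\<^esub>"
      using sub unfolding \<A>_def by blast
    ultimately show ?thesis unfolding \<A>_def by blast
  qed
  ultimately obtain \<Gamma> where \<Gamma>: "\<Gamma> \<in> \<A>" and max: "\<And>X. X \<in> \<A> ==> \<Gamma> \<subseteq> X ==> X = \<Gamma>"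
    using subset_Zorn_nonempty[of \<A>] by blast
  have \<Gamma>Y: "\<Gamma> \<subseteq> carrier Y" and \<Gamma>0: "\<zero>\<^bsub>Y\<^esub> \<in> \<Gamma>"
    and \<Gamma>add: "\<And>x y. x \<in> \<Gamma> ==> y \<in> \<Gamma> ==> x \<oplus>\<^bsub>Y\<^esub> y \<in> \<Gamma>"
    and \<Gamma>sm: "\<And>c x. c \<in> carrier K ==> x \<in> \<Gamma> ==> c \<odot>\<^bsub>Y\<^esub> x \<in> \<Gamma>"
    and \<Gamma>ker: "\<And>x. x \<in> \<Gamma> ==> g x = \<zero>\<^bsub>Z\<^esub> ==> x = \<zero>\<^bsub>Y\<^esub>"
    using \<Gamma> unfolding \<A>_def by blast+
  have \<Gamma>Y': "x \<in> \<Gamma> ==> x \<in> carrier Y" for x using \<Gamma>Y by blast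
  have \<Gamma>neg: "\<ominus>\<^bsub>Y\<^esub> x \<in> \<Gamma>" if "x \<in> \<Gamma>" for x
  proof -
    have "(\<ominus>\<^bsub>K\<^esub> \<one>\<^bsub>K\<^esub>) \<odot>\<^bsub>Y\<^esub> x \<in> \<Gamma>" using that by (intro \<Gamma>sm) auto
    then show ?thesis using \<Gamma>Y'[OF that] by (simp add: Y.smult_l_minus)
  qed
  have inj: "inj_on g \<Gamma>"
  proof (rule inj_onI)
    fix x y assume xy: "x \<in> \<Gamma>" "y \<in> \<Gamma>" "g x = g y"
    have "g (x \<oplus>\<^bsub>Y\<^esub> \<ominus>\<^bsub>Y\<^esub> y) = \<zero>\<^bsub>Z\<^esub>"
      using xy \<Gamma>Y' by (simp add: g gneg Z.r_neg)
    then have "x \<oplus>\<^bsub>Y\<^esub> \<ominus>\<^bsub>Y\<^esub> y = \<zero>\<^bsub>Y\<^esub>" using xy by (intro \<Gamma>ker \<Gamma>add \<Gamma>neg)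
    then show "x = y" using xy \<Gamma>Y' by (metis Y.a_inv_closed Y.minus_equality Y.minus_minus)
  qed
  have onto: "g ` \<Gamma> = g ` carrier Y"
  proof (intro subset_antisym subsetI)
    fix z assume "z \<in> g ` carrier Y"
    then obtain y where y: "y \<in> carrier Y" "z = g y" by auto
    show "z \<in> g ` \<Gamma>"
    proof (rule ccontr)
      assume nz: "z \<notin> g ` \<Gamma>"
      define \<Gamma>' where "\<Gamma>' = {x \<oplus>\<^bsub>Y\<^esub> c \<odot>\<^bsub>Y\<^esub> y | x c. x \<in> \<Gamma> \<and> c \<in> carrier K}"
      have "\<Gamma>' \<in> \<A>"
        unfolding \<A>_def
      proof (intro CollectI conjI ballI impI)
        show "\<Gamma>' \<subseteq> carrier Y" using \<Gamma>Y y(1) by (auto simp: \<Gamma>'_def)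
        show "\<zero>\<^bsub>Y\<^esub> \<in> \<Gamma>'" unfolding \<Gamma>'_def using \<Gamma>0 y(1)
          by (intro CollectI exI[of _ "\<zero>\<^bsub>Y\<^esub>"] exI[of _ "\<zero>\<^bsub>K\<^esub>"]) auto
      next
        fix u v assume "u \<in> \<Gamma>'" "v \<in> \<Gamma>'"
        then obtain x c x' c' where *: "u = x \<oplus>\<^bsub>Y\<^esub> c \<odot>\<^bsub>Y\<^esub> y" "v = x' \<oplus>\<^bsub>Y\<^esub> c' \<odot>\<^bsub>Y\<^esub> y"
          "x \<in> \<Gamma>" "x' \<in> \<Gamma>" "c \<in> carrier K" "c' \<in> carrier K" by (auto simp: \<Gamma>'_def)
        then have "u \<oplus>\<^bsub>Y\<^esub> v = (x \<oplus>\<^bsub>Y\<^esub> x') \<oplus>\<^bsub>Y\<^esub> (c \<oplus>\<^bsub>K\<^esub> c') \<odot>\<^bsub>Y\<^esub> y"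
          using y(1) \<Gamma>Y' by (simp add: Y.smult_l_distr Y.a_ac)
        then show "u \<oplus>\<^bsub>Y\<^esub> v \<in> \<Gamma>'" using * \<Gamma>add unfolding \<Gamma>'_def by blast
      next
        fix a u assume a: "a \<in> carrier K" and "u \<in> \<Gamma>'"
        then obtain x c where *: "u = x \<oplus>\<^bsub>Y\<^esub> c \<odot>\<^bsub>Y\<^esub> y" "x \<in> \<Gamma>" "c \<in> carrier K"
          by (auto simp: \<Gamma>'_def)
        then have "a \<odot>\<^bsub>Y\<^esub> u = a \<odot>\<^bsub>Y\<^esub> x \<oplus>\<^bsub>Y\<^esub> (a \<otimes>\<^bsub>K\<^esub> c) \<odot>\<^bsub>Y\<^esub> y"
          using a y(1) \<Gamma>Y' by (simp add: Y.smult_r_distr Y.smult_assoc1)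
        then show "a \<odot>\<^bsub>Y\<^esub> u \<in> \<Gamma>'" using * a \<Gamma>sm unfolding \<Gamma>'_def by blast
      next
        fix u assume "u \<in> \<Gamma>'" and u0: "g u = \<zero>\<^bsub>Z\<^esub>"
        then obtain x c where *: "u = x \<oplus>\<^bsub>Y\<^esub> c \<odot>\<^bsub>Y\<^esub> y" "x \<in> \<Gamma>" "c \<in> carrier K"
          by (auto simp: \<Gamma>'_def)
        have xY: "x \<in> carrier Y" using * \<Gamma>Y' by blast
        have gu: "g x \<oplus>\<^bsub>Z\<^esub> c \<odot>\<^bsub>Z\<^esub> z = \<zero>\<^bsub>Z\<^esub>" using u0 * xY y by (simp add: g)
        have zZ: "z \<in> carrier Z" using y g(1) by blast
        show "u = \<zero>\<^bsub>Y\<^esub>"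
        proof (cases "c = \<zero>\<^bsub>K\<^esub>")
          case True
          then have "u = x" using * xY y by simp
          then show ?thesis using u0 * \<Gamma>ker by simp
        next
          case False
          \<comment> \<open>This is where K must be a field: dividing by c expresses z as the image
            of an element of \<Gamma>, against its choice.\<close>
          then have c: "c \<in> Units K" using *(3) by (simp add: K.field_Units)
          then have ic: "inv\<^bsub>K\<^esub> c \<in> carrier K" by simp
          have "c \<odot>\<^bsub>Z\<^esub> z = \<ominus>\<^bsub>Z\<^esub> g x"
            using gu *(3) zZ g(1)[OF xY] by (metis Z.add.inv_comm Z.add.m_closed Z.minus_equality Z.smult_closed)
          then have "inv\<^bsub>K\<^esub> c \<odot>\<^bsub>Z\<^esub> (c \<odot>\<^bsub>Z\<^esub> z) = g (inv\<^bsub>K\<^esub> c \<odot>\<^bsub>Y\<^esub> (\<ominus>\<^bsub>Y\<^esub> x))"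
            using ic xY by (simp add: g gneg)
          moreover have "inv\<^bsub>K\<^esub> c \<odot>\<^bsub>Z\<^esub> (c \<odot>\<^bsub>Z\<^esub> z) = z"
            using ic *(3) zZ c by (simp add: Z.smult_assoc1[symmetric])
          ultimately have "z \<in> g ` \<Gamma>" using \<Gamma>sm[OF ic \<Gamma>neg[OF *(2)]] by simp
          with nz show ?thesis ..
        qed
      qed
      moreover have "\<Gamma> \<subseteq> \<Gamma>'"
      proof
        fix x assume x: "x \<in> \<Gamma>"
        have "x = x \<oplus>\<^bsub>Y\<^esub> \<zero>\<^bsub>K\<^esub> \<odot>\<^bsub>Y\<^esub> y" using \<Gamma>Y'[OF x] y by simp
        then show "x \<in> \<Gamma>'" using x unfolding \<Gamma>'_def by blast
      qed
      ultimately have "\<Gamma>' = \<Gamma>" by (rule max)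
      moreover have "y \<in> \<Gamma>'" unfolding \<Gamma>'_def using \<Gamma>0 y(1)
        by (intro CollectI exI[of _ "\<zero>\<^bsub>Y\<^esub>"] exI[of _ "\<one>\<^bsub>K\<^esub>"]) auto
      ultimately show False using nz y by blast
    qed
  qed (use \<Gamma>Y in auto)
  define \<sigma> where "\<sigma> = inv_into \<Gamma> g"
  have \<sigma>: "\<sigma> z \<in> \<Gamma>" "g (\<sigma> z) = z" if "z \<in> g ` carrier Y" for z
    using that unfolding \<sigma>_def onto[symmetric] by (auto intro: inv_into_into f_inv_into_f)
  have uniq: "\<sigma> z = x" if "x \<in> \<Gamma>" "g x = z" for x z
    using that inj by (auto simp: \<sigma>_def)
  show thesis
  proof (rule that[of \<sigma>])
    fix z w assume "z \<in> g ` carrier Y" "w \<in> g ` carrier Y"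
    then show "\<sigma> (z \<oplus>\<^bsub>Z\<^esub> w) = \<sigma> z \<oplus>\<^bsub>Y\<^esub> \<sigma> w"
      using \<sigma> \<Gamma>Y' by (intro uniq \<Gamma>add) (auto simp: g)
  next
    fix c z assume "c \<in> carrier K" "z \<in> g ` carrier Y"
    then show "\<sigma> (c \<odot>\<^bsub>Z\<^esub> z) = c \<odot>\<^bsub>Y\<^esub> \<sigma> z"
      using \<sigma> \<Gamma>Y' by (intro uniq \<Gamma>sm) (auto simp: g)
  qed (use \<sigma> \<Gamma>Y' in auto)
qed

section \<open>Homomorphisms of bimodules\<close>

definition subalg :: "('k, 'z) ring_scheme \<Rightarrow> ('k, 'a) module \<Rightarrow> ('k, 'a) module \<Rightarrow> bool" where
  "subalg K A B \<longleftrightarrow> k_algebra K A \<and> k_algebra K B \<and> carrier B \<subseteq> carrier A \<and> mult B = mult A \<and>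
     add B = add A \<and> one B = one A \<and> zero B = zero A \<and> smult B = smult A"

lemma subalgD:
  assumes "subalg K A B"
  shows "k_algebra K A" "k_algebra K B" "b \<in> carrier B ==> b \<in> carrier A" "mult B = mult A"
     "add B = add A" "one B = one A" "zero B = zero A" "smult B = smult A"
  using assms by (auto simp: subalg_def)

lemma left_module_restrict: "subalg K A B ==> left_module K A M ==> left_module K B M"
  by (auto simp: left_module_def subalgD)

lemma right_module_restrict: "subalg K A B ==> right_module K A M ==> right_module K B M"
  by (auto simp: right_module_def subalgD)

lemma bim_restrict_left: "subalg K A B ==> bim K A S M ==> bim K B S M"
  by (auto simp: bim_def subalgD left_module_restrict)

lemma bim_restrict_right: "subalg K A B ==> bim K S A M ==> bim K S B M"
  by (auto simp: bim_def subalgD right_module_restrict)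

lemma bim_regular:
  assumes "k_algebra K A"
  shows "bim K A A (regular A)"
proof -
  interpret A: ring A using assms by (rule k_algebra_ring)
  interpret M: module K A using assms by (rule k_algebra_module)
  have "module K (regular A)"
    by (rule moduleI) (auto simp: regular_def M.smult_l_distr M.smult_r_distr M.smult_assoc1
        M.R.is_cring intro!: abelian_groupI A.add.m_assoc A.add.m_comm bexI[of _ "\<ominus>\<^bsub>A\<^esub> x" for x] A.l_neg)
  then show ?thesis
    by (auto simp: bim_def left_module_def right_module_def regular_def A.l_distr A.r_distr A.m_assoc
        k_algebra_smult_left[OF assms] k_algebra_smult_right[OF assms])
qed

lemma regular_simps [simp]:
  "carrier (regular A) = carrier A" "zero (regular A) = zero A" "add (regular A) = add A"
  "smult (regular A) = smult A" "lact (regular A) = mult A" "ract (regular A) = mult A"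
  by (simp_all add: regular_def)

text \<open>The ground field as an algebra over itself, so that tensor products over k become an
  instance of tensor products over an algebra.\<close>

definition scalars :: "'k ring \<Rightarrow> ('k, 'k) module" where
  "scalars K = \<lparr>carrier = carrier K, mult = mult K, one = one K, zero = zero K, add = add K, smult = mult K\<rparr>"

lemma scalars_simps [simp]:
  "carrier (scalars K) = carrier K" "mult (scalars K) = mult K" "one (scalars K) = one K"
  "zero (scalars K) = zero K" "add (scalars K) = add K" "smult (scalars K) = mult K"
  by (simp_all add: scalars_def)

lemma left_regular_simps [simp]:
  "carrier (left_regular A) = carrier A" "zero (left_regular A) = zero A" "add (left_regular A) = add A"
  "smult (left_regular A) = smult A" "lact (left_regular A) = mult A" "ract (left_regular A) x c = c \<odot>\<^bsub>A\<^esub> x"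
  by (simp_all add: left_regular_def)

lemma k_bimod_simps [simp]:
  "carrier (k_bimod V) = carrier V" "zero (k_bimod V) = zero V" "add (k_bimod V) = add V"
  "smult (k_bimod V) = smult V" "lact (k_bimod V) = smult V" "ract (k_bimod V) x c = c \<odot>\<^bsub>V\<^esub> x"
  by (simp_all add: k_bimod_def)

lemma module_cong:
  assumes "module K M" "carrier N = carrier M" "add N = add M" "zero N = zero M" "smult N = smult M"
  shows "module K N"
proof -
  interpret M: module K M by fact
  show ?thesis
    by (rule moduleI) (auto simp: assms M.smult_l_distr M.smult_r_distr M.smult_assoc1
        M.R.is_cring M.a_ac intro!: abelian_groupI bexI[of _ "\<ominus>\<^bsub>M\<^esub> x" for x] M.l_neg)
qed

lemma abelian_group_cong:
  assumes "abelian_group M" "carrier N = carrier M" "add N = add M" "zero N = zero M"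
  shows "abelian_group N"
proof -
  interpret M: abelian_group M by fact
  show ?thesis
    by (auto simp: assms M.a_ac intro!: abelian_groupI bexI[of _ "\<ominus>\<^bsub>M\<^esub> x" for x] M.l_neg)
qed

lemma k_algebra_scalars:
  assumes "cring K"
  shows "k_algebra K (scalars K)"
proof -
  interpret K: cring K by fact
  have "module K (scalars K)"
    by (rule moduleI) (auto simp: K.l_distr K.r_distr K.m_assoc K.is_cring
        intro: abelian_group_cong[OF K.abelian_group_axioms])
  moreover have "ring (scalars K)"
    by (rule ringI) (auto simp: K.l_distr K.r_distr K.m_assoc
        intro: abelian_group_cong[OF K.abelian_group_axioms] monoidI)
  ultimately show ?thesis by (auto simp: k_algebra_def K.m_ac)
qed

lemma bim_k_bimod: "module K V ==> bim K (scalars K) (scalars K) (k_bimod V)"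
proof -
  assume V: "module K V"
  interpret V: module K V by fact
  show ?thesis
    by (auto simp: bim_def left_module_def right_module_def module_cong[OF V] V.smult_l_distr V.smult_r_distr
        V.smult_assoc1[symmetric] V.R.m_comm)
qed

lemma bim_left_regular:
  assumes "k_algebra K A"
  shows "bim K A (scalars K) (left_regular A)"
proof -
  interpret A: ring A using assms by (rule k_algebra_ring)
  interpret V: module K A using assms by (rule k_algebra_module)
  show ?thesis
    by (auto simp: bim_def left_module_def right_module_def module_cong[OF V.module_axioms] V.smult_l_distr V.smult_r_distr
        V.smult_assoc1[symmetric] V.R.m_comm A.l_distr A.r_distr A.m_assoc
        k_algebra_smult_left[OF assms] k_algebra_smult_right[OF assms])
qed

lemma bimod_homI:
  assumes "f \<in> add_hom M N"
    and "\<And>r x. r \<in> carrier R ==> x \<in> carrier M ==> f (lact M r x) = lact N r (f x)"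
    and "\<And>r x. r \<in> carrier R ==> x \<in> carrier M ==> f (ract M x r) = ract N (f x) r"
  shows "f \<in> bimod_hom R M N"
  using assms by (auto simp: bimod_hom_def left_hom_def right_hom_def add_hom_def)

lemma bimod_homD:
  assumes "f \<in> bimod_hom R M N"
  shows bimod_hom_add_hom: "f \<in> add_hom M N"
    and bimod_hom_closed: "\<And>x. x \<in> carrier M ==> f x \<in> carrier N"
    and bimod_hom_add: "\<And>x y. x \<in> carrier M ==> y \<in> carrier M ==> f (x \<oplus>\<^bsub>M\<^esub> y) = f x \<oplus>\<^bsub>N\<^esub> f y"
    and bimod_hom_lact: "\<And>r x. r \<in> carrier R ==> x \<in> carrier M ==> f (lact M r x) = lact N r (f x)"
    and bimod_hom_ract: "\<And>r x. r \<in> carrier R ==> x \<in> carrier M ==> f (ract M x r) = ract N (f x) r"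
  using assms by (auto simp: bimod_hom_def left_hom_def right_hom_def add_hom_def)

lemma bimod_hom_restrict: "subalg K A B ==> f \<in> bimod_hom A M N ==> f \<in> bimod_hom B M N"
  by (auto simp: bimod_hom_def left_hom_def right_hom_def subalgD)

lemma bimod_hom_cong:
  assumes "f \<in> bimod_hom R M N" "\<And>x. x \<in> carrier M ==> f x = f' x" "bim K R R M"
  shows "f' \<in> bimod_hom R M N"
proof -
  interpret M: abelian_group M using assms(3) by (rule bim_abelian_group)
  show ?thesis
    using assms(1) by (intro bimod_homI add_homI)
      (auto simp: assms(2)[symmetric] bimod_homD M.a_closed lact_closed[OF bim_left[OF assms(3)]]
        ract_closed[OF bim_right[OF assms(3)]])
qed

lemma bimod_hom_compose:
  "f \<in> bimod_hom R L M ==> g \<in> bimod_hom R M N ==> (\<lambda>x. g (f x)) \<in> bimod_hom R L N"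
  by (rule bimod_homI) (auto intro: add_hom_compose[of f L M g] simp: bimod_homD)

lemma bimod_hom_id: "(\<lambda>x. x) \<in> bimod_hom R M M"
  by (rule bimod_homI) (auto intro: add_hom_id)

lemma bimod_hom_zero:
  assumes "f \<in> bimod_hom R M N" "bim K R R M" "bim K R R N"
  shows "f \<zero>\<^bsub>M\<^esub> = \<zero>\<^bsub>N\<^esub>"
  by (rule add_hom_zero[OF bimod_hom_add_hom[OF assms(1)] bim_abelian_group[OF assms(2)] bim_abelian_group[OF assms(3)]])

lemma lact_minus:
  assumes "left_module K R M" "r \<in> carrier R" "x \<in> carrier M" "y \<in> carrier M"
  shows "lact M r (x \<ominus>\<^bsub>M\<^esub> y) = lact M r x \<ominus>\<^bsub>M\<^esub> lact M r y"
  by (rule add_hom_minus[OF lact_add_hom[OF assms(1,2)] left_module_abelian_group[OF assms(1)] left_module_abelian_group[OF assms(1)] assms(3,4)])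

lemma ract_minus:
  assumes "right_module K R M" "r \<in> carrier R" "x \<in> carrier M" "y \<in> carrier M"
  shows "ract M (x \<ominus>\<^bsub>M\<^esub> y) r = ract M x r \<ominus>\<^bsub>M\<^esub> ract M y r"
  by (rule add_hom_minus[OF ract_add_hom[OF assms(1,2)] right_module_abelian_group[OF assms(1)] right_module_abelian_group[OF assms(1)] assms(3,4)])

lemma bimod_hom_minus:
  assumes "f \<in> bimod_hom R M N" "g \<in> bimod_hom R M N" "bim K R R N"
  shows "(\<lambda>x. f x \<ominus>\<^bsub>N\<^esub> g x) \<in> bimod_hom R M N"
  by (rule bimod_homI) (use assms in \<open>auto intro!: add_hom_sub bim_abelian_group[OF assms(3)]
     simp: bimod_homD lact_minus[OF bim_left[OF assms(3)]] ract_minus[OF bim_right[OF assms(3)]]\<close>)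

lemma bimod_hom_plus:
  assumes "f \<in> bimod_hom R M N" "g \<in> bimod_hom R M N" "bim K R R N"
  shows "(\<lambda>x. f x \<oplus>\<^bsub>N\<^esub> g x) \<in> bimod_hom R M N"
  by (rule bimod_homI) (use assms in \<open>auto intro!: add_hom_plus bim_abelian_group[OF assms(3)]
     simp: bimod_homD lact_add[OF bim_left[OF assms(3)]] ract_add[OF bim_right[OF assms(3)]]\<close>)

text \<open>Homomorphisms are required to respect the algebra actions only; linearity over k follows
  because c acts as the algebra element c 1.\<close>

lemma bimod_hom_smult:
  assumes "f \<in> bimod_hom R M N" "k_algebra K R" "bim K R R M" "bim K R R N" "c \<in> carrier K" "x \<in> carrier M"
  shows "f (c \<odot>\<^bsub>M\<^esub> x) = c \<odot>\<^bsub>N\<^esub> f x"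
proof -
  have "f (lact M (c \<odot>\<^bsub>R\<^esub> \<one>\<^bsub>R\<^esub>) x) = lact N (c \<odot>\<^bsub>R\<^esub> \<one>\<^bsub>R\<^esub>) (f x)"
    using assms by (simp add: bimod_homD k_algebra_scalar_closed)
  then show ?thesis
    using assms by (simp add: lact_scalar[OF bim_left[OF assms(3)]] lact_scalar[OF bim_left[OF assms(4)]] bimod_homD)
qed

lemma left_hom_linear:
  assumes "f \<in> left_hom R M N" "left_module K R M" "left_module K R N" "k_algebra K R"
  shows "f \<in> k_linear K M N"
proof -
  have "f (c \<odot>\<^bsub>M\<^esub> x) = c \<odot>\<^bsub>N\<^esub> f x" if "c \<in> carrier K" "x \<in> carrier M" for c x
  proof -
    have "f (lact M (c \<odot>\<^bsub>R\<^esub> \<one>\<^bsub>R\<^esub>) x) = lact N (c \<odot>\<^bsub>R\<^esub> \<one>\<^bsub>R\<^esub>) (f x)" "f x \<in> carrier N"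
      using assms(1) that k_algebra_scalar_closed[OF assms(4)] by (auto simp: left_hom_def)
    then show ?thesis using that by (simp add: lact_scalar[OF assms(2)] lact_scalar[OF assms(3)])
  qed
  then show ?thesis using assms(1) by (auto simp: k_linear_def left_hom_def)
qed

lemma right_hom_linear:
  assumes "f \<in> right_hom R M N" "right_module K R M" "right_module K R N" "k_algebra K R"
  shows "f \<in> k_linear K M N"
proof -
  have "f (c \<odot>\<^bsub>M\<^esub> x) = c \<odot>\<^bsub>N\<^esub> f x" if "c \<in> carrier K" "x \<in> carrier M" for c x
  proof -
    have "f (ract M x (c \<odot>\<^bsub>R\<^esub> \<one>\<^bsub>R\<^esub>)) = ract N (f x) (c \<odot>\<^bsub>R\<^esub> \<one>\<^bsub>R\<^esub>)" "f x \<in> carrier N"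
      using assms(1) that k_algebra_scalar_closed[OF assms(4)] by (auto simp: right_hom_def)
    then show ?thesis using that by (simp add: ract_scalar[OF assms(2)] ract_scalar[OF assms(3)])
  qed
  then show ?thesis using assms(1) by (auto simp: k_linear_def right_hom_def)
qed

section \<open>Comparison of complexes\<close>

text \<open>Projectivity relative to one pair of modules, so that the carrier types stay explicit.
  Asking that f land in the image of g, rather than that g be onto, lets exactness of a complex feed
  it directly.\<close>

definition bilift ::
  "('k, 'a, 'y) module_scheme \<Rightarrow> ('k, 'a, 'a, 'p) bimod \<Rightarrow> ('k, 'a, 'a, 'm) bimod \<Rightarrow>
   ('k, 'a, 'a, 'n) bimod \<Rightarrow> bool"
where
  "bilift R P Y Z \<longleftrightarrow> (\<forall>f\<in>bimod_hom R P Z. \<forall>g\<in>bimod_hom R Y Z.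
     f ` carrier P \<subseteq> g ` carrier Y \<longrightarrow> (\<exists>h\<in>bimod_hom R P Y. \<forall>x\<in>carrier P. g (h x) = f x))"

lemma bilift_obtain:
  assumes "bilift R P Y Z" "f \<in> bimod_hom R P Z" "g \<in> bimod_hom R Y Z"
    and "\<And>x. x \<in> carrier P ==> f x \<in> g ` carrier Y"
  obtains h where "h \<in> bimod_hom R P Y" "\<And>x. x \<in> carrier P ==> g (h x) = f x"
  using assms unfolding bilift_def by blast

definition bicomplex ::
  "('k, 'z) ring_scheme \<Rightarrow> ('k, 'a) module \<Rightarrow> (nat \<Rightarrow> ('k, 'a, 'a, 'x) bimod) \<Rightarrow> (nat \<Rightarrow> 'x \<Rightarrow> 'x) \<Rightarrow> bool"
where
  "bicomplex K R X d \<longleftrightarrow> (\<forall>n. bim K R R (X n)) \<and> (\<forall>n. d n \<in> bimod_hom R (X (Suc n)) (X n)) \<and>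
     (\<forall>n. \<forall>x\<in>carrier (X (Suc (Suc n))). d n (d (Suc n) x) = \<zero>\<^bsub>X n\<^esub>)"

lemma bicomplexD:
  assumes "bicomplex K R X d"
  shows "bim K R R (X n)" "d n \<in> bimod_hom R (X (Suc n)) (X n)"
    "x \<in> carrier (X (Suc (Suc n))) ==> d n (d (Suc n) x) = \<zero>\<^bsub>X n\<^esub>"
    "abelian_group (X n)" "x \<in> carrier (X (Suc n)) ==> d n x \<in> carrier (X n)"
  using assms by (auto simp: bicomplex_def intro: bim_abelian_group bimod_hom_closed)

text \<open>Exactness in positive degrees. Degree 0 is left out because the end of the complex is
  described by an augmentation, and the complexes compared here have different ones.\<close>

definition exact_pos :: "(nat \<Rightarrow> ('k, 'a, 'b, 'x) bimod) \<Rightarrow> (nat \<Rightarrow> 'x \<Rightarrow> 'x) \<Rightarrow> bool" where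
  "exact_pos X d \<longleftrightarrow> (\<forall>n. \<forall>x\<in>carrier (X (Suc n)). d n x = \<zero>\<^bsub>X n\<^esub> \<longrightarrow>
     x \<in> d (Suc n) ` carrier (X (Suc (Suc n))))"

text \<open>The comparison theorem of homological algebra. \<open>start\<close> takes the place of
  compatibility with augmentations; afterwards f d is a cycle, hence a boundary, and can be lifted.
  The invariant \<open>?Q\<close> stores exactly this for the map just constructed.\<close>

lemma chain_map_exists:
  assumes P: "bicomplex K R P dP" and Y: "bicomplex K R Y dY" and ex: "exact_pos Y dY"
    and lift: "\<And>n. bilift R (P (Suc n)) (Y (Suc n)) (Y n)"
    and f0: "f0 \<in> bimod_hom R (P 0) (Y 0)"
    and start: "\<And>x. x \<in> carrier (P (Suc 0)) ==> f0 (dP 0 x) \<in> dY 0 ` carrier (Y (Suc 0))"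
  obtains f where "f 0 = f0" "\<And>n. f n \<in> bimod_hom R (P n) (Y n)"
    "\<And>n x. x \<in> carrier (P (Suc n)) ==> dY n (f (Suc n) x) = f n (dP n x)"
proof -
  let ?Q = "\<lambda>n f. f \<in> bimod_hom R (P n) (Y n) \<and> (n = 0 \<longrightarrow> f = f0) \<and>
    (\<forall>x\<in>carrier (P (Suc n)). f (dP n x) \<in> dY n ` carrier (Y (Suc n)))"
  let ?S = "\<lambda>n f f'. \<forall>x\<in>carrier (P (Suc n)). dY n (f' x) = f (dP n x)"
  have "\<exists>f. \<forall>n. ?Q n (f n) \<and> ?S n (f n) (f (Suc n))"
  proof (rule dependent_nat_choice)
    show "\<exists>f. ?Q 0 f" using f0 start by auto
  next
    fix f n assume Q: "?Q n f"
    have "(\<lambda>x. f (dP n x)) \<in> bimod_hom R (P (Suc n)) (Y n)"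
      using Q by (intro bimod_hom_compose[OF bicomplexD(2)[OF P]]) auto
    from bilift_obtain[OF lift this bicomplexD(2)[OF Y]] Q
    obtain h where h: "h \<in> bimod_hom R (P (Suc n)) (Y (Suc n))"
      "\<And>x. x \<in> carrier (P (Suc n)) ==> dY n (h x) = f (dP n x)" by metis
    have "h (dP (Suc n) x) \<in> dY (Suc n) ` carrier (Y (Suc (Suc n)))"
      if x: "x \<in> carrier (P (Suc (Suc n)))" for x
    proof -
      have d: "dP (Suc n) x \<in> carrier (P (Suc n))" using bicomplexD(5)[OF P] x .
      have "dY n (h (dP (Suc n) x)) = f \<zero>\<^bsub>P n\<^esub>"
        using h(2)[OF d] bicomplexD(3)[OF P x] by simp
      also have "\<dots> = \<zero>\<^bsub>Y n\<^esub>"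
        using Q by (intro bimod_hom_zero[OF _ bicomplexD(1)[OF P] bicomplexD(1)[OF Y]]) auto
      finally show ?thesis
        using ex bimod_hom_closed[OF h(1) d] unfolding exact_pos_def by blast
    qed
    then show "\<exists>f'. ?Q (Suc n) f' \<and> ?S n f f'" using h by auto
  qed
  then show thesis using that by auto
qed

text \<open>Here h is already the difference of two chain maps, and \<open>start\<close> says that
  it induces zero on augmentations. The last clause of \<open>?Q\<close>, d s d = h d, is what makes
  the next obstruction a cycle.\<close>

lemma chain_homotopy_exists:
  assumes P: "bicomplex K R P dP" and Y: "bicomplex K R Y dY" and ex: "exact_pos Y dY"
    and lift: "\<And>n. bilift R (P n) (Y (Suc n)) (Y n)"
    and h: "\<And>n. h n \<in> bimod_hom R (P n) (Y n)"
    and chain: "\<And>n x. x \<in> carrier (P (Suc n)) ==> dY n (h (Suc n) x) = h n (dP n x)"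
    and start: "\<And>x. x \<in> carrier (P 0) ==> h 0 x \<in> dY 0 ` carrier (Y (Suc 0))"
  obtains s where "\<And>n. s n \<in> bimod_hom R (P n) (Y (Suc n))"
    "\<And>x. x \<in> carrier (P 0) ==> h 0 x = dY 0 (s 0 x)"
    "\<And>n x. x \<in> carrier (P (Suc n)) ==> h (Suc n) x = dY (Suc n) (s (Suc n) x) \<oplus>\<^bsub>Y (Suc n)\<^esub> s n (dP n x)"
proof -
  let ?Q = "\<lambda>n s. s \<in> bimod_hom R (P n) (Y (Suc n)) \<and> (n = 0 \<longrightarrow> (\<forall>x\<in>carrier (P 0). h 0 x = dY 0 (s x))) \<and>
    (\<forall>x\<in>carrier (P (Suc n)). dY n (s (dP n x)) = h n (dP n x))"
  let ?S = "\<lambda>n s s'. \<forall>x\<in>carrier (P (Suc n)). h (Suc n) x = dY (Suc n) (s' x) \<oplus>\<^bsub>Y (Suc n)\<^esub> s (dP n x)"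
  have "\<exists>s. \<forall>n. ?Q n (s n) \<and> ?S n (s n) (s (Suc n))"
  proof (rule dependent_nat_choice)
    obtain s where "s \<in> bimod_hom R (P 0) (Y (Suc 0))" "\<And>x. x \<in> carrier (P 0) ==> dY 0 (s x) = h 0 x"
      by (rule bilift_obtain[OF lift h bicomplexD(2)[OF Y] start]) auto
    then show "\<exists>s. ?Q 0 s" using bicomplexD(5)[OF P] by (intro exI[of _ s]) auto
  next
    fix s n assume Q: "?Q n s"
    interpret Y1: abelian_group "Y (Suc n)" by (rule bicomplexD(4)[OF Y])
    \<comment> \<open>What d s' has to equal. It is a cycle, since d h = h d and d s d = h d, so
      exactness puts it in the image of d.\<close>
    let ?k = "\<lambda>x. h (Suc n) x \<ominus>\<^bsub>Y (Suc n)\<^esub> s (dP n x)"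
    have k: "?k \<in> bimod_hom R (P (Suc n)) (Y (Suc n))"
      using Q by (intro bimod_hom_minus[OF h _ bicomplexD(1)[OF Y]] bimod_hom_compose[OF bicomplexD(2)[OF P]]) auto
    have sc: "s (dP n x) \<in> carrier (Y (Suc n))" if "x \<in> carrier (P (Suc n))" for x
      using Q bicomplexD(5)[OF P that] by (auto simp: bimod_homD)
    have "?k x \<in> dY (Suc n) ` carrier (Y (Suc (Suc n)))" if x: "x \<in> carrier (P (Suc n))" for x
    proof -
      interpret Y0: abelian_group "Y n" by (rule bicomplexD(4)[OF Y])
      have hx: "h (Suc n) x \<in> carrier (Y (Suc n))" using bimod_hom_closed[OF h x] .
      have "dY n (?k x) = dY n (h (Suc n) x) \<ominus>\<^bsub>Y n\<^esub> dY n (s (dP n x))"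
        by (rule add_hom_minus[OF bimod_hom_add_hom[OF bicomplexD(2)[OF Y]] Y1.abelian_group_axioms
              Y0.abelian_group_axioms hx sc[OF x]])
      also have "\<dots> = \<zero>\<^bsub>Y n\<^esub>"
        using Q x chain[OF x] bimod_hom_closed[OF h bicomplexD(5)[OF P x]] by (simp add: Y0.minus_self)
      finally show ?thesis using ex bimod_hom_closed[OF k x] unfolding exact_pos_def by blast
    qed
    from bilift_obtain[OF lift k bicomplexD(2)[OF Y] this]
    obtain s' where s': "s' \<in> bimod_hom R (P (Suc n)) (Y (Suc (Suc n)))"
      "\<And>x. x \<in> carrier (P (Suc n)) ==> dY (Suc n) (s' x) = ?k x" by metis
    have "?S n s s'"
    proof
      fix x assume x: "x \<in> carrier (P (Suc n))"
      show "h (Suc n) x = dY (Suc n) (s' x) \<oplus>\<^bsub>Y (Suc n)\<^esub> s (dP n x)"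
        using s'(2)[OF x] sc[OF x] bimod_hom_closed[OF h x]
        by (simp add: a_minus_def Y1.a_assoc Y1.l_neg)
    qed
    moreover have "?Q (Suc n) s'"
    proof (intro conjI ballI)
      fix x assume x: "x \<in> carrier (P (Suc (Suc n)))"
      have d: "dP (Suc n) x \<in> carrier (P (Suc n))" using bicomplexD(5)[OF P x] .
      have "s (dP n (dP (Suc n) x)) = \<zero>\<^bsub>Y (Suc n)\<^esub>"
        using Q bicomplexD(3)[OF P x] bimod_hom_zero[OF _ bicomplexD(1)[OF P] bicomplexD(1)[OF Y]] by metis
      then show "dY (Suc n) (s' (dP (Suc n) x)) = h (Suc n) (dP (Suc n) x)"
        using s'(2)[OF d] bimod_hom_closed[OF h d] by (simp add: a_minus_def)
    qed (use s' in auto)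
    ultimately show "\<exists>s'. ?Q (Suc n) s' \<and> ?S n s s'" by blast
  qed
  then obtain s where s: "\<forall>n. ?Q n (s n) \<and> ?S n (s n) (s (Suc n))" by blast
  show thesis by (rule that[of s]) (use s in blast)+
qed

section \<open>The bar complex\<close>

text \<open>The target is just an abelian group, so homogeneity cannot mention scalars there; it is
  stated, like the relators of \<open>bar\<close>, as moving a scalar from one slot to
  another.\<close>

definition multilinear ::
  "('k, 'z) ring_scheme \<Rightarrow> ('k, 'a) module \<Rightarrow> nat \<Rightarrow> ('h, 'y) ring_scheme \<Rightarrow> ('a list \<Rightarrow> 'h) \<Rightarrow> bool"
where
  "multilinear K A n H \<phi> \<longleftrightarrow>
     (\<forall>xs\<in>bar_gens A n. \<phi> xs \<in> carrier H) \<and>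
     (\<forall>xs\<in>bar_gens A n. \<forall>i<n + 2. \<forall>y\<in>carrier A.
        \<phi> (xs[i := xs ! i \<oplus>\<^bsub>A\<^esub> y]) = \<phi> xs \<oplus>\<^bsub>H\<^esub> \<phi> (xs[i := y])) \<and>
     (\<forall>xs\<in>bar_gens A n. \<forall>i<n + 2. \<forall>j<n + 2. \<forall>c\<in>carrier K.
        \<phi> (xs[i := c \<odot>\<^bsub>A\<^esub> xs ! i]) = \<phi> (xs[j := c \<odot>\<^bsub>A\<^esub> xs ! j]))"

lemma multilinearD:
  assumes "multilinear K A n H \<phi>"
  shows "xs \<in> bar_gens A n ==> \<phi> xs \<in> carrier H"
    and "xs \<in> bar_gens A n ==> i < n + 2 ==> y \<in> carrier A ==>
        \<phi> (xs[i := xs ! i \<oplus>\<^bsub>A\<^esub> y]) = \<phi> xs \<oplus>\<^bsub>H\<^esub> \<phi> (xs[i := y])"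
    and "xs \<in> bar_gens A n ==> i < n + 2 ==> j < n + 2 ==> c \<in> carrier K ==>
        \<phi> (xs[i := c \<odot>\<^bsub>A\<^esub> xs ! i]) = \<phi> (xs[j := c \<odot>\<^bsub>A\<^esub> xs ! j])"
proof -
  note m = assms[unfolded multilinear_def]
  show "xs \<in> bar_gens A n ==> \<phi> xs \<in> carrier H" by (rule m[THEN conjunct1, rule_format])
  show "xs \<in> bar_gens A n ==> i < n + 2 ==> y \<in> carrier A ==>
        \<phi> (xs[i := xs ! i \<oplus>\<^bsub>A\<^esub> y]) = \<phi> xs \<oplus>\<^bsub>H\<^esub> \<phi> (xs[i := y])"
    by (rule m[THEN conjunct2, THEN conjunct1, rule_format])
  show "xs \<in> bar_gens A n ==> i < n + 2 ==> j < n + 2 ==> c \<in> carrier K ==>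
        \<phi> (xs[i := c \<odot>\<^bsub>A\<^esub> xs ! i]) = \<phi> (xs[j := c \<odot>\<^bsub>A\<^esub> xs ! j])"
    by (rule m[THEN conjunct2, THEN conjunct2, rule_format])
qed

lemma bar_gens_update: "xs \<in> bar_gens A n ==> v \<in> carrier A ==> xs[i := v] \<in> bar_gens A n"
  using set_update_subset_insert[of xs i v] by (auto simp: bar_gens_def)

lemma bar_gens_nth: "xs \<in> bar_gens A n ==> i < n + 2 ==> xs ! i \<in> carrier A"
  by (auto simp: bar_gens_def)

lemma bar_gens_length: "xs \<in> bar_gens A n ==> length xs = n + 2"
  by (simp add: bar_gens_def)

lemma bar_gensI: "length xs = n + 2 ==> (\<And>i. i < n + 2 ==> xs ! i \<in> carrier A) ==> xs \<in> bar_gens A n"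
  by (auto simp: bar_gens_def in_set_conv_nth)

text \<open>Changing one entry of the argument changes one entry of the value, through a linear map.
  Faces, actions and the contraction all have this form, so a single lemma shows that they descend
  from lists to tensors.\<close>

definition slotwise ::
  "('k, 'z) ring_scheme \<Rightarrow> ('k, 'a) module \<Rightarrow> nat \<Rightarrow> nat \<Rightarrow> ('a list \<Rightarrow> 'a list) \<Rightarrow> bool"
where
  "slotwise K A m n F \<longleftrightarrow> (\<forall>xs\<in>bar_gens A m. F xs \<in> bar_gens A n \<and>
     (\<forall>i<m + 2. \<exists>p<n + 2. \<exists>l\<in>k_linear K A A. \<forall>v\<in>carrier A. F (xs[i := v]) = (F xs)[p := l v]))"

locale bar_alg =
  fixes K :: "('k, 'z) ring_scheme" and A :: "('k, 'a) module"
  assumes alg: "k_algebra K A"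
begin

sublocale A: ring A using alg by (rule k_algebra_ring)
sublocale V: module K A using alg by (rule k_algebra_module)

abbreviation "Bar \<equiv> bar K A"
abbreviation "bt \<equiv> bar_ptens K A"

sublocale Bar: presented "bar_gens A n" "bar_rels K A n" "Bar n" for n
proof
  show "bar_rels K A n \<subseteq> carrier (free_Abelian_group (bar_gens A n))"
  proof
    fix r assume "r \<in> bar_rels K A n"
    then have "Poly_Mapping.keys r \<subseteq> bar_gens A n"
      unfolding bar_rels_def
      by (elim UnE CollectE exE conjE; hypsubst)
         (rule keys_frag_diff2 keys_frag_diff3; simp add: bar_gens_def)+
    then show "r \<in> carrier (free_Abelian_group (bar_gens A n))" by simp
  qed
qed (simp_all add: bar_def Let_def)

lemmas bar_abelian_group = Bar.abelian_group

lemma bt_closed: "xs \<in> bar_gens A n ==> bt n xs \<in> carrier (Bar n)"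
  by (simp add: bar_ptens_def Bar.gen_closed)

lemma split_at:
  assumes "xs \<in> bar_gens A n" "i < n + 2"
  shows "xs[i := v] = take i xs @ v # drop (Suc i) xs" "xs = take i xs @ xs ! i # drop (Suc i) xs"
  using assms id_take_nth_drop[of i xs] upd_conv_take_nth_drop[of i xs v] by (auto simp: bar_gens_length)

lemma bt_multilinear: "multilinear K A n (Bar n) (bt n)"
  unfolding multilinear_def
proof (intro conjI ballI allI impI bt_closed)
  fix xs i y assume xs: "xs \<in> bar_gens A n" and i: "i < n + 2" and y: "y \<in> carrier A"
  note s = split_at[OF xs i]
  have "frag_of (xs[i := xs ! i \<oplus>\<^bsub>A\<^esub> y]) - frag_of xs - frag_of (xs[i := y]) \<in> bar_rels K A n"
    unfolding bar_rels_def
    by (rule UnI1, rule CollectI, rule exI[of _ "take i xs"], rule exI[of _ "xs ! i"], rule exI[of _ y],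
        rule exI[of _ "drop (Suc i) xs"]) (use xs bar_gens_update[OF xs y, of i] s in simp)
  then have "frag_of (xs[i := xs ! i \<oplus>\<^bsub>A\<^esub> y]) - (frag_of xs + frag_of (xs[i := y])) \<in> gspan (bar_rels K A n)"
    by (simp add: gspan.base diff_diff_eq)
  then show "bt n (xs[i := xs ! i \<oplus>\<^bsub>A\<^esub> y]) = bt n xs \<oplus>\<^bsub>Bar n\<^esub> bt n (xs[i := y])"
    by (simp add: bar_ptens_def Bar.gen_eq Bar.add_eq gcls_eq_iff)
next
  fix xs i j c assume xs: "xs \<in> bar_gens A n" and "i < n + 2" "j < n + 2" and c: "c \<in> carrier K"
  \<comment> \<open>A relator moves a scalar from an earlier slot to a later one; the other
    direction follows by symmetry.\<close>
  have *: "bt n (xs[i := c \<odot>\<^bsub>A\<^esub> xs ! i]) = bt n (xs[j := c \<odot>\<^bsub>A\<^esub> xs ! j])"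
    if ij: "i < j" "j < n + 2" for i j
  proof -
    let ?us = "take i xs" and ?vs = "take (j - Suc i) (drop (Suc i) xs)" and ?ws = "drop (Suc j) xs"
    have len: "length xs = n + 2" using xs by (rule bar_gens_length)
    have eq: "xs[i := u, j := v] = ?us @ u # ?vs @ v # ?ws" for u v
    proof (rule nth_equalityI)
      fix k assume "k < length (xs[i := u, j := v])"
      then show "xs[i := u, j := v] ! k = (?us @ u # ?vs @ v # ?ws) ! k"
        using ij len by (auto simp: nth_append nth_Cons' nth_list_update min_def)
    qed (use ij len in auto)
    have j: "xs[i := u, j := xs ! j] = xs[i := u]" for u
      using list_update_id[of "xs[i := u]" j] ij by simp
    have e: "xs = ?us @ xs ! i # ?vs @ xs ! j # ?ws"
      "xs[i := c \<odot>\<^bsub>A\<^esub> xs ! i] = ?us @ (c \<odot>\<^bsub>A\<^esub> xs ! i) # ?vs @ xs ! j # ?ws"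
      "xs[j := c \<odot>\<^bsub>A\<^esub> xs ! j] = ?us @ xs ! i # ?vs @ (c \<odot>\<^bsub>A\<^esub> xs ! j) # ?ws"
      using eq[of "xs ! i" "xs ! j"] eq[of "c \<odot>\<^bsub>A\<^esub> xs ! i" "xs ! j"] eq[of "xs ! i" "c \<odot>\<^bsub>A\<^esub> xs ! j"] j
      by simp_all
    have "frag_of (xs[i := c \<odot>\<^bsub>A\<^esub> xs ! i]) - frag_of (xs[j := c \<odot>\<^bsub>A\<^esub> xs ! j]) \<in> bar_rels K A n"
      unfolding bar_rels_def
      by (rule UnI2, rule CollectI, rule exI[of _ ?us], rule exI[of _ c], rule exI[of _ "xs ! i"],
          rule exI[of _ ?vs], rule exI[of _ "xs ! j"], rule exI[of _ ?ws])
         (unfold e(2,3), use xs c e(1) in simp)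
    then show ?thesis by (simp add: bar_ptens_def Bar.gen_eq gcls_eq_iff gspan.base)
  qed
  consider "i < j" | "j < i" | "i = j" by linarith
  then show "bt n (xs[i := c \<odot>\<^bsub>A\<^esub> xs ! i]) = bt n (xs[j := c \<odot>\<^bsub>A\<^esub> xs ! j])"
    by cases (use * \<open>i < n + 2\<close> \<open>j < n + 2\<close> in auto)
qed

lemma bt_add: "xs \<in> bar_gens A n ==> i < n + 2 ==> y \<in> carrier A ==>
    bt n (xs[i := xs ! i \<oplus>\<^bsub>A\<^esub> y]) = bt n xs \<oplus>\<^bsub>Bar n\<^esub> bt n (xs[i := y])"
  and bt_scale: "xs \<in> bar_gens A n ==> i < n + 2 ==> j < n + 2 ==> c \<in> carrier K ==>
    bt n (xs[i := c \<odot>\<^bsub>A\<^esub> xs ! i]) = bt n (xs[j := c \<odot>\<^bsub>A\<^esub> xs ! j])"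
  by (fact multilinearD[OF bt_multilinear])+

lemma bt_add':
  assumes "xs \<in> bar_gens A n" "i < n + 2" "x \<in> carrier A" "y \<in> carrier A"
  shows "bt n (xs[i := x \<oplus>\<^bsub>A\<^esub> y]) = bt n (xs[i := x]) \<oplus>\<^bsub>Bar n\<^esub> bt n (xs[i := y])"
  using bt_add[OF bar_gens_update[OF assms(1,3)] assms(2,4)] assms(2) bar_gens_length[OF assms(1)]
  by (metis (no_types, lifting) list_update_overwrite nth_list_update_eq)

lemma bar_lift:
  assumes "abelian_group H" "multilinear K A n H \<phi>"
  shows bar_lift_hom: "lift_hom H \<phi> \<in> add_hom (Bar n) H"
    and bar_lift_bt: "\<And>xs. xs \<in> bar_gens A n ==> lift_hom H \<phi> (bt n xs) = \<phi> xs"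
proof -
  interpret H: abelian_group H by fact
  have cl: "\<phi> \<in> bar_gens A n \<rightarrow> carrier H" using assms(2) by (auto simp: multilinear_def)
  have vanish: "feval H \<phi> r = \<zero>\<^bsub>H\<^esub>" if "r \<in> bar_rels K A n" for r
    using that unfolding bar_rels_def
  proof (elim UnE CollectE exE conjE)
    fix us x y vs
    assume r: "r = frag_of (us @ (x \<oplus>\<^bsub>A\<^esub> y) # vs) - frag_of (us @ x # vs) - frag_of (us @ y # vs)"
      and g: "us @ x # vs \<in> bar_gens A n" "us @ y # vs \<in> bar_gens A n"
    have i: "length us < n + 2" and y: "y \<in> carrier A" and x: "x \<in> carrier A"
      using g by (auto simp: bar_gens_def)
    note multilinearD(2)[OF assms(2) g(1) i y]
    then have *: "\<phi> (us @ (x \<oplus>\<^bsub>A\<^esub> y) # vs) = \<phi> (us @ x # vs) \<oplus>\<^bsub>H\<^esub> \<phi> (us @ y # vs)" by simp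
    have "us @ (x \<oplus>\<^bsub>A\<^esub> y) # vs \<in> bar_gens A n" using g by (auto simp: bar_gens_def)
    then show ?thesis unfolding r using g cl *
      by (subst H.feval_frag_diff3[OF cl]) (auto intro!: H.minus_minus_zero)
  next
    fix us c x vs y ws
    assume r: "r = frag_of (us @ (c \<odot>\<^bsub>A\<^esub> x) # vs @ y # ws) - frag_of (us @ x # vs @ (c \<odot>\<^bsub>A\<^esub> y) # ws)"
      and c: "c \<in> carrier K" and g: "us @ x # vs @ y # ws \<in> bar_gens A n"
    let ?xs = "us @ x # vs @ y # ws" and ?j = "length (us @ x # vs)"
    have xs2: "?xs = (us @ x # vs) @ y # ws" by simp
    have i: "length us < n + 2" "?j < n + 2" using g by (auto simp: bar_gens_def)
    have "\<phi> (?xs[length us := c \<odot>\<^bsub>A\<^esub> ?xs ! length us]) = \<phi> (?xs[?j := c \<odot>\<^bsub>A\<^esub> ?xs ! ?j])"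
      by (rule multilinearD(3)[OF assms(2) g i c])
    moreover have "?xs[?j := c \<odot>\<^bsub>A\<^esub> ?xs ! ?j] = us @ x # vs @ (c \<odot>\<^bsub>A\<^esub> y) # ws"
      unfolding xs2 nth_append_length list_update_length by simp
    ultimately have *: "\<phi> (us @ (c \<odot>\<^bsub>A\<^esub> x) # vs @ y # ws) = \<phi> (us @ x # vs @ (c \<odot>\<^bsub>A\<^esub> y) # ws)" by simp
    have "us @ (c \<odot>\<^bsub>A\<^esub> x) # vs @ y # ws \<in> bar_gens A n" "us @ x # vs @ (c \<odot>\<^bsub>A\<^esub> y) # ws \<in> bar_gens A n"
      using g c by (auto simp: bar_gens_def)
    then show ?thesis unfolding r using cl * by (subst H.feval_frag_diff2[OF cl]) (auto intro!: H.minus_self)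
  qed
  note * = Bar.lift_hom[OF assms(1) _ vanish]
  show "lift_hom H \<phi> \<in> add_hom (Bar n) H" by (rule *(1)) (use cl in auto)
  show "lift_hom H \<phi> (bt n xs) = \<phi> xs" if "xs \<in> bar_gens A n" for xs
    unfolding bar_ptens_def by (rule *(2)) (use cl that in auto)
qed

lemma bar_ext:
  assumes "f \<in> add_hom (Bar n) H" "g \<in> add_hom (Bar n) H" "abelian_group H"
    and "\<And>xs. xs \<in> bar_gens A n ==> f (bt n xs) = g (bt n xs)" "t \<in> carrier (Bar n)"
  shows "f t = g t"
  by (rule Bar.hom_eq[OF assms(1-3) _ assms(5)]) (use assms(4) in \<open>simp add: bar_ptens_def\<close>)

lemma multilinear_hom:
  assumes "f \<in> add_hom (Bar n) H" "\<And>xs. xs \<in> bar_gens A n ==> \<phi> xs = f (bt n xs)"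
  shows "multilinear K A n H \<phi>"
  unfolding multilinear_def
proof (intro conjI ballI allI impI)
  fix xs i y assume xs: "xs \<in> bar_gens A n" and i: "i < n + 2" and y: "y \<in> carrier A"
  have "xs[i := xs ! i \<oplus>\<^bsub>A\<^esub> y] \<in> bar_gens A n" "xs[i := y] \<in> bar_gens A n"
    using bar_gens_update[OF xs] bar_gens_nth[OF xs i] y by auto
  then show "\<phi> (xs[i := xs ! i \<oplus>\<^bsub>A\<^esub> y]) = \<phi> xs \<oplus>\<^bsub>H\<^esub> \<phi> (xs[i := y])"
    using xs by (simp add: assms(2) bt_add[OF xs i y] add_hom_add[OF assms(1)] bt_closed)
next
  fix xs i j c assume xs: "xs \<in> bar_gens A n" and ij: "i < n + 2" "j < n + 2" and c: "c \<in> carrier K"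
  have "xs[i := c \<odot>\<^bsub>A\<^esub> xs ! i] \<in> bar_gens A n" "xs[j := c \<odot>\<^bsub>A\<^esub> xs ! j] \<in> bar_gens A n"
    using bar_gens_update[OF xs] bar_gens_nth[OF xs] ij c by auto
  then show "\<phi> (xs[i := c \<odot>\<^bsub>A\<^esub> xs ! i]) = \<phi> (xs[j := c \<odot>\<^bsub>A\<^esub> xs ! j])"
    by (simp add: assms(2) bt_scale[OF xs ij c])
qed (simp add: assms(2) add_hom_closed[OF assms(1)] bt_closed)

lemma bar_lift_eq:
  assumes "f \<in> add_hom (Bar n) H" "abelian_group H" "\<And>xs. xs \<in> bar_gens A n ==> \<phi> xs = f (bt n xs)"
    "t \<in> carrier (Bar n)"
  shows "lift_hom H \<phi> t = f t"
proof -
  note m = multilinear_hom[OF assms(1,3)]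
  show ?thesis
    by (rule bar_ext[OF bar_lift_hom[OF assms(2) m] assms(1,2) _ assms(4)])
       (simp_all add: bar_lift_bt[OF assms(2) m] assms(3))
qed

lemma slotwise_multilinear:
  assumes "slotwise K A m n F"
  shows "multilinear K A m (Bar n) (\<lambda>xs. bt n (F xs))"
  unfolding multilinear_def
proof (intro conjI ballI allI impI)
  fix xs assume "xs \<in> bar_gens A m"
  then show "bt n (F xs) \<in> carrier (Bar n)" using assms by (auto simp: slotwise_def bt_closed)
next
  fix xs i y assume xs: "xs \<in> bar_gens A m" and i: "i < m + 2" and y: "y \<in> carrier A"
  obtain p l where p: "p < n + 2" "l \<in> k_linear K A A" and F: "\<And>v. v \<in> carrier A ==> F (xs[i := v]) = (F xs)[p := l v]"
    using assms xs i unfolding slotwise_def by blast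
  have Fxs: "F xs \<in> bar_gens A n" using assms xs by (auto simp: slotwise_def)
  have x: "xs ! i \<in> carrier A" using xs i by (rule bar_gens_nth)
  have "F xs = (F xs)[p := l (xs ! i)]" using F[OF x] by simp
  then show "bt n (F (xs[i := xs ! i \<oplus>\<^bsub>A\<^esub> y])) = bt n (F xs) \<oplus>\<^bsub>Bar n\<^esub> bt n (F (xs[i := y]))"
    using x y p(1) Fxs k_linearD[OF p(2)] by (simp add: F bt_add')
next
  fix xs i j c assume xs: "xs \<in> bar_gens A m" and ij: "i < m + 2" "j < m + 2" and c: "c \<in> carrier K"
  have Fxs: "F xs \<in> bar_gens A n" using assms xs by (auto simp: slotwise_def)
  have *: "\<exists>p<n + 2. F (xs[i := c \<odot>\<^bsub>A\<^esub> xs ! i]) = (F xs)[p := c \<odot>\<^bsub>A\<^esub> F xs ! p]" if i: "i < m + 2" for i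
  proof -
    obtain p l where p: "p < n + 2" "l \<in> k_linear K A A" and F: "\<And>v. v \<in> carrier A ==> F (xs[i := v]) = (F xs)[p := l v]"
      using assms xs i unfolding slotwise_def by blast
    have x: "xs ! i \<in> carrier A" using xs i by (rule bar_gens_nth)
    have "F xs ! p = l (xs ! i)" using F[OF x] p(1) bar_gens_length[OF Fxs] by (metis list_update_id nth_list_update_eq)
    then show ?thesis using F[of "c \<odot>\<^bsub>A\<^esub> xs ! i"] x c p k_linearD(3)[OF p(2) c x] by auto
  qed
  show "bt n (F (xs[i := c \<odot>\<^bsub>A\<^esub> xs ! i])) = bt n (F (xs[j := c \<odot>\<^bsub>A\<^esub> xs ! j]))"
    using *[OF ij(1)] *[OF ij(2)] bt_scale[OF Fxs _ _ c] by metis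
qed

lemma k_linear_id: "(\<lambda>x. x) \<in> k_linear K A A"
  by (auto simp: k_linear_def)

lemma slotwise_update:
  assumes "l \<in> k_linear K A A" "p < n + 2"
  shows "slotwise K A n n (\<lambda>xs. xs[p := l (xs ! p)])"
  unfolding slotwise_def
proof (intro ballI conjI allI impI)
  fix xs assume xs: "xs \<in> bar_gens A n"
  show "xs[p := l (xs ! p)] \<in> bar_gens A n"
    using bar_gens_update[OF xs] k_linearD(1)[OF assms(1)] bar_gens_nth[OF xs assms(2)] by blast
  fix i assume i: "i < n + 2"
  show "\<exists>q<n + 2. \<exists>l'\<in>k_linear K A A. \<forall>v\<in>carrier A. xs[i := v, p := l (xs[i := v] ! p)] = xs[p := l (xs ! p), q := l' v]"
  proof (cases "i = p")
    case True
    then show ?thesis using assms bar_gens_length[OF xs] by (intro exI[of _ p] conjI bexI[of _ l]) auto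
  next
    case False
    then show ?thesis using i by (intro exI[of _ i] conjI bexI[of _ "\<lambda>x. x"] k_linear_id)
      (auto simp: list_update_swap)
  qed
qed

text \<open>Common form of the scalar action and of the left and right actions: an operator applied
  to one tensor factor.\<close>

definition upd :: "nat \<Rightarrow> nat \<Rightarrow> ('a \<Rightarrow> 'a) \<Rightarrow> 'a chain \<Rightarrow> 'a chain" where
  "upd n p l = lift_hom (Bar n) (\<lambda>xs. bt n (xs[p := l (xs ! p)]))"

lemma upd:
  assumes "l \<in> k_linear K A A" "p < n + 2"
  shows upd_hom: "upd n p l \<in> add_hom (Bar n) (Bar n)"
    and upd_bt: "\<And>xs. xs \<in> bar_gens A n ==> upd n p l (bt n xs) = bt n (xs[p := l (xs ! p)])"
  unfolding upd_def using bar_lift[OF bar_abelian_group slotwise_multilinear[OF slotwise_update[OF assms]]] by auto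

lemma k_linear_smult: "c \<in> carrier K ==> smult A c \<in> k_linear K A A"
  by (auto simp: k_linear_def V.smult_r_distr V.smult_assoc1[symmetric] V.R.m_comm)

lemma k_linear_left: "a \<in> carrier A ==> mult A a \<in> k_linear K A A"
  by (auto simp: k_linear_def A.r_distr k_algebra_smult_right[OF alg])

lemma k_linear_right: "a \<in> carrier A ==> (\<lambda>x. x \<otimes>\<^bsub>A\<^esub> a) \<in> k_linear K A A"
  by (auto simp: k_linear_def A.l_distr k_algebra_smult_left[OF alg])

lemma bar_action_eq:
  assumes "f \<in> add_hom (Bar n) (Bar n)" "\<And>xs. xs \<in> bar_gens A n ==> \<phi> xs = f (bt n xs)" "t \<in> carrier (Bar n)"
  shows "lift_hom (presented_group (bar_gens A n) (bar_rels K A n)) \<phi> t = f t"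
proof -
  have *: "lift_hom (presented_group (bar_gens A n) (bar_rels K A n)) = lift_hom (Bar n)"
    by (rule lift_hom_cong) (simp_all add: bar_def Let_def)
  show ?thesis unfolding * by (rule bar_lift_eq[OF assms(1) bar_abelian_group assms(2,3)])
qed

lemma update_0: "xs \<in> bar_gens A n ==> f (hd xs) # tl xs = xs[0 := f (xs ! 0)]"
  by (cases xs) (auto simp: bar_gens_def)

lemma update_last: "xs \<in> bar_gens A n ==> butlast xs @ [f (last xs)] = xs[Suc n := f (xs ! Suc n)]"
  by (cases xs rule: rev_cases) (auto simp: bar_gens_def nth_append list_update_append)

lemma bar_action_lift:
  "smult (Bar n) c = lift_hom (presented_group (bar_gens A n) (bar_rels K A n)) (\<lambda>xs. bt n ((c \<odot>\<^bsub>A\<^esub> hd xs) # tl xs))"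
  "lact (Bar n) a = lift_hom (presented_group (bar_gens A n) (bar_rels K A n)) (\<lambda>xs. bt n ((a \<otimes>\<^bsub>A\<^esub> hd xs) # tl xs))"
  "ract (Bar n) t a = lift_hom (presented_group (bar_gens A n) (bar_rels K A n)) (\<lambda>xs. bt n (butlast xs @ [last xs \<otimes>\<^bsub>A\<^esub> a])) t"
  by (simp_all add: bar_def Let_def)

lemma bar_smult: "c \<in> carrier K ==> t \<in> carrier (Bar n) ==> smult (Bar n) c t = upd n 0 (smult A c) t"
  unfolding bar_action_lift
  by (rule bar_action_eq[OF upd_hom]) (simp_all add: k_linear_smult upd_bt update_0)

lemma bar_lact: "a \<in> carrier A ==> t \<in> carrier (Bar n) ==> lact (Bar n) a t = upd n 0 (mult A a) t"
  unfolding bar_action_lift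
  by (rule bar_action_eq[OF upd_hom]) (simp_all add: k_linear_left upd_bt update_0)

lemma bar_ract: "a \<in> carrier A ==> t \<in> carrier (Bar n) ==> ract (Bar n) t a = upd n (Suc n) (\<lambda>x. x \<otimes>\<^bsub>A\<^esub> a) t"
  unfolding bar_action_lift
  by (rule bar_action_eq[OF upd_hom])
     (simp_all add: k_linear_right upd_bt update_last[where f = "\<lambda>x. x \<otimes>\<^bsub>A\<^esub> a" for a])

lemma add_hom_cong':
  assumes "f \<in> add_hom (Bar n) H" "\<And>t. t \<in> carrier (Bar n) ==> f' t = f t"
  shows "f' \<in> add_hom (Bar n) H"
  using assms by (auto simp: add_hom_def)

lemma bar_smult_hom: "c \<in> carrier K ==> smult (Bar n) c \<in> add_hom (Bar n) (Bar n)"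
  by (rule add_hom_cong'[OF upd_hom]) (auto simp: bar_smult k_linear_smult)

lemma bar_lact_hom: "a \<in> carrier A ==> lact (Bar n) a \<in> add_hom (Bar n) (Bar n)"
  by (rule add_hom_cong'[OF upd_hom]) (auto simp: bar_lact k_linear_left)

lemma bar_ract_hom: "a \<in> carrier A ==> (\<lambda>t. ract (Bar n) t a) \<in> add_hom (Bar n) (Bar n)"
  by (rule add_hom_cong'[OF upd_hom]) (auto simp: bar_ract k_linear_right)

lemma bar_smult_bt: "c \<in> carrier K ==> xs \<in> bar_gens A n ==>
    smult (Bar n) c (bt n xs) = bt n (xs[0 := c \<odot>\<^bsub>A\<^esub> xs ! 0])"
  by (simp add: bar_smult bt_closed upd_bt k_linear_smult)

lemma bar_lact_bt: "a \<in> carrier A ==> xs \<in> bar_gens A n ==>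
    lact (Bar n) a (bt n xs) = bt n (xs[0 := a \<otimes>\<^bsub>A\<^esub> xs ! 0])"
  by (simp add: bar_lact bt_closed upd_bt k_linear_left)

lemma bar_ract_bt: "a \<in> carrier A ==> xs \<in> bar_gens A n ==>
    ract (Bar n) (bt n xs) a = bt n (xs[Suc n := xs ! Suc n \<otimes>\<^bsub>A\<^esub> a])"
  by (simp add: bar_ract bt_closed upd_bt k_linear_right)

lemma bar_smult_bt_slot: "c \<in> carrier K ==> xs \<in> bar_gens A n ==> i < n + 2 ==>
    smult (Bar n) c (bt n xs) = bt n (xs[i := c \<odot>\<^bsub>A\<^esub> xs ! i])"
  using bt_scale[of xs n 0 i c] by (simp add: bar_smult_bt)

lemmas bar_ext' = bar_ext[OF _ _ bar_abelian_group]

lemma module_bar: "module K (Bar n)"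
proof (rule moduleI)
  note s = bar_smult_bt bar_gens_update bar_gens_nth[where n = n] bar_gens_length[where n = n]
    and i = bar_smult_hom add_hom_plus bar_abelian_group add_hom_id add_hom_compose[OF bar_smult_hom bar_smult_hom]
  fix a b x assume a: "a \<in> carrier K" "b \<in> carrier K" and x: "x \<in> carrier (Bar n)"
  show "(a \<oplus>\<^bsub>K\<^esub> b) \<odot>\<^bsub>Bar n\<^esub> x = a \<odot>\<^bsub>Bar n\<^esub> x \<oplus>\<^bsub>Bar n\<^esub> b \<odot>\<^bsub>Bar n\<^esub> x"
    by (rule bar_ext'[OF _ _ _ x]) (use a in \<open>auto intro!: i simp: s V.smult_l_distr bt_add'\<close>)
  show "(a \<otimes>\<^bsub>K\<^esub> b) \<odot>\<^bsub>Bar n\<^esub> x = a \<odot>\<^bsub>Bar n\<^esub> (b \<odot>\<^bsub>Bar n\<^esub> x)"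
    by (rule bar_ext'[OF _ _ _ x]) (use a in \<open>auto intro!: i simp: s V.smult_assoc1\<close>)
next
  fix x assume x: "x \<in> carrier (Bar n)"
  show "\<one>\<^bsub>K\<^esub> \<odot>\<^bsub>Bar n\<^esub> x = x"
    by (rule bar_ext'[OF _ _ _ x]) (auto intro!: bar_smult_hom add_hom_id simp: bar_smult_bt bar_gens_nth[where n = n])
qed (auto simp: V.R.is_cring bar_abelian_group add_hom_closed[OF bar_smult_hom] add_hom_add[OF bar_smult_hom])

lemma bim_bar: "bim K A A (Bar n)"
  unfolding bim_def left_module_def right_module_def
proof (intro conjI ballI module_bar)
  note s = bar_lact_bt bar_ract_bt bar_gens_update bar_gens_nth[where n = n] bar_gens_length[where n = n]
    and i = bar_lact_hom bar_ract_hom bar_smult_hom add_hom_plus bar_abelian_group add_hom_id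
  fix r s x assume r: "r \<in> carrier A" "s \<in> carrier A" and x: "x \<in> carrier (Bar n)"
  show "lact (Bar n) (r \<oplus>\<^bsub>A\<^esub> s) x = lact (Bar n) r x \<oplus>\<^bsub>Bar n\<^esub> lact (Bar n) s x"
    by (rule bar_ext'[OF _ _ _ x]) (use r in \<open>auto intro!: i simp: s A.l_distr bt_add'\<close>)
  show "lact (Bar n) (r \<otimes>\<^bsub>A\<^esub> s) x = lact (Bar n) r (lact (Bar n) s x)"
    by (rule bar_ext'[OF _ _ _ x]) (use r in \<open>auto intro!: i add_hom_compose[OF bar_lact_hom bar_lact_hom] simp: s A.m_assoc\<close>)
  show "ract (Bar n) x (r \<oplus>\<^bsub>A\<^esub> s) = ract (Bar n) x r \<oplus>\<^bsub>Bar n\<^esub> ract (Bar n) x s"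
    by (rule bar_ext'[OF _ _ _ x]) (use r in \<open>auto intro!: i simp: s A.r_distr bt_add'\<close>)
  show "ract (Bar n) x (r \<otimes>\<^bsub>A\<^esub> s) = ract (Bar n) (ract (Bar n) x r) s"
    by (rule bar_ext'[OF _ _ _ x]) (use r in \<open>auto intro!: i add_hom_compose[OF bar_ract_hom bar_ract_hom] simp: s A.m_assoc\<close>)
  show "ract (Bar n) (lact (Bar n) r x) s = lact (Bar n) r (ract (Bar n) x s)"
    by (rule bar_ext'[OF _ _ _ x])
       (use r in \<open>auto intro!: add_hom_compose[OF bar_lact_hom bar_ract_hom] add_hom_compose[OF bar_ract_hom bar_lact_hom]
         simp: s list_update_swap\<close>)
next
  note s = bar_lact_bt bar_ract_bt bar_gens_nth[where n = n]
    and i = bar_lact_hom bar_ract_hom bar_smult_hom add_hom_id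
  fix x assume x: "x \<in> carrier (Bar n)"
  show "lact (Bar n) \<one>\<^bsub>A\<^esub> x = x" by (rule bar_ext'[OF _ _ _ x]) (auto intro!: i simp: s)
  show "ract (Bar n) x \<one>\<^bsub>A\<^esub> = x" by (rule bar_ext'[OF _ _ _ x]) (auto intro!: i simp: s)
  fix c assume c: "c \<in> carrier K"
  show "lact (Bar n) (c \<odot>\<^bsub>A\<^esub> \<one>\<^bsub>A\<^esub>) x = c \<odot>\<^bsub>Bar n\<^esub> x"
    by (rule bar_ext'[OF _ _ _ x])
       (use c in \<open>auto intro!: i simp: s bar_smult_bt k_algebra_scalar_central(1)[OF alg]\<close>)
  show "ract (Bar n) x (c \<odot>\<^bsub>A\<^esub> \<one>\<^bsub>A\<^esub>) = c \<odot>\<^bsub>Bar n\<^esub> x"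
    by (rule bar_ext'[OF _ _ _ x])
       (use c in \<open>auto intro!: i simp: s bar_smult_bt_slot[of _ _ _ "Suc n"] k_algebra_scalar_central(2)[OF alg]\<close>)
qed (auto simp: add_hom_closed[OF bar_lact_hom] add_hom_closed[OF bar_ract_hom] add_hom_add[OF bar_lact_hom]
    add_hom_add[OF bar_ract_hom])

end

lemma (in abelian_group) finsum_single: "f x \<in> carrier G ==> finsum G f {x} = f x"
  using finsum_insert[of "{}" x f] by simp

section \<open>Faces and the bar differential\<close>

context bar_alg
begin

lemma merge_at_length: "Suc i < length xs ==> length (merge_at A i xs) = length xs - 1"
  by (simp add: merge_at_def)

lemma merge_at_nth:
  assumes "Suc i < length xs" "k < length xs - 1"
  shows "merge_at A i xs ! k = (if k < i then xs ! k else if k = i then xs ! i \<otimes>\<^bsub>A\<^esub> xs ! Suc i else xs ! Suc k)"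
  using assms by (auto simp: merge_at_def nth_append nth_Cons' min_def)

lemma merge_at_closed:
  assumes "xs \<in> bar_gens A (Suc n)" "i \<le> Suc n"
  shows "merge_at A i xs \<in> bar_gens A n"
proof (rule bar_gensI)
  have len: "length xs = n + 3" using bar_gens_length[OF assms(1)] by simp
  then show "length (merge_at A i xs) = n + 2" using assms(2) by (simp add: merge_at_length)
  fix k assume "k < n + 2"
  then show "merge_at A i xs ! k \<in> carrier A"
    using assms(2) len bar_gens_nth[OF assms(1)] by (simp add: merge_at_nth)
qed

lemma merge_at_update:
  assumes "length xs = n + 3" "i \<le> Suc n" "j < n + 3"
  shows "merge_at A i (xs[j := v]) =
    (if j < i then (merge_at A i xs)[j := v]
     else if j = i then (merge_at A i xs)[i := v \<otimes>\<^bsub>A\<^esub> xs ! Suc i]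
     else if j = Suc i then (merge_at A i xs)[i := xs ! i \<otimes>\<^bsub>A\<^esub> v]
     else (merge_at A i xs)[j - 1 := v])"
  by (rule nth_equalityI) (use assms in \<open>auto simp: merge_at_length merge_at_nth nth_list_update\<close>)

lemma slotwise_merge:
  assumes i: "i \<le> Suc n"
  shows "slotwise K A (Suc n) n (merge_at A i)"
  unfolding slotwise_def
proof (intro ballI conjI allI impI)
  fix xs assume xs: "xs \<in> bar_gens A (Suc n)"
  show "merge_at A i xs \<in> bar_gens A n" using xs i by (rule merge_at_closed)
  fix j assume j: "j < Suc n + 2"
  have len: "length xs = n + 3" using bar_gens_length[OF xs] by simp
  have j': "j < n + 3" using j by simp
  note u = merge_at_update[OF len i j']
  have x: "xs ! i \<in> carrier A" "xs ! Suc i \<in> carrier A" using bar_gens_nth[OF xs] i by auto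
  consider "j < i" | "j = i" | "j = Suc i" | "Suc i < j" by linarith
  then show "\<exists>p<n + 2. \<exists>l\<in>k_linear K A A. \<forall>v\<in>carrier A. merge_at A i (xs[j := v]) = (merge_at A i xs)[p := l v]"
  proof cases
    case 1
    then show ?thesis using i by (intro exI[of _ j] conjI bexI[OF _ k_linear_id]) (auto simp: u)
  next
    case 2
    then show ?thesis using i x by (intro exI[of _ i] conjI bexI[OF _ k_linear_right[of "xs ! Suc i"]]) (auto simp: u[unfolded 2] 2)
  next
    case 3
    then show ?thesis using i x by (intro exI[of _ i] conjI bexI[OF _ k_linear_left[of "xs ! i"]]) (auto simp: u[unfolded 3] 3)
  next
    case 4
    then show ?thesis using i j by (intro exI[of _ "j - 1"] conjI bexI[OF _ k_linear_id]) (auto simp: u)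
  qed
qed

definition face :: "nat \<Rightarrow> nat \<Rightarrow> 'a chain \<Rightarrow> 'a chain" where
  "face n i = lift_hom (Bar n) (\<lambda>xs. bt n (merge_at A i xs))"

lemma face:
  assumes "i \<le> Suc n"
  shows face_hom: "face n i \<in> add_hom (Bar (Suc n)) (Bar n)"
    and face_bt: "\<And>xs. xs \<in> bar_gens A (Suc n) ==> face n i (bt (Suc n) xs) = bt n (merge_at A i xs)"
  unfolding face_def using bar_lift[OF bar_abelian_group slotwise_multilinear[OF slotwise_merge[OF assms]]] by auto

lemma face_lact:
  assumes "i \<le> Suc n" "a \<in> carrier A" "t \<in> carrier (Bar (Suc n))"
  shows "face n i (lact (Bar (Suc n)) a t) = lact (Bar n) a (face n i t)"
proof (rule bar_ext'[OF _ _ _ assms(3)])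
  fix xs assume xs: "xs \<in> bar_gens A (Suc n)"
  have len: "length xs = n + 3" using bar_gens_length[OF xs] by simp
  have xn: "\<And>k. k < n + 3 ==> xs ! k \<in> carrier A" using bar_gens_nth[OF xs] by simp
  have g: "xs[0 := a \<otimes>\<^bsub>A\<^esub> xs ! 0] \<in> bar_gens A (Suc n)"
    using assms(2) xn[of 0] xs by (intro bar_gens_update) auto
  have "merge_at A i (xs[0 := a \<otimes>\<^bsub>A\<^esub> xs ! 0]) = (merge_at A i xs)[0 := a \<otimes>\<^bsub>A\<^esub> merge_at A i xs ! 0]"
    using assms(1,2) len xn[of 0] xn[of "Suc 0"]
    by (subst merge_at_update[OF len assms(1)]) (auto simp: merge_at_nth A.m_assoc)
  then show "face n i (lact (Bar (Suc n)) a (bt (Suc n) xs)) = lact (Bar n) a (face n i (bt (Suc n) xs))"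
    using assms xs g by (simp add: bar_lact_bt face_bt merge_at_closed)
qed (use assms in \<open>auto intro!: add_hom_compose[OF bar_lact_hom face_hom] add_hom_compose[OF face_hom bar_lact_hom]\<close>)

lemma face_ract:
  assumes "i \<le> Suc n" "a \<in> carrier A" "t \<in> carrier (Bar (Suc n))"
  shows "face n i (ract (Bar (Suc n)) t a) = ract (Bar n) (face n i t) a"
proof (rule bar_ext'[OF _ _ _ assms(3)])
  fix xs assume xs: "xs \<in> bar_gens A (Suc n)"
  have len: "length xs = n + 3" using bar_gens_length[OF xs] by simp
  have xn: "\<And>k. k < n + 3 ==> xs ! k \<in> carrier A" using bar_gens_nth[OF xs] by simp
  have g: "xs[Suc (Suc n) := xs ! Suc (Suc n) \<otimes>\<^bsub>A\<^esub> a] \<in> bar_gens A (Suc n)"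
    using assms(2) xn[of "Suc (Suc n)"] xs by (intro bar_gens_update) auto
  have "merge_at A i (xs[Suc (Suc n) := xs ! Suc (Suc n) \<otimes>\<^bsub>A\<^esub> a]) =
      (merge_at A i xs)[Suc n := merge_at A i xs ! Suc n \<otimes>\<^bsub>A\<^esub> a]"
    using assms(1,2) len xn[of "Suc n"] xn[of "Suc (Suc n)"]
    by (subst merge_at_update[OF len assms(1)]) (auto simp: merge_at_nth A.m_assoc)
  then show "face n i (ract (Bar (Suc n)) (bt (Suc n) xs) a) = ract (Bar n) (face n i (bt (Suc n) xs)) a"
    using assms xs g by (simp add: bar_ract_bt face_bt merge_at_closed)
qed (use assms in \<open>auto intro!: add_hom_compose[OF bar_ract_hom face_hom] add_hom_compose[OF face_hom bar_ract_hom]\<close>)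

text \<open>The sign is a case distinction on parity instead of an integer power, so that additivity
  and bilinearity are inherited from \<open>face\<close>.\<close>

definition sgn_face :: "nat \<Rightarrow> nat \<Rightarrow> 'a chain \<Rightarrow> 'a chain" where
  "sgn_face n i t = (if even i then face n i t else \<ominus>\<^bsub>Bar n\<^esub> face n i t)"

abbreviation "bd \<equiv> bar_diff K A"

lemma neg_hom: "f \<in> add_hom G (Bar n) ==> (\<lambda>x. \<ominus>\<^bsub>Bar n\<^esub> f x) \<in> add_hom G (Bar n)"
  by (auto simp: add_hom_def Pi_iff Bar.minus_add Bar.a_comm)

lemma sgn_face_hom: "i \<le> Suc n ==> sgn_face n i \<in> add_hom (Bar (Suc n)) (Bar n)"
  unfolding sgn_face_def[abs_def] by (cases "even i") (auto intro: neg_hom face_hom)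

lemma add_pow_sign: "x \<in> carrier (Bar n) ==>
    add_pow (Bar n) ((-1) ^ i :: int) x = (if even i then x else \<ominus>\<^bsub>Bar n\<^esub> x)"
  using Bar.add.int_pow_neg[of x n 1] by (auto simp: Bar.add.int_pow_1)

lemma bar_diff_eq:
  assumes "t \<in> carrier (Bar (Suc n))"
  shows "bd n t = finsum (Bar n) (\<lambda>i. sgn_face n i t) {..Suc n}"
  unfolding bar_diff_def
proof (rule bar_lift_eq[OF _ bar_abelian_group _ assms])
  show "(\<lambda>t. finsum (Bar n) (\<lambda>i. sgn_face n i t) {..Suc n}) \<in> add_hom (Bar (Suc n)) (Bar n)"
    by (rule add_hom_finsum[OF bar_abelian_group]) (auto intro: sgn_face_hom)
  fix xs assume xs: "xs \<in> bar_gens A (Suc n)"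
  show "finsum (Bar n) (\<lambda>i. add_pow (Bar n) ((-1) ^ i :: int) (bt n (merge_at A i xs))) {0..Suc n} =
      finsum (Bar n) (\<lambda>i. sgn_face n i (bt (Suc n) xs)) {..Suc n}"
    unfolding atLeast0AtMost
    by (rule Bar.finsum_cong')
       (use xs in \<open>auto simp: add_pow_sign bt_closed merge_at_closed sgn_face_def face_bt\<close>)
qed

lemma bar_diff_hom: "bd n \<in> bimod_hom A (Bar (Suc n)) (Bar n)"
proof (rule bimod_homI)
  have "(\<lambda>t. finsum (Bar n) (\<lambda>i. sgn_face n i t) {..Suc n}) \<in> add_hom (Bar (Suc n)) (Bar n)"
    by (rule add_hom_finsum[OF bar_abelian_group]) (auto intro: sgn_face_hom)
  then show "bd n \<in> add_hom (Bar (Suc n)) (Bar n)"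
    by (rule add_hom_cong') (rule bar_diff_eq)
next
  fix a t assume a: "a \<in> carrier A" and t: "t \<in> carrier (Bar (Suc n))"
  have cl: "(\<lambda>i. sgn_face n i t) \<in> {..Suc n} \<rightarrow> carrier (Bar n)"
    using t by (auto intro: add_hom_closed[OF sgn_face_hom])
  have "sgn_face n i (lact (Bar (Suc n)) a t) = lact (Bar n) a (sgn_face n i t)" if "i \<le> Suc n" for i
    using that a t add_hom_closed[OF face_hom[OF that] t]
    by (simp add: sgn_face_def face_lact add_hom_neg[OF bar_lact_hom bar_abelian_group bar_abelian_group])
  then show "bd n (lact (Bar (Suc n)) a t) = lact (Bar n) a (bd n t)"
    unfolding bar_diff_eq[OF t] bar_diff_eq[OF lact_closed[OF bim_left[OF bim_bar] a t]]
      add_hom_finsum_arg[OF bar_lact_hom[OF a] bar_abelian_group bar_abelian_group cl]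
    using cl by (intro Bar.finsum_cong') (auto intro!: add_hom_closed[OF bar_lact_hom[OF a]])
  have "sgn_face n i (ract (Bar (Suc n)) t a) = ract (Bar n) (sgn_face n i t) a" if "i \<le> Suc n" for i
    using that a t add_hom_closed[OF face_hom[OF that] t]
    by (simp add: sgn_face_def face_ract add_hom_neg[OF bar_ract_hom bar_abelian_group bar_abelian_group])
  then show "bd n (ract (Bar (Suc n)) t a) = ract (Bar n) (bd n t) a"
    unfolding bar_diff_eq[OF t] bar_diff_eq[OF ract_closed[OF bim_right[OF bim_bar] a t]]
      add_hom_finsum_arg[OF bar_ract_hom[OF a] bar_abelian_group bar_abelian_group cl]
    using cl by (intro Bar.finsum_cong') (auto intro!: add_hom_closed[OF bar_ract_hom[OF a]])
qed

lemmas bar_diff_add_hom = bimod_hom_add_hom[OF bar_diff_hom]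

section \<open>A left linear contraction of the bar complex\<close>

lemma append_one_closed: "xs \<in> bar_gens A n ==> xs @ [\<one>\<^bsub>A\<^esub>] \<in> bar_gens A (Suc n)"
  by (auto simp: bar_gens_def)

lemma slotwise_append: "slotwise K A n (Suc n) (\<lambda>xs. xs @ [\<one>\<^bsub>A\<^esub>])"
  unfolding slotwise_def
proof (intro ballI conjI allI impI append_one_closed)
  fix xs i assume "xs \<in> bar_gens A n" "i < n + 2"
  then show "\<exists>p<Suc n + 2. \<exists>l\<in>k_linear K A A. \<forall>v\<in>carrier A. xs[i := v] @ [\<one>\<^bsub>A\<^esub>] = (xs @ [\<one>\<^bsub>A\<^esub>])[p := l v]"
    by (intro exI[of _ i] conjI bexI[OF _ k_linear_id]) (auto simp: list_update_append bar_gens_length)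
qed

text \<open>The unit is appended at the right end, not at the left: this contraction is left
  A-linear, so it survives T \<otimes>_A - and proves exactness of the entwined complex as well. The
  price is a sign depending on the degree.\<close>

definition contr :: "nat \<Rightarrow> 'a chain \<Rightarrow> 'a chain" where
  "contr n = lift_hom (Bar (Suc n)) (\<lambda>xs. bt (Suc n) (xs @ [\<one>\<^bsub>A\<^esub>]))"

lemma contr_hom: "contr n \<in> add_hom (Bar n) (Bar (Suc n))"
  and contr_bt: "\<And>xs. xs \<in> bar_gens A n ==> contr n (bt n xs) = bt (Suc n) (xs @ [\<one>\<^bsub>A\<^esub>])"
  unfolding contr_def using bar_lift[OF bar_abelian_group slotwise_multilinear[OF slotwise_append]] by auto

lemma contr_lact:
  assumes "a \<in> carrier A" "t \<in> carrier (Bar n)"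
  shows "contr n (lact (Bar n) a t) = lact (Bar (Suc n)) a (contr n t)"
proof (rule bar_ext'[OF _ _ _ assms(2)])
  fix xs assume xs: "xs \<in> bar_gens A n"
  have g: "xs[0 := a \<otimes>\<^bsub>A\<^esub> xs ! 0] \<in> bar_gens A n"
    using assms(1) bar_gens_nth[OF xs, of 0] xs by (intro bar_gens_update) auto
  show "contr n (lact (Bar n) a (bt n xs)) = lact (Bar (Suc n)) a (contr n (bt n xs))"
    using assms xs g by (simp add: bar_lact_bt contr_bt append_one_closed list_update_append nth_append bar_gens_length[OF xs])
qed (use assms in \<open>auto intro!: add_hom_compose[OF bar_lact_hom contr_hom] add_hom_compose[OF contr_hom bar_lact_hom]\<close>)

lemma face_contr_bt:
  assumes "xs \<in> bar_gens A (Suc n)" "i \<le> Suc n"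
  shows "face (Suc n) i (contr (Suc n) (bt (Suc n) xs)) = contr n (face n i (bt (Suc n) xs))"
proof -
  have "length xs = n + 3" using bar_gens_length[OF assms(1)] by simp
  then have "merge_at A i (xs @ [\<one>\<^bsub>A\<^esub>]) = merge_at A i xs @ [\<one>\<^bsub>A\<^esub>]"
    using assms(2) by (auto simp: merge_at_def nth_append)
  then show ?thesis
    using assms by (simp add: contr_bt face_bt append_one_closed merge_at_closed)
qed

lemma face_last_contr_bt:
  assumes "xs \<in> bar_gens A n"
  shows "face n (Suc n) (contr n (bt n xs)) = bt n xs"
proof -
  have len: "length xs = n + 2" using bar_gens_length[OF assms] .
  have "merge_at A (Suc n) (xs @ [\<one>\<^bsub>A\<^esub>]) = xs"
    using len bar_gens_nth[OF assms]
    by (intro nth_equalityI) (auto simp: merge_at_length merge_at_nth nth_append less_Suc_eq)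
  then show ?thesis
    using assms by (simp add: contr_bt face_bt append_one_closed)
qed

definition sg :: "nat \<Rightarrow> nat \<Rightarrow> 'a chain \<Rightarrow> 'a chain" where
  "sg m n t = (if even m then t else \<ominus>\<^bsub>Bar n\<^esub> t)"

lemma sg_hom: "sg m n \<in> add_hom (Bar n) (Bar n)"
  unfolding sg_def[abs_def] using neg_hom[OF add_hom_id] add_hom_id by (cases "even m") auto

text \<open>All faces but the last ignore the appended unit and commute with \<open>contr\<close>;
  the last one multiplies by it and returns t. In degree n + 1 the last face has index n + 2, which
  is the sign recorded by \<open>sg\<close>.\<close>

lemma bar_diff_contr:
  assumes "t \<in> carrier (Bar (Suc n))"
  shows "bd (Suc n) (contr (Suc n) t) = contr n (bd n t) \<oplus>\<^bsub>Bar (Suc n)\<^esub> sg (Suc (Suc n)) (Suc n) t"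
proof (rule bar_ext'[OF _ _ _ assms])
  fix xs assume xs: "xs \<in> bar_gens A (Suc n)"
  let ?x = "bt (Suc n) xs"
  have x: "?x \<in> carrier (Bar (Suc n))" using xs by (rule bt_closed)
  have cx: "contr (Suc n) ?x \<in> carrier (Bar (Suc (Suc n)))" using contr_hom x by (rule add_hom_closed)
  have cl: "(\<lambda>i. sgn_face n i ?x) \<in> {..Suc n} \<rightarrow> carrier (Bar n)"
    using x by (auto intro: add_hom_closed[OF sgn_face_hom])
  have sf: "sgn_face (Suc n) i (contr (Suc n) ?x) \<in> carrier (Bar (Suc n))" if "i \<le> Suc (Suc n)" for i
    using that cx by (auto intro: add_hom_closed[OF sgn_face_hom])
  have "bd (Suc n) (contr (Suc n) ?x) =
     sgn_face (Suc n) (Suc (Suc n)) (contr (Suc n) ?x) \<oplus>\<^bsub>Bar (Suc n)\<^esub>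
     finsum (Bar (Suc n)) (\<lambda>i. sgn_face (Suc n) i (contr (Suc n) ?x)) {..Suc n}"
    unfolding bar_diff_eq[OF cx] by (rule Bar.finsum_Suc) (use sf in auto)
  also have "sgn_face (Suc n) (Suc (Suc n)) (contr (Suc n) ?x) = sg (Suc (Suc n)) (Suc n) ?x"
    using face_last_contr_bt[OF xs] by (simp add: sgn_face_def sg_def)
  also have "finsum (Bar (Suc n)) (\<lambda>i. sgn_face (Suc n) i (contr (Suc n) ?x)) {..Suc n} =
      finsum (Bar (Suc n)) (\<lambda>i. contr n (sgn_face n i ?x)) {..Suc n}"
  proof (rule Bar.finsum_cong')
    fix i assume "i \<in> {..Suc n}"
    then show "sgn_face (Suc n) i (contr (Suc n) ?x) = contr n (sgn_face n i ?x)"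
      using xs x face_hom[of i n]
      by (simp add: sgn_face_def face_contr_bt add_hom_neg[OF contr_hom bar_abelian_group bar_abelian_group] add_hom_closed)
  qed (use cl in \<open>auto intro: add_hom_closed[OF contr_hom]\<close>)
  also have "\<dots> = contr n (bd n ?x)"
    unfolding bar_diff_eq[OF x] by (rule add_hom_finsum_arg[OF contr_hom bar_abelian_group bar_abelian_group cl, symmetric])
  finally show "bd (Suc n) (contr (Suc n) ?x) = contr n (bd n ?x) \<oplus>\<^bsub>Bar (Suc n)\<^esub> sg (Suc (Suc n)) (Suc n) ?x"
    using add_hom_closed[OF sg_hom x] add_hom_closed[OF contr_hom add_hom_closed[OF bar_diff_add_hom x]]
    by (simp add: Bar.a_comm)
qed (auto intro!: add_hom_plus bar_abelian_group sg_hom add_hom_compose[OF contr_hom bar_diff_add_hom]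
     add_hom_compose[OF bar_diff_add_hom contr_hom])

section \<open>The augmentation, and the vanishing of squares of the differential\<close>

definition bar_aug :: "'a chain \<Rightarrow> 'a" where
  "bar_aug = lift_hom A (\<lambda>xs. xs ! 0 \<otimes>\<^bsub>A\<^esub> xs ! 1)"

lemma bar_aug_multilinear: "multilinear K A 0 A (\<lambda>xs. xs ! 0 \<otimes>\<^bsub>A\<^esub> xs ! 1)"
  unfolding multilinear_def
proof (intro conjI ballI allI impI)
  fix xs assume xs: "xs \<in> bar_gens A 0"
  have x: "xs ! 0 \<in> carrier A" "xs ! Suc 0 \<in> carrier A" "length xs = 2"
    using bar_gens_nth[OF xs] bar_gens_length[OF xs] by auto
  show "xs ! 0 \<otimes>\<^bsub>A\<^esub> xs ! 1 \<in> carrier A" using x by simp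
  fix i assume "i < 0 + (2 :: nat)"
  then have i: "i = 0 \<or> i = 1" by auto
  { fix y assume "y \<in> carrier A"
    then show "xs[i := xs ! i \<oplus>\<^bsub>A\<^esub> y] ! 0 \<otimes>\<^bsub>A\<^esub> xs[i := xs ! i \<oplus>\<^bsub>A\<^esub> y] ! 1 =
      xs ! 0 \<otimes>\<^bsub>A\<^esub> xs ! 1 \<oplus>\<^bsub>A\<^esub> xs[i := y] ! 0 \<otimes>\<^bsub>A\<^esub> xs[i := y] ! 1"
      using i x by (auto simp: A.l_distr A.r_distr) }
  fix j c assume "j < 0 + (2 :: nat)" "c \<in> carrier K"
  then have "j = 0 \<or> j = 1" "c \<in> carrier K" by auto
  then show "xs[i := c \<odot>\<^bsub>A\<^esub> xs ! i] ! 0 \<otimes>\<^bsub>A\<^esub> xs[i := c \<odot>\<^bsub>A\<^esub> xs ! i] ! 1 =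
      xs[j := c \<odot>\<^bsub>A\<^esub> xs ! j] ! 0 \<otimes>\<^bsub>A\<^esub> xs[j := c \<odot>\<^bsub>A\<^esub> xs ! j] ! 1"
    using i x by (auto simp: k_algebra_smult_left[OF alg] k_algebra_smult_right[OF alg])
qed

lemma bar_aug_hom: "bar_aug \<in> add_hom (Bar 0) A"
  and bar_aug_bt: "\<And>xs. xs \<in> bar_gens A 0 ==> bar_aug (bt 0 xs) = xs ! 0 \<otimes>\<^bsub>A\<^esub> xs ! 1"
  unfolding bar_aug_def using bar_lift[OF A.abelian_group_axioms bar_aug_multilinear] by auto

lemma bar_aug_bimod_hom: "bar_aug \<in> bimod_hom A (Bar 0) (regular A)"
proof (rule bimod_homI)
  show "bar_aug \<in> add_hom (Bar 0) (regular A)" using bar_aug_hom by (simp add: add_hom_def)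
  fix a t assume a: "a \<in> carrier A" and t: "t \<in> carrier (Bar 0)"
  have "bar_aug (lact (Bar 0) a t) = a \<otimes>\<^bsub>A\<^esub> bar_aug t"
  proof (rule bar_ext[OF _ _ A.abelian_group_axioms _ t])
    fix xs assume xs: "xs \<in> bar_gens A 0"
    have x: "xs ! 0 \<in> carrier A" "xs ! Suc 0 \<in> carrier A" "length xs = 2"
      using bar_gens_nth[OF xs] bar_gens_length[OF xs] by auto
    have "xs[0 := a \<otimes>\<^bsub>A\<^esub> xs ! 0] \<in> bar_gens A 0" using xs x a by (intro bar_gens_update) auto
    then show "bar_aug (lact (Bar 0) a (bt 0 xs)) = a \<otimes>\<^bsub>A\<^esub> bar_aug (bt 0 xs)"
      using a xs x by (simp add: bar_lact_bt bar_aug_bt A.m_assoc)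
  qed (use a in \<open>auto intro!: add_hom_compose[OF bar_lact_hom bar_aug_hom] add_hom_compose[OF bar_aug_hom, of "mult A a"]
      add_homI simp: A.r_distr\<close>)
  then show "bar_aug (lact (Bar 0) a t) = lact (regular A) a (bar_aug t)" by simp
  have "bar_aug (ract (Bar 0) t a) = bar_aug t \<otimes>\<^bsub>A\<^esub> a"
  proof (rule bar_ext[OF _ _ A.abelian_group_axioms _ t])
    fix xs assume xs: "xs \<in> bar_gens A 0"
    have x: "xs ! 0 \<in> carrier A" "xs ! Suc 0 \<in> carrier A" "length xs = 2"
      using bar_gens_nth[OF xs] bar_gens_length[OF xs] by auto
    have "xs[Suc 0 := xs ! Suc 0 \<otimes>\<^bsub>A\<^esub> a] \<in> bar_gens A 0" using xs x a by (intro bar_gens_update) auto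
    then show "bar_aug (ract (Bar 0) (bt 0 xs) a) = bar_aug (bt 0 xs) \<otimes>\<^bsub>A\<^esub> a"
      using a xs x by (simp add: bar_ract_bt bar_aug_bt A.m_assoc)
  qed (use a in \<open>auto intro!: add_hom_compose[OF bar_ract_hom bar_aug_hom]
      add_hom_compose[OF bar_aug_hom, of "\<lambda>x. x \<otimes>\<^bsub>A\<^esub> a"] add_homI simp: A.l_distr\<close>)
  then show "bar_aug (ract (Bar 0) t a) = ract (regular A) (bar_aug t) a" by simp
qed

lemma bd_0_bt:
  assumes "xs \<in> bar_gens A (Suc 0)"
  shows "bd 0 (bt (Suc 0) xs) = bt 0 [xs ! 0 \<otimes>\<^bsub>A\<^esub> xs ! 1, xs ! 2] \<ominus>\<^bsub>Bar 0\<^esub> bt 0 [xs ! 0, xs ! 1 \<otimes>\<^bsub>A\<^esub> xs ! 2]"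
proof -
  have len: "length xs = 3" using bar_gens_length[OF assms] by simp
  then obtain x y z where xs: "xs = [x, y, z]"
    by (auto simp: numeral_3_eq_3 length_Suc_conv)
  have m: "merge_at A 0 xs = [x \<otimes>\<^bsub>A\<^esub> y, z]" "merge_at A (Suc 0) xs = [x, y \<otimes>\<^bsub>A\<^esub> z]"
    by (simp_all add: xs merge_at_def)
  have cl: "(\<lambda>i. sgn_face 0 i (bt (Suc 0) xs)) \<in> {..Suc 0} \<rightarrow> carrier (Bar 0)"
    by (auto intro!: add_hom_closed[OF sgn_face_hom] bt_closed[OF assms])
  have "bd 0 (bt (Suc 0) xs) = sgn_face 0 (Suc 0) (bt (Suc 0) xs) \<oplus>\<^bsub>Bar 0\<^esub> sgn_face 0 0 (bt (Suc 0) xs)"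
    unfolding bar_diff_eq[OF bt_closed[OF assms]] using cl by (subst Bar.finsum_Suc) (simp_all add: Bar.finsum_single Pi_iff)
  also have "\<dots> = bt 0 [x \<otimes>\<^bsub>A\<^esub> y, z] \<ominus>\<^bsub>Bar 0\<^esub> bt 0 [x, y \<otimes>\<^bsub>A\<^esub> z]"
    using assms merge_at_closed[OF assms, of 0] merge_at_closed[OF assms, of "Suc 0"]
    by (simp add: sgn_face_def face_bt m a_minus_def Bar.a_comm bt_closed)
  finally show ?thesis by (simp add: xs)
qed

lemma bar_aug_bd:
  assumes "t \<in> carrier (Bar (Suc 0))"
  shows "bar_aug (bd 0 t) = \<zero>\<^bsub>A\<^esub>"
proof (rule bar_ext[where g = "\<lambda>_. \<zero>\<^bsub>A\<^esub>", OF _ add_hom_null A.abelian_group_axioms _ assms])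
  fix xs assume xs: "xs \<in> bar_gens A (Suc 0)"
  have x: "xs ! 0 \<in> carrier A" "xs ! 1 \<in> carrier A" "xs ! 2 \<in> carrier A"
    using bar_gens_nth[OF xs] by auto
  have g: "[xs ! 0 \<otimes>\<^bsub>A\<^esub> xs ! 1, xs ! 2] \<in> bar_gens A 0" "[xs ! 0, xs ! 1 \<otimes>\<^bsub>A\<^esub> xs ! 2] \<in> bar_gens A 0"
    using x by (auto simp: bar_gens_def)
  show "bar_aug (bd 0 (bt (Suc 0) xs)) = \<zero>\<^bsub>A\<^esub>"
    unfolding bd_0_bt[OF xs] using g x
    by (simp add: add_hom_minus[OF bar_aug_hom bar_abelian_group A.abelian_group_axioms] bt_closed bar_aug_bt
        A.m_assoc A.minus_self)
qed (auto intro!: add_hom_compose[OF bar_diff_add_hom bar_aug_hom] A.abelian_group_axioms)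

lemma bt_one_hom: "(\<lambda>x. bt 0 [x, \<one>\<^bsub>A\<^esub>]) \<in> add_hom A (Bar 0)"
proof (rule add_homI)
  fix x y assume xy: "x \<in> carrier A" "y \<in> carrier A"
  then have "[x, \<one>\<^bsub>A\<^esub>] \<in> bar_gens A 0" by (auto simp: bar_gens_def)
  from bt_add'[OF this, of 0 x y] xy
  show "bt 0 [x \<oplus>\<^bsub>A\<^esub> y, \<one>\<^bsub>A\<^esub>] = bt 0 [x, \<one>\<^bsub>A\<^esub>] \<oplus>\<^bsub>Bar 0\<^esub> bt 0 [y, \<one>\<^bsub>A\<^esub>]" by simp
qed (auto intro!: bt_closed simp: bar_gens_def)

text \<open>In degree 0 the two faces of [x, y, 1] are [x y, 1] and [x, y]; the first factors
  through the augmentation and plays the part of \<open>contr\<close> after the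
  differential.\<close>

lemma bar_diff_contr_0:
  assumes "t \<in> carrier (Bar 0)"
  shows "bd 0 (contr 0 t) = bt 0 [bar_aug t, \<one>\<^bsub>A\<^esub>] \<ominus>\<^bsub>Bar 0\<^esub> t"
proof -
  note 1 = bt_one_hom
  show ?thesis
  proof (rule bar_ext'[OF _ _ _ assms])
    fix xs assume xs: "xs \<in> bar_gens A 0"
    then obtain x y where xy: "xs = [x, y]" "x \<in> carrier A" "y \<in> carrier A"
      by (auto simp: bar_gens_def numeral_2_eq_2 length_Suc_conv)
    show "bd 0 (contr 0 (bt 0 xs)) = bt 0 [bar_aug (bt 0 xs), \<one>\<^bsub>A\<^esub>] \<ominus>\<^bsub>Bar 0\<^esub> bt 0 xs"
      using xs append_one_closed[OF xs] xy by (simp add: contr_bt bd_0_bt bar_aug_bt)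
  qed (auto intro!: add_hom_sub bar_abelian_group add_hom_id add_hom_compose[OF contr_hom bar_diff_add_hom]
      add_hom_compose[OF bar_aug_hom 1])
qed

text \<open>Up to the right action every generator is of the form \<open>contr\<close>. Right linear
  maps out of the bar complex can therefore be tested on the image of the contraction.\<close>

lemma contr_generates:
  assumes "xs \<in> bar_gens A (Suc n)"
  shows "bt (Suc n) xs = ract (Bar (Suc n)) (contr n (bt n (butlast xs))) (last xs)"
proof -
  have len: "length xs = n + 3" using bar_gens_length[OF assms] by simp
  then obtain ys y where xs: "xs = ys @ [y]" by (cases xs rule: rev_cases) auto
  with assms have ys: "ys \<in> bar_gens A n" "y \<in> carrier A" by (auto simp: bar_gens_def)
  have "(ys @ [\<one>\<^bsub>A\<^esub>])[Suc (Suc n) := (ys @ [\<one>\<^bsub>A\<^esub>]) ! Suc (Suc n) \<otimes>\<^bsub>A\<^esub> y] = xs"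
    using ys(2) by (simp add: xs nth_append list_update_append bar_gens_length[OF ys(1)])
  then show ?thesis
    using ys append_one_closed[OF ys(1)] by (simp add: xs contr_bt bar_ract_bt)
qed

text \<open>No identities between faces are used. The composite is right linear, so it is enough to
  evaluate it on the image of \<open>contr\<close>, where the contraction identity expresses it
  through the same composite one degree lower; in degree 0 the augmentation ends the
  recursion.\<close>

lemma bd_bd: "t \<in> carrier (Bar (Suc (Suc n))) ==> bd n (bd (Suc n) t) = \<zero>\<^bsub>Bar n\<^esub>"
proof (induction n arbitrary: t)
  case (Suc n)
  show ?case
  proof (rule bar_ext'[OF add_hom_compose[OF bar_diff_add_hom bar_diff_add_hom] add_hom_null[OF bar_abelian_group] _ Suc.prems])
    fix xs assume xs: "xs \<in> bar_gens A (Suc (Suc (Suc n)))"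
    let ?y = "bt (Suc (Suc n)) (butlast xs)"
    have "butlast xs \<in> bar_gens A (Suc (Suc n))" "last xs \<in> carrier A" "xs \<noteq> []"
      using xs last_in_set[of xs] by (cases "xs = []"; auto simp: bar_gens_def dest: in_set_butlastD)+
    then have y: "?y \<in> carrier (Bar (Suc (Suc n)))" and l: "last xs \<in> carrier A" by (auto intro: bt_closed)
    have cy: "contr (Suc (Suc n)) ?y \<in> carrier (Bar (Suc (Suc (Suc n))))"
      "bd (Suc n) ?y \<in> carrier (Bar (Suc n))"
      "contr (Suc n) (bd (Suc n) ?y) \<in> carrier (Bar (Suc (Suc n)))"
      using y by (auto intro!: add_hom_closed[OF contr_hom] add_hom_closed[OF bar_diff_add_hom])
    have s: "sg k (Suc (Suc n)) ?y \<in> carrier (Bar (Suc (Suc n)))" for k using add_hom_closed[OF sg_hom y] .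
    have "bd (Suc n) (bd (Suc (Suc n)) (contr (Suc (Suc n)) ?y)) =
        bd (Suc n) (contr (Suc n) (bd (Suc n) ?y)) \<oplus>\<^bsub>Bar (Suc n)\<^esub> bd (Suc n) (sg (Suc (Suc (Suc n))) (Suc (Suc n)) ?y)"
      using y cy s by (simp add: bar_diff_contr add_hom_add[OF bar_diff_add_hom])
    also have "bd (Suc n) (contr (Suc n) (bd (Suc n) ?y)) = sg (Suc (Suc n)) (Suc n) (bd (Suc n) ?y)"
      using cy y Suc.IH add_hom_closed[OF sg_hom cy(2)] add_hom_zero[OF contr_hom bar_abelian_group bar_abelian_group]
      by (simp add: bar_diff_contr)
    \<comment> \<open>The two sign exponents n + 2 and n + 3 have opposite parity, so the terms
      cancel.\<close>
    also have "sg (Suc (Suc n)) (Suc n) (bd (Suc n) ?y) \<oplus>\<^bsub>Bar (Suc n)\<^esub> bd (Suc n) (sg (Suc (Suc (Suc n))) (Suc (Suc n)) ?y) = \<zero>\<^bsub>Bar (Suc n)\<^esub>"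
      using cy y by (simp add: sg_def add_hom_neg[OF bar_diff_add_hom bar_abelian_group bar_abelian_group] Bar.r_neg Bar.l_neg)
    finally have z: "bd (Suc n) (bd (Suc (Suc n)) (contr (Suc (Suc n)) ?y)) = \<zero>\<^bsub>Bar (Suc n)\<^esub>" .
    have cl2: "bd (Suc (Suc n)) (contr (Suc (Suc n)) ?y) \<in> carrier (Bar (Suc (Suc n)))"
      using cy(1) by (rule add_hom_closed[OF bar_diff_add_hom])
    show "bd (Suc n) (bd (Suc (Suc n)) (bt (Suc (Suc (Suc n))) xs)) = \<zero>\<^bsub>Bar (Suc n)\<^esub>"
      unfolding contr_generates[OF xs]
      using l cy(1) cl2 z add_hom_zero[OF bar_ract_hom[OF l] bar_abelian_group bar_abelian_group]
      by (simp add: bimod_hom_ract[OF bar_diff_hom])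
  qed
next
  case 0
  show ?case
  proof (rule bar_ext'[OF add_hom_compose[OF bar_diff_add_hom bar_diff_add_hom] add_hom_null[OF bar_abelian_group] _ 0])
    fix xs assume xs: "xs \<in> bar_gens A (Suc (Suc 0))"
    let ?y = "bt (Suc 0) (butlast xs)"
    have "butlast xs \<in> bar_gens A (Suc 0)" "last xs \<in> carrier A" "xs \<noteq> []"
      using xs last_in_set[of xs] by (cases "xs = []"; auto simp: bar_gens_def dest: in_set_butlastD)+
    then have y: "?y \<in> carrier (Bar (Suc 0))" and l: "last xs \<in> carrier A" by (auto intro: bt_closed)
    have cy: "contr (Suc 0) ?y \<in> carrier (Bar (Suc (Suc 0)))"
      "bd 0 ?y \<in> carrier (Bar 0)" "contr 0 (bd 0 ?y) \<in> carrier (Bar (Suc 0))"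
      using y by (auto intro!: add_hom_closed[OF contr_hom] add_hom_closed[OF bar_diff_add_hom])
    have z1: "bt 0 [\<zero>\<^bsub>A\<^esub>, \<one>\<^bsub>A\<^esub>] = \<zero>\<^bsub>Bar 0\<^esub>"
      by (rule add_hom_zero[OF bt_one_hom A.abelian_group_axioms bar_abelian_group])
    have "bd 0 (bd (Suc 0) (contr (Suc 0) ?y)) = bd 0 (contr 0 (bd 0 ?y)) \<oplus>\<^bsub>Bar 0\<^esub> bd 0 ?y"
      using y cy by (simp add: bar_diff_contr add_hom_add[OF bar_diff_add_hom] sg_def)
    also have "\<dots> = \<zero>\<^bsub>Bar 0\<^esub>"
      using y cy by (simp add: bar_diff_contr_0 bar_aug_bd z1 a_minus_def Bar.l_neg)
    finally have z: "bd 0 (bd (Suc 0) (contr (Suc 0) ?y)) = \<zero>\<^bsub>Bar 0\<^esub>" .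
    have cl2: "bd (Suc 0) (contr (Suc 0) ?y) \<in> carrier (Bar (Suc 0))"
      using cy(1) by (rule add_hom_closed[OF bar_diff_add_hom])
    show "bd 0 (bd (Suc 0) (bt (Suc (Suc 0)) xs)) = \<zero>\<^bsub>Bar 0\<^esub>"
      unfolding contr_generates[OF xs]
      using l cy(1) cl2 z add_hom_zero[OF bar_ract_hom[OF l] bar_abelian_group bar_abelian_group]
      by (simp add: bimod_hom_ract[OF bar_diff_hom])
  qed
qed

end

section \<open>The entwined bar complex\<close>

text \<open>The right action of T is kept abstract: lifting and exactness see T only as an
  A-bimodule whose left module is A \<otimes> C. The formula for the right action is dealt with
  separately, through the Galois map.\<close>

locale entw = bar_alg K A
  for K :: "'k ring" and A :: "('k, 'a) module" +
  fixes C :: "('k, 'c) coalg" and T :: "('k, 'a, 'a, ('a, 'c) tens) bimod"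
  assumes field_K: "field K" and module_C: "module K C" and bim_T: "bim K A A T"
    and T_carrier: "carrier T = carrier (algcoalg K A C)"
    and T_add: "add T = add (algcoalg K A C)"
    and T_zero: "zero T = zero (algcoalg K A C)"
    and T_smult: "smult T = smult (algcoalg K A C)"
    and T_lact: "lact T = lact (algcoalg K A C)"

lemma algcoalg_tens_bim:
  assumes "k_algebra K A" "module K C"
  shows "tens_bim K A (scalars K) (scalars K) (left_regular A) (k_bimod C)"
proof -
  have "cring K" using assms(2) by (simp add: module_def)
  then show ?thesis
    by (intro tens_bimI bim_left_regular bim_k_bimod k_algebra_scalars assms)
qed

context entw
begin

sublocale AC: tens_bim K A "scalars K" "scalars K" "left_regular A" "k_bimod C"
  rewrites "carrier (scalars K) = carrier K"
  by (rule algcoalg_tens_bim[OF alg module_C]) simp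

sublocale XT: tens_bim K A A A T "Bar n" for n
  by (intro tens_bimI bim_T bim_bar alg)

sublocale Cm: module K C by (rule module_C)

abbreviation "X n \<equiv> tensor (carrier A) T (Bar n)"
abbreviation "xt n \<equiv> ptens (carrier A) T (Bar n)"
abbreviation "ac \<equiv> algcoalg_ptens K A C"
abbreviation "Xd n \<equiv> tensor_map (carrier A) T (Bar n) id (bd n)"

lemma T_abelian_group: "abelian_group T"
  using bim_T by (rule bim_abelian_group)

lemma ac_closed: "a \<in> carrier A ==> c \<in> carrier C ==> ac a c \<in> carrier T"
  using AC.ptens_closed[of a c] by (simp add: T_carrier algcoalg_def)

lemma ac_lact: "b \<in> carrier A ==> a \<in> carrier A ==> c \<in> carrier C ==> lact T b (ac a c) = ac (b \<otimes>\<^bsub>A\<^esub> a) c"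
  using AC.lact_ptens[of b a c] by (simp add: T_lact algcoalg_def)

lemma ac_add: "a \<in> carrier A ==> c \<in> carrier C ==> c' \<in> carrier C ==> ac a (c \<oplus>\<^bsub>C\<^esub> c') = ac a c \<oplus>\<^bsub>T\<^esub> ac a c'"
  using AC.ptens_add_right[of a c c'] by (simp add: T_add algcoalg_def)

lemma ac_smult: "k \<in> carrier K ==> a \<in> carrier A ==> c \<in> carrier C ==> ac a (k \<odot>\<^bsub>C\<^esub> c) = k \<odot>\<^bsub>T\<^esub> ac a c"
  using AC.smult_ptens_right[of k a c] by (simp add: T_smult algcoalg_def)

lemma T_lift:
  assumes "abelian_group H" "balanced (carrier K) (left_regular A) (k_bimod C) H \<phi>"
  shows "lift_hom H (\<lambda>(a, c). \<phi> a c) \<in> add_hom T H"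
    and "\<And>a c. a \<in> carrier A ==> c \<in> carrier C ==> lift_hom H (\<lambda>(a, c). \<phi> a c) (ac a c) = \<phi> a c"
  using AC.lift[OF assms] by (auto simp: add_hom_def T_carrier T_add algcoalg_def)

lemma T_ext:
  assumes "f \<in> add_hom T H" "g \<in> add_hom T H" "abelian_group H"
    and "\<And>a c. a \<in> carrier A ==> c \<in> carrier C ==> f (ac a c) = g (ac a c)" "t \<in> carrier T"
  shows "f t = g t"
  using AC.tensor_ext[of f H g t] assms by (simp add: add_hom_def T_carrier T_add algcoalg_def)

lemma X_ext:
  assumes "f \<in> add_hom (X n) H" "g \<in> add_hom (X n) H" "abelian_group H"
    and "\<And>t xs. t \<in> carrier T ==> xs \<in> bar_gens A n ==> f (xt n t (bt n xs)) = g (xt n t (bt n xs))"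
    and "x \<in> carrier (X n)"
  shows "f x = g x"
proof (rule XT.tensor_ext[OF assms(1-3) _ assms(5)])
  fix t w assume t: "t \<in> carrier T" and w: "w \<in> carrier (Bar n)"
  show "f (xt n t w) = g (xt n t w)"
    by (rule bar_ext[OF _ _ assms(3) _ w])
       (use t assms(1,2,4) in \<open>auto intro: add_hom_compose[OF XT.ptens_right_hom]\<close>)
qed

subsection \<open>Lifting\<close>

context
  fixes n :: nat and Y :: "('k, 'a, 'a, 'y) bimod" and Z :: "('k, 'a, 'a, 'w) bimod" and f g \<sigma>
  assumes Y: "bim K A A Y" and Z: "bim K A A Z"
    and f: "f \<in> bimod_hom A (X n) Z" and g: "g \<in> bimod_hom A Y Z"
    and im: "\<And>x. x \<in> carrier (X n) ==> f x \<in> g ` carrier Y"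
    and \<sigma>_closed: "\<And>z. z \<in> g ` carrier Y ==> \<sigma> z \<in> carrier Y"
    and \<sigma>_section: "\<And>z. z \<in> g ` carrier Y ==> g (\<sigma> z) = z"
    and \<sigma>_add: "\<And>z w. z \<in> g ` carrier Y ==> w \<in> g ` carrier Y ==> \<sigma> (z \<oplus>\<^bsub>Z\<^esub> w) = \<sigma> z \<oplus>\<^bsub>Y\<^esub> \<sigma> w"
    and \<sigma>_smult: "\<And>c z. c \<in> carrier K ==> z \<in> g ` carrier Y ==> \<sigma> (c \<odot>\<^bsub>Z\<^esub> z) = c \<odot>\<^bsub>Y\<^esub> \<sigma> z"
begin

private lemmas lY = bim_left[OF Y] and rY = bim_right[OF Y]
private lemmas Yag = bim_abelian_group[OF Y]
private lemmas XTc = XT.bim_tensor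

interpretation Ym: module K Y by (rule bim_module[OF Y])

text \<open>The elements (1 \<otimes> c) \<otimes> [1, a1, ..., an, 1] span a copy of C \<otimes>
  A^n on which the bimodule is free. There \<open>f\<close> is lifted through the k-linear section
  \<sigma>; it is \<open>mid\<close> that later sets the outer entries of \<open>zs\<close> to
  1.\<close>

private definition core :: "'a list \<Rightarrow> 'c \<Rightarrow> 'y" where
  "core zs c = \<sigma> (f (xt n (ac \<one>\<^bsub>A\<^esub> c) (bt n zs)))"

private lemma core_arg: "zs \<in> bar_gens A n ==> c \<in> carrier C ==> xt n (ac \<one>\<^bsub>A\<^esub> c) (bt n zs) \<in> carrier (X n)"
  by (intro XT.ptens_closed ac_closed bt_closed) auto

private lemma core_closed: "zs \<in> bar_gens A n ==> c \<in> carrier C ==> core zs c \<in> carrier Y"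
  unfolding core_def by (intro \<sigma>_closed im core_arg)

private lemma core_add_c: "zs \<in> bar_gens A n ==> c \<in> carrier C ==> c' \<in> carrier C ==>
    core zs (c \<oplus>\<^bsub>C\<^esub> c') = core zs c \<oplus>\<^bsub>Y\<^esub> core zs c'"
  unfolding core_def
  by (simp add: ac_add XT.ptens_add_left ac_closed bt_closed bimod_hom_add[OF f] XT.ptens_closed \<sigma>_add im)

private lemma f_smult: "k \<in> carrier K ==> x \<in> carrier (X n) ==> f (k \<odot>\<^bsub>X n\<^esub> x) = k \<odot>\<^bsub>Z\<^esub> f x"
  by (rule bimod_hom_smult[OF f alg XTc Z])

private lemma core_smult_c: "zs \<in> bar_gens A n ==> c \<in> carrier C ==> k \<in> carrier K ==>
    core zs (k \<odot>\<^bsub>C\<^esub> c) = k \<odot>\<^bsub>Y\<^esub> core zs c"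
  unfolding core_def
  by (simp add: ac_smult XT.smult_ptens[symmetric] ac_closed bt_closed f_smult XT.ptens_closed \<sigma>_smult im)

private lemma core_add: "zs \<in> bar_gens A n ==> i < n + 2 ==> u \<in> carrier A ==> v \<in> carrier A ==> c \<in> carrier C ==>
    core (zs[i := u \<oplus>\<^bsub>A\<^esub> v]) c = core (zs[i := u]) c \<oplus>\<^bsub>Y\<^esub> core (zs[i := v]) c"
  unfolding core_def
  by (simp add: bt_add' bar_gens_update XT.ptens_add_right ac_closed bt_closed bimod_hom_add[OF f] XT.ptens_closed \<sigma>_add im)

private lemma core_smult: "zs \<in> bar_gens A n ==> i < n + 2 ==> c \<in> carrier C ==> k \<in> carrier K ==>
    core (zs[i := k \<odot>\<^bsub>A\<^esub> zs ! i]) c = k \<odot>\<^bsub>Y\<^esub> core zs c"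
  unfolding core_def
  by (simp add: bar_smult_bt_slot[symmetric] XT.smult_ptens_right[symmetric] ac_closed bt_closed f_smult
      XT.ptens_closed \<sigma>_smult im)

text \<open>The extension a \<otimes> c \<mapsto> a (core zs c) y. The last bar entry y is a
  separate argument, so that linearity in it is just linearity of the right action of Y.\<close>

private definition th :: "'a list \<Rightarrow> 'a \<Rightarrow> ('a, 'c) tens \<Rightarrow> 'y" where
  "th zs y = lift_hom Y (\<lambda>(a, c). ract Y (lact Y a (core zs c)) y)"

private lemma th_balanced: "zs \<in> bar_gens A n ==> y \<in> carrier A ==>
    balanced (carrier K) (left_regular A) (k_bimod C) Y (\<lambda>a c. ract Y (lact Y a (core zs c)) y)"
  by (rule balancedI)
     (auto simp: ract_closed[OF rY] lact_closed[OF lY] core_closed lact_add_left[OF lY] ract_add[OF rY]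
       core_add_c lact_add[OF lY] core_smult_c smult_lact[OF alg lY])

private lemma th_hom: "zs \<in> bar_gens A n ==> y \<in> carrier A ==> th zs y \<in> add_hom T Y"
  unfolding th_def by (rule T_lift(1)[OF Yag th_balanced])

private lemma th_ac: "zs \<in> bar_gens A n ==> y \<in> carrier A ==> a \<in> carrier A ==> c \<in> carrier C ==>
    th zs y (ac a c) = ract Y (lact Y a (core zs c)) y"
  unfolding th_def by (rule T_lift(2)[OF Yag th_balanced])

private lemma th_closed: "zs \<in> bar_gens A n ==> y \<in> carrier A ==> t \<in> carrier T ==> th zs y t \<in> carrier Y"
  by (rule add_hom_closed[OF th_hom])

private lemma th_add: "zs \<in> bar_gens A n ==> i < n + 2 ==> u \<in> carrier A ==> v \<in> carrier A ==> y \<in> carrier A ==>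
    t \<in> carrier T ==> th (zs[i := u \<oplus>\<^bsub>A\<^esub> v]) y t = th (zs[i := u]) y t \<oplus>\<^bsub>Y\<^esub> th (zs[i := v]) y t"
  by (rule T_ext[OF _ _ Yag])
     (auto intro!: add_hom_plus Yag th_hom bar_gens_update simp: th_ac bar_gens_update core_add lact_add[OF lY]
       ract_add[OF rY] core_closed lact_closed[OF lY])

private lemma th_smult: "zs \<in> bar_gens A n ==> i < n + 2 ==> k \<in> carrier K ==> y \<in> carrier A ==>
    t \<in> carrier T ==> th (zs[i := k \<odot>\<^bsub>A\<^esub> zs ! i]) y t = k \<odot>\<^bsub>Y\<^esub> th zs y t"
  by (rule T_ext[OF _ _ Yag])
     (auto intro!: add_hom_compose[OF th_hom, of _ _ "smult Y k"] add_homI th_hom bar_gens_update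
       simp: th_ac bar_gens_update bar_gens_nth core_smult Ym.smult_r_distr th_closed add_hom_add[OF th_hom] smult_lact[OF alg lY] smult_ract[OF alg rY]
       core_closed lact_closed[OF lY])

private lemma th_add_right: "zs \<in> bar_gens A n ==> y \<in> carrier A ==> y' \<in> carrier A ==>
    t \<in> carrier T ==> th zs (y \<oplus>\<^bsub>A\<^esub> y') t = th zs y t \<oplus>\<^bsub>Y\<^esub> th zs y' t"
  by (rule T_ext[OF _ _ Yag])
     (auto intro!: add_hom_plus Yag th_hom simp: th_ac ract_add_right[OF rY] core_closed lact_closed[OF lY])

private lemma th_smult_right: "zs \<in> bar_gens A n ==> y \<in> carrier A ==> k \<in> carrier K ==>
    t \<in> carrier T ==> th zs (k \<odot>\<^bsub>A\<^esub> y) t = k \<odot>\<^bsub>Y\<^esub> th zs y t"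
  by (rule T_ext[OF _ _ Yag])
     (auto intro!: add_hom_compose[OF th_hom, of _ _ "smult Y k"] add_homI th_hom
       simp: th_ac Ym.smult_r_distr th_closed add_hom_add[OF th_hom] smult_ract[OF alg rY] core_closed lact_closed[OF lY])

private lemma th_ract: "zs \<in> bar_gens A n ==> y \<in> carrier A ==> b \<in> carrier A ==>
    t \<in> carrier T ==> th zs (y \<otimes>\<^bsub>A\<^esub> b) t = ract Y (th zs y t) b"
  by (rule T_ext[OF _ _ Yag])
     (auto intro!: add_hom_compose[OF th_hom ract_add_hom[OF rY]] th_hom
       simp: th_ac ract_mult[OF rY] core_closed lact_closed[OF lY])

private lemma th_lact: "zs \<in> bar_gens A n ==> y \<in> carrier A ==> b \<in> carrier A ==>
    t \<in> carrier T ==> th zs y (lact T b t) = lact Y b (th zs y t)"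
  by (rule T_ext[OF _ _ Yag])
     (auto intro!: add_hom_compose[OF th_hom lact_add_hom[OF lY]] add_hom_compose[OF lact_add_hom[OF bim_left[OF bim_T]] th_hom]
       simp: th_ac lact_mult[OF lY] core_closed lact_closed[OF lY] ac_lact bim_comm[OF Y] ac_closed)

private lemma g_th: "zs \<in> bar_gens A n ==> y \<in> carrier A ==>
    t \<in> carrier T ==> g (th zs y t) = ract Z (f (xt n t (bt n zs))) y"
  by (rule T_ext[OF _ _ bim_abelian_group[OF Z]])
     (auto intro!: add_hom_compose[OF th_hom bimod_hom_add_hom[OF g]]
        add_hom_compose[OF add_hom_compose[OF XT.ptens_left_hom bimod_hom_add_hom[OF f]] ract_add_hom[OF bim_right[OF Z]]] bt_closed
       simp: th_ac bimod_hom_ract[OF g] bimod_hom_lact[OF g] core_closed lact_closed[OF lY] core_def \<sigma>_section im core_arg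
         \<sigma>_closed bimod_hom_lact[OF f, symmetric] XT.lact_ptens ac_closed bt_closed ac_lact)

private definition mid :: "'a list \<Rightarrow> 'a list" where
  "mid xs = xs[0 := \<one>\<^bsub>A\<^esub>, Suc n := \<one>\<^bsub>A\<^esub>]"

private lemma mid_closed: "xs \<in> bar_gens A n ==> mid xs \<in> bar_gens A n"
  unfolding mid_def by (intro bar_gens_update) auto

private lemma mid_update: "xs \<in> bar_gens A n ==> i < n + 2 ==>
    mid (xs[i := v]) = (if i = 0 \<or> i = Suc n then mid xs else (mid xs)[i := v])"
  unfolding mid_def by (intro nth_equalityI) (auto simp: nth_list_update bar_gens_length)

text \<open>This is the normal form t \<otimes> [x0, ..., y] = (t x0) \<otimes> [1, ..., 1] y: the
  first entry is first absorbed by the right action of T, and only then are the coordinates in A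
  \<otimes> C read off.\<close>

private definition ph :: "('a, 'c) tens \<Rightarrow> 'a list \<Rightarrow> 'y" where
  "ph t xs = th (mid xs) (xs ! Suc n) (ract T t (xs ! 0))"

private lemmas rT = bim_right[OF bim_T]

private lemma ph_closed: "t \<in> carrier T ==> xs \<in> bar_gens A n ==> ph t xs \<in> carrier Y"
  unfolding ph_def by (intro th_closed mid_closed ract_closed[OF rT] bar_gens_nth) auto

private lemma ph_smult:
  assumes t: "t \<in> carrier T" and xs: "xs \<in> bar_gens A n" and i: "i < n + 2" and k: "k \<in> carrier K"
  shows "ph t (xs[i := k \<odot>\<^bsub>A\<^esub> xs ! i]) = k \<odot>\<^bsub>Y\<^esub> ph t xs"
proof -
  have x: "\<And>j. j < n + 2 ==> xs ! j \<in> carrier A" using bar_gens_nth[OF xs] .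
  have len: "length xs = n + 2" using bar_gens_length[OF xs] .
  have rt: "ract T t (xs ! 0) \<in> carrier T" using t x[of 0] by (simp add: ract_closed[OF rT])
  have m: "mid xs ! i = xs ! i" if "i \<noteq> 0" "i \<noteq> Suc n" using that i len by (simp add: mid_def)
  consider "i = 0" | "i = Suc n" | "i \<noteq> 0" "i \<noteq> Suc n" by blast
  then show ?thesis
  proof cases
    case 1
    have "th (mid xs) (xs ! Suc n) (k \<odot>\<^bsub>T\<^esub> ract T t (xs ! 0)) = k \<odot>\<^bsub>Y\<^esub> th (mid xs) (xs ! Suc n) (ract T t (xs ! 0))"
      using th_lact[OF mid_closed[OF xs] x[of "Suc n"] k_algebra_scalar_closed[OF alg k] rt]
      by (simp add: lact_scalar[OF bim_left[OF bim_T] k] rt lact_scalar[OF lY k] th_closed[OF mid_closed[OF xs] x rt])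
    with 1 show ?thesis using xs len t x[of 0] k
      by (simp add: ph_def mid_update smult_ract(2)[OF alg rT])
  next
    case 2
    then show ?thesis using xs len x[of "Suc n"] k rt
      by (simp add: ph_def mid_update th_smult_right mid_closed)
  next
    case 3
    then show ?thesis using xs len x[of "Suc n"] k rt i th_smult[OF mid_closed[OF xs] i k x[of "Suc n"] rt] m
      by (simp add: ph_def mid_update)
  qed
qed

private lemma ph_multilinear:
  assumes t: "t \<in> carrier T"
  shows "multilinear K A n Y (ph t)"
  unfolding multilinear_def
proof (intro conjI ballI allI impI)
  fix xs i y assume xs: "xs \<in> bar_gens A n" and i: "i < n + 2" and y: "y \<in> carrier A"
  have x: "\<And>j. j < n + 2 ==> xs ! j \<in> carrier A" using bar_gens_nth[OF xs] .
  have len: "length xs = n + 2" using bar_gens_length[OF xs] .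
  have rt: "ract T t (xs ! 0) \<in> carrier T" "ract T t y \<in> carrier T" using t x[of 0] y by (simp_all add: ract_closed[OF rT])
  have m: "(mid xs)[i := xs ! i] = mid xs" if "i \<noteq> 0" "i \<noteq> Suc n"
    using that i len by (intro nth_equalityI) (auto simp: mid_def nth_list_update)
  consider "i = 0" | "i = Suc n" | "i \<noteq> 0" "i \<noteq> Suc n" by blast
  then show "ph t (xs[i := xs ! i \<oplus>\<^bsub>A\<^esub> y]) = ph t xs \<oplus>\<^bsub>Y\<^esub> ph t (xs[i := y])"
  proof cases
    case 1
    then show ?thesis using xs len t x[of 0] x[of "Suc n"] y rt
      by (simp add: ph_def mid_update ract_add_right[OF rT] add_hom_add[OF th_hom] mid_closed)
  next
    case 2
    then show ?thesis using xs len x[of "Suc n"] y rt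
      by (simp add: ph_def mid_update th_add_right mid_closed)
  next
    case 3
    then show ?thesis using xs len x[of "Suc n"] y rt i x[OF i] m
      by (simp add: ph_def mid_update th_add mid_closed)
  qed
qed (simp_all add: ph_closed t ph_smult)

private definition Hw :: "('a, 'c) tens \<Rightarrow> 'a chain \<Rightarrow> 'y" where
  "Hw t = lift_hom Y (ph t)"

private lemma Hw_hom: "t \<in> carrier T ==> Hw t \<in> add_hom (Bar n) Y"
  unfolding Hw_def by (rule bar_lift_hom[OF Yag ph_multilinear])

private lemma Hw_bt: "t \<in> carrier T ==> xs \<in> bar_gens A n ==> Hw t (bt n xs) = ph t xs"
  unfolding Hw_def by (rule bar_lift_bt[OF Yag ph_multilinear])

text \<open>The first bar entry enters only through the right action on t, so balancing over A is
  the associativity (t a) x0 = t (a x0).\<close>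

private lemma Hw_balanced: "balanced (carrier A) T (Bar n) Y Hw"
proof (rule balancedI)
  fix t t' w assume t: "t \<in> carrier T" "t' \<in> carrier T" and w: "w \<in> carrier (Bar n)"
  interpret Tg: abelian_group T by (rule T_abelian_group)
  show "Hw (t \<oplus>\<^bsub>T\<^esub> t') w = Hw t w \<oplus>\<^bsub>Y\<^esub> Hw t' w"
  proof (rule bar_ext[OF _ _ Yag _ w])
    fix xs assume xs: "xs \<in> bar_gens A n"
    show "Hw (t \<oplus>\<^bsub>T\<^esub> t') (bt n xs) = Hw t (bt n xs) \<oplus>\<^bsub>Y\<^esub> Hw t' (bt n xs)"
      using t xs by (simp add: Hw_bt ph_def ract_add[OF rT] bar_gens_nth add_hom_add[OF th_hom] mid_closed ract_closed[OF rT])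
  qed (use t in \<open>auto intro!: add_hom_plus Yag Hw_hom\<close>)
next
  fix t a w assume t: "t \<in> carrier T" "a \<in> carrier A" and w: "w \<in> carrier (Bar n)"
  show "Hw (ract T t a) w = Hw t (lact (Bar n) a w)"
  proof (rule bar_ext[OF _ _ Yag _ w])
    fix xs assume xs: "xs \<in> bar_gens A n"
    have x: "xs ! 0 \<in> carrier A" using bar_gens_nth[OF xs] by simp
    have "xs[0 := a \<otimes>\<^bsub>A\<^esub> xs ! 0] \<in> bar_gens A n" using xs x t by (intro bar_gens_update) auto
    then show "Hw (ract T t a) (bt n xs) = Hw t (lact (Bar n) a (bt n xs))"
      using t xs x by (simp add: bar_lact_bt Hw_bt ract_closed[OF rT] ph_def mid_update ract_mult[OF rT] bar_gens_length[OF xs])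
  qed (use t in \<open>auto intro!: Hw_hom ract_closed[OF rT] add_hom_compose[OF bar_lact_hom Hw_hom]\<close>)
qed (use add_hom_closed[OF Hw_hom] add_hom_add[OF Hw_hom] in auto)

private definition hh :: "(('a, 'c) tens, 'a chain) tens \<Rightarrow> 'y" where
  "hh = lift_hom Y (\<lambda>(t, w). Hw t w)"

private lemma hh_hom: "hh \<in> add_hom (X n) Y"
  unfolding hh_def by (rule XT.lift_add_hom[OF Yag Hw_balanced])

private lemma hh_xt: "t \<in> carrier T ==> xs \<in> bar_gens A n ==> hh (xt n t (bt n xs)) = ph t xs"
  unfolding hh_def by (simp add: XT.lift_ptens[OF Yag Hw_balanced] bt_closed Hw_bt)

lemma X_lift_exists: "\<exists>h\<in>bimod_hom A (X n) Y. \<forall>x\<in>carrier (X n). g (h x) = f x"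
proof (intro bexI[of _ hh] ballI)
  fix x assume x: "x \<in> carrier (X n)"
  show "g (hh x) = f x"
  proof (rule X_ext[OF add_hom_compose[OF hh_hom bimod_hom_add_hom[OF g]] bimod_hom_add_hom[OF f] bim_abelian_group[OF Z] _ x])
    fix t xs assume t: "t \<in> carrier T" and xs: "xs \<in> bar_gens A n"
    have x0: "xs ! 0 \<in> carrier A" "xs ! Suc n \<in> carrier A" using bar_gens_nth[OF xs] by auto
    have len: "length xs = n + 2" using bar_gens_length[OF xs] .
    have m: "bt n (mid xs) \<in> carrier (Bar n)" "mid xs \<in> bar_gens A n" using xs by (auto intro: bt_closed mid_closed)
    have rm: "lact (Bar n) (xs ! 0) (bt n (mid xs)) = bt n (xs[Suc n := \<one>\<^bsub>A\<^esub>])"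
      "ract (Bar n) (bt n (xs[Suc n := \<one>\<^bsub>A\<^esub>])) (xs ! Suc n) = bt n xs"
      "xs[Suc n := \<one>\<^bsub>A\<^esub>] \<in> bar_gens A n"
      using x0 m len bar_gens_update[OF xs] by (simp_all add: bar_lact_bt bar_ract_bt mid_def list_update_swap)
    have "g (hh (xt n t (bt n xs))) = ract Z (f (xt n (ract T t (xs ! 0)) (bt n (mid xs)))) (xs ! Suc n)"
      using t xs x0 m by (simp add: hh_xt ph_def g_th ract_closed[OF rT])
    \<comment> \<open>Balancing moves the first entry back into the bar factor, and right linearity
      of f restores the last one.\<close>
    also have "\<dots> = f (xt n t (bt n xs))"
      using t xs x0 m rm by (simp add: bimod_hom_ract[OF f, symmetric] XT.ptens_closed XT.ptens_swap XT.ract_ptens ract_closed[OF rT] bt_closed)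
    finally show "g (hh (xt n t (bt n xs))) = f (xt n t (bt n xs))" .
  qed
next
  show "hh \<in> bimod_hom A (X n) Y"
  proof (rule bimod_homI[OF hh_hom])
    fix b x assume b: "b \<in> carrier A" and x: "x \<in> carrier (X n)"
    show "hh (lact (X n) b x) = lact Y b (hh x)"
    proof (rule X_ext[OF add_hom_compose[OF XT.lact_hom[OF b] hh_hom] add_hom_compose[OF hh_hom lact_add_hom[OF lY b]] Yag _ x])
      fix t xs assume t: "t \<in> carrier T" and xs: "xs \<in> bar_gens A n"
      then show "hh (lact (X n) b (xt n t (bt n xs))) = lact Y b (hh (xt n t (bt n xs)))"
        using b by (simp add: XT.lact_ptens bt_closed hh_xt lact_closed[OF bim_left[OF bim_T]] ph_def
            bim_comm[OF bim_T] bar_gens_nth th_lact mid_closed ract_closed[OF rT])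
    qed
    show "hh (ract (X n) x b) = ract Y (hh x) b"
    proof (rule X_ext[OF add_hom_compose[OF XT.ract_hom[OF b] hh_hom] add_hom_compose[OF hh_hom ract_add_hom[OF rY b]] Yag _ x])
      fix t xs assume t: "t \<in> carrier T" and xs: "xs \<in> bar_gens A n"
      have "xs[Suc n := xs ! Suc n \<otimes>\<^bsub>A\<^esub> b] \<in> bar_gens A n"
        using xs b bar_gens_nth[OF xs, of "Suc n"] by (intro bar_gens_update) auto
      then show "hh (ract (X n) (xt n t (bt n xs)) b) = ract Y (hh (xt n t (bt n xs))) b"
        using b t xs by (simp add: XT.ract_ptens bt_closed bar_ract_bt hh_xt ph_def
            bar_gens_nth th_ract mid_closed ract_closed[OF rT] mid_update bar_gens_length[OF xs])
    qed
  qed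
qed

end

lemma X_bilift:
  assumes Y: "bim K A A Y" and Z: "bim K A A Z"
  shows "bilift A (X n) Y Z"
  unfolding bilift_def
proof (intro ballI impI)
  fix f g assume f: "f \<in> bimod_hom A (X n) Z" and g: "g \<in> bimod_hom A Y Z" and im: "f ` carrier (X n) \<subseteq> g ` carrier Y"
  have gl: "g \<in> k_linear K Y Z"
    using left_hom_linear[OF _ bim_left[OF Y] bim_left[OF Z] alg] g by (simp add: bimod_hom_def)
  obtain \<sigma> where "\<And>z. z \<in> g ` carrier Y ==> \<sigma> z \<in> carrier Y"
    "\<And>z. z \<in> g ` carrier Y ==> g (\<sigma> z) = z"
    "\<And>z w. z \<in> g ` carrier Y ==> w \<in> g ` carrier Y ==> \<sigma> (z \<oplus>\<^bsub>Z\<^esub> w) = \<sigma> z \<oplus>\<^bsub>Y\<^esub> \<sigma> w"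
    "\<And>c z. c \<in> carrier K ==> z \<in> g ` carrier Y ==> \<sigma> (c \<odot>\<^bsub>Z\<^esub> z) = c \<odot>\<^bsub>Y\<^esub> \<sigma> z"
    using linear_section[OF field_K bim_module[OF Y] bim_module[OF Z] gl] by blast
  then show "\<exists>h\<in>bimod_hom A (X n) Y. \<forall>x\<in>carrier (X n). g (h x) = f x"
    using im by (intro X_lift_exists[OF Y Z f g, of \<sigma>]) auto
qed

subsection \<open>Exactness\<close>

lemma Xd_map: "tens_map (carrier A) T (Bar (Suc n)) T (Bar n) id (bd n)"
  by unfold_locales (auto simp: add_hom_def bimod_hom_lact[OF bar_diff_hom] bimod_homD[OF bar_diff_hom])

lemma Xd_hom: "Xd n \<in> add_hom (X (Suc n)) (X n)"
  by (rule tens_map.map_hom[OF Xd_map])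

lemma Xd_xt: "t \<in> carrier T ==> w \<in> carrier (Bar (Suc n)) ==> Xd n (xt (Suc n) t w) = xt n t (bd n w)"
  using tens_map.map_ptens[OF Xd_map] by simp

lemma Xd_bimod_hom: "Xd n \<in> bimod_hom A (X (Suc n)) (X n)"
proof (rule bimod_homI[OF Xd_hom])
  note bdc = bimod_hom_closed[OF bar_diff_hom]
  fix b x assume b: "b \<in> carrier A" and x: "x \<in> carrier (X (Suc n))"
  show "Xd n (lact (X (Suc n)) b x) = lact (X n) b (Xd n x)"
    by (rule XT.tensor_ext[OF add_hom_compose[OF XT.lact_hom[OF b] Xd_hom] add_hom_compose[OF Xd_hom XT.lact_hom[OF b]]
          XT.P.abelian_group _ x])
       (use b in \<open>simp add: XT.lact_ptens Xd_xt bdc lact_closed[OF bim_left[OF bim_T]]\<close>)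
  show "Xd n (ract (X (Suc n)) x b) = ract (X n) (Xd n x) b"
    by (rule XT.tensor_ext[OF add_hom_compose[OF XT.ract_hom[OF b] Xd_hom] add_hom_compose[OF Xd_hom XT.ract_hom[OF b]]
          XT.P.abelian_group _ x])
       (use b in \<open>simp add: XT.ract_ptens Xd_xt bdc ract_closed[OF bim_right[OF bim_bar]] bimod_hom_ract[OF bar_diff_hom]\<close>)
qed

lemma X_bicomplex: "bicomplex K A X Xd"
  unfolding bicomplex_def
proof (intro conjI allI ballI XT.bim_tensor Xd_bimod_hom)
  fix n x assume x: "x \<in> carrier (X (Suc (Suc n)))"
  note bdc = bimod_hom_closed[OF bar_diff_hom]
  show "Xd n (Xd (Suc n) x) = \<zero>\<^bsub>X n\<^esub>"
    by (rule XT.tensor_ext[OF add_hom_compose[OF Xd_hom Xd_hom] add_hom_null[OF XT.P.abelian_group]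
          XT.P.abelian_group _ x])
       (simp add: Xd_xt bdc bd_bd XT.ptens_zero)
qed

abbreviation "Xs n \<equiv> tensor_map (carrier A) T (Bar (Suc n)) id (contr n)"

lemma Xs_map: "tens_map (carrier A) T (Bar n) T (Bar (Suc n)) id (contr n)"
  by unfold_locales (auto simp: add_hom_def contr_lact add_hom_closed[OF contr_hom] add_hom_add[OF contr_hom])

lemma Xs_hom: "Xs n \<in> add_hom (X n) (X (Suc n))"
  by (rule tens_map.map_hom[OF Xs_map])

lemma Xs_xt: "t \<in> carrier T ==> w \<in> carrier (Bar n) ==> Xs n (xt n t w) = xt (Suc n) t (contr n w)"
  using tens_map.map_ptens[OF Xs_map] by simp

lemma Xd_Xs:
  assumes "x \<in> carrier (X (Suc n))"
  shows "Xd (Suc n) (Xs (Suc n) x) =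
    Xs n (Xd n x) \<oplus>\<^bsub>X (Suc n)\<^esub> (if even n then x else \<ominus>\<^bsub>X (Suc n)\<^esub> x)"
proof -
  have sh: "(\<lambda>x. if even n then x else \<ominus>\<^bsub>X (Suc n)\<^esub> x) \<in> add_hom (X (Suc n)) (X (Suc n))"
    using XT.P.minus_add[of _ "Suc n"] XT.P.a_comm[of _ "Suc n"] by (auto simp: add_hom_def)
  show ?thesis
  proof (rule XT.tensor_ext[OF add_hom_compose[OF Xs_hom Xd_hom] add_hom_plus[OF add_hom_compose[OF Xd_hom Xs_hom] sh]
          XT.P.abelian_group _ assms])
    fix t w assume t: "t \<in> carrier T" and w: "w \<in> carrier (Bar (Suc n))"
    have cl: "contr (Suc n) w \<in> carrier (Bar (Suc (Suc n)))" "bd n w \<in> carrier (Bar n)"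
      "contr n (bd n w) \<in> carrier (Bar (Suc n))" "sg (Suc (Suc n)) (Suc n) w \<in> carrier (Bar (Suc n))"
      using w by (auto intro!: add_hom_closed[OF contr_hom] bimod_hom_closed[OF bar_diff_hom] add_hom_closed[OF sg_hom])
    \<comment> \<open>The sign of the bar contraction has exponent n + 2, of the same parity as
      n.\<close>
    have "xt (Suc n) t (sg (Suc (Suc n)) (Suc n) w) = (if even n then xt (Suc n) t w else \<ominus>\<^bsub>X (Suc n)\<^esub> xt (Suc n) t w)"
      using t w by (simp add: sg_def add_hom_neg[OF XT.ptens_right_hom bar_abelian_group XT.P.abelian_group])
    then show "Xd (Suc n) (Xs (Suc n) (xt (Suc n) t w)) = Xs n (Xd n (xt (Suc n) t w)) \<oplus>\<^bsub>X (Suc n)\<^esub>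
        (if even n then xt (Suc n) t w else \<ominus>\<^bsub>X (Suc n)\<^esub> xt (Suc n) t w)"
      using t w cl by (simp only: Xs_xt Xd_xt bar_diff_contr XT.ptens_add_right)
  qed (rule XT.P.abelian_group)
qed

lemma X_exact_pos: "exact_pos X Xd"
  unfolding exact_pos_def
proof (intro allI ballI impI)
  fix n x assume x: "x \<in> carrier (X (Suc n))" and z: "Xd n x = \<zero>\<^bsub>X n\<^esub>"
  have c: "Xs (Suc n) x \<in> carrier (X (Suc (Suc n)))" using Xs_hom x by (rule add_hom_closed)
  have *: "Xd (Suc n) (Xs (Suc n) x) = (if even n then x else \<ominus>\<^bsub>X (Suc n)\<^esub> x)"
    using x unfolding Xd_Xs[OF x] z add_hom_zero[OF Xs_hom XT.P.abelian_group XT.P.abelian_group] by simp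
  show "x \<in> Xd (Suc n) ` carrier (X (Suc (Suc n)))"
  proof (cases "even n")
    case True
    then show ?thesis using * c by force
  next
    case False
    then have "Xd (Suc n) (\<ominus>\<^bsub>X (Suc (Suc n))\<^esub> Xs (Suc n) x) = x"
      using * x add_hom_neg[OF Xd_hom XT.P.abelian_group XT.P.abelian_group c] by simp
    then show ?thesis using c by (metis XT.P.a_inv_closed image_eqI)
  qed
qed

section \<open>The augmentation of the entwined bar complex onto T\<close>

definition X_aug :: "(('a, 'c) tens, 'a chain) tens \<Rightarrow> ('a, 'c) tens" where
  "X_aug = lift_hom T (\<lambda>(t, w). ract T t (bar_aug w))"

lemma X_aug_balanced: "balanced (carrier A) T (Bar 0) T (\<lambda>t w. ract T t (bar_aug w))"
  using bimod_homD[OF bar_aug_bimod_hom]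
  by (intro balancedI) (auto simp: ract_closed[OF bim_right[OF bim_T]] ract_add[OF bim_right[OF bim_T]]
      ract_add_right[OF bim_right[OF bim_T]] ract_mult[OF bim_right[OF bim_T]])

lemma X_aug_hom: "X_aug \<in> add_hom (X 0) T"
  unfolding X_aug_def by (rule XT.lift_add_hom[OF T_abelian_group X_aug_balanced])

lemma X_aug_xt: "t \<in> carrier T ==> w \<in> carrier (Bar 0) ==> X_aug (xt 0 t w) = ract T t (bar_aug w)"
  unfolding X_aug_def by (rule XT.lift_ptens[OF T_abelian_group X_aug_balanced])

lemma X_aug_bimod_hom: "X_aug \<in> bimod_hom A (X 0) T"
proof (rule bimod_homI[OF X_aug_hom])
  note ba = bimod_homD[OF bar_aug_bimod_hom]
  fix b x assume b: "b \<in> carrier A" and x: "x \<in> carrier (X 0)"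
  show "X_aug (lact (X 0) b x) = lact T b (X_aug x)"
    by (rule XT.tensor_ext[OF add_hom_compose[OF XT.lact_hom[OF b] X_aug_hom]
          add_hom_compose[OF X_aug_hom lact_add_hom[OF bim_left[OF bim_T] b]] T_abelian_group _ x])
       (use b ba in \<open>simp add: XT.lact_ptens X_aug_xt lact_closed[OF bim_left[OF bim_T]] bim_comm[OF bim_T]\<close>)
  show "X_aug (ract (X 0) x b) = ract T (X_aug x) b"
    by (rule XT.tensor_ext[OF add_hom_compose[OF XT.ract_hom[OF b] X_aug_hom]
          add_hom_compose[OF X_aug_hom ract_add_hom[OF bim_right[OF bim_T] b]] T_abelian_group _ x])
       (use b ba in \<open>simp add: XT.ract_ptens X_aug_xt ract_closed[OF bim_right[OF bim_bar]] ract_mult[OF bim_right[OF bim_T]]\<close>)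
qed

lemma ract_T_zero: "t \<in> carrier T ==> ract T t \<zero>\<^bsub>A\<^esub> = \<zero>\<^bsub>T\<^esub>"
  by (rule add_hom_zero[where f = "ract T t", OF _ A.abelian_group_axioms T_abelian_group])
     (auto intro!: add_homI simp: ract_closed[OF bim_right[OF bim_T]] ract_add_right[OF bim_right[OF bim_T]])

lemma X_aug_Xd:
  assumes "x \<in> carrier (X (Suc 0))"
  shows "X_aug (Xd 0 x) = \<zero>\<^bsub>T\<^esub>"
  by (rule XT.tensor_ext[OF add_hom_compose[OF Xd_hom X_aug_hom] add_hom_null[OF T_abelian_group] T_abelian_group _ assms])
     (simp add: Xd_xt X_aug_xt bimod_hom_closed[OF bar_diff_hom] bar_aug_bd ract_T_zero)

text \<open>A section of \<open>X_aug\<close> that is not right A-linear in general. Additivity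
  suffices for exactness in degree 0, and on cocycles the missing linearity comes back because they
  depend on the augmentation only.\<close>

definition X_unit :: "('a, 'c) tens \<Rightarrow> (('a, 'c) tens, 'a chain) tens" where
  "X_unit t = xt 0 t (bt 0 [\<one>\<^bsub>A\<^esub>, \<one>\<^bsub>A\<^esub>])"

lemma bt_11: "bt 0 [\<one>\<^bsub>A\<^esub>, \<one>\<^bsub>A\<^esub>] \<in> carrier (Bar 0)" "[\<one>\<^bsub>A\<^esub>, \<one>\<^bsub>A\<^esub>] \<in> bar_gens A 0"
  by (auto intro!: bt_closed simp: bar_gens_def)

lemma X_unit_hom: "X_unit \<in> add_hom T (X 0)"
  unfolding X_unit_def[abs_def] by (rule XT.ptens_left_hom[OF bt_11(1)])

lemma X_aug_unit: "t \<in> carrier T ==> X_aug (X_unit t) = t"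
  by (simp add: X_unit_def X_aug_xt bt_11 bar_aug_bt ract_one[OF bim_right[OF bim_T]])

lemma Xd_Xs_0:
  assumes "x \<in> carrier (X 0)"
  shows "Xd 0 (Xs 0 x) = X_unit (X_aug x) \<ominus>\<^bsub>X 0\<^esub> x"
proof (rule XT.tensor_ext[OF add_hom_compose[OF Xs_hom Xd_hom]
        add_hom_sub[OF add_hom_compose[OF X_aug_hom X_unit_hom] add_hom_id] XT.P.abelian_group _ assms])
  fix t w assume t: "t \<in> carrier T" and w: "w \<in> carrier (Bar 0)"
  have b: "bar_aug w \<in> carrier A" using add_hom_closed[OF bar_aug_hom w] .
  have g: "[bar_aug w, \<one>\<^bsub>A\<^esub>] \<in> bar_gens A 0" using b by (auto simp: bar_gens_def)
  have "bt 0 [bar_aug w, \<one>\<^bsub>A\<^esub>] = lact (Bar 0) (bar_aug w) (bt 0 [\<one>\<^bsub>A\<^esub>, \<one>\<^bsub>A\<^esub>])"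
    using b bt_11 by (simp add: bar_lact_bt)
  then have u: "xt 0 t (bt 0 [bar_aug w, \<one>\<^bsub>A\<^esub>]) = X_unit (X_aug (xt 0 t w))"
    using t w b bt_11 by (simp add: X_unit_def X_aug_xt XT.ptens_swap)
  have "Xd 0 (Xs 0 (xt 0 t w)) = xt 0 t (bt 0 [bar_aug w, \<one>\<^bsub>A\<^esub>] \<ominus>\<^bsub>Bar 0\<^esub> w)"
    using t w by (simp add: Xs_xt Xd_xt add_hom_closed[OF contr_hom] bar_diff_contr_0)
  also have "\<dots> = X_unit (X_aug (xt 0 t w)) \<ominus>\<^bsub>X 0\<^esub> xt 0 t w"
    using t w bt_closed[OF g] by (simp add: add_hom_minus[OF XT.ptens_right_hom bar_abelian_group XT.P.abelian_group] u)
  finally show "Xd 0 (Xs 0 (xt 0 t w)) = X_unit (X_aug (xt 0 t w)) \<ominus>\<^bsub>X 0\<^esub> xt 0 t w" .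
qed (rule XT.P.abelian_group)

lemma X_exact_0:
  assumes "x \<in> carrier (X 0)" "X_aug x = \<zero>\<^bsub>T\<^esub>"
  shows "x \<in> Xd 0 ` carrier (X (Suc 0))"
proof -
  have c: "Xs 0 x \<in> carrier (X (Suc 0))" using Xs_hom assms(1) by (rule add_hom_closed)
  have "Xd 0 (Xs 0 x) = \<ominus>\<^bsub>X 0\<^esub> x"
    using assms Xd_Xs_0[OF assms(1)] add_hom_zero[OF X_unit_hom T_abelian_group XT.P.abelian_group]
    by (simp add: a_minus_def)
  then have "Xd 0 (\<ominus>\<^bsub>X (Suc 0)\<^esub> Xs 0 x) = x"
    using assms add_hom_neg[OF Xd_hom XT.P.abelian_group XT.P.abelian_group c] by simp
  then show ?thesis using c by (metis XT.P.a_inv_closed image_eqI)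
qed

end

section \<open>Projective bimodules\<close>

text \<open>The one-sided analogue of \<open>bilift\<close>; it is what turns a bimodule resolution
  of B into a complex that is contractible as a complex of left modules.\<close>

definition leftlift ::
  "('k, 'a, 'y) module_scheme \<Rightarrow> ('k, 'a, 'b, 'p) bimod \<Rightarrow> ('k, 'a, 'b, 'm) bimod \<Rightarrow>
   ('k, 'a, 'b, 'n) bimod \<Rightarrow> bool"
where
  "leftlift R P Y Z \<longleftrightarrow> (\<forall>f\<in>left_hom R P Z. \<forall>g\<in>left_hom R Y Z.
     f ` carrier P \<subseteq> g ` carrier Y \<longrightarrow> (\<exists>h\<in>left_hom R P Y. \<forall>x\<in>carrier P. g (h x) = f x))"

definition rightlift ::
  "('k, 'b, 'y) module_scheme \<Rightarrow> ('k, 'a, 'b, 'p) bimod \<Rightarrow> ('k, 'a, 'b, 'm) bimod \<Rightarrow>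
   ('k, 'a, 'b, 'n) bimod \<Rightarrow> bool"
where
  "rightlift R P Y Z \<longleftrightarrow> (\<forall>f\<in>right_hom R P Z. \<forall>g\<in>right_hom R Y Z.
     f ` carrier P \<subseteq> g ` carrier Y \<longrightarrow> (\<exists>h\<in>right_hom R P Y. \<forall>x\<in>carrier P. g (h x) = f x))"

lemma leftlift_obtain:
  assumes "leftlift R P Y Z" "f \<in> left_hom R P Z" "g \<in> left_hom R Y Z"
    and "\<And>x. x \<in> carrier P ==> f x \<in> g ` carrier Y"
  obtains h where "h \<in> left_hom R P Y" "\<And>x. x \<in> carrier P ==> g (h x) = f x"
  using assms(1)[unfolded leftlift_def, rule_format, OF assms(2,3)] assms(4) by blast

lemma rightlift_obtain:
  assumes "rightlift R P Y Z" "f \<in> right_hom R P Z" "g \<in> right_hom R Y Z"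
    and "\<And>x. x \<in> carrier P ==> f x \<in> g ` carrier Y"
  obtains h where "h \<in> right_hom R P Y" "\<And>x. x \<in> carrier P ==> g (h x) = f x"
  using assms(1)[unfolded rightlift_def, rule_format, OF assms(2,3)] assms(4) by blast

lemma left_homI:
  assumes "f \<in> add_hom M N" "\<And>r x. r \<in> carrier R ==> x \<in> carrier M ==> f (lact M r x) = lact N r (f x)"
  shows "f \<in> left_hom R M N"
  using assms by (auto simp: left_hom_def add_hom_def)

lemma right_homI:
  assumes "f \<in> add_hom M N" "\<And>r x. r \<in> carrier R ==> x \<in> carrier M ==> f (ract M x r) = ract N (f x) r"
  shows "f \<in> right_hom R M N"
  using assms by (auto simp: right_hom_def add_hom_def)

lemma left_homD:
  assumes "f \<in> left_hom R M N"
  shows "f \<in> add_hom M N" "\<And>r x. r \<in> carrier R ==> x \<in> carrier M ==> f (lact M r x) = lact N r (f x)"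
  using assms by (auto simp: left_hom_def add_hom_def)

lemma right_homD:
  assumes "f \<in> right_hom R M N"
  shows "f \<in> add_hom M N" "\<And>r x. r \<in> carrier R ==> x \<in> carrier M ==> f (ract M x r) = ract N (f x) r"
  using assms by (auto simp: right_hom_def add_hom_def)

locale free_bim =
  fixes K :: "'k ring" and B :: "('k, 'a) module" and F :: "('k, 'a, 'a, 'f) bimod" and X :: "'f set"
  assumes algB: "k_algebra K B" and free: "free_bimodule_on K B F X"
begin

sublocale V: module K B using algB by (rule k_algebra_module)
sublocale B: ring B using algB by (rule k_algebra_ring)

sublocale E: tens_bim K "scalars K" "scalars K" "scalars K" "k_bimod B" "k_bimod B"
  rewrites "carrier (scalars K) = carrier K"
  using V.R.cring_axioms by (intro tens_bimI bim_k_bimod k_algebra_scalars V.module_axioms) auto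

abbreviation "E \<equiv> tensor (carrier K) (k_bimod B) (k_bimod B)"
abbreviation "et \<equiv> ptens (carrier K) (k_bimod B) (k_bimod B)"

lemma bim_F: "bim K B B F" and X_F: "X \<subseteq> carrier F"
  using free by (auto simp: free_bimodule_on_def bimodule_bim Let_def)

lemmas lF = bim_left[OF bim_F] and rF = bim_right[OF bim_F] and agF = bim_abelian_group[OF bim_F]

sublocale Fg: abelian_group F by (rule agF)

abbreviation "supp t \<equiv> {x \<in> X. t x \<noteq> \<zero>\<^bsub>E\<^esub>}"

definition coords :: "'f \<Rightarrow> ('f \<Rightarrow> ('a, 'a) tens) \<Rightarrow> bool" where
  "coords m t \<longleftrightarrow> t \<in> X \<rightarrow>\<^sub>E carrier E \<and> finite (supp t) \<and>
     m = finsum F (\<lambda>x. env_act F (t x) x) (supp t)"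

lemma coords_unique: "m \<in> carrier F ==> \<exists>!t. coords m t"
  using free unfolding free_bimodule_on_def coords_def Let_def by blast

definition co :: "'f \<Rightarrow> 'f \<Rightarrow> ('a, 'a) tens" where
  "co m = (THE t. coords m t)"

lemma co: "m \<in> carrier F ==> coords m (co m)"
  unfolding co_def by (rule theI'[OF coords_unique])

lemma co_eq: "m \<in> carrier F ==> coords m t ==> co m = t"
  using coords_unique co by blast

lemma env_act_balanced:
  "x \<in> carrier F ==> balanced (carrier K) (k_bimod B) (k_bimod B) F (\<lambda>b b'. ract F (lact F b x) b')"
  by (rule balancedI)
     (auto simp: lact_closed[OF lF] ract_closed[OF rF] lact_add_left[OF lF] ract_add[OF rF] ract_add_right[OF rF]
       smult_lact[OF algB lF] smult_ract[OF algB rF])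

lemma env_act_hom: "x \<in> carrier F ==> (\<lambda>t. env_act F t x) \<in> add_hom E F"
  unfolding env_act_def by (rule E.lift_add_hom[OF agF env_act_balanced])

lemma env_act_et: "x \<in> carrier F ==> b \<in> carrier B ==> b' \<in> carrier B ==>
    env_act F (et b b') x = ract F (lact F b x) b'"
  unfolding env_act_def using E.lift_ptens[OF agF env_act_balanced, of x b b'] by simp

text \<open>Two coordinate functions and their sum have different supports, so they have to be
  summed over a common finite set before they can be compared.\<close>

lemma finsum_supp:
  assumes H: "abelian_group H" and u: "\<And>x. x \<in> X ==> u x \<in> add_hom E H" and t: "t \<in> X \<rightarrow> carrier E"
    and I: "finite I" "supp t \<subseteq> I" "I \<subseteq> X"
  shows "finsum H (\<lambda>x. u x (t x)) (supp t) = finsum H (\<lambda>x. u x (t x)) I"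
proof -
  interpret H: abelian_group H by fact
  have z: "u x \<zero>\<^bsub>E\<^esub> = \<zero>\<^bsub>H\<^esub>" if "x \<in> X" for x
    by (rule add_hom_zero[OF u[OF that] E.P.abelian_group H])
  show ?thesis
    by (rule H.add.finprod_mono_neutral_cong_left)
       (use I t z u in \<open>auto simp: subset_iff Pi_iff intro!: add_hom_closed[OF u]\<close>)
qed

lemma finsum_add:
  assumes H: "abelian_group H" and u: "\<And>x. x \<in> X ==> u x \<in> add_hom E H"
    and t: "t \<in> X \<rightarrow> carrier E" "finite (supp t)" and t': "t' \<in> X \<rightarrow> carrier E" "finite (supp t')"
    and s: "\<And>x. x \<in> X ==> s x = t x \<oplus>\<^bsub>E\<^esub> t' x"
  shows "finsum H (\<lambda>x. u x (s x)) (supp s) =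
    finsum H (\<lambda>x. u x (t x)) (supp t) \<oplus>\<^bsub>H\<^esub> finsum H (\<lambda>x. u x (t' x)) (supp t')"
proof -
  interpret H: abelian_group H by fact
  let ?I = "supp t \<union> supp t'"
  have I: "finite ?I" "?I \<subseteq> X" using t t' by auto
  have ss: "supp s \<subseteq> ?I" using s t t' by (auto simp: Pi_iff)
  have sE: "s \<in> X \<rightarrow> carrier E" using s t t' by (auto simp: Pi_iff)
  have cl: "u x (t x) \<in> carrier H" "u x (t' x) \<in> carrier H" if "x \<in> X" for x
    using that t t' by (auto intro!: add_hom_closed[OF u])
  have "finsum H (\<lambda>x. u x (s x)) (supp s) = finsum H (\<lambda>x. u x (s x)) ?I"
    by (rule finsum_supp[OF H u sE I(1) ss I(2)])
  also have "\<dots> = finsum H (\<lambda>x. u x (t x) \<oplus>\<^bsub>H\<^esub> u x (t' x)) ?I"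
    by (rule H.finsum_cong') (use I s t t' u cl in \<open>auto simp: Pi_iff add_hom_add[OF u]\<close>)
  also have "\<dots> = finsum H (\<lambda>x. u x (t x)) ?I \<oplus>\<^bsub>H\<^esub> finsum H (\<lambda>x. u x (t' x)) ?I"
    by (rule H.finsum_addf) (use cl I in auto)
  finally show ?thesis
    using finsum_supp[OF H u t(1) I(1) _ I(2)] finsum_supp[OF H u t'(1) I(1) _ I(2)] by auto
qed

lemma coD:
  assumes "m \<in> carrier F"
  shows "co m \<in> X \<rightarrow> carrier E" "finite (supp (co m))" "m = finsum F (\<lambda>x. env_act F (co m x) x) (supp (co m))"
  using co[OF assms] by (auto simp: coords_def PiE_def)

lemma env_hom_X: "x \<in> X ==> (\<lambda>t. env_act F t x) \<in> add_hom E F"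
  using X_F by (intro env_act_hom) auto

lemma co_add:
  assumes "m \<in> carrier F" "m' \<in> carrier F"
  shows "co (m \<oplus>\<^bsub>F\<^esub> m') = (\<lambda>x\<in>X. co m x \<oplus>\<^bsub>E\<^esub> co m' x)"
proof (rule co_eq)
  let ?s = "\<lambda>x\<in>X. co m x \<oplus>\<^bsub>E\<^esub> co m' x"
  note m = coD[OF assms(1)] and m' = coD[OF assms(2)]
  have "supp ?s \<subseteq> supp (co m) \<union> supp (co m')" using m(1) m'(1) by (auto simp: Pi_iff)
  then have "finite (supp ?s)" using m(2) m'(2) by (meson finite_UnI finite_subset)
  moreover have "m \<oplus>\<^bsub>F\<^esub> m' = finsum F (\<lambda>x. env_act F (?s x) x) (supp ?s)"
    by (subst finsum_add[OF agF env_hom_X m(1,2) m'(1,2)]) (use m(3) m'(3) in auto)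
  moreover have "?s \<in> X \<rightarrow>\<^sub>E carrier E" using m(1) m'(1) by (auto simp: Pi_iff)
  ultimately show "coords (m \<oplus>\<^bsub>F\<^esub> m') ?s" by (simp add: coords_def)
qed (simp add: assms)

text \<open>The universal property of a free bimodule before any linearity over B: prescribe
  \<theta> x b b' at b x b', subject to balancing over k. Different choices of \<theta> give the
  bilinear, the left linear and the right linear lifts.\<close>

definition ext :: "('h, 'z) ring_scheme \<Rightarrow> ('f \<Rightarrow> 'a \<Rightarrow> 'a \<Rightarrow> 'h) \<Rightarrow> 'f \<Rightarrow> 'h" where
  "ext H \<theta> m = finsum H (\<lambda>x. lift_hom H (\<lambda>(b, b'). \<theta> x b b') (co m x)) (supp (co m))"

lemma ext:
  assumes H: "abelian_group H"
    and \<theta>: "\<And>x. x \<in> X ==> balanced (carrier K) (k_bimod B) (k_bimod B) H (\<theta> x)"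
  shows ext_hom: "ext H \<theta> \<in> add_hom F H"
    and ext_gen: "\<And>x b b'. x \<in> X ==> b \<in> carrier B ==> b' \<in> carrier B ==>
      ext H \<theta> (ract F (lact F b x) b') = \<theta> x b b'"
proof -
  interpret H: abelian_group H by fact
  let ?u = "\<lambda>x. lift_hom H (\<lambda>(b, b'). \<theta> x b b')"
  have u: "?u x \<in> add_hom E H" if "x \<in> X" for x
    by (rule E.lift_add_hom[OF H \<theta>[OF that]])
  show "ext H \<theta> \<in> add_hom F H"
  proof (rule add_homI)
    fix m m' assume m: "m \<in> carrier F" and m': "m' \<in> carrier F"
    show "ext H \<theta> (m \<oplus>\<^bsub>F\<^esub> m') = ext H \<theta> m \<oplus>\<^bsub>H\<^esub> ext H \<theta> m'"
      unfolding ext_def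
      by (rule finsum_add[OF H u coD(1,2)[OF m] coD(1,2)[OF m']]) (simp_all add: co_add[OF m m'])
  next
    fix m assume "m \<in> carrier F"
    from coD(1)[OF this] show "ext H \<theta> m \<in> carrier H"
      unfolding ext_def by (intro H.finsum_closed) (auto intro!: add_hom_closed[OF u])
  qed
  fix x b b' assume x: "x \<in> X" and b: "b \<in> carrier B" "b' \<in> carrier B"
  have xF: "x \<in> carrier F" using x X_F by auto
  let ?m = "ract F (lact F b x) b'"
  have mF: "?m \<in> carrier F" using xF b by (simp add: lact_closed[OF lF] ract_closed[OF rF])
  have e: "et b b' \<in> carrier E" using E.ptens_closed[of b b'] b by simp
  \<comment> \<open>The coordinates of b x b'. The tensor may be zero, so its support is only known
    to lie in {x}.\<close>
  let ?t = "\<lambda>y\<in>X. if y = x then et b b' else \<zero>\<^bsub>E\<^esub>"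
  have tE: "?t \<in> X \<rightarrow> carrier E" using e by auto
  have st: "supp ?t \<subseteq> {x}" by auto
  have sg: "finsum G (\<lambda>y. v y (?t y)) (supp ?t) = v x (et b b')"
    if "abelian_group G" "\<And>y. y \<in> X ==> v y \<in> add_hom E G" for G :: "('g, 'w) ring_scheme" and v
  proof -
    interpret G: abelian_group G by fact
    have "finsum G (\<lambda>y. v y (?t y)) (supp ?t) = finsum G (\<lambda>y. v y (?t y)) {x}"
      by (rule finsum_supp[OF that tE _ st]) (use x in auto)
    also have "\<dots> = v x (et b b')"
      using x e add_hom_closed[OF that(2)[OF x] e] by (simp add: G.finsum_single)
    finally show ?thesis .
  qed
  have "coords ?m ?t"
    unfolding coords_def
  proof (intro conjI)
    show "?t \<in> X \<rightarrow>\<^sub>E carrier E" using e by auto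
    show "finite (supp ?t)" using st by (rule finite_subset) simp
    show "?m = finsum F (\<lambda>x. env_act F (?t x) x) (supp ?t)"
      using sg[OF agF, of "\<lambda>y t. env_act F t y"] env_hom_X x xF b by (simp add: env_act_et)
  qed
  from co_eq[OF mF this] sg[OF H u] E.lift_ptens[OF H \<theta>[OF x], of b b'] b
  show "ext H \<theta> ?m = \<theta> x b b'"
    by (simp add: ext_def)
qed

lemma F_ext:
  assumes f: "f \<in> add_hom F H" and g: "g \<in> add_hom F H" and H: "abelian_group H"
    and eq: "\<And>x b b'. x \<in> X ==> b \<in> carrier B ==> b' \<in> carrier B ==>
      f (ract F (lact F b x) b') = g (ract F (lact F b x) b')" and m: "m \<in> carrier F"
  shows "f m = g m"
proof -
  interpret H: abelian_group H by fact
  have *: "f (env_act F t x) = g (env_act F t x)" if "x \<in> X" "t \<in> carrier E" for x t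
    by (rule E.tensor_ext[OF add_hom_compose[OF env_hom_X[OF that(1)] f] add_hom_compose[OF env_hom_X[OF that(1)] g] H _ that(2)])
       (use eq that X_F in \<open>auto simp: env_act_et subset_iff\<close>)
  note c = coD[OF m]
  have cl: "(\<lambda>x. env_act F (co m x) x) \<in> supp (co m) \<rightarrow> carrier F"
    using c(1) by (auto intro!: add_hom_closed[OF env_hom_X])
  have "f m = finsum H (\<lambda>x. f (env_act F (co m x) x)) (supp (co m))"
    using add_hom_finsum_arg[OF f agF H cl] c(3) by simp
  also have "\<dots> = finsum H (\<lambda>x. g (env_act F (co m x) x)) (supp (co m))"
    by (rule H.finsum_cong') (use * c(1) cl in \<open>auto intro!: add_hom_closed[OF g] simp: Pi_iff\<close>)
  also have "\<dots> = g m"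
    using add_hom_finsum_arg[OF g agF H cl] c(3) by simp
  finally show ?thesis .
qed

lemma gen_act:
  assumes "x \<in> X" "b \<in> carrier B" "b' \<in> carrier B" "r \<in> carrier B"
  shows "lact F r (ract F (lact F b x) b') = ract F (lact F (r \<otimes>\<^bsub>B\<^esub> b) x) b'"
    "ract F (ract F (lact F b x) b') r = ract F (lact F b x) (b' \<otimes>\<^bsub>B\<^esub> r)"
proof -
  have "x \<in> carrier F" using assms X_F by auto
  then show "lact F r (ract F (lact F b x) b') = ract F (lact F (r \<otimes>\<^bsub>B\<^esub> b) x) b'"
    "ract F (ract F (lact F b x) b') r = ract F (lact F b x) (b' \<otimes>\<^bsub>B\<^esub> r)"
    using assms by (simp_all add: lact_mult[OF lF] ract_mult[OF rF] lact_closed[OF lF] bim_comm[OF bim_F])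
qed

section \<open>Lifting properties of free and projective bimodules\<close>

lemma free_bilift:
  assumes Y: "bim K B B Y" and Z: "bim K B B Z"
  shows "bilift B F Y Z"
  unfolding bilift_def
proof (intro ballI impI)
  fix f g assume f: "f \<in> bimod_hom B F Z" and g: "g \<in> bimod_hom B Y Z" and im: "f ` carrier F \<subseteq> g ` carrier Y"
  note lY = bim_left[OF Y] and rY = bim_right[OF Y] and agY = bim_abelian_group[OF Y] and agZ = bim_abelian_group[OF Z]
  have "\<forall>x\<in>X. \<exists>y\<in>carrier Y. g y = f x" using im X_F by (force simp: image_subset_iff image_iff)
  then obtain y where y: "\<And>x. x \<in> X ==> y x \<in> carrier Y" "\<And>x. x \<in> X ==> g (y x) = f x" by metis
  let ?\<theta> = "\<lambda>x b b'. ract Y (lact Y b (y x)) b'"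
  have \<theta>: "balanced (carrier K) (k_bimod B) (k_bimod B) Y (?\<theta> x)" if "x \<in> X" for x
    using y(1)[OF that]
    by (intro balancedI)
       (auto simp: lact_closed[OF lY] ract_closed[OF rY] lact_add_left[OF lY] ract_add[OF rY] ract_add_right[OF rY]
         smult_lact[OF algB lY] smult_ract[OF algB rY])
  let ?h = "ext Y ?\<theta>"
  note h = ext_hom[OF agY \<theta>] and hg = ext_gen[OF agY \<theta>]
  have gh: "g (?h m) = f m" if "m \<in> carrier F" for m
  proof (rule F_ext[OF add_hom_compose[OF h bimod_hom_add_hom[OF g]] bimod_hom_add_hom[OF f] agZ _ that])
    fix x b b' assume x: "x \<in> X" and b: "b \<in> carrier B" "b' \<in> carrier B"
    have xF: "x \<in> carrier F" using x X_F by auto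
    show "g (?h (ract F (lact F b x) b')) = f (ract F (lact F b x) b')"
      using x xF b y by (simp add: hg bimod_hom_lact[OF g] bimod_hom_ract[OF g] bimod_hom_lact[OF f] bimod_hom_ract[OF f]
          lact_closed[OF lY] lact_closed[OF lF])
  qed
  have "?h \<in> bimod_hom B F Y"
  proof (rule bimod_homI[OF h])
    fix r m assume r: "r \<in> carrier B" and m: "m \<in> carrier F"
    show "?h (lact F r m) = lact Y r (?h m)"
    proof (rule F_ext[OF add_hom_compose[OF lact_add_hom[OF lF r] h] add_hom_compose[OF h lact_add_hom[OF lY r]] agY _ m])
      fix x b b' assume x: "x \<in> X" and b: "b \<in> carrier B" "b' \<in> carrier B"
      show "?h (lact F r (ract F (lact F b x) b')) = lact Y r (?h (ract F (lact F b x) b'))"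
        using x b r y(1)[OF x] by (simp add: gen_act hg lact_mult[OF lY] lact_closed[OF lY] bim_comm[OF Y])
    qed
    show "?h (ract F m r) = ract Y (?h m) r"
    proof (rule F_ext[OF add_hom_compose[OF ract_add_hom[OF rF r] h] add_hom_compose[OF h ract_add_hom[OF rY r]] agY _ m])
      fix x b b' assume x: "x \<in> X" and b: "b \<in> carrier B" "b' \<in> carrier B"
      show "?h (ract F (ract F (lact F b x) b') r) = ract Y (?h (ract F (lact F b x) b')) r"
        using x b r y(1)[OF x] by (simp add: gen_act hg ract_mult[OF rY] lact_closed[OF lY])
    qed
  qed
  with gh show "\<exists>h\<in>bimod_hom B F Y. \<forall>x\<in>carrier F. g (h x) = f x" by blast
qed

text \<open>As a left module a free bimodule is induced from the vector space spanned by the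
  elements x b'. The right factor b' is therefore treated linearly: it is applied to x inside f, the
  k-linear section \<sigma> lifts the value, and b acts last.\<close>

lemma free_leftlift:
  assumes fK: "field K" and Y: "left_module K B Y" and Z: "left_module K B Z"
  shows "leftlift B F Y Z"
  unfolding leftlift_def
proof (intro ballI impI)
  fix f g assume f: "f \<in> left_hom B F Z" and g: "g \<in> left_hom B Y Z" and im: "f ` carrier F \<subseteq> g ` carrier Y"
  note agY = left_module_abelian_group[OF Y] and agZ = left_module_abelian_group[OF Z]
  note fl = k_linearD[OF left_hom_linear[OF f lF Z algB]]
  obtain \<sigma> where \<sigma>: "\<And>z. z \<in> g ` carrier Y ==> \<sigma> z \<in> carrier Y"
    "\<And>z. z \<in> g ` carrier Y ==> g (\<sigma> z) = z"
    "\<And>z w. z \<in> g ` carrier Y ==> w \<in> g ` carrier Y ==> \<sigma> (z \<oplus>\<^bsub>Z\<^esub> w) = \<sigma> z \<oplus>\<^bsub>Y\<^esub> \<sigma> w"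
    "\<And>c z. c \<in> carrier K ==> z \<in> g ` carrier Y ==> \<sigma> (c \<odot>\<^bsub>Z\<^esub> z) = c \<odot>\<^bsub>Y\<^esub> \<sigma> z"
    using linear_section[OF fK left_module_module[OF Y] left_module_module[OF Z] left_hom_linear[OF g Y Z algB]] by blast
  have fg: "f m \<in> g ` carrier Y" if "m \<in> carrier F" for m using that im by blast
  let ?\<theta> = "\<lambda>x b b'. lact Y b (\<sigma> (f (ract F x b')))"
  have \<theta>: "balanced (carrier K) (k_bimod B) (k_bimod B) Y (?\<theta> x)" if "x \<in> X" for x
  proof -
    have xF: "x \<in> carrier F" using that X_F by auto
    show ?thesis
      by (rule balancedI)
         (use xF in \<open>auto simp: lact_closed[OF Y] ract_closed[OF rF] lact_add_left[OF Y] lact_add[OF Y] ract_add_right[OF rF]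
           smult_lact[OF algB Y] smult_ract[OF algB rF] \<sigma> fg fl\<close>)
  qed
  let ?h = "ext Y ?\<theta>"
  note h = ext_hom[OF agY \<theta>] and hg = ext_gen[OF agY \<theta>]
  have gh: "g (?h m) = f m" if "m \<in> carrier F" for m
  proof (rule F_ext[OF add_hom_compose[OF h left_homD(1)[OF g]] left_homD(1)[OF f] agZ _ that])
    fix x b b' assume x: "x \<in> X" and b: "b \<in> carrier B" "b' \<in> carrier B"
    have xF: "x \<in> carrier F" using x X_F by auto
    show "g (?h (ract F (lact F b x) b')) = f (ract F (lact F b x) b')"
    proof -
      have "f (ract F (lact F b x) b') = lact Z b (f (ract F x b'))"
        using xF b by (simp add: bim_comm[OF bim_F] left_homD(2)[OF f] ract_closed[OF rF])
      then show ?thesis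
        using x xF b by (simp add: hg left_homD(2)[OF g] \<sigma> fg ract_closed[OF rF])
    qed
  qed
  have "?h \<in> left_hom B F Y"
  proof (rule left_homI[OF h])
    fix r m assume r: "r \<in> carrier B" and m: "m \<in> carrier F"
    show "?h (lact F r m) = lact Y r (?h m)"
    proof (rule F_ext[OF add_hom_compose[OF lact_add_hom[OF lF r] h] add_hom_compose[OF h lact_add_hom[OF Y r]] agY _ m])
      fix x b b' assume x: "x \<in> X" and b: "b \<in> carrier B" "b' \<in> carrier B"
      have xF: "x \<in> carrier F" using x X_F by auto
      show "?h (lact F r (ract F (lact F b x) b')) = lact Y r (?h (ract F (lact F b x) b'))"
        using x xF b r by (simp add: gen_act hg lact_mult[OF Y] \<sigma> fg ract_closed[OF rF])
    qed
  qed
  with gh show "\<exists>h\<in>left_hom B F Y. \<forall>x\<in>carrier F. g (h x) = f x" by blast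
qed

text \<open>The mirror image: now b x goes through f and \<sigma>, and b' acts last.\<close>

lemma free_rightlift:
  assumes fK: "field K" and Y: "right_module K B Y" and Z: "right_module K B Z"
  shows "rightlift B F Y Z"
  unfolding rightlift_def
proof (intro ballI impI)
  fix f g assume f: "f \<in> right_hom B F Z" and g: "g \<in> right_hom B Y Z" and im: "f ` carrier F \<subseteq> g ` carrier Y"
  note agY = right_module_abelian_group[OF Y] and agZ = right_module_abelian_group[OF Z]
  note fl = k_linearD[OF right_hom_linear[OF f rF Z algB]]
  obtain \<sigma> where \<sigma>: "\<And>z. z \<in> g ` carrier Y ==> \<sigma> z \<in> carrier Y"
    "\<And>z. z \<in> g ` carrier Y ==> g (\<sigma> z) = z"
    "\<And>z w. z \<in> g ` carrier Y ==> w \<in> g ` carrier Y ==> \<sigma> (z \<oplus>\<^bsub>Z\<^esub> w) = \<sigma> z \<oplus>\<^bsub>Y\<^esub> \<sigma> w"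
    "\<And>c z. c \<in> carrier K ==> z \<in> g ` carrier Y ==> \<sigma> (c \<odot>\<^bsub>Z\<^esub> z) = c \<odot>\<^bsub>Y\<^esub> \<sigma> z"
    using linear_section[OF fK right_module_module[OF Y] right_module_module[OF Z] right_hom_linear[OF g Y Z algB]] by blast
  have fg: "f m \<in> g ` carrier Y" if "m \<in> carrier F" for m using that im by blast
  let ?\<theta> = "\<lambda>x b b'. ract Y (\<sigma> (f (lact F b x))) b'"
  have \<theta>: "balanced (carrier K) (k_bimod B) (k_bimod B) Y (?\<theta> x)" if "x \<in> X" for x
  proof -
    have xF: "x \<in> carrier F" using that X_F by auto
    show ?thesis
      by (rule balancedI)
         (use xF in \<open>auto simp: ract_closed[OF Y] lact_closed[OF lF] ract_add_right[OF Y] ract_add[OF Y] lact_add_left[OF lF]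
           smult_lact[OF algB lF] smult_ract[OF algB Y] \<sigma> fg fl\<close>)
  qed
  let ?h = "ext Y ?\<theta>"
  note h = ext_hom[OF agY \<theta>] and hg = ext_gen[OF agY \<theta>]
  have gh: "g (?h m) = f m" if "m \<in> carrier F" for m
  proof (rule F_ext[OF add_hom_compose[OF h right_homD(1)[OF g]] right_homD(1)[OF f] agZ _ that])
    fix x b b' assume x: "x \<in> X" and b: "b \<in> carrier B" "b' \<in> carrier B"
    have xF: "x \<in> carrier F" using x X_F by auto
    show "g (?h (ract F (lact F b x) b')) = f (ract F (lact F b x) b')"
      using x xF b by (simp add: hg right_homD(2)[OF g] right_homD(2)[OF f] \<sigma> fg lact_closed[OF lF])
  qed
  have "?h \<in> right_hom B F Y"
  proof (rule right_homI[OF h])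
    fix r m assume r: "r \<in> carrier B" and m: "m \<in> carrier F"
    show "?h (ract F m r) = ract Y (?h m) r"
    proof (rule F_ext[OF add_hom_compose[OF ract_add_hom[OF rF r] h] add_hom_compose[OF h ract_add_hom[OF Y r]] agY _ m])
      fix x b b' assume x: "x \<in> X" and b: "b \<in> carrier B" "b' \<in> carrier B"
      have xF: "x \<in> carrier F" using x X_F by auto
      show "?h (ract F (ract F (lact F b x) b') r) = ract Y (?h (ract F (lact F b x) b')) r"
        using x xF b r by (simp add: gen_act hg ract_mult[OF Y] \<sigma> fg lact_closed[OF lF])
    qed
  qed
  with gh show "\<exists>h\<in>right_hom B F Y. \<forall>x\<in>carrier F. g (h x) = f x" by blast
qed

end

lemma projective_bimod:
  assumes "projective_bimodule (TYPE('f)) K B P"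
  shows "bim K B B P"
  using assms by (simp add: projective_bimodule_def bimodule_bim)

text \<open>Each lifting property passes to retracts: lift f p from the free bimodule and restrict
  along i, using p i = id.\<close>

lemma projective_lifts:
  fixes K :: "'k ring" and B :: "('k, 'a) module" and P :: "('k, 'a, 'a, 'p) bimod"
  assumes alg: "k_algebra K B" and P: "projective_bimodule (TYPE('f)) K B P"
  shows projective_bilift: "\<And>(Y :: ('k, 'a, 'a, 'y) bimod) (Z :: ('k, 'a, 'a, 'z) bimod).
      bim K B B Y ==> bim K B B Z ==> bilift B P Y Z"
    and projective_leftlift: "\<And>(Y :: ('k, 'a, 'a, 'y) bimod) (Z :: ('k, 'a, 'a, 'z) bimod).
      field K ==> left_module K B Y ==> left_module K B Z ==> leftlift B P Y Z"
    and projective_rightlift: "\<And>(Y :: ('k, 'a, 'a, 'y) bimod) (Z :: ('k, 'a, 'a, 'z) bimod).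
      field K ==> right_module K B Y ==> right_module K B Z ==> rightlift B P Y Z"
proof -
  obtain F :: "('k, 'a, 'a, 'f) bimod" and X i p where F: "free_bimodule_on K B F X"
    and i: "i \<in> bimod_hom B P F" and p: "p \<in> bimod_hom B F P" and pi: "\<And>x. x \<in> carrier P ==> p (i x) = x"
    using P unfolding projective_bimodule_def by blast
  interpret free_bim K B F X using alg F by unfold_locales
  have pl: "p \<in> left_hom B F P" "p \<in> right_hom B F P" "i \<in> left_hom B P F" "i \<in> right_hom B P F"
    using p i by (auto simp: bimod_hom_def)
  have icl: "i x \<in> carrier F" if "x \<in> carrier P" for x using bimod_hom_closed[OF i that] .
  have pcl: "p x \<in> carrier P" if "x \<in> carrier F" for x using bimod_hom_closed[OF p that] .
  fix Y :: "('k, 'a, 'a, 'y) bimod" and Z :: "('k, 'a, 'a, 'z) bimod"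
  { assume YZ: "bim K B B Y" "bim K B B Z"
    show "bilift B P Y Z"
      unfolding bilift_def
    proof (intro ballI impI)
      fix f g assume f: "f \<in> bimod_hom B P Z" and g: "g \<in> bimod_hom B Y Z" and im: "f ` carrier P \<subseteq> g ` carrier Y"
      have "f (p x) \<in> g ` carrier Y" if "x \<in> carrier F" for x using pcl[OF that] im by blast
      from bilift_obtain[OF free_bilift[OF YZ] bimod_hom_compose[OF p f] g this]
      obtain h where h: "h \<in> bimod_hom B F Y" "\<And>x. x \<in> carrier F ==> g (h x) = f (p x)" by metis
      show "\<exists>h\<in>bimod_hom B P Y. \<forall>x\<in>carrier P. g (h x) = f x"
        by (rule bexI[OF _ bimod_hom_compose[OF i h(1)]]) (simp add: h(2) icl pi)
    qed }
  { assume YZ: "field K" "left_module K B Y" "left_module K B Z"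
    show "leftlift B P Y Z"
      unfolding leftlift_def
    proof (intro ballI impI)
      fix f g assume f: "f \<in> left_hom B P Z" and g: "g \<in> left_hom B Y Z" and im: "f ` carrier P \<subseteq> g ` carrier Y"
      have fp: "(\<lambda>x. f (p x)) \<in> left_hom B F Z"
        using f pl(1) by (auto simp: left_hom_def Pi_iff)
      have "f (p x) \<in> g ` carrier Y" if "x \<in> carrier F" for x using pcl[OF that] im by blast
      from leftlift_obtain[OF free_leftlift[OF YZ] fp g this]
      obtain h where h: "h \<in> left_hom B F Y" "\<And>x. x \<in> carrier F ==> g (h x) = f (p x)" by metis
      have "(\<lambda>x. h (i x)) \<in> left_hom B P Y"
        using h(1) pl(3) by (auto simp: left_hom_def Pi_iff)
      then show "\<exists>h\<in>left_hom B P Y. \<forall>x\<in>carrier P. g (h x) = f x"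
        by (rule rev_bexI) (simp add: h(2) icl pi)
    qed }
  { assume YZ: "field K" "right_module K B Y" "right_module K B Z"
    show "rightlift B P Y Z"
      unfolding rightlift_def
    proof (intro ballI impI)
      fix f g assume f: "f \<in> right_hom B P Z" and g: "g \<in> right_hom B Y Z" and im: "f ` carrier P \<subseteq> g ` carrier Y"
      have fp: "(\<lambda>x. f (p x)) \<in> right_hom B F Z"
        using f pl(2) by (auto simp: right_hom_def Pi_iff)
      have "f (p x) \<in> g ` carrier Y" if "x \<in> carrier F" for x using pcl[OF that] im by blast
      from rightlift_obtain[OF free_rightlift[OF YZ] fp g this]
      obtain h where h: "h \<in> right_hom B F Y" "\<And>x. x \<in> carrier F ==> g (h x) = f (p x)" by metis
      have "(\<lambda>x. h (i x)) \<in> right_hom B P Y"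
        using h(1) pl(4) by (auto simp: right_hom_def Pi_iff)
      then show "\<exists>h\<in>right_hom B P Y. \<forall>x\<in>carrier P. g (h x) = f x"
        by (rule rev_bexI) (simp add: h(2) icl pi)
    qed }
qed

section \<open>Contractions of one-sided projective resolutions\<close>

text \<open>A null-homotopy of the identity of the augmented complex P \<rightarrow> B by left
  B-linear maps. Its component from B to \<open>P 0\<close> is b \<mapsto> b p, determined by the
  image p of the unit.\<close>

definition contraction ::
  "('k, 'a) module \<Rightarrow> (nat \<Rightarrow> ('k, 'a, 'a, 'p) bimod) \<Rightarrow> (nat \<Rightarrow> 'p \<Rightarrow> 'p) \<Rightarrow> ('p \<Rightarrow> 'a) \<Rightarrow> 'p \<Rightarrow>
   (nat \<Rightarrow> 'p \<Rightarrow> 'p) \<Rightarrow> bool"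
where
  "contraction B P d \<epsilon> p s \<longleftrightarrow> p \<in> carrier (P 0) \<and> \<epsilon> p = \<one>\<^bsub>B\<^esub> \<and>
     (\<forall>n. s n \<in> left_hom B (P n) (P (Suc n))) \<and>
     (\<forall>x\<in>carrier (P 0). d 0 (s 0 x) = x \<ominus>\<^bsub>P 0\<^esub> lact (P 0) (\<epsilon> x) p) \<and>
     (\<forall>n. \<forall>x\<in>carrier (P (Suc n)). d (Suc n) (s (Suc n) x) = x \<ominus>\<^bsub>P (Suc n)\<^esub> s n (d n x))"

text \<open>Exactness without projectivity. In this form the data pass to the opposite algebra
  unchanged, while projectivity is kept as separate lifting statements.\<close>

definition resolves ::
  "('k, 'z) ring_scheme \<Rightarrow> ('k, 'a) module \<Rightarrow> (nat \<Rightarrow> ('k, 'a, 'a, 'p) bimod) \<Rightarrow> (nat \<Rightarrow> 'p \<Rightarrow> 'p) \<Rightarrow>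
   ('p \<Rightarrow> 'a) \<Rightarrow> bool"
where
  "resolves K B P d \<epsilon> \<longleftrightarrow> bicomplex K B P d \<and> exact_pos P d \<and> \<epsilon> \<in> bimod_hom B (P 0) (regular B) \<and>
     \<epsilon> ` carrier (P 0) = carrier B \<and> d 0 ` carrier (P 1) = {x \<in> carrier (P 0). \<epsilon> x = \<zero>\<^bsub>B\<^esub>}"

lemma projective_resolution_resolves:
  assumes "projective_resolution (TYPE('f)) K B (regular B) P d \<epsilon>"
  shows "resolves K B P d \<epsilon>"
proof -
  have b: "bim K B B (P n)" for n
    using assms by (auto simp: projective_resolution_def intro: projective_bimod)
  have d: "d n \<in> bimod_hom B (P (Suc n)) (P n)" for n
    using assms by (auto simp: projective_resolution_def)
  have e0: "d 0 ` carrier (P (Suc 0)) = {x \<in> carrier (P 0). \<epsilon> x = \<zero>\<^bsub>B\<^esub>}"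
    and e: "\<And>n. d (Suc n) ` carrier (P (Suc (Suc n))) = {x \<in> carrier (P (Suc n)). d n x = \<zero>\<^bsub>P n\<^esub>}"
    using assms by (auto simp: projective_resolution_def)
  have "d n (d (Suc n) x) = \<zero>\<^bsub>P n\<^esub>" if "x \<in> carrier (P (Suc (Suc n)))" for n x
    using e[of n] that by blast
  moreover have "exact_pos P d"
    unfolding exact_pos_def using e by blast
  ultimately show ?thesis
    using assms b d by (auto simp: resolves_def bicomplex_def projective_resolution_def)
qed

text \<open>B is free on 1 as a left module, so choosing p with \<epsilon>(p) = 1 splits the
  augmentation. The homotopy is then built by lifting x - \<epsilon>(x) p, and afterwards x - s(d
  x), against d; the last clause of \<open>?Q\<close> makes the latter a cycle.\<close>

lemma left_contraction_exists:
  fixes B :: "('k, 'a) module" and P :: "nat \<Rightarrow> ('k, 'a, 'a, 'p) bimod"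
  assumes res: "resolves K B P d \<epsilon>" and alg: "k_algebra K B"
    and lift: "\<And>n m m'. leftlift B (P n) (P m) (P m')"
  obtains p s where "contraction B P d \<epsilon> p s"
proof -
  interpret B: ring B using alg by (rule k_algebra_ring)
  have cx: "bicomplex K B P d" and ex: "exact_pos P d" and \<epsilon>: "\<epsilon> \<in> bimod_hom B (P 0) (regular B)"
    and onto: "\<epsilon> ` carrier (P 0) = carrier B" and ex0: "d 0 ` carrier (P 1) = {x \<in> carrier (P 0). \<epsilon> x = \<zero>\<^bsub>B\<^esub>}"
    using res by (auto simp: resolves_def)
  note bP = bicomplexD(1)[OF cx] and dP = bicomplexD(2)[OF cx] and agP = bicomplexD(4)[OF cx]
  note lP = bim_left[OF bP]
  have dl: "d n \<in> left_hom B (P (Suc n)) (P n)" for n using dP[of n] by (simp add: bimod_hom_def)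
  have left_sub: "(\<lambda>x. f x \<ominus>\<^bsub>P m\<^esub> g x) \<in> left_hom B (P n) (P m)"
    if "f \<in> left_hom B (P n) (P m)" "g \<in> left_hom B (P n) (P m)" for f g n m
    using that left_homD[OF that(1)] left_homD[OF that(2)]
    by (intro left_homI add_hom_sub agP) (auto simp: lact_minus[OF lP] add_hom_closed)
  have left_id: "(\<lambda>x. x) \<in> left_hom B (P n) (P n)" for n by (intro left_homI add_hom_id) auto
  have left_comp: "(\<lambda>x. g (f x)) \<in> left_hom B L N" if "f \<in> left_hom B L M" "g \<in> left_hom B M N"
    for f g and L M N :: "('k, 'a, 'a, 'p) bimod"
    using that by (auto simp: left_hom_def Pi_iff)
  obtain p where p: "p \<in> carrier (P 0)" "\<epsilon> p = \<one>\<^bsub>B\<^esub>" using onto B.one_closed by (metis image_iff)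
  note \<epsilon>D = bimod_homD[OF \<epsilon>, simplified]
  have u: "(\<lambda>x. lact (P 0) (\<epsilon> x) p) \<in> left_hom B (P 0) (P 0)"
    using p by (intro left_homI add_homI) (auto simp: \<epsilon>D lact_closed[OF lP] lact_add_left[OF lP] lact_mult[OF lP])
  let ?Q = "\<lambda>n s. s \<in> left_hom B (P n) (P (Suc n)) \<and>
    (n = 0 \<longrightarrow> (\<forall>x\<in>carrier (P 0). d 0 (s x) = x \<ominus>\<^bsub>P 0\<^esub> lact (P 0) (\<epsilon> x) p)) \<and>
    (\<forall>x\<in>carrier (P (Suc n)). d n (s (d n x)) = d n x)"
  let ?S = "\<lambda>n s s'. \<forall>x\<in>carrier (P (Suc n)). d (Suc n) (s' x) = x \<ominus>\<^bsub>P (Suc n)\<^esub> s (d n x)"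
  have "\<exists>s. \<forall>n. ?Q n (s n) \<and> ?S n (s n) (s (Suc n))"
  proof (rule dependent_nat_choice)
    interpret P0: abelian_group "P 0" by (rule agP)
    have *: "x \<ominus>\<^bsub>P 0\<^esub> lact (P 0) (\<epsilon> x) p \<in> d 0 ` carrier (P (Suc 0))" if x: "x \<in> carrier (P 0)" for x
    proof -
      let ?z = "x \<ominus>\<^bsub>P 0\<^esub> lact (P 0) (\<epsilon> x) p"
      have ex: "\<epsilon> x \<in> carrier B" using \<epsilon>D x by simp
      have "\<epsilon> ?z = \<epsilon> x \<ominus>\<^bsub>B\<^esub> \<epsilon> x \<otimes>\<^bsub>B\<^esub> \<one>\<^bsub>B\<^esub>"
        using x p ex add_hom_minus[of \<epsilon> "P 0" B x "lact (P 0) (\<epsilon> x) p"] \<epsilon>D(1) agP B.abelian_group_axioms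
        by (simp add: add_hom_def \<epsilon>D lact_closed[OF lP])
      then have "\<epsilon> ?z = \<zero>\<^bsub>B\<^esub>" using ex by (simp add: B.minus_self)
      moreover have "?z \<in> carrier (P 0)" using x p ex by (simp add: lact_closed[OF lP])
      ultimately show "?z \<in> d 0 ` carrier (P (Suc 0))" using ex0 by simp
    qed
    from leftlift_obtain[OF lift left_sub[OF left_id u] dl *]
    obtain s where s: "s \<in> left_hom B (P 0) (P (Suc 0))"
      "\<And>x. x \<in> carrier (P 0) ==> d 0 (s x) = x \<ominus>\<^bsub>P 0\<^esub> lact (P 0) (\<epsilon> x) p" by metis
    have "d 0 (s (d 0 x)) = d 0 x" if x: "x \<in> carrier (P (Suc 0))" for x
    proof -
      have "\<epsilon> (d 0 x) = \<zero>\<^bsub>B\<^esub>" using ex0 x by auto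
      moreover have "lact (P 0) \<zero>\<^bsub>B\<^esub> p = \<zero>\<^bsub>P 0\<^esub>"
        by (rule add_hom_zero[where f = "\<lambda>b. lact (P 0) b p", OF _ B.abelian_group_axioms agP])
           (use p in \<open>auto intro!: add_homI simp: lact_closed[OF lP] lact_add_left[OF lP]\<close>)
      ultimately show ?thesis using s(2) bicomplexD(5)[OF cx x] by (simp add: a_minus_def)
    qed
    with s show "\<exists>s. ?Q 0 s" by (intro exI[of _ s]) auto
  next
    fix s n assume Q: "?Q n s"
    interpret P0: abelian_group "P n" by (rule agP)
    interpret P1: abelian_group "P (Suc n)" by (rule agP)
    have sl: "s \<in> left_hom B (P n) (P (Suc n))" using Q by blast
    have k: "(\<lambda>x. x \<ominus>\<^bsub>P (Suc n)\<^esub> s (d n x)) \<in> left_hom B (P (Suc n)) (P (Suc n))"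
      by (rule left_sub[OF left_id left_comp[OF dl sl]])
    have *: "x \<ominus>\<^bsub>P (Suc n)\<^esub> s (d n x) \<in> d (Suc n) ` carrier (P (Suc (Suc n)))" if x: "x \<in> carrier (P (Suc n))" for x
    proof -
      let ?z = "x \<ominus>\<^bsub>P (Suc n)\<^esub> s (d n x)"
      have sc: "s (d n x) \<in> carrier (P (Suc n))"
        using add_hom_closed[OF left_homD(1)[OF sl] bicomplexD(5)[OF cx x]] .
      have "d n ?z = d n x \<ominus>\<^bsub>P n\<^esub> d n (s (d n x))"
        by (rule add_hom_minus[OF bimod_hom_add_hom[OF dP] agP agP x sc])
      then have "d n ?z = \<zero>\<^bsub>P n\<^esub>" using Q x bicomplexD(5)[OF cx x] by (simp add: P0.minus_self)
      moreover have "?z \<in> carrier (P (Suc n))" using x sc by simp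
      ultimately show "?z \<in> d (Suc n) ` carrier (P (Suc (Suc n)))" using ex unfolding exact_pos_def by blast
    qed
    from leftlift_obtain[OF lift k dl *]
    obtain s' where s': "s' \<in> left_hom B (P (Suc n)) (P (Suc (Suc n)))"
      "\<And>x. x \<in> carrier (P (Suc n)) ==> d (Suc n) (s' x) = x \<ominus>\<^bsub>P (Suc n)\<^esub> s (d n x)" by metis
    have "d (Suc n) (s' (d (Suc n) x)) = d (Suc n) x" if x: "x \<in> carrier (P (Suc (Suc n)))" for x
      using s'(2) bicomplexD(5)[OF cx x] bicomplexD(3)[OF cx x] add_hom_zero[OF left_homD(1)[OF sl] agP agP]
      by (simp add: a_minus_def)
    with s' show "\<exists>s'. ?Q (Suc n) s' \<and> ?S n s s'" by (intro exI[of _ s']) auto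
  qed
  then obtain s where s: "\<forall>n. ?Q n (s n) \<and> ?S n (s n) (s (Suc n))" by blast
  show thesis by (rule that[of p s]) (unfold contraction_def, use s p in blast)
qed

section \<open>The bimodule of a Galois extension\<close>

locale galois =
  fixes K :: "'k ring" and C :: "('k, 'c) coalg" and A B :: "('k, 'a) module"
    and \<rho> :: "'a \<Rightarrow> ('a, 'c) tens"
  assumes field_K: "field K" and coalg_C: "coalgebra K C" and gal: "galois_extension K C A \<rho> B"
begin

lemma algA: "k_algebra K A" and coinv: "B = coinvariants K C A \<rho>"
  and \<beta>_bij: "bij_betw (galois_map K C A \<rho>) (carrier (tensor (carrier B) (regular A) (regular A))) (carrier (algcoalg K A C))"
  and \<rho>: "\<rho> \<in> k_linear K A (algcoalg K A C)"
  using gal by (auto simp: galois_extension_def right_comodule_def Let_def)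

lemma module_C: "module K C"
  using coalg_C by (simp add: coalgebra_def Let_def)

sublocale A: ring A by (rule k_algebra_ring[OF algA])
sublocale V: module K A by (rule k_algebra_module[OF algA])

sublocale AC: tens_bim K A "scalars K" "scalars K" "left_regular A" "k_bimod C"
  rewrites "carrier (scalars K) = carrier K"
  by (rule algcoalg_tens_bim[OF algA module_C]) simp

abbreviation "TT \<equiv> algcoalg K A C"
abbreviation "ac \<equiv> algcoalg_ptens K A C"

lemmas bim_TT = AC.bim_tensor[folded algcoalg_def]
lemmas lTT = bim_left[OF bim_TT] and agTT = bim_abelian_group[OF bim_TT] and mTT = bim_module[OF bim_TT]
lemmas \<rho>D = k_linearD[OF \<rho>]

lemma carrier_B: "carrier B = {b \<in> carrier A. \<forall>a\<in>carrier A. \<rho> (b \<otimes>\<^bsub>A\<^esub> a) = lact TT b (\<rho> a)}"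
  by (simp add: coinv coinvariants_def)

lemma \<rho>_B: "b \<in> carrier B ==> a \<in> carrier A ==> \<rho> (b \<otimes>\<^bsub>A\<^esub> a) = lact TT b (\<rho> a)"
  by (simp add: carrier_B)

lemma B_ops: "B = A\<lparr>carrier := carrier B\<rparr>"
  by (simp add: coinv coinvariants_def)

lemma B_simps: "mult B = mult A" "add B = add A" "one B = one A" "zero B = zero A" "smult B = smult A"
  by (subst B_ops; simp)+

lemma subalg_B: "subalg K A B"
proof -
  have one: "\<one>\<^bsub>A\<^esub> \<in> carrier B"
    by (auto simp: carrier_B lact_one[OF lTT] \<rho>D(1))
  have add: "x \<oplus>\<^bsub>A\<^esub> y \<in> carrier B" if "x \<in> carrier B" "y \<in> carrier B" for x y
    using that by (auto simp: carrier_B A.l_distr \<rho>D(1,2) lact_add_left[OF lTT])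
  have mul: "x \<otimes>\<^bsub>A\<^esub> y \<in> carrier B" if "x \<in> carrier B" "y \<in> carrier B" for x y
    using that by (auto simp: carrier_B A.m_assoc \<rho>D(1) lact_mult[OF lTT])
  have sm: "c \<odot>\<^bsub>A\<^esub> x \<in> carrier B" if "c \<in> carrier K" "x \<in> carrier B" for c x
    using that by (auto simp: carrier_B k_algebra_smult_left[OF algA] \<rho>D(1,3) smult_lact(2)[OF algA lTT])
  have neg: "\<ominus>\<^bsub>A\<^esub> x \<in> carrier B" if x: "x \<in> carrier B" for x
  proof -
    have "(\<ominus>\<^bsub>K\<^esub> \<one>\<^bsub>K\<^esub>) \<odot>\<^bsub>A\<^esub> x \<in> carrier B" using x by (intro sm) auto
    moreover have "x \<in> carrier A" using x by (simp add: carrier_B)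
    ultimately show ?thesis by (simp add: V.smult_l_minus)
  qed
  have sub: "carrier B \<subseteq> carrier A" by (auto simp: carrier_B)
  have zero: "\<zero>\<^bsub>A\<^esub> \<in> carrier B" using add[OF one neg[OF one]] by (simp add: A.r_neg)
  have "submodule (carrier B) K A"
    by (rule V.submoduleI) (use sub zero add sm neg in auto)
  then have "module K (A\<lparr>carrier := carrier B\<rparr>)"
    by (rule submodule.submodule_is_module) (rule V.module_axioms)
  then have m: "module K B" using B_ops by simp
  have r: "ring B"
    by (rule ringI[OF module_abelian_group[OF m]])
       (use sub one mul in \<open>auto simp: B_simps subset_iff A.m_assoc A.l_distr A.r_distr intro!: monoidI\<close>)
  have "k_algebra K B"
    unfolding k_algebra_def using m r sub
    by (auto simp: B_simps k_algebra_smult_left[OF algA] k_algebra_smult_right[OF algA] subset_iff)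
  then show ?thesis using algA sub by (simp add: subalg_def B_simps)
qed

lemmas algB = subalgD(2)[OF subalg_B] and B_A = subalgD(3)[OF subalg_B]

lemmas bim_AA = bim_regular[OF algA]

section \<open>The Galois map as an isomorphism of left modules\<close>

sublocale U: tens_bim K A B A "regular A" "regular A"
  by (intro tens_bimI bim_restrict_left[OF subalg_B] bim_restrict_right[OF subalg_B] bim_AA algA algB)

abbreviation "U \<equiv> tensor (carrier B) (regular A) (regular A)"
abbreviation "ut \<equiv> ptens (carrier B) (regular A) (regular A)"
abbreviation "\<beta> \<equiv> galois_map K C A \<rho>"

text \<open>Balancing over B is the very condition that defines the coinvariants, read at the second
  tensor factor.\<close>

lemma \<beta>_balanced: "balanced (carrier B) (regular A) (regular A) TT (\<lambda>a a'. lact TT a (\<rho> a'))"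
proof (rule balancedI)
  fix x s y assume "x \<in> carrier (regular A)" "s \<in> carrier B" "y \<in> carrier (regular A)"
  then show "lact TT (ract (regular A) x s) (\<rho> y) = lact TT x (\<rho> (lact (regular A) s y))"
    by (simp add: B_A \<rho>_B lact_mult[OF lTT] \<rho>D(1))
qed (auto simp: lact_closed[OF lTT] \<rho>D(1,2) lact_add_left[OF lTT] lact_add[OF lTT])

lemma \<beta>_hom: "\<beta> \<in> add_hom U TT"
  unfolding galois_map_def by (rule U.lift_add_hom[OF agTT \<beta>_balanced])

lemma \<beta>_ut: "a \<in> carrier A ==> a' \<in> carrier A ==> \<beta> (ut a a') = lact TT a (\<rho> a')"
  unfolding galois_map_def using U.lift_ptens[OF agTT \<beta>_balanced, of a a'] by simp

lemma \<beta>_lact: "b \<in> carrier A ==> u \<in> carrier U ==> \<beta> (lact U b u) = lact TT b (\<beta> u)"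
  by (rule U.tensor_ext[OF add_hom_compose[OF U.lact_hom \<beta>_hom] add_hom_compose[OF \<beta>_hom lact_add_hom[OF lTT]] agTT])
     (simp_all add: U.lact_ptens \<beta>_ut lact_mult[OF lTT] \<rho>D(1))

lemma \<beta>_smult: "c \<in> carrier K ==> u \<in> carrier U ==> \<beta> (c \<odot>\<^bsub>U\<^esub> u) = c \<odot>\<^bsub>TT\<^esub> \<beta> u"
  using \<beta>_lact[of "c \<odot>\<^bsub>A\<^esub> \<one>\<^bsub>A\<^esub>" u] k_algebra_scalar_closed[OF algA]
  by (simp add: lact_scalar[OF bim_left[OF U.bim_tensor]] lact_scalar[OF lTT] add_hom_closed[OF \<beta>_hom])

definition \<beta>' :: "('a, 'c) tens \<Rightarrow> ('a, 'a) tens" where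
  "\<beta>' = inv_into (carrier U) \<beta>"

lemma \<beta>': "t \<in> carrier TT ==> \<beta>' t \<in> carrier U" "t \<in> carrier TT ==> \<beta> (\<beta>' t) = t"
  "u \<in> carrier U ==> \<beta>' (\<beta> u) = u"
  using \<beta>_bij unfolding \<beta>'_def
  by (auto simp: bij_betw_def inv_into_into f_inv_into_f)

lemma \<beta>'_eq: "u \<in> carrier U ==> \<beta> u = t ==> \<beta>' t = u"
  using \<beta>'(3) by auto

lemma \<beta>'_hom: "\<beta>' \<in> add_hom TT U"
  by (rule add_homI) (auto intro!: \<beta>'_eq simp: \<beta>' add_hom_add[OF \<beta>_hom])

lemma \<beta>'_lact: "b \<in> carrier A ==> t \<in> carrier TT ==> \<beta>' (lact TT b t) = lact U b (\<beta>' t)"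
  by (rule \<beta>'_eq) (simp_all add: \<beta>' \<beta>_lact lact_closed[OF bim_left[OF U.bim_tensor]])

lemma \<beta>'_smult: "c \<in> carrier K ==> t \<in> carrier TT ==> \<beta>' (c \<odot>\<^bsub>TT\<^esub> t) = c \<odot>\<^bsub>U\<^esub> \<beta>' t"
  by (rule \<beta>'_eq) (simp_all add: \<beta>' \<beta>_smult module.smult_closed[OF bim_module[OF U.bim_tensor]])

lemma ac_closed: "a \<in> carrier A ==> c \<in> carrier C ==> ac a c \<in> carrier TT"
  using AC.ptens_closed[of a c] by (simp add: algcoalg_def)

lemma translation: "c \<in> carrier C ==> translation_map K C A \<rho> B c = \<beta>' (ac \<one>\<^bsub>A\<^esub> c)"
  unfolding translation_map_def
  by (rule the_equality) (simp add: \<beta>' ac_closed, metis \<beta>'_eq)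

section \<open>The canonical entwining map and the right action on A \<otimes> C\<close>

sublocale CA: tens_bim K "scalars K" "scalars K" "scalars K" "k_bimod C" "k_bimod A"
  rewrites "carrier (scalars K) = carrier K"
  using V.R.cring_axioms by (intro tens_bimI bim_k_bimod k_algebra_scalars V.module_axioms module_C) auto

abbreviation "\<psi> \<equiv> canonical_entwining K C A \<rho> B"
abbreviation "ca \<equiv> ptens (carrier K) (k_bimod C) (k_bimod A)"

lemma ac_add: "a \<in> carrier A ==> c \<in> carrier C ==> c' \<in> carrier C ==> ac a (c \<oplus>\<^bsub>C\<^esub> c') = ac a c \<oplus>\<^bsub>TT\<^esub> ac a c'"
  using AC.ptens_add_right[of a c c'] by (simp add: algcoalg_def)

lemma ac_smult: "k \<in> carrier K ==> a \<in> carrier A ==> c \<in> carrier C ==> ac a (k \<odot>\<^bsub>C\<^esub> c) = k \<odot>\<^bsub>TT\<^esub> ac a c"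
  using AC.smult_ptens_right[of k a c] by (simp add: algcoalg_def)

lemma ac_lact: "b \<in> carrier A ==> a \<in> carrier A ==> c \<in> carrier C ==> lact TT b (ac a c) = ac (b \<otimes>\<^bsub>A\<^esub> a) c"
  using AC.lact_ptens[of b a c] by (simp add: algcoalg_def)

lemmas lU = bim_left[OF U.bim_tensor] and rU = bim_right[OF U.bim_tensor] and agU = bim_abelian_group[OF U.bim_tensor]

sublocale Cm: module K C by (rule module_C)

lemma \<psi>_balanced: "balanced (carrier K) (k_bimod C) (k_bimod A) TT
    (\<lambda>c a. \<beta> (ract U (translation_map K C A \<rho> B c) a))"
proof (rule balancedI)
  fix x s y assume "x \<in> carrier (k_bimod C)" "s \<in> carrier K" "y \<in> carrier (k_bimod A)"
  then show "\<beta> (ract U (translation_map K C A \<rho> B (ract (k_bimod C) x s)) y) =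
      \<beta> (ract U (translation_map K C A \<rho> B x) (lact (k_bimod A) s y))"
    by (simp add: translation ac_smult ac_closed \<beta>'_smult \<beta>' smult_ract[OF algA rU])
qed (simp_all add: translation \<beta>' ac_closed ract_closed[OF rU] add_hom_closed[OF \<beta>_hom] ac_add
    add_hom_add[OF \<beta>'_hom] ract_add[OF rU] ract_add_right[OF rU] add_hom_add[OF \<beta>_hom])

lemma \<psi>_ca: "c \<in> carrier C ==> a \<in> carrier A ==> \<psi> (ca c a) = \<beta> (ract U (\<beta>' (ac \<one>\<^bsub>A\<^esub> c)) a)"
  unfolding canonical_entwining_def
  using CA.lift_ptens[OF agTT \<psi>_balanced, of c a] by (simp add: translation)

abbreviation "T \<equiv> entwined_bimod K A C \<psi>"

lemma T_simps: "carrier T = carrier TT" "add T = add TT" "zero T = zero TT" "smult T = smult TT" "lact T = lact TT"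
  "ract T t r = lift_hom TT (\<lambda>(a, c). lact TT a (\<psi> (ca c r))) t"
  by (simp_all add: entwined_bimod_def Let_def)

lemma ract_T_balanced: "r \<in> carrier A ==> balanced (carrier K) (left_regular A) (k_bimod C) TT (\<lambda>a c. lact TT a (\<psi> (ca c r)))"
  by (rule balancedI)
     (simp_all add: \<psi>_ca \<beta>' ac_closed ract_closed[OF rU] add_hom_closed[OF \<beta>_hom] ac_add
    add_hom_add[OF \<beta>'_hom] ract_add[OF rU] ract_add_right[OF rU] add_hom_add[OF \<beta>_hom]
    ac_smult \<beta>'_smult smult_ract[OF algA rU] \<beta>_smult lact_closed[OF lTT] lact_add[OF lTT] lact_add_left[OF lTT]
    smult_lact[OF algA lTT])

text \<open>On a \<otimes> c the action is a \<psi>(c \<otimes> r) = a \<beta>(\<gamma>(c) r) =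
  \<beta>(a \<gamma>(c) r), and a \<gamma>(c) is the preimage of a \<otimes> c. So the right action
  is right multiplication on A \<otimes>_B A carried over by \<beta>, and the bimodule axioms of T
  follow by transport.\<close>

lemma ract_T:
  assumes "t \<in> carrier TT" "r \<in> carrier A"
  shows "ract T t r = \<beta> (ract U (\<beta>' t) r)"
  unfolding T_simps
proof (rule AC.tensor_ext[where f = "lift_hom TT (\<lambda>(a, c). lact TT a (\<psi> (ca c r)))"
      and g = "\<lambda>t. \<beta> (ract U (\<beta>' t) r)", OF _ _ agTT])
  let ?f = "lift_hom TT (\<lambda>(a, c). lact TT a (\<psi> (ca c r)))"
  show "?f \<in> add_hom (tensor (carrier K) (left_regular A) (k_bimod C)) TT"
    by (rule AC.lift_add_hom[OF agTT ract_T_balanced[OF assms(2)]])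
  show "(\<lambda>t. \<beta> (ract U (\<beta>' t) r)) \<in> add_hom (tensor (carrier K) (left_regular A) (k_bimod C)) TT"
    using add_hom_compose[OF add_hom_compose[OF \<beta>'_hom ract_add_hom[OF rU assms(2)]] \<beta>_hom] by (simp add: algcoalg_def)
  show "t \<in> carrier (tensor (carrier K) (left_regular A) (k_bimod C))" using assms(1) by (simp add: algcoalg_def)
  fix a c assume "a \<in> carrier (left_regular A)" "c \<in> carrier (k_bimod C)"
  then have a: "a \<in> carrier A" and c: "c \<in> carrier C" by simp_all
  have "?f (ac a c) = lact TT a (\<psi> (ca c r))"
    using AC.lift_ptens[OF agTT ract_T_balanced[OF assms(2)], of a c] a c by simp
  also have "\<dots> = \<beta> (ract U (lact U a (\<beta>' (ac \<one>\<^bsub>A\<^esub> c))) r)"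
    using a c assms(2) by (simp add: \<psi>_ca \<beta>_lact[symmetric] \<beta>' ac_closed ract_closed[OF rU] bim_comm[OF U.bim_tensor])
  also have "lact U a (\<beta>' (ac \<one>\<^bsub>A\<^esub> c)) = \<beta>' (ac a c)"
    using a c by (simp add: \<beta>'_lact[symmetric] ac_closed ac_lact)
  finally show "?f (ac a c) = \<beta> (ract U (\<beta>' (ac a c)) r)" .
qed

lemma \<beta>_ract: "u \<in> carrier U ==> r \<in> carrier A ==> \<beta> (ract U u r) = ract T (\<beta> u) r"
  by (simp add: ract_T add_hom_closed[OF \<beta>_hom] \<beta>')

lemma bim_T: "bim K A A T"
proof -
  have mT: "module K T" by (rule module_cong[OF mTT]) (simp_all add: T_simps)
  have l: "left_module K A T"
    using lTT mT by (simp add: left_module_def T_simps(1-5))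
  have cl: "ract T x s \<in> carrier TT" if "x \<in> carrier TT" "s \<in> carrier A" for x s
    using that by (simp add: ract_T \<beta>' ract_closed[OF rU] add_hom_closed[OF \<beta>_hom])
  have r: "right_module K A T"
    unfolding right_module_def
  proof (intro conjI ballI mT)
    fix x s assume "x \<in> carrier T" "s \<in> carrier A"
    then show "ract T x s \<in> carrier T" by (simp add: T_simps(1) cl)
  next
    fix s x y assume "s \<in> carrier A" "x \<in> carrier T" "y \<in> carrier T"
    then have *: "s \<in> carrier A" "x \<in> carrier TT" "y \<in> carrier TT" by (simp_all add: T_simps(1))
    have xy: "x \<oplus>\<^bsub>TT\<^esub> y \<in> carrier TT" using * agTT by (simp add: abelian_group.axioms abelian_monoid.a_closed)
    show "ract T (x \<oplus>\<^bsub>T\<^esub> y) s = ract T x s \<oplus>\<^bsub>T\<^esub> ract T y s"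
      using * xy by (simp add: T_simps(2) ract_T add_hom_add[OF \<beta>'_hom] ract_add[OF rU] \<beta>' add_hom_add[OF \<beta>_hom] ract_closed[OF rU])
  next
    fix r s x assume "r \<in> carrier A" "s \<in> carrier A" "x \<in> carrier T"
    then have *: "r \<in> carrier A" "s \<in> carrier A" "x \<in> carrier TT" by (simp_all add: T_simps(1))
    show "ract T x (r \<oplus>\<^bsub>A\<^esub> s) = ract T x r \<oplus>\<^bsub>T\<^esub> ract T x s"
      using * by (simp add: T_simps(2) ract_T ract_add_right[OF rU] \<beta>' add_hom_add[OF \<beta>_hom] ract_closed[OF rU])
    show "ract T x (r \<otimes>\<^bsub>A\<^esub> s) = ract T (ract T x r) s"
      using * by (simp add: ract_T ract_mult[OF rU] \<beta>' add_hom_closed[OF \<beta>_hom] ract_closed[OF rU])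
  next
    fix x assume "x \<in> carrier T"
    then show "ract T x \<one>\<^bsub>A\<^esub> = x" by (simp add: T_simps(1) ract_T ract_one[OF rU] \<beta>')
  next
    fix c x assume "c \<in> carrier K" "x \<in> carrier T"
    then show "ract T x (c \<odot>\<^bsub>A\<^esub> \<one>\<^bsub>A\<^esub>) = c \<odot>\<^bsub>T\<^esub> x"
      by (simp add: T_simps(1,4) ract_T ract_scalar[OF rU] \<beta>' \<beta>_smult k_algebra_scalar_closed[OF algA])
  qed
  have "ract T (lact T r x) s = lact T r (ract T x s)"
    if "r \<in> carrier A" "s \<in> carrier A" "x \<in> carrier T" for r s x
    using that
    by (simp add: T_simps(1,5) ract_T lact_closed[OF lTT] \<beta>'_lact bim_comm[OF U.bim_tensor] \<beta>' \<beta>_lact ract_closed[OF rU])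
  with l r show ?thesis by (simp add: bim_def)
qed

sublocale X: entw K A C T
  by (intro entw.intro bar_alg.intro entw_axioms.intro algA field_K module_C bim_T T_simps(1-5))

section \<open>The central generator of T\<close>

definition unit_T :: "('a, 'c) tens" where
  "unit_T = \<rho> \<one>\<^bsub>A\<^esub>"

lemma unit_T_closed: "unit_T \<in> carrier T"
  by (simp add: unit_T_def T_simps(1) \<rho>D)

lemma \<beta>_unit: "a \<in> carrier A ==> a' \<in> carrier A ==> \<beta> (ut a a') = ract T (lact T a unit_T) a'"
proof -
  assume a: "a \<in> carrier A" "a' \<in> carrier A"
  have u: "unit_T = \<beta> (ut \<one>\<^bsub>A\<^esub> \<one>\<^bsub>A\<^esub>)"
    by (simp add: unit_T_def \<beta>_ut lact_one[OF lTT] \<rho>D(1))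
  have cl: "ut \<one>\<^bsub>A\<^esub> \<one>\<^bsub>A\<^esub> \<in> carrier U" "ut a \<one>\<^bsub>A\<^esub> \<in> carrier U" using a by (auto intro!: U.ptens_closed)
  have "ract T (lact T a unit_T) a' = \<beta> (ract U (lact U a (ut \<one>\<^bsub>A\<^esub> \<one>\<^bsub>A\<^esub>)) a')"
    using a cl by (simp add: u T_simps(5) \<beta>_lact[symmetric] \<beta>_ract lact_closed[OF lU])
  also have "\<dots> = \<beta> (ut a a')" using a cl by (simp add: U.lact_ptens U.ract_ptens)
  finally show ?thesis by simp
qed

text \<open>Under \<beta> both sides come from the equal tensors b \<otimes> 1 and 1 \<otimes> b
  over B.\<close>

lemma unit_T_central: "b \<in> carrier B ==> lact T b unit_T = ract T unit_T b"
proof -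
  assume b: "b \<in> carrier B"
  then have bA: "b \<in> carrier A" by (rule B_A)
  have "ut b \<one>\<^bsub>A\<^esub> = ut \<one>\<^bsub>A\<^esub> b" using U.ptens_swap[of "\<one>\<^bsub>A\<^esub>" b "\<one>\<^bsub>A\<^esub>"] b bA by simp
  then have "ract T (lact T b unit_T) \<one>\<^bsub>A\<^esub> = ract T (lact T \<one>\<^bsub>A\<^esub> unit_T) b"
    using \<beta>_unit[of b "\<one>\<^bsub>A\<^esub>"] \<beta>_unit[of "\<one>\<^bsub>A\<^esub>" b] bA by simp
  then show ?thesis
    using bA unit_T_closed by (simp add: ract_one[OF bim_right[OF bim_T]] lact_one[OF bim_left[OF bim_T]] lact_closed[OF bim_left[OF bim_T]])
qed

text \<open>The map is \<beta> itself, rewritten in terms of the bimodule T and one element. In this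
  form the Galois condition makes sense for the opposite algebras too.\<close>

lemma T_bij: "bij_betw (lift_hom T (\<lambda>(a, a'). ract T (lact T a unit_T) a')) (carrier U) (carrier T)"
proof -
  have bal: "balanced (carrier B) (regular A) (regular A) T (\<lambda>a a'. ract T (lact T a unit_T) a')"
    using B_A unit_T_closed
    by (intro balancedI) (simp_all add: ract_closed[OF bim_right[OF bim_T]] lact_closed[OF bim_left[OF bim_T]]
        lact_add_left[OF bim_left[OF bim_T]] ract_add[OF bim_right[OF bim_T]] ract_add_right[OF bim_right[OF bim_T]]
        lact_mult[OF bim_left[OF bim_T]] ract_mult[OF bim_right[OF bim_T]] unit_T_central bim_comm[OF bim_T])
  have "lift_hom T (\<lambda>(a, a'). ract T (lact T a unit_T) a') u = \<beta> u" if "u \<in> carrier U" for u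
  proof (rule U.tensor_ext[OF U.lift_add_hom[OF X.T_abelian_group bal] _ X.T_abelian_group _ that])
    show "\<beta> \<in> add_hom U T" using \<beta>_hom by (simp add: add_hom_def T_simps(1,2))
  qed (use U.lift_ptens[OF X.T_abelian_group bal] \<beta>_unit in simp)
  then have "bij_betw (lift_hom T (\<lambda>(a, a'). ract T (lact T a unit_T) a')) (carrier U) (carrier TT)"
    using \<beta>_bij by (simp cong: bij_betw_cong)
  then show ?thesis by (simp only: T_simps(1))
qed

end

section \<open>Opposite algebras\<close>

definition opa :: "('k, 'a) module \<Rightarrow> ('k, 'a) module" where
  "opa A = A\<lparr>mult := \<lambda>x y. y \<otimes>\<^bsub>A\<^esub> x\<rparr>"

definition opb :: "('k, 'r, 's, 'm) bimod \<Rightarrow> ('k, 's, 'r, 'm) bimod" where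
  "opb M = make_bimod M (smult M) (\<lambda>s x. ract M x s) (\<lambda>x r. lact M r x)"

lemma opa_simps [simp]:
  "carrier (opa A) = carrier A" "mult (opa A) x y = y \<otimes>\<^bsub>A\<^esub> x" "one (opa A) = one A"
  "zero (opa A) = zero A" "add (opa A) = add A" "smult (opa A) = smult A"
  by (simp_all add: opa_def)

lemma opb_simps [simp]:
  "carrier (opb M) = carrier M" "zero (opb M) = zero M" "add (opb M) = add M" "smult (opb M) = smult M"
  "lact (opb M) s x = ract M x s" "ract (opb M) x r = lact M r x"
  by (simp_all add: opb_def)

lemma opb_opb [simp]: "opb (opb M) = M"
  by (simp add: opb_def make_bimod_def)

lemma module_opb: "module K (opb M) \<longleftrightarrow> module K M"
  using module_cong[of K M "opb M"] module_cong[of K "opb M" M] by auto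

lemma left_module_opb: "left_module K (opa S) (opb M) \<longleftrightarrow> right_module K S M"
  by (auto simp: left_module_def right_module_def module_opb)

lemma right_module_opb: "right_module K (opa S) (opb M) \<longleftrightarrow> left_module K S M"
  by (auto simp: left_module_def right_module_def module_opb)

lemma left_module_opb': "left_module K S (opb M) \<longleftrightarrow> right_module K (opa S) M"
  using right_module_opb[of K S "opb M"] by simp

lemma bim_opb: "bim K (opa S) (opa R) (opb M) \<longleftrightarrow> bim K R S M"
  unfolding bim_def left_module_opb right_module_opb by auto

lemma left_hom_opb: "left_hom (opa R) (opb M) (opb N) = right_hom R M N"
  by (simp add: left_hom_def right_hom_def)

lemma right_hom_opb: "right_hom (opa R) (opb M) (opb N) = left_hom R M N"
  by (simp add: left_hom_def right_hom_def)

lemma bimod_hom_opb: "bimod_hom (opa R) (opb M) (opb N) = bimod_hom R M N"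
  by (auto simp: bimod_hom_def left_hom_opb right_hom_opb)

lemma opa_opa [simp]: "opa (opa A) = A"
  by (simp add: opa_def)

lemma k_algebra_opa:
  assumes "k_algebra K A"
  shows "k_algebra K (opa A)"
proof -
  interpret A: ring A by (rule k_algebra_ring[OF assms])
  have "module K (opa A)" by (rule module_cong[OF k_algebra_module[OF assms]]) simp_all
  moreover have "ring (opa A)"
    by (rule ringI) (auto intro!: abelian_group_cong[OF A.abelian_group_axioms] monoidI simp: A.l_distr A.r_distr A.m_assoc)
  ultimately show ?thesis
    by (simp add: k_algebra_def k_algebra_smult_left[OF assms] k_algebra_smult_right[OF assms])
qed

lemma subalg_opa:
  assumes "subalg K A B"
  shows "subalg K (opa A) (opa B)"
proof -
  have "mult (opa B) = mult (opa A)" by (intro ext) (simp add: subalgD(4)[OF assms])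
  then show ?thesis using assms by (simp add: subalg_def k_algebra_opa)
qed

section \<open>Flipping a tensor product\<close>

lemma tens_opb:
  assumes "tens S X Y"
  shows "tens S (opb Y) (opb X)"
proof -
  interpret tens S X Y by fact
  show ?thesis
    using ok by unfold_locales (auto simp: tens_ok_def intro: abelian_group_cong)
qed

definition flip :: "'s set \<Rightarrow> ('k, 'r, 's, 'x) bimod \<Rightarrow> ('k, 's, 't, 'y) bimod \<Rightarrow>
    ('x, 'y) tens \<Rightarrow> ('y, 'x) tens" where
  "flip S X Y = lift_hom (tensor S (opb Y) (opb X)) (\<lambda>(x, y). ptens S (opb Y) (opb X) y x)"

lemma flip:
  assumes "tens S X Y"
  shows flip_hom: "flip S X Y \<in> add_hom (tensor S X Y) (tensor S (opb Y) (opb X))"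
    and flip_ptens: "\<And>x y. x \<in> carrier X ==> y \<in> carrier Y ==>
      flip S X Y (ptens S X Y x y) = ptens S (opb Y) (opb X) y x"
proof -
  interpret T: tens S X Y by fact
  interpret T': tens S "opb Y" "opb X" by (rule tens_opb[OF assms])
  have "balanced S X Y (tensor S (opb Y) (opb X)) (\<lambda>x y. ptens S (opb Y) (opb X) y x)"
  proof (rule balancedI)
    fix x s y assume "x \<in> carrier X" "s \<in> S" "y \<in> carrier Y"
    then show "ptens S (opb Y) (opb X) y (ract X x s) = ptens S (opb Y) (opb X) (lact Y s y) x"
      using T'.ptens_swap[of y s x] by simp
  next
    fix x x' y assume "x \<in> carrier X" "x' \<in> carrier X" "y \<in> carrier Y"
    then show "ptens S (opb Y) (opb X) y (x \<oplus>\<^bsub>X\<^esub> x') = ptens S (opb Y) (opb X) y x \<oplus>\<^bsub>tensor S (opb Y) (opb X)\<^esub> ptens S (opb Y) (opb X) y x'"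
      using T'.ptens_add_right[of y x x'] by simp
  next
    fix x y y' assume "x \<in> carrier X" "y \<in> carrier Y" "y' \<in> carrier Y"
    then show "ptens S (opb Y) (opb X) (y \<oplus>\<^bsub>Y\<^esub> y') x = ptens S (opb Y) (opb X) y x \<oplus>\<^bsub>tensor S (opb Y) (opb X)\<^esub> ptens S (opb Y) (opb X) y' x"
      using T'.ptens_add_left[of y y' x] by simp
  qed (use T'.ptens_closed in simp)
  from T.lift[OF T'.P.abelian_group this]
  show "flip S X Y \<in> add_hom (tensor S X Y) (tensor S (opb Y) (opb X))"
    "\<And>x y. x \<in> carrier X ==> y \<in> carrier Y ==> flip S X Y (ptens S X Y x y) = ptens S (opb Y) (opb X) y x"
    unfolding flip_def by auto
qed

lemma flip_flip:
  assumes "tens S X Y" "t \<in> carrier (tensor S X Y)"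
  shows "flip S (opb Y) (opb X) (flip S X Y t) = t"
proof -
  interpret T: tens S X Y by fact
  interpret T': tens S "opb Y" "opb X" by (rule tens_opb[OF assms(1)])
  note f = flip[OF assms(1)] and f' = flip[OF tens_opb[OF assms(1)], unfolded opb_opb]
  show ?thesis
    by (rule T.tensor_ext[OF add_hom_compose[OF f(1) f'(1)] add_hom_id T.P.abelian_group _ assms(2)])
       (simp add: f f')
qed

section \<open>Flatness\<close>

lemma tensor_cong_right:
  assumes "carrier Y' = carrier Y" "add Y' = add Y" "lact Y' = lact Y" "ract Y' = ract Y"
  shows "tensor S X Y' = tensor S X Y" "ptens S X Y' = ptens S X Y" "tensor_map S X Y' f g = tensor_map S X Y f g"
proof -
  have r: "tensor_rels S X Y' = tensor_rels S X Y" by (simp add: tensor_rels_def assms)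
  show p: "ptens S X Y' = ptens S X Y" by (intro ext) (simp add: ptens_def r assms)
  show t: "tensor S X Y' = tensor S X Y" by (simp add: tensor_def r p assms)
  show "tensor_map S X Y' f g = tensor_map S X Y f g" by (simp add: tensor_map_def t p)
qed

lemma tensor_cong_left:
  assumes "carrier X' = carrier X" "add X' = add X" "lact X' = lact X" "ract X' = ract X" "smult X' = smult X"
  shows "tensor S X' Y = tensor S X Y" "ptens S X' Y = ptens S X Y"
proof -
  have r: "tensor_rels S X' Y = tensor_rels S X Y" by (simp add: tensor_rels_def assms)
  show p: "ptens S X' Y = ptens S X Y" by (intro ext) (simp add: ptens_def r assms)
  show t: "tensor S X' Y = tensor S X Y" by (simp add: tensor_def r p assms)
qed

text \<open>\<open>regular (opa A)\<close> and \<open>opb (regular A)\<close> are the same module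
  but different records, as they differ in \<open>mult\<close>; flatness has to be carried from one
  to the other.\<close>

lemma left_flat_cong:
  assumes "left_flat ty K R X" "module K X'" "carrier X' = carrier X" "add X' = add X" "zero X' = zero X"
    "smult X' = smult X" "lact X' = lact X" "ract X' = ract X"
  shows "left_flat ty K R X'"
proof -
  have "left_module K R X'" using assms by (simp add: left_flat_def left_module_def)
  then show ?thesis
    using assms(1) unfolding left_flat_def
    by (simp add: tensor_cong_right[OF assms(3,4,7,8)])
qed

text \<open>Flipping source and target conjugates f \<otimes> id into id \<otimes> f, and flips are
  bijective.\<close>

lemma right_flat_opb:
  fixes ty :: "'n itself" and R :: "('k, 'r) module" and X :: "('k, 'l, 'r, 'x) bimod"
  assumes "right_flat ty K R X"
  shows "left_flat ty K (opa R) (opb X)"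
  unfolding left_flat_def
proof (intro conjI allI impI)
  have X: "right_module K R X" using assms by (simp add: right_flat_def)
  then show lX: "left_module K (opa R) (opb X)" by (simp add: left_module_opb)
  fix N N' :: "('k, 'r, 'r, 'n) bimod" and f :: "'n \<Rightarrow> 'n"
  assume *: "right_module K (opa R) N \<and> right_module K (opa R) N' \<and> f \<in> right_hom (opa R) N N' \<and> inj_on f (carrier N)"
  have N: "left_module K R (opb N)" "left_module K R (opb N')" using * by (simp_all add: left_module_opb')
  have f: "f \<in> left_hom R (opb N) (opb N')"
    using * right_hom_opb[of R "opb N" "opb N'"] by simp
  have inj: "inj_on (tensor_map (carrier R) X (opb N') id f) (carrier (tensor (carrier R) X (opb N)))"
    by (rule assms[unfolded right_flat_def, THEN conjunct2, rule_format]) (use N f * in simp)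
  have t1: "tens (carrier R) N (opb X)" and t2: "tens (carrier R) N' (opb X)"
    using * tens_ok_modules[OF _ lX] by (auto simp: tens_def)
  interpret T1: tens "carrier R" N "opb X" by (rule t1)
  interpret T2: tens "carrier R" N' "opb X" by (rule t2)
  have t3: "tens (carrier R) X (opb N)" and t4: "tens (carrier R) X (opb N')"
    using tens_opb[OF t1] tens_opb[OF t2] by simp_all
  interpret T3: tens "carrier R" X "opb N" by (rule t3)
  interpret T4: tens "carrier R" X "opb N'" by (rule t4)
  note f1 = flip[OF t1, unfolded opb_opb] and f2 = flip[OF t2, unfolded opb_opb]
  interpret M: tens_map "carrier R" N "opb X" N' "opb X" f id
    using * right_homD[of f "opa R" N N'] by unfold_locales (auto simp: add_hom_def)
  interpret M': tens_map "carrier R" X "opb N" X "opb N'" id f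
    using left_homD[OF f] by unfold_locales (auto simp: add_hom_def)
  have nat: "flip (carrier R) N' (opb X) (tensor_map (carrier R) N' (opb X) f id t) =
      tensor_map (carrier R) X (opb N') id f (flip (carrier R) N (opb X) t)"
    if "t \<in> carrier (tensor (carrier R) N (opb X))" for t
    by (rule T1.tensor_ext[OF add_hom_compose[OF M.map_hom f2(1)] add_hom_compose[OF f1(1) M'.map_hom] T4.P.abelian_group _ that])
       (use * in \<open>simp add: M.map_ptens f1 f2 M'.map_ptens add_hom_closed[OF M.f]\<close>)
  show "inj_on (tensor_map (carrier (opa R)) N' (opb X) f id) (carrier (tensor (carrier (opa R)) N (opb X)))"
    unfolding opa_simps
  proof (rule inj_onI)
    fix s t assume st: "s \<in> carrier (tensor (carrier R) N (opb X))" "t \<in> carrier (tensor (carrier R) N (opb X))"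
      and eq: "tensor_map (carrier R) N' (opb X) f id s = tensor_map (carrier R) N' (opb X) f id t"
    have "flip (carrier R) N (opb X) s = flip (carrier R) N (opb X) t"
      using inj_onD[OF inj] nat[OF st(1)] nat[OF st(2)] eq add_hom_closed[OF f1(1)] st by simp
    then show "s = t" using flip_flip[OF t1 st(1)] flip_flip[OF t1 st(2)] by simp
  qed
qed

subsection \<open>Testing flatness on finitely generated submodules\<close>

lemma gspan_mono: "R \<subseteq> R' ==> gspan R \<subseteq> gspan R'"
proof
  fix a assume "R \<subseteq> R'" "a \<in> gspan R"
  from this(2,1) show "a \<in> gspan R'" by induction (auto intro: gspan.intros)
qed

lemma tensor_rels_mono:
  "carrier X \<subseteq> carrier X' ==> add X' = add X ==> ract X' = ract X ==> tensor_rels S X Y \<subseteq> tensor_rels S X' Y"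
  unfolding tensor_rels_def by (intro Un_mono) auto

text \<open>An element of the relator subgroup is built from finitely many relators, each of which
  involves at most two elements of X besides those obtained by adding or acting. The finite set D is
  used as a carrier without being closed under the operations.\<close>

lemma gspan_tensor_finite:
  assumes "p \<in> gspan (tensor_rels S X Y)"
  obtains D where "finite D" "D \<subseteq> carrier X" "p \<in> gspan (tensor_rels S (X\<lparr>carrier := D\<rparr>) Y)"
proof -
  have "\<exists>D. finite D \<and> D \<subseteq> carrier X \<and> p \<in> gspan (tensor_rels S (X\<lparr>carrier := D\<rparr>) Y)"
    using assms
  proof induction
    case zero
    show ?case by (intro exI[of _ "{}"]) (auto intro: gspan.zero)
  next
    case (base r)
    then consider (1) x x' y where "r = frag_of (x \<oplus>\<^bsub>X\<^esub> x', y) - frag_of (x, y) - frag_of (x', y)"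
        "x \<in> carrier X" "x' \<in> carrier X" "y \<in> carrier Y"
      | (2) x y y' where "r = frag_of (x, y \<oplus>\<^bsub>Y\<^esub> y') - frag_of (x, y) - frag_of (x, y')"
        "x \<in> carrier X" "y \<in> carrier Y" "y' \<in> carrier Y"
      | (3) x s y where "r = frag_of (ract X x s, y) - frag_of (x, lact Y s y)"
        "x \<in> carrier X" "s \<in> S" "y \<in> carrier Y"
      unfolding tensor_rels_def by blast
    then show ?case
    proof cases
      case 1
      have "r \<in> tensor_rels S (X\<lparr>carrier := {x, x'}\<rparr>) Y"
        unfolding tensor_rels_def
        by (rule UnI1, rule UnI1, rule CollectI, rule exI[of _ x], rule exI[of _ x'], rule exI[of _ y]) (use 1 in simp)
      with 1 show ?thesis by (intro exI[of _ "{x, x'}"] conjI gspan.base) auto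
    next
      case 2
      have "r \<in> tensor_rels S (X\<lparr>carrier := {x}\<rparr>) Y"
        unfolding tensor_rels_def
        by (rule UnI1, rule UnI2, rule CollectI, rule exI[of _ x], rule exI[of _ y], rule exI[of _ y']) (use 2 in simp)
      with 2 show ?thesis by (intro exI[of _ "{x}"] conjI gspan.base) auto
    next
      case 3
      have "r \<in> tensor_rels S (X\<lparr>carrier := {x}\<rparr>) Y"
        unfolding tensor_rels_def
        by (rule UnI2, rule CollectI, rule exI[of _ x], rule exI[of _ s], rule exI[of _ y]) (use 3 in simp)
      with 3 show ?thesis by (intro exI[of _ "{x}"] conjI gspan.base) auto
    qed
  next
    case (diff a b)
    then obtain D D' where D: "finite D" "D \<subseteq> carrier X" "a \<in> gspan (tensor_rels S (X\<lparr>carrier := D\<rparr>) Y)"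
      "finite D'" "D' \<subseteq> carrier X" "b \<in> gspan (tensor_rels S (X\<lparr>carrier := D'\<rparr>) Y)" by blast
    have "gspan (tensor_rels S (X\<lparr>carrier := D\<rparr>) Y) \<subseteq> gspan (tensor_rels S (X\<lparr>carrier := D \<union> D'\<rparr>) Y)"
      "gspan (tensor_rels S (X\<lparr>carrier := D'\<rparr>) Y) \<subseteq> gspan (tensor_rels S (X\<lparr>carrier := D \<union> D'\<rparr>) Y)"
      by (intro gspan_mono tensor_rels_mono; auto)+
    with D show ?case by (intro exI[of _ "D \<union> D'"]) (auto intro: gspan.diff)
  qed
  then show thesis using that by blast
qed

text \<open>Scalars act through c 1 in R and negation is the scalar -1, so closure under addition
  and the right action gives a submodule.\<close>

lemma right_module_sub:
  assumes M: "right_module K R M" and D: "D \<subseteq> carrier M" "\<zero>\<^bsub>M\<^esub> \<in> D" "\<And>x y. x \<in> D ==> y \<in> D ==> x \<oplus>\<^bsub>M\<^esub> y \<in> D"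
    "\<And>x r. x \<in> D ==> r \<in> carrier R ==> ract M x r \<in> D" and R: "k_algebra K R"
  shows "right_module K R (M\<lparr>carrier := D\<rparr>)"
proof -
  interpret M: module K M by (rule right_module_module[OF M])
  have sm: "c \<odot>\<^bsub>M\<^esub> x \<in> D" if "c \<in> carrier K" "x \<in> D" for c x
  proof -
    have "ract M x (c \<odot>\<^bsub>R\<^esub> \<one>\<^bsub>R\<^esub>) \<in> D" using that by (intro D k_algebra_scalar_closed[OF R])
    then show ?thesis using ract_scalar[OF M that(1), of x] that D(1) by auto
  qed
  have neg: "\<ominus>\<^bsub>M\<^esub> x \<in> D" if "x \<in> D" for x
  proof -
    have "(\<ominus>\<^bsub>K\<^esub> \<one>\<^bsub>K\<^esub>) \<odot>\<^bsub>M\<^esub> x \<in> D" using that by (intro sm) auto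
    moreover have "x \<in> carrier M" using that D by auto
    ultimately show ?thesis by (simp add: M.smult_l_minus)
  qed
  have "submodule D K M" by (rule M.submoduleI) (use D sm neg in auto)
  then have "module K (M\<lparr>carrier := D\<rparr>)" by (rule submodule.submodule_is_module) (rule M.module_axioms)
  then show ?thesis using M D by (auto simp: right_module_def subset_iff)
qed

text \<open>Transport of structure along an injection into another type. Only the right module
  structure is carried over, since that is what flatness of a left module tests.\<close>

definition timg :: "('m \<Rightarrow> 'n) \<Rightarrow> ('k, 'r, 's, 'm) bimod \<Rightarrow> ('k, 'q, 's, 'n) bimod" where
  "timg \<iota> M = (let i = inv_into (carrier M) \<iota> in
     \<lparr>carrier = \<iota> ` carrier M, mult = undefined, one = undefined, zero = \<iota> \<zero>\<^bsub>M\<^esub>,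
      add = (\<lambda>x y. \<iota> (i x \<oplus>\<^bsub>M\<^esub> i y)), smult = (\<lambda>c x. \<iota> (c \<odot>\<^bsub>M\<^esub> i x)), lact = undefined,
      ract = (\<lambda>x s. \<iota> (ract M (i x) s))\<rparr>)"

lemma timg_simps:
  assumes "inj_on \<iota> (carrier M)"
  shows "carrier (timg \<iota> M) = \<iota> ` carrier M" "zero (timg \<iota> M) = \<iota> \<zero>\<^bsub>M\<^esub>"
    "\<And>x y. x \<in> carrier M ==> y \<in> carrier M ==> \<iota> x \<oplus>\<^bsub>timg \<iota> M\<^esub> \<iota> y = \<iota> (x \<oplus>\<^bsub>M\<^esub> y)"
    "\<And>c x. x \<in> carrier M ==> c \<odot>\<^bsub>timg \<iota> M\<^esub> \<iota> x = \<iota> (c \<odot>\<^bsub>M\<^esub> x)"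
    "\<And>s x. x \<in> carrier M ==> ract (timg \<iota> M) (\<iota> x) s = \<iota> (ract M x s)"
  using assms by (simp_all add: timg_def Let_def)

lemma right_module_timg:
  assumes M: "right_module K R M" and inj: "inj_on \<iota> (carrier M)"
  shows "right_module K R (timg \<iota> M)"
proof -
  interpret M: module K M by (rule right_module_module[OF M])
  note s = timg_simps[OF inj]
  have "abelian_group (timg \<iota> M)"
  proof (rule abelian_groupI)
    fix x assume "x \<in> carrier (timg \<iota> M)"
    then obtain u where u: "u \<in> carrier M" "x = \<iota> u" by (auto simp: s)
    then show "\<exists>y\<in>carrier (timg \<iota> M). y \<oplus>\<^bsub>timg \<iota> M\<^esub> x = \<zero>\<^bsub>timg \<iota> M\<^esub>"
      by (intro bexI[of _ "\<iota> (\<ominus>\<^bsub>M\<^esub> u)"]) (auto simp: s M.l_neg)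
  qed (auto simp: s M.a_ac)
  then have "module K (timg \<iota> M)"
    by (rule moduleI[OF M.R.is_cring]) (auto simp: s M.smult_l_distr M.smult_r_distr M.smult_assoc1)
  then show ?thesis
    using M by (auto simp: right_module_def s)
qed

fun rlc :: "('k, 'r, 's, 'm) bimod \<Rightarrow> 'm list \<Rightarrow> 's list \<Rightarrow> 'm" where
  "rlc M (g # gs) (b # bs) = ract M g b \<oplus>\<^bsub>M\<^esub> rlc M gs bs"
| "rlc M _ _ = \<zero>\<^bsub>M\<^esub>"

context
  fixes K :: "('k, 'z) ring_scheme" and R :: "('k, 's) module" and M :: "('k, 'r, 's, 'm) bimod"
  assumes M: "right_module K R M" and R: "k_algebra K R"
begin

interpretation M: abelian_group M by (rule right_module_abelian_group[OF M])
interpretation R: ring R by (rule k_algebra_ring[OF R])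

lemma rlc_closed: "set gs \<subseteq> carrier M ==> set bs \<subseteq> carrier R ==> rlc M gs bs \<in> carrier M"
proof (induction gs arbitrary: bs)
  case (Cons g gs)
  then show ?case by (cases bs) (auto simp: ract_closed[OF M])
qed simp

lemma rlc_add:
  "length bs = length gs ==> length cs = length gs ==> set gs \<subseteq> carrier M ==> set bs \<subseteq> carrier R ==>
   set cs \<subseteq> carrier R ==> rlc M gs bs \<oplus>\<^bsub>M\<^esub> rlc M gs cs = rlc M gs (map2 (add R) bs cs)"
proof (induction gs arbitrary: bs cs)
  case (Cons g gs)
  then obtain b bs' c cs' where *: "bs = b # bs'" "cs = c # cs'" by (auto simp: length_Suc_conv)
  have cl: "rlc M gs bs' \<in> carrier M" "rlc M gs cs' \<in> carrier M" "ract M g b \<in> carrier M" "ract M g c \<in> carrier M"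
    using Cons.prems * by (auto intro!: rlc_closed ract_closed[OF M])
  have "rlc M gs bs' \<oplus>\<^bsub>M\<^esub> rlc M gs cs' = rlc M gs (map2 (add R) bs' cs')"
    using Cons.prems * by (intro Cons.IH) auto
  then show ?case
    using Cons.prems * cl by (simp add: ract_add_right[OF M] M.a_ac flip: M.a_assoc) (metis M.a_assoc M.a_comm M.add.m_closed)
qed auto

lemma rlc_ract:
  "length bs = length gs ==> set gs \<subseteq> carrier M ==> set bs \<subseteq> carrier R ==> r \<in> carrier R ==>
   ract M (rlc M gs bs) r = rlc M gs (map (\<lambda>b. b \<otimes>\<^bsub>R\<^esub> r) bs)"
proof (induction gs arbitrary: bs)
  case Nil
  then show ?case
    using add_hom_zero[OF ract_add_hom[OF M, of r]] M.abelian_group_axioms by simp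
next
  case (Cons g gs)
  then obtain b bs' where *: "bs = b # bs'" by (auto simp: length_Suc_conv)
  have cl: "rlc M gs bs' \<in> carrier M" "ract M g b \<in> carrier M"
    using Cons.prems * by (auto intro!: rlc_closed ract_closed[OF M])
  show ?case
    using Cons * cl by (simp add: ract_add[OF M] ract_mult[OF M])
qed

lemma ract_zero: "x \<in> carrier M ==> ract M x \<zero>\<^bsub>R\<^esub> = \<zero>\<^bsub>M\<^esub>"
  by (rule add_hom_zero[where f = "ract M x", OF _ R.abelian_group_axioms M.abelian_group_axioms])
     (auto intro!: add_homI simp: ract_closed[OF M] ract_add_right[OF M])

lemma rlc_zero: "set gs \<subseteq> carrier M ==> rlc M gs (replicate (length gs) \<zero>\<^bsub>R\<^esub>) = \<zero>\<^bsub>M\<^esub>"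
  by (induction gs) (auto simp: ract_zero)

lemma rlc_member:
  "set gs \<subseteq> carrier M ==> g \<in> set gs ==> \<exists>bs. length bs = length gs \<and> set bs \<subseteq> carrier R \<and> rlc M gs bs = g"
proof (induction gs)
  case (Cons h gs)
  show ?case
  proof (cases "g = h")
    case True
    then show ?thesis
      using Cons.prems rlc_zero[of gs]
      by (intro exI[of _ "\<one>\<^bsub>R\<^esub> # replicate (length gs) \<zero>\<^bsub>R\<^esub>"]) (auto simp: ract_one[OF M])
  next
    case False
    then obtain bs where "length bs = length gs" "set bs \<subseteq> carrier R" "rlc M gs bs = g" "g \<in> carrier M"
      using Cons by auto
    then show ?thesis
      using Cons.prems by (intro exI[of _ "\<zero>\<^bsub>R\<^esub> # bs"]) (auto simp: ract_zero)
  qed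
qed simp

text \<open>Coefficient lists embed a finitely generated module into the test type of the flatness hypothesis.\<close>

lemma finite_span:
  assumes "finite G" "G \<subseteq> carrier M"
  obtains D and \<iota> :: "'m \<Rightarrow> 's chain" where "G \<subseteq> D" "D \<subseteq> carrier M" "\<zero>\<^bsub>M\<^esub> \<in> D" "inj_on \<iota> D"
    "\<And>x y. x \<in> D ==> y \<in> D ==> x \<oplus>\<^bsub>M\<^esub> y \<in> D" "\<And>x r. x \<in> D ==> r \<in> carrier R ==> ract M x r \<in> D"
proof -
  obtain gs where gs: "set gs = G" using finite_list[OF assms(1)] by blast
  let ?ok = "\<lambda>bs. length bs = length gs \<and> set bs \<subseteq> carrier R"
  define D where "D = {rlc M gs bs | bs. ?ok bs}"
  define \<kappa> where "\<kappa> x = (SOME bs. ?ok bs \<and> rlc M gs bs = x)" for x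
  have \<kappa>: "rlc M gs (\<kappa> x) = x" if "x \<in> D" for x
  proof -
    have "\<exists>bs. ?ok bs \<and> rlc M gs bs = x" using that by (auto simp: D_def)
    from someI_ex[OF this] show ?thesis by (simp add: \<kappa>_def)
  qed
  have gM: "set gs \<subseteq> carrier M" using gs assms by simp
  show thesis
  \<comment> \<open>\<kappa> x is one coefficient list for x. The singleton of its basis vector is
    an element of the test type, and x is recovered from it by forming the linear
    combination.\<close>
  proof (rule that[of D "\<lambda>x. {frag_of (\<kappa> x)}"])
    show "G \<subseteq> D"
    proof
      fix g assume "g \<in> G"
      then obtain bs where "?ok bs" "rlc M gs bs = g" using rlc_member[OF gM] gs by blast
      then show "g \<in> D" by (auto simp: D_def)
    qed
    show "D \<subseteq> carrier M" using rlc_closed[OF gM] by (auto simp: D_def)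
    show "\<zero>\<^bsub>M\<^esub> \<in> D" unfolding D_def
      using rlc_zero[OF gM] by (intro CollectI exI[of _ "replicate (length gs) \<zero>\<^bsub>R\<^esub>"]) auto
    show "inj_on (\<lambda>x. {frag_of (\<kappa> x)}) D"
      by (rule inj_onI) (metis \<kappa> frag_of_eq singleton_inject)
    fix x assume "x \<in> D"
    then obtain bs where bs: "?ok bs" "x = rlc M gs bs" by (auto simp: D_def)
    { fix y assume "y \<in> D"
      then obtain cs where cs: "?ok cs" "y = rlc M gs cs" by (auto simp: D_def)
      have "set (map2 (add R) bs cs) \<subseteq> carrier R"
      proof
        fix z assume "z \<in> set (map2 (add R) bs cs)"
        then obtain a b where "(a, b) \<in> set (zip bs cs)" "z = a \<oplus>\<^bsub>R\<^esub> b" by auto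
        moreover from this have "a \<in> set bs" "b \<in> set cs" by (auto dest: set_zip_leftD set_zip_rightD)
        ultimately show "z \<in> carrier R" using bs cs by auto
      qed
      then show "x \<oplus>\<^bsub>M\<^esub> y \<in> D"
        using bs cs rlc_add[of bs gs cs] gM unfolding D_def
        by (intro CollectI exI[of _ "map2 (add R) bs cs"]) auto }
    fix r assume r: "r \<in> carrier R"
    then show "ract M x r \<in> D"
      using bs rlc_ract[of bs gs r] gM unfolding D_def
      by (intro CollectI exI[of _ "map (\<lambda>b. b \<otimes>\<^bsub>R\<^esub> r) bs"]) auto
  qed
qed

end

section \<open>Flatness against modules of arbitrary carrier type\<close>

lemma keys_frag_map: "Poly_Mapping.keys (frag_extend (frag_of \<circ> h) p) \<subseteq> h ` Poly_Mapping.keys p"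
  using keys_frag_extend[of "frag_of \<circ> h" p] by (auto simp: keys_frag_of)

lemma (in tens_map) map_gcls:
  assumes "Poly_Mapping.keys p \<subseteq> carrier X \<times> carrier Y"
  shows "tensor_map S X' Y' f g (gcls (tensor_rels S X Y) p) =
    gcls (tensor_rels S X' Y') (frag_extend (frag_of \<circ> map_prod f g) p)"
proof -
  have cl: "Poly_Mapping.keys (frag_extend (frag_of \<circ> map_prod f g) q) \<subseteq> carrier X' \<times> carrier Y'"
    if "Poly_Mapping.keys q \<subseteq> carrier X \<times> carrier Y" for q
    by (rule subset_trans[OF keys_frag_map]) (use that add_hom_closed[OF f] add_hom_closed[OF g] in auto)
  show ?thesis
    using assms
  proof (induction p rule: free_Abelian_group_induct[consumes 1])
    case 1
    show ?case using add_hom_zero[OF map_hom T.P.abelian_group T'.P.abelian_group] by (simp add: T.P.zero_eq T'.P.zero_eq)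
  next
    case (2 x y)
    then show ?case
      using add_hom_minus[OF map_hom T.P.abelian_group T'.P.abelian_group T.P.gcls_closed T.P.gcls_closed, of x y]
      by (simp only: T.P.diff_eq T'.P.diff_eq[OF cl cl] frag_extend_diff)
  next
    case (3 a)
    then obtain x y where "a = (x, y)" "x \<in> carrier X" "y \<in> carrier Y" by auto
    then show ?case using map_ptens[of x y] by (simp add: ptens_def T.P.gen_eq T'.P.gen_eq)
  qed
qed

text \<open>The hypothesis speaks about modules inside \<open>'a chain\<close> only. The proof that
  the image of t vanishes uses finitely many elements of N'; these and the entries of t span a
  finitely generated D, and D with its submodule D \<inter> f(N) can be copied into the test type.
  Injectivity there kills the copy of t, which is then sent back to N.\<close>

lemma flat_vanish:
  fixes R :: "('k, 'a) module" and N :: "('k, 'r, 'a, 'n) bimod" and N' :: "('k, 'q, 'a, 'n1) bimod"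
    and Y :: "('k, 'a, 't, 'y) bimod"
  assumes flat: "left_flat TYPE('a chain) K R Y" and R: "k_algebra K R"
    and N: "right_module K R N" and N': "right_module K R N'"
    and f: "f \<in> add_hom N N'" "\<And>x r. x \<in> carrier N ==> r \<in> carrier R ==> f (ract N x r) = ract N' (f x) r"
    and inj: "inj_on f (carrier N)"
    and t: "t \<in> carrier (tensor (carrier R) N Y)"
    and zero: "tensor_map (carrier R) N' Y f id t = \<zero>\<^bsub>tensor (carrier R) N' Y\<^esub>"
  shows "t = \<zero>\<^bsub>tensor (carrier R) N Y\<^esub>"
proof -
  let ?B = "carrier R"
  have Y: "left_module K R Y" using flat by (simp add: left_flat_def)
  have tens: "tens ?B L Y" if "right_module K R L" for L :: "('k, 'u, 'a, 'v) bimod"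
    using tens_ok_modules[OF that Y] by (simp add: tens_def)
  interpret TN: tens ?B N Y by (rule tens[OF N])
  interpret TN': tens ?B N' Y by (rule tens[OF N'])
  interpret M: tens_map ?B N Y N' Y f id
    by unfold_locales (use f in \<open>auto simp: add_hom_def\<close>)
  let ?m = "\<lambda>h. frag_extend (frag_of \<circ> map_prod h id)"
  obtain p where p: "Poly_Mapping.keys p \<subseteq> carrier N \<times> carrier Y" "t = gcls (tensor_rels ?B N Y) p"
    using t by (auto simp: TN.P.carrier_eq)
  have keys: "x \<in> carrier N" "y \<in> carrier Y" "f x \<in> carrier N'" if "(x, y) \<in> Poly_Mapping.keys p" for x y
    using p(1) that add_hom_closed[OF f(1)] by auto
  have "gcls (tensor_rels ?B N' Y) (?m f p) = gcls (tensor_rels ?B N' Y) 0"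
    using zero M.map_gcls[OF p(1)] p(2) by (simp add: TN'.P.zero_eq)
  then have "?m f p \<in> gspan (tensor_rels ?B N' Y)" by (simp add: gcls_eq_iff)
  then obtain W where W: "finite W" "W \<subseteq> carrier N'" "?m f p \<in> gspan (tensor_rels ?B (N'\<lparr>carrier := W\<rparr>) Y)"
    by (rule gspan_tensor_finite)
  \<comment> \<open>W carries the relators that kill the image of t; the second set makes sure that
    the representative p itself has its image over D.\<close>
  let ?G = "W \<union> f ` fst ` Poly_Mapping.keys p"
  have "finite ?G" "?G \<subseteq> carrier N'" using W keys by auto
  from finite_span[OF N' R this] obtain D and \<iota> :: "'n1 \<Rightarrow> 'a chain" where
    D: "?G \<subseteq> D" "D \<subseteq> carrier N'" "\<zero>\<^bsub>N'\<^esub> \<in> D" "inj_on \<iota> D"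
    "\<And>x y. x \<in> D ==> y \<in> D ==> x \<oplus>\<^bsub>N'\<^esub> y \<in> D" "\<And>x r. x \<in> D ==> r \<in> carrier R ==> ract N' x r \<in> D"
    by metis
  have f0: "f \<zero>\<^bsub>N\<^esub> = \<zero>\<^bsub>N'\<^esub>" by (rule add_hom_zero[OF f(1) TN.X.abelian_group_axioms TN'.X.abelian_group_axioms])
  let ?D1 = "D \<inter> f ` carrier N"
  let ?ND = "N'\<lparr>carrier := D\<rparr>" and ?N1 = "N'\<lparr>carrier := ?D1\<rparr>"
  have ND: "right_module K R ?ND" by (rule right_module_sub[OF N' D(2,3,5,6) R])
  have N1: "right_module K R ?N1"
  proof (rule right_module_sub[OF N' _ _ _ _ R])
    show "\<zero>\<^bsub>N'\<^esub> \<in> ?D1" using D(3) f0 TN.X.zero_closed by (metis IntI image_eqI)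
    fix x y assume "x \<in> ?D1" "y \<in> ?D1"
    then show "x \<oplus>\<^bsub>N'\<^esub> y \<in> ?D1" using D(5) by (auto simp: add_hom_add[OF f(1), symmetric])
  next
    fix x r assume "x \<in> ?D1" "r \<in> carrier R"
    then show "ract N' x r \<in> ?D1" using D(6) by (auto simp: f(2)[symmetric] intro!: imageI ract_closed[OF N])
  qed (use D in auto)
  have injD: "inj_on \<iota> (carrier ?ND)" and inj1: "inj_on \<iota> (carrier ?N1)"
    using D(4) by (auto intro: inj_on_subset)
  let ?\<N> = "timg \<iota> ?ND :: ('k, 'a, 'a, 'a chain) bimod"
  let ?\<N>1 = "timg \<iota> ?N1 :: ('k, 'a, 'a, 'a chain) bimod"
  have \<N>: "right_module K R ?\<N>" "right_module K R ?\<N>1"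
    by (rule right_module_timg[OF ND injD], rule right_module_timg[OF N1 inj1])
  note sD = timg_simps[OF injD, simplified] and s1 = timg_simps[OF inj1, simplified]
  have incl: "id \<in> right_hom R ?\<N>1 ?\<N>" "inj_on id (carrier ?\<N>1)"
    by (auto simp: right_hom_def sD s1)
  have injm: "inj_on (tensor_map ?B ?\<N> Y id id) (carrier (tensor ?B ?\<N>1 Y))"
    using flat \<N> incl unfolding left_flat_def by blast
  interpret TD: tens ?B ?ND Y by (rule tens[OF ND])
  interpret T\<N>: tens ?B ?\<N> Y by (rule tens[OF \<N>(1)])
  interpret T\<N>1: tens ?B ?\<N>1 Y by (rule tens[OF \<N>(2)])
  interpret MI: tens_map ?B ?\<N>1 Y ?\<N> Y id id
    using right_homD[OF incl(1)] by unfold_locales (auto simp: add_hom_def)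
  interpret MD: tens_map ?B ?ND Y ?\<N> Y \<iota> id
    by unfold_locales (auto simp: add_hom_def sD)
  \<comment> \<open>The way back from the test module to N. It is defined on the copy of D \<inter>
    f(N) because f and \<iota> are injective there.\<close>
  let ?b = "\<lambda>z. inv_into (carrier N) f (inv_into ?D1 \<iota> z)"
  have b: "?b (\<iota> (f x)) = x" if "x \<in> carrier N" "f x \<in> D" for x
    using that inj inj1 by (simp add: inv_into_f_f)
  have b1: "\<exists>x\<in>carrier N. f x \<in> D \<and> z = \<iota> (f x)" if "z \<in> carrier ?\<N>1" for z
    using that by (auto simp: s1)
  interpret MB: tens_map ?B ?\<N>1 Y N Y ?b id
  proof unfold_locales
    show "?b \<in> add_hom ?\<N>1 N"
    proof (rule add_homI)
      fix x y assume "x \<in> carrier ?\<N>1" "y \<in> carrier ?\<N>1"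
      then obtain u v where u: "u \<in> carrier N" "f u \<in> D" "x = \<iota> (f u)" and v: "v \<in> carrier N" "f v \<in> D" "y = \<iota> (f v)"
        using b1 by metis
      have "x \<oplus>\<^bsub>?\<N>1\<^esub> y = \<iota> (f (u \<oplus>\<^bsub>N\<^esub> v))" using u v by (simp add: s1 add_hom_add[OF f(1)])
      moreover have "f (u \<oplus>\<^bsub>N\<^esub> v) \<in> D" using u v D(5) by (simp add: add_hom_add[OF f(1)])
      ultimately show "?b (x \<oplus>\<^bsub>?\<N>1\<^esub> y) = ?b x \<oplus>\<^bsub>N\<^esub> ?b y" using u v b by simp
    qed (use b1 b in metis)
    fix x s assume "x \<in> carrier ?\<N>1" and s: "s \<in> ?B"
    then obtain u where u: "u \<in> carrier N" "f u \<in> D" "x = \<iota> (f u)" using b1 by metis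
    have "ract ?\<N>1 x s = \<iota> (f (ract N u s))" using u s by (simp add: s1 f(2))
    moreover have "f (ract N u s) \<in> D" using u s D(6) by (simp add: f(2))
    ultimately show "?b (ract ?\<N>1 x s) = ract N (?b x) s" using u s b ract_closed[OF N] by simp
  qed (auto simp: add_hom_def)
  have fD: "f x \<in> D" if "(x, y) \<in> Poly_Mapping.keys p" for x y
    using D(1) that by force
  have kD: "Poly_Mapping.keys (?m f p) \<subseteq> carrier ?ND \<times> carrier Y"
    by (rule subset_trans[OF keys_frag_map]) (use fD keys in auto)
  have k1: "Poly_Mapping.keys (?m (\<iota> \<circ> f) p) \<subseteq> carrier ?\<N>1 \<times> carrier Y"
    by (rule subset_trans[OF keys_frag_map]) (use fD keys in \<open>auto simp: s1\<close>)
  have "?m f p \<in> gspan (tensor_rels ?B ?ND Y)"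
    using W(3) gspan_mono[OF tensor_rels_mono[of "N'\<lparr>carrier := W\<rparr>" ?ND]] D(1) by auto
  then have tD0: "gcls (tensor_rels ?B ?ND Y) (?m f p) = \<zero>\<^bsub>tensor ?B ?ND Y\<^esub>"
    using TD.P.zero_eq gcls_eq_iff[of _ "?m f p" 0] by simp
  \<comment> \<open>The copy of t over the test module. The inclusion sends it to zero, so flatness
    makes it zero, and \<open>?b\<close> maps it to t.\<close>
  let ?t1 = "gcls (tensor_rels ?B ?\<N>1 Y) (?m (\<iota> \<circ> f) p)"
  have "tensor_map ?B ?\<N> Y id id ?t1 = tensor_map ?B ?\<N> Y \<iota> id (gcls (tensor_rels ?B ?ND Y) (?m f p))"
    unfolding MI.map_gcls[OF k1] MD.map_gcls[OF kD] by (simp add: frag_extend_compose comp_assoc map_prod.comp)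
  also have "\<dots> = tensor_map ?B ?\<N> Y id id \<zero>\<^bsub>tensor ?B ?\<N>1 Y\<^esub>"
    unfolding tD0 add_hom_zero[OF MD.map_hom TD.P.abelian_group T\<N>.P.abelian_group]
    by (rule add_hom_zero[OF MI.map_hom T\<N>1.P.abelian_group T\<N>.P.abelian_group, symmetric])
  finally have t10: "?t1 = \<zero>\<^bsub>tensor ?B ?\<N>1 Y\<^esub>"
    using inj_onD[OF injm] T\<N>1.P.gcls_closed[OF k1] by simp
  have "tensor_map ?B N Y ?b id ?t1 = gcls (tensor_rels ?B N Y) (frag_extend frag_of p)"
    unfolding MB.map_gcls[OF k1] frag_extend_compose
    by (rule arg_cong[where f = "gcls (tensor_rels ?B N Y)"], rule frag_extend_eq) (use fD keys b in auto)
  then show ?thesis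
    using t10 add_hom_zero[OF MB.map_hom T\<N>1.P.abelian_group TN.P.abelian_group] by (simp add: p(2) frag_expansion[symmetric])
qed

section \<open>Right exactness\<close>

text \<open>The cokernel of u \<otimes> id receives a map from N \<otimes> Y, namely n \<otimes> y
  \<mapsto> class of m \<otimes> y for any m over n. Composed with v \<otimes> id it is the
  projection, so whatever v \<otimes> id kills lies in the image of u \<otimes> id.\<close>

lemma tensor_right_exact:
  fixes N :: "('k, 'r2, 's, 'n) bimod" and L :: "('k, 'r1, 's, 'l) bimod"
    and M :: "('k, 'r, 's, 'm) bimod" and Y :: "('k, 's, 't, 'y) bimod"
  assumes L: "tens_map S L Y M Y u id" and V: "tens_map S M Y N Y v id"
    and onto: "v ` carrier M = carrier N"
    and ker: "\<And>m. m \<in> carrier M ==> v m = \<zero>\<^bsub>N\<^esub> ==> m \<in> u ` carrier L"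
    and t: "t \<in> carrier (tensor S M Y)" and zero: "tensor_map S N Y v id t = \<zero>\<^bsub>tensor S N Y\<^esub>"
  shows "t \<in> tensor_map S M Y u id ` carrier (tensor S L Y)"
proof -
  interpret U: tens_map S L Y M Y u id by fact
  interpret V: tens_map S M Y N Y v id by fact
  let ?Z = "tensor S M Y" and ?I = "tensor_map S M Y u id ` carrier (tensor S L Y)"
  note uc = add_hom_closed[OF U.f]
  have uI: "ptens S M Y (u l) y \<in> ?I" if "l \<in> carrier L" "y \<in> carrier Y" for l y
    using that U.T.ptens_closed by (intro image_eqI[of _ _ "ptens S L Y l y"]) (simp_all add: U.map_ptens)
  have "subgroup ?I (add_monoid ?Z)"
  proof (rule group.subgroupI[OF abelian_group.a_group[OF U.T'.P.abelian_group]])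
    fix a b assume "a \<in> ?I" "b \<in> ?I"
    then obtain x y where *: "x \<in> carrier (tensor S L Y)" "a = tensor_map S M Y u id x"
      "y \<in> carrier (tensor S L Y)" "b = tensor_map S M Y u id y" by blast
    show "inv\<^bsub>add_monoid ?Z\<^esub> a \<in> ?I"
      by (rule image_eqI[of _ _ "\<ominus>\<^bsub>tensor S L Y\<^esub> x"])
         (use * in \<open>simp_all add: add_hom_neg[OF U.map_hom U.T.P.abelian_group U.T'.P.abelian_group] a_inv_def[symmetric]\<close>)
    show "a \<otimes>\<^bsub>add_monoid ?Z\<^esub> b \<in> ?I"
      by (rule image_eqI[of _ _ "x \<oplus>\<^bsub>tensor S L Y\<^esub> y"]) (use * in \<open>simp_all add: add_hom_add[OF U.map_hom]\<close>)
  qed (use add_hom_closed[OF U.map_hom] U.T.P.zero_closed in auto)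
  then interpret I: abelian_subgroup ?I ?Z
    by (intro abelian_subgroupI3 additive_subgroup.intro U.T'.P.abelian_group)
  let ?G = "\<lparr>carrier = a_rcosets\<^bsub>?Z\<^esub> ?I, mult = undefined, one = undefined, zero = ?I, add = set_add ?Z\<rparr>"
  have G: "abelian_group ?G"
    using I.a_factorgroup_is_comm_group unfolding abelian_group_def abelian_monoid_def abelian_group_axioms_def
    by (simp add: A_FactGroup_def' comm_group_def)
  interpret G: abelian_group ?G by (rule G)
  have \<pi>: "(\<lambda>z. ?I +>\<^bsub>?Z\<^esub> z) \<in> add_hom ?Z ?G"
    by (rule add_homI) (auto simp: I.a_rcos_sum A_RCOSETS_def')
  let ?g = "\<lambda>m y. ?I +>\<^bsub>?Z\<^esub> ptens S M Y m y"
  note g_add = add_hom_add[OF add_hom_compose[OF U.T'.ptens_left_hom \<pi>]]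
    and g_add2 = add_hom_add[OF add_hom_compose[OF U.T'.ptens_right_hom \<pi>]]
    and g_closed = add_hom_closed[OF add_hom_compose[OF U.T'.ptens_right_hom \<pi>]]
  have g_swap: "?g (ract M m s) y = ?g m (lact Y s y)" if "m \<in> carrier M" "s \<in> S" "y \<in> carrier Y" for m s y
    using U.T'.ptens_swap[OF that] by simp
  have g_u: "?g (u l) y = \<zero>\<^bsub>?G\<^esub>" if "l \<in> carrier L" "y \<in> carrier Y" for l y
    using U.T'.P.a_coset_join2[OF _ I.a_subgroup uI[OF that]] that uc by (simp add: U.T'.ptens_closed)
  \<comment> \<open>Two preimages of the same element differ by some u l, whose class with any y is
    zero.\<close>
  have well: "?g m y = ?g m' y" if "m \<in> carrier M" "m' \<in> carrier M" "v m = v m'" "y \<in> carrier Y" for m m' y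
  proof -
    have v0: "v (m \<ominus>\<^bsub>M\<^esub> m') = \<zero>\<^bsub>N\<^esub>"
      using that add_hom_closed[OF V.f]
      by (simp add: add_hom_minus[OF V.f U.T'.X.abelian_group_axioms V.T'.X.abelian_group_axioms] V.T'.X.minus_self)
    have "m \<ominus>\<^bsub>M\<^esub> m' \<in> u ` carrier L" using that by (intro ker v0) simp
    then obtain l where l: "m \<ominus>\<^bsub>M\<^esub> m' = u l" "l \<in> carrier L" by (rule imageE)
    have "m = u l \<oplus>\<^bsub>M\<^esub> m'"
      using that l(1)[symmetric] by (simp add: a_minus_def U.T'.X.a_assoc U.T'.X.l_neg)
    then have "?g m y = ?g (u l) y \<oplus>\<^bsub>?G\<^esub> ?g m' y" using l that add_hom_closed[OF U.f] by (simp add: g_add)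
    then show ?thesis using l that g_u G.l_zero[OF g_closed[OF that(2,4)]] by simp
  qed
  \<comment> \<open>An arbitrary choice of preimages, not additive in general; by
    \<open>well\<close> the resulting classes are.\<close>
  let ?w = "\<lambda>n. inv_into (carrier M) v n"
  have w: "?w n \<in> carrier M" "v (?w n) = n" if "n \<in> carrier N" for n
    using that onto by (auto intro: inv_into_into f_inv_into_f)
  have gw: "?g (?w (v m)) y = ?g m y" if "m \<in> carrier M" "y \<in> carrier Y" for m y
    using that w add_hom_closed[OF V.f] by (intro well) auto
  have bal: "balanced S N Y ?G (\<lambda>n y. ?g (?w n) y)"
  proof (rule balancedI)
    fix n n' y assume *: "n \<in> carrier N" "n' \<in> carrier N" "y \<in> carrier Y"
    have "n \<oplus>\<^bsub>N\<^esub> n' = v (?w n \<oplus>\<^bsub>M\<^esub> ?w n')" using * w by (simp add: add_hom_add[OF V.f])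
    then show "?g (?w (n \<oplus>\<^bsub>N\<^esub> n')) y = ?g (?w n) y \<oplus>\<^bsub>?G\<^esub> ?g (?w n') y"
      using * w gw by (simp add: g_add)
  next
    fix n s y assume *: "n \<in> carrier N" "s \<in> S" "y \<in> carrier Y"
    have "ract N n s = v (ract M (?w n) s)" using * w by (simp add: V.f_ract)
    then show "?g (?w (ract N n s)) y = ?g (?w n) (lact Y s y)"
      using * w gw U.T'.ract_X by (simp add: g_swap)
  qed (use w g_closed g_add2 in auto)
  let ?\<psi> = "lift_hom ?G (\<lambda>(n, y). ?g (?w n) y)"
  note \<psi> = V.T'.lift[OF G bal]
  have "?\<psi> (tensor_map S N Y v id t) = ?I +>\<^bsub>?Z\<^esub> t"
    by (rule U.T'.tensor_ext[OF add_hom_compose[OF V.map_hom \<psi>(1)] \<pi> G _ t])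
       (simp add: V.map_ptens \<psi> add_hom_closed[OF V.f] gw)
  moreover have "?\<psi> (tensor_map S N Y v id t) = \<zero>\<^bsub>?G\<^esub>"
    unfolding zero by (rule add_hom_zero[OF \<psi>(1) V.T'.P.abelian_group G])
  ultimately have "?I +>\<^bsub>?Z\<^esub> t = ?I" by (simp only: ring_record_simps)
  then show ?thesis by (rule U.T'.P.a_coset_join1[OF _ t I.a_subgroup])
qed

section \<open>The induced resolution\<close>

text \<open>An induction principle for bimodules. Applied to the equaliser of two bilinear maps it
  shows that they are determined by their values on G.\<close>

definition generated_by ::
  "('k, 'a) module \<Rightarrow> ('k, 'a, 'a, 'q) bimod \<Rightarrow> 'q set \<Rightarrow> bool"
where
  "generated_by A Q G \<longleftrightarrow> (\<forall>D. D \<subseteq> carrier Q \<and> G \<subseteq> D \<and> (\<forall>u\<in>D. \<forall>v\<in>D. u \<oplus>\<^bsub>Q\<^esub> v \<in> D) \<and>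
     (\<forall>a\<in>carrier A. \<forall>u\<in>D. lact Q a u \<in> D \<and> ract Q u a \<in> D) \<longrightarrow> carrier Q \<subseteq> D)"

text \<open>The existence half of the universal property of A \<otimes>_B P \<otimes>_B A, with j as
  the unit x \<mapsto> 1 \<otimes> x \<otimes> 1; uniqueness is \<open>generated_by\<close>. Keeping
  M as a parameter fixes its carrier type.\<close>

definition extends ::
  "('k, 'a) module \<Rightarrow> ('k, 'a) module \<Rightarrow> ('k, 'a, 'a, 'p) bimod \<Rightarrow> ('k, 'a, 'a, 'q) bimod \<Rightarrow>
   ('p \<Rightarrow> 'q) \<Rightarrow> ('k, 'a, 'a, 'm) bimod \<Rightarrow> bool"
where
  "extends A B P Q j M \<longleftrightarrow> (\<forall>u\<in>bimod_hom B P M. \<exists>v\<in>bimod_hom A Q M. \<forall>x\<in>carrier P. v (j x) = u x)"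

text \<open>All that later arguments use about the induced complex. As the concrete tensor products
  are hidden, the left construction and its opposite deliver the same interface.\<close>

definition induced_resolution ::
  "('k, 'z) ring_scheme \<Rightarrow> ('k, 'a) module \<Rightarrow> ('k, 'a) module \<Rightarrow> (nat \<Rightarrow> ('k, 'a, 'a, 'p) bimod) \<Rightarrow>
   (nat \<Rightarrow> 'p \<Rightarrow> 'p) \<Rightarrow> ('p \<Rightarrow> 'a) \<Rightarrow> ('k, 'a, 'a, 't) bimod \<Rightarrow> 't \<Rightarrow>
   (nat \<Rightarrow> ('k, 'a, 'a, 'q) bimod) \<Rightarrow> (nat \<Rightarrow> 'q \<Rightarrow> 'q) \<Rightarrow> ('q \<Rightarrow> 't) \<Rightarrow> (nat \<Rightarrow> 'p \<Rightarrow> 'q) \<Rightarrow> bool"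
where
  "induced_resolution K A B P d \<epsilon> T e Q dQ \<epsilon>Q j \<longleftrightarrow>
     bicomplex K A Q dQ \<and> exact_pos Q dQ \<and> \<epsilon>Q \<in> bimod_hom A (Q 0) T \<and>
     \<epsilon>Q ` carrier (Q 0) = carrier T \<and>
     (\<forall>x\<in>carrier (Q 0). \<epsilon>Q x = \<zero>\<^bsub>T\<^esub> \<longrightarrow> x \<in> dQ 0 ` carrier (Q (Suc 0))) \<and>
     (\<forall>n. j n \<in> bimod_hom B (P n) (Q n)) \<and>
     (\<forall>n. \<forall>x\<in>carrier (P (Suc n)). dQ n (j (Suc n) x) = j n (d n x)) \<and>
     (\<forall>x\<in>carrier (P 0). \<epsilon>Q (j 0 x) = lact T (\<epsilon> x) e) \<and>
     (\<forall>n. generated_by A (Q n) (j n ` carrier (P n)))"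

lemma generated_by_eq:
  assumes gen: "generated_by A Q (j ` carrier P)" and Q: "bim K A A Q"
    and g: "g \<in> bimod_hom A Q M" and h: "h \<in> bimod_hom A Q M"
    and j: "\<And>x. x \<in> carrier P ==> j x \<in> carrier Q"
    and eq: "\<And>x. x \<in> carrier P ==> g (j x) = h (j x)" and q: "q \<in> carrier Q"
  shows "g q = h q"
proof -
  interpret Q: abelian_group Q using Q by (rule bim_abelian_group)
  let ?D = "{q \<in> carrier Q. g q = h q}"
  have "carrier Q \<subseteq> ?D"
    by (rule gen[unfolded generated_by_def, rule_format])
       (use j eq in \<open>auto simp: bimod_homD[OF g] bimod_homD[OF h] lact_closed[OF bim_left[OF Q]] ract_closed[OF bim_right[OF Q]]\<close>)
  then show ?thesis using q by blast
qed

text \<open>The isomorphism A \<otimes>_B A \<cong> T in terms of the image e of 1 \<otimes> 1,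
  without coaction or entwining, so that it can be read over the opposite algebras.\<close>

definition central_bij ::
  "('k, 'a) module \<Rightarrow> ('k, 'a) module \<Rightarrow> ('k, 'a, 'a, 't) bimod \<Rightarrow> 't \<Rightarrow> bool"
where
  "central_bij A B T e \<longleftrightarrow> e \<in> carrier T \<and> (\<forall>b\<in>carrier B. lact T b e = ract T e b) \<and>
     bij_betw (lift_hom T (\<lambda>(a, a'). ract T (lact T a e) a'))
       (carrier (tensor (carrier B) (regular A) (regular A))) (carrier T)"

locale induced =
  fixes K :: "'k ring" and A B :: "('k, 'a) module" and P :: "nat \<Rightarrow> ('k, 'a, 'a, 'p) bimod"
    and d :: "nat \<Rightarrow> 'p \<Rightarrow> 'p" and \<epsilon> :: "'p \<Rightarrow> 'a" and p :: 'p and s :: "nat \<Rightarrow> 'p \<Rightarrow> 'p"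
    and T :: "('k, 'a, 'a, 't) bimod" and e :: 't
  assumes sub: "subalg K A B" and res: "resolves K B P d \<epsilon>" and contr: "contraction B P d \<epsilon> p s"
    and bim_T: "bim K A A T" and Te: "central_bij A B T e"
begin

lemmas algA = subalgD(1)[OF sub] and algB = subalgD(2)[OF sub] and B_A = subalgD(3)[OF sub]

sublocale A: ring A by (rule k_algebra_ring[OF algA])

lemmas bim_A = bim_regular[OF algA]

lemma cx: "bicomplex K B P d" and \<epsilon>: "\<epsilon> \<in> bimod_hom B (P 0) (regular B)"
  using res by (auto simp: resolves_def)

lemmas bP = bicomplexD(1)[OF cx] and dP = bicomplexD(2)[OF cx]
lemmas dD = bimod_homD[OF dP]

lemma \<epsilon>_closed: "x \<in> carrier (P 0) ==> \<epsilon> x \<in> carrier A"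
  and \<epsilon>_add: "x \<in> carrier (P 0) ==> y \<in> carrier (P 0) ==> \<epsilon> (x \<oplus>\<^bsub>P 0\<^esub> y) = \<epsilon> x \<oplus>\<^bsub>A\<^esub> \<epsilon> y"
  and \<epsilon>_lact: "b \<in> carrier B ==> x \<in> carrier (P 0) ==> \<epsilon> (lact (P 0) b x) = b \<otimes>\<^bsub>A\<^esub> \<epsilon> x"
  and \<epsilon>_ract: "b \<in> carrier B ==> x \<in> carrier (P 0) ==> \<epsilon> (ract (P 0) x b) = \<epsilon> x \<otimes>\<^bsub>A\<^esub> b"
  using bimod_homD[OF \<epsilon>] B_A by (auto simp: subalgD(4,5)[OF sub])

lemma p: "p \<in> carrier (P 0)" "\<epsilon> p = \<one>\<^bsub>A\<^esub>"
  and s: "s n \<in> left_hom B (P n) (P (Suc n))"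
  and s0: "x \<in> carrier (P 0) ==> d 0 (s 0 x) = x \<ominus>\<^bsub>P 0\<^esub> lact (P 0) (\<epsilon> x) p"
  and sn: "x \<in> carrier (P (Suc n)) ==> d (Suc n) (s (Suc n) x) = x \<ominus>\<^bsub>P (Suc n)\<^esub> s n (d n x)"
  using contr by (auto simp: contraction_def subalgD(6)[OF sub])

sublocale EE: tens_bim K A B B "regular A" "P n" for n
  by (rule tens_bimI[OF bim_restrict_right[OF sub bim_A] bP algA algB algB])

text \<open>The left copy of A is attached first: the contraction of P is left B-linear and survives
  A \<otimes>_B -. Attaching the right copy is the step that flatness controls.\<close>

abbreviation "E n \<equiv> tensor (carrier B) (regular A) (P n)"
abbreviation "et n \<equiv> ptens (carrier B) (regular A) (P n)"

sublocale QQ: tens_bim K A B A "E n" "regular A" for n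
  by (rule tens_bimI[OF EE.bim_tensor bim_restrict_left[OF sub bim_A] algA algB algA])

abbreviation "Q n \<equiv> tensor (carrier B) (E n) (regular A)"
abbreviation "qt n a x a' \<equiv> ptens (carrier B) (E n) (regular A) (et n a x) a'"

sublocale UU: tens_bim K A B A "regular A" "regular A"
  by (rule tens_bimI[OF bim_restrict_right[OF sub bim_A] bim_restrict_left[OF sub bim_A] algA algB algA])

abbreviation "U \<equiv> tensor (carrier B) (regular A) (regular A)"

lemma et_closed: "a \<in> carrier A ==> x \<in> carrier (P n) ==> et n a x \<in> carrier (E n)"
  using EE.ptens_closed[of a x n] by simp

lemma qt_closed: "a \<in> carrier A ==> x \<in> carrier (P n) ==> a' \<in> carrier A ==> qt n a x a' \<in> carrier (Q n)"
  using QQ.ptens_closed[OF et_closed, of a x n a'] by simp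

lemma E_ext:
  assumes "f \<in> add_hom (E n) H" "g \<in> add_hom (E n) H" "abelian_group H"
    and "\<And>a x. a \<in> carrier A ==> x \<in> carrier (P n) ==> f (et n a x) = g (et n a x)" "t \<in> carrier (E n)"
  shows "f t = g t"
  by (rule EE.tensor_ext[OF assms(1-3) _ assms(5)]) (use assms(4) in simp)

lemma Q_ext:
  assumes "f \<in> add_hom (Q n) H" "g \<in> add_hom (Q n) H" "abelian_group H"
    and "\<And>a x a'. a \<in> carrier A ==> x \<in> carrier (P n) ==> a' \<in> carrier A ==> f (qt n a x a') = g (qt n a x a')"
    and "t \<in> carrier (Q n)"
  shows "f t = g t"
proof (rule QQ.tensor_ext[OF assms(1-3) _ assms(5)])
  fix y a' assume y: "y \<in> carrier (E n)" and a': "a' \<in> carrier (regular A)"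
  show "f (ptens (carrier B) (E n) (regular A) y a') = g (ptens (carrier B) (E n) (regular A) y a')"
    by (rule E_ext[OF _ _ assms(3) _ y])
       (use a' assms(1,2,4) in \<open>auto intro: add_hom_compose[OF QQ.ptens_left_hom]\<close>)
qed

lemma Q_act:
  assumes "a \<in> carrier A" "x \<in> carrier (P n)" "a' \<in> carrier A" "b \<in> carrier A"
  shows "lact (Q n) b (qt n a x a') = qt n (b \<otimes>\<^bsub>A\<^esub> a) x a'" "ract (Q n) (qt n a x a') b = qt n a x (a' \<otimes>\<^bsub>A\<^esub> b)"
  using assms by (simp_all add: QQ.lact_ptens QQ.ract_ptens EE.lact_ptens et_closed)

lemma qt_swap:
  assumes "a \<in> carrier A" "x \<in> carrier (P n)" "a' \<in> carrier A" "b \<in> carrier B"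
  shows "qt n (a \<otimes>\<^bsub>A\<^esub> b) x a' = qt n a (lact (P n) b x) a'" "qt n a (ract (P n) x b) a' = qt n a x (b \<otimes>\<^bsub>A\<^esub> a')"
  using assms EE.ptens_swap[of a b x n] QQ.ptens_swap[OF et_closed, of a x n b a'] EE.ract_ptens[of b a x n]
  by simp_all

subsection \<open>The left half\<close>

abbreviation "dE n \<equiv> tensor_map (carrier B) (regular A) (P n) id (d n)"

lemma dE_map: "tens_map (carrier B) (regular A) (P (Suc n)) (regular A) (P n) id (d n)"
  by unfold_locales (use dD in \<open>auto simp: add_hom_def\<close>)

lemma dE_hom: "dE n \<in> add_hom (E (Suc n)) (E n)"
  by (rule tens_map.map_hom[OF dE_map])

lemma dE_et: "a \<in> carrier A ==> x \<in> carrier (P (Suc n)) ==> dE n (et (Suc n) a x) = et n a (d n x)"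
  using tens_map.map_ptens[OF dE_map, of a x n] by simp

lemma dE_ract: "b \<in> carrier B ==> y \<in> carrier (E (Suc n)) ==> dE n (ract (E (Suc n)) y b) = ract (E n) (dE n y) b"
  by (rule E_ext[OF add_hom_compose[OF EE.ract_hom dE_hom] add_hom_compose[OF dE_hom EE.ract_hom] EE.P.abelian_group])
     (simp_all add: EE.ract_ptens dE_et dD ract_closed[OF bim_right[OF bP]])

definition \<epsilon>E where "\<epsilon>E = lift_hom (regular A) (\<lambda>(a, x). a \<otimes>\<^bsub>A\<^esub> \<epsilon> x)"

lemmas agA = bim_abelian_group[OF bim_A]

lemma \<epsilon>E_balanced: "balanced (carrier B) (regular A) (P 0) (regular A) (\<lambda>a x. a \<otimes>\<^bsub>A\<^esub> \<epsilon> x)"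
  by (rule balancedI) (auto simp: \<epsilon>_closed \<epsilon>_add \<epsilon>_lact A.l_distr A.r_distr A.m_assoc B_A)

lemma \<epsilon>E_hom: "\<epsilon>E \<in> add_hom (E 0) (regular A)"
  unfolding \<epsilon>E_def by (rule EE.lift_add_hom[OF agA \<epsilon>E_balanced])

lemma \<epsilon>E_et: "a \<in> carrier A ==> x \<in> carrier (P 0) ==> \<epsilon>E (et 0 a x) = a \<otimes>\<^bsub>A\<^esub> \<epsilon> x"
  unfolding \<epsilon>E_def using EE.lift_ptens[OF agA \<epsilon>E_balanced, of a x] by simp

lemma \<epsilon>E_ract: "b \<in> carrier B ==> y \<in> carrier (E 0) ==> \<epsilon>E (ract (E 0) y b) = \<epsilon>E y \<otimes>\<^bsub>A\<^esub> b"
  by (rule E_ext[OF add_hom_compose[OF EE.ract_hom \<epsilon>E_hom] add_hom_compose[OF \<epsilon>E_hom, of "\<lambda>z. z \<otimes>\<^bsub>A\<^esub> b"] agA])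
     (auto intro!: add_homI simp: EE.ract_ptens \<epsilon>E_et \<epsilon>_ract ract_closed[OF bim_right[OF bP]] A.l_distr B_A A.m_assoc \<epsilon>_closed)

abbreviation "sE n \<equiv> tensor_map (carrier B) (regular A) (P (Suc n)) id (s n)"

lemma sE_map: "tens_map (carrier B) (regular A) (P n) (regular A) (P (Suc n)) id (s n)"
  by unfold_locales (use left_homD[OF s] in \<open>auto simp: add_hom_def\<close>)

lemma sE_hom: "sE n \<in> add_hom (E n) (E (Suc n))"
  by (rule tens_map.map_hom[OF sE_map])

lemma sE_et: "a \<in> carrier A ==> x \<in> carrier (P n) ==> sE n (et n a x) = et (Suc n) a (s n x)"
  using tens_map.map_ptens[OF sE_map, of a x n] by simp

lemmas s_closed = add_hom_closed[OF left_homD(1)[OF s]]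
lemmas agP = bim_abelian_group[OF bP]

lemma et_minus: "a \<in> carrier A ==> x \<in> carrier (P n) ==> y \<in> carrier (P n) ==>
    et n a (x \<ominus>\<^bsub>P n\<^esub> y) = et n a x \<ominus>\<^bsub>E n\<^esub> et n a y"
  using add_hom_minus[OF EE.ptens_right_hom[of a n] agP EE.P.abelian_group, of x y] by simp

text \<open>The contraction gives y = d s y + \<epsilon>(y) \<otimes> p, where a \<otimes>
  \<epsilon>(x) p = a \<epsilon>(x) \<otimes> p by balancing over B; the last term vanishes on the
  kernel.\<close>

lemma E_exact_0:
  assumes "y \<in> carrier (E 0)" "\<epsilon>E y = \<zero>\<^bsub>A\<^esub>"
  shows "y \<in> dE 0 ` carrier (E (Suc 0))"
proof -
  have pE: "(\<lambda>a. et 0 a p) \<in> add_hom (regular A) (E 0)"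
    by (rule EE.ptens_left_hom[OF p(1)])
  have "dE 0 (sE 0 y) = y \<ominus>\<^bsub>E 0\<^esub> et 0 (\<epsilon>E y) p"
  proof (rule E_ext[OF add_hom_compose[OF sE_hom dE_hom] add_hom_sub[OF add_hom_id add_hom_compose[OF \<epsilon>E_hom pE]] EE.P.abelian_group _ assms(1)])
    fix a x assume a: "a \<in> carrier A" and x: "x \<in> carrier (P 0)"
    have eB: "\<epsilon> x \<in> carrier B" using bimod_hom_closed[OF \<epsilon> x] by simp
    have "et 0 a (lact (P 0) (\<epsilon> x) p) = et 0 (a \<otimes>\<^bsub>A\<^esub> \<epsilon> x) p"
      using EE.ptens_swap[of a "\<epsilon> x" p 0] a eB p by simp
    then show "dE 0 (sE 0 (et 0 a x)) = et 0 a x \<ominus>\<^bsub>E 0\<^esub> et 0 (\<epsilon>E (et 0 a x)) p"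
      using a x eB p by (simp add: sE_et dE_et s_closed s0 et_minus lact_closed[OF bim_left[OF bP]] \<epsilon>E_et)
  qed (rule EE.P.abelian_group)
  moreover have "et 0 \<zero>\<^bsub>A\<^esub> p = \<zero>\<^bsub>E 0\<^esub>" using add_hom_zero[OF pE agA EE.P.abelian_group] by simp
  ultimately have *: "y = dE 0 (sE 0 y)" using assms by (simp add: a_minus_def)
  show ?thesis by (rule image_eqI[where f = "dE 0", OF * add_hom_closed[OF sE_hom assms(1)]])
qed

lemma E_exact:
  assumes y: "y \<in> carrier (E (Suc n))" and z: "dE n y = \<zero>\<^bsub>E n\<^esub>"
  shows "y \<in> dE (Suc n) ` carrier (E (Suc (Suc n)))"
proof -
  have "dE (Suc n) (sE (Suc n) y) = y \<ominus>\<^bsub>E (Suc n)\<^esub> sE n (dE n y)"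
    by (rule E_ext[OF add_hom_compose[OF sE_hom dE_hom] add_hom_sub[OF add_hom_id add_hom_compose[OF dE_hom sE_hom]] EE.P.abelian_group _ y])
       (simp_all add: sE_et dE_et s_closed sn et_minus dD EE.P.abelian_group)
  moreover have "sE n (dE n y) = \<zero>\<^bsub>E (Suc n)\<^esub>" unfolding z by (rule add_hom_zero[OF sE_hom EE.P.abelian_group EE.P.abelian_group])
  ultimately have *: "y = dE (Suc n) (sE (Suc n) y)" using y by (simp add: a_minus_def)
  show ?thesis by (rule image_eqI[where f = "dE (Suc n)", OF * add_hom_closed[OF sE_hom y]])
qed

subsection \<open>The full complex\<close>

abbreviation "dQ n \<equiv> tensor_map (carrier B) (E n) (regular A) (dE n) id"

lemma dQ_map: "tens_map (carrier B) (E (Suc n)) (regular A) (E n) (regular A) (dE n) id"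
  by unfold_locales (use dE_hom dE_ract in \<open>auto simp: add_hom_def\<close>)

lemma dQ_hom: "dQ n \<in> add_hom (Q (Suc n)) (Q n)"
  by (rule tens_map.map_hom[OF dQ_map])

lemma dQ_qt: "a \<in> carrier A ==> x \<in> carrier (P (Suc n)) ==> a' \<in> carrier A ==>
    dQ n (qt (Suc n) a x a') = qt n a (d n x) a'"
  using tens_map.map_ptens[OF dQ_map et_closed, of a x n a'] by (simp add: dE_et)

lemma dQ_bimod_hom: "dQ n \<in> bimod_hom A (Q (Suc n)) (Q n)"
proof (rule bimod_homI[OF dQ_hom])
  fix b x assume b: "b \<in> carrier A" and x: "x \<in> carrier (Q (Suc n))"
  show "dQ n (lact (Q (Suc n)) b x) = lact (Q n) b (dQ n x)"
    by (rule Q_ext[OF add_hom_compose[OF QQ.lact_hom[OF b] dQ_hom] add_hom_compose[OF dQ_hom QQ.lact_hom[OF b]] QQ.P.abelian_group _ x])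
       (use b in \<open>simp add: Q_act dQ_qt dD\<close>)
  show "dQ n (ract (Q (Suc n)) x b) = ract (Q n) (dQ n x) b"
    by (rule Q_ext[OF add_hom_compose[OF QQ.ract_hom[OF b] dQ_hom] add_hom_compose[OF dQ_hom QQ.ract_hom[OF b]] QQ.P.abelian_group _ x])
       (use b in \<open>simp add: Q_act dQ_qt dD\<close>)
qed

lemma qt_zero: "a \<in> carrier A ==> a' \<in> carrier A ==> qt n a \<zero>\<^bsub>P n\<^esub> a' = \<zero>\<^bsub>Q n\<^esub>"
  using EE.ptens_zero[of a n] QQ.zero_ptens[of a' n] by simp

lemma Q_bicomplex: "bicomplex K A Q dQ"
  unfolding bicomplex_def
proof (intro conjI allI ballI QQ.bim_tensor dQ_bimod_hom)
  fix n x assume x: "x \<in> carrier (Q (Suc (Suc n)))"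
  show "dQ n (dQ (Suc n) x) = \<zero>\<^bsub>Q n\<^esub>"
    by (rule Q_ext[OF add_hom_compose[OF dQ_hom dQ_hom] add_hom_null[OF QQ.P.abelian_group] QQ.P.abelian_group _ x])
       (simp add: dQ_qt dD bicomplexD(3)[OF cx] qt_zero)
qed

text \<open>Factor d through its image I. By right exactness a tensor that dies in I \<otimes> A is
  a boundary; by flatness dying in E_n \<otimes> A already means dying in I \<otimes> A.\<close>

lemma Q_exact_pos:
  assumes flat: "left_flat TYPE('a chain) K B (regular A)"
  shows "exact_pos Q dQ"
  unfolding exact_pos_def
proof (intro allI ballI impI)
  fix n t assume t: "t \<in> carrier (Q (Suc n))" and z: "dQ n t = \<zero>\<^bsub>Q n\<^esub>"
  \<comment> \<open>The image of the differential, as a right B-module inside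
    \<open>E n\<close>.\<close>
  let ?I = "(E n)\<lparr>carrier := dE n ` carrier (E (Suc n))\<rparr>"
  have rE: "right_module K B (E n)" for n by (rule bim_right[OF EE.bim_tensor])
  have I: "right_module K B ?I"
  proof (rule right_module_sub[OF rE _ _ _ _ algB])
    show "\<zero>\<^bsub>E n\<^esub> \<in> dE n ` carrier (E (Suc n))"
      using add_hom_zero[OF dE_hom EE.P.abelian_group EE.P.abelian_group, of n] EE.P.zero_closed[of "Suc n"]
      by (metis image_eqI)
  next
    fix x y assume "x \<in> dE n ` carrier (E (Suc n))" "y \<in> dE n ` carrier (E (Suc n))"
    then obtain u v where "x = dE n u" "u \<in> carrier (E (Suc n))" "y = dE n v" "v \<in> carrier (E (Suc n))" by auto
    then show "x \<oplus>\<^bsub>E n\<^esub> y \<in> dE n ` carrier (E (Suc n))"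
      by (simp add: add_hom_add[OF dE_hom, symmetric])
  next
    fix x r assume "x \<in> dE n ` carrier (E (Suc n))" "r \<in> carrier B"
    then obtain u where "x = dE n u" "u \<in> carrier (E (Suc n))" "r \<in> carrier B" by auto
    then show "ract (E n) x r \<in> dE n ` carrier (E (Suc n))"
      by (simp add: dE_ract[symmetric] ract_closed[OF rE])
  qed (use add_hom_closed[OF dE_hom] in auto)
  have lA: "left_module K B (regular A)" by (rule bim_left[OF bim_restrict_left[OF sub bim_A]])
  interpret I: tens "carrier B" ?I "regular A"
    using tens_ok_modules[OF I lA] by unfold_locales
  interpret V: tens_map "carrier B" "E (Suc n)" "regular A" ?I "regular A" "dE n" id
    by unfold_locales (use dE_hom dE_ract in \<open>auto simp: add_hom_def\<close>)
  interpret W: tens_map "carrier B" ?I "regular A" "E n" "regular A" id id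
    by unfold_locales (use add_hom_closed[OF dE_hom] in \<open>auto simp: add_hom_def\<close>)
  let ?ti = "tensor_map (carrier B) ?I (regular A) (dE n) id t"
  have "tensor_map (carrier B) (E n) (regular A) id id ?ti = dQ n t"
    by (rule QQ.tensor_ext[OF add_hom_compose[OF V.map_hom W.map_hom] dQ_hom QQ.P.abelian_group _ t])
       (simp add: V.map_ptens W.map_ptens tens_map.map_ptens[OF dQ_map])
  then have "?ti = \<zero>\<^bsub>tensor (carrier B) ?I (regular A)\<^esub>"
    using z add_hom_closed[OF V.map_hom t] add_hom_closed[OF dE_hom]
    by (intro flat_vanish[OF flat algB I rE, of id]) (auto simp: add_hom_def)
  then show "t \<in> dQ (Suc n) ` carrier (Q (Suc (Suc n)))"
    by (intro tensor_right_exact[OF dQ_map V.tens_map_axioms _ _ t]) (auto intro!: E_exact)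
qed

section \<open>The augmentation of the induced complex\<close>

abbreviation "\<tau> \<equiv> lift_hom T (\<lambda>(a, a'). ract T (lact T a e) a')"

lemma e: "e \<in> carrier T" "b \<in> carrier B ==> lact T b e = ract T e b" "bij_betw \<tau> (carrier U) (carrier T)"
  using Te by (auto simp: central_bij_def)

lemmas lT = bim_left[OF bim_T] and rT = bim_right[OF bim_T] and agT = bim_abelian_group[OF bim_T]

lemma \<tau>_balanced: "balanced (carrier B) (regular A) (regular A) T (\<lambda>a a'. ract T (lact T a e) a')"
  using e by (intro balancedI) (simp_all add: lact_closed[OF lT] ract_closed[OF rT] lact_add_left[OF lT] ract_add[OF rT]
      ract_add_right[OF rT] lact_mult[OF lT] ract_mult[OF rT] bim_comm[OF bim_T] B_A)

lemma \<tau>_hom: "\<tau> \<in> add_hom U T"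
  by (rule UU.lift_add_hom[OF agT \<tau>_balanced])

lemma \<tau>_ut: "a \<in> carrier A ==> a' \<in> carrier A ==> \<tau> (ptens (carrier B) (regular A) (regular A) a a') = ract T (lact T a e) a'"
  using UU.lift_ptens[OF agT \<tau>_balanced, of a a'] by simp

lemma \<epsilon>U_map: "tens_map (carrier B) (E 0) (regular A) (regular A) (regular A) \<epsilon>E id"
  by unfold_locales (use \<epsilon>E_hom \<epsilon>E_ract in \<open>auto simp: add_hom_def\<close>)

abbreviation "\<epsilon>U \<equiv> tensor_map (carrier B) (regular A) (regular A) \<epsilon>E id"

definition \<epsilon>Q where "\<epsilon>Q x = \<tau> (\<epsilon>U x)"

lemma \<epsilon>Q_hom: "\<epsilon>Q \<in> add_hom (Q 0) T"
  unfolding \<epsilon>Q_def[abs_def] by (rule add_hom_compose[OF tens_map.map_hom[OF \<epsilon>U_map] \<tau>_hom])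

lemma \<epsilon>Q_qt: "a \<in> carrier A ==> x \<in> carrier (P 0) ==> a' \<in> carrier A ==>
    \<epsilon>Q (qt 0 a x a') = ract T (lact T (a \<otimes>\<^bsub>A\<^esub> \<epsilon> x) e) a'"
  using tens_map.map_ptens[OF \<epsilon>U_map et_closed, of a x a'] by (simp add: \<epsilon>Q_def \<epsilon>E_et \<tau>_ut \<epsilon>_closed)

lemma \<epsilon>Q_bimod_hom: "\<epsilon>Q \<in> bimod_hom A (Q 0) T"
proof (rule bimod_homI[OF \<epsilon>Q_hom])
  fix b x assume b: "b \<in> carrier A" and x: "x \<in> carrier (Q 0)"
  show "\<epsilon>Q (lact (Q 0) b x) = lact T b (\<epsilon>Q x)"
    by (rule Q_ext[OF add_hom_compose[OF QQ.lact_hom[OF b] \<epsilon>Q_hom] add_hom_compose[OF \<epsilon>Q_hom lact_add_hom[OF lT b]] agT _ x])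
       (use b e in \<open>simp add: Q_act \<epsilon>Q_qt \<epsilon>_closed A.m_assoc lact_mult[OF lT] lact_closed[OF lT] bim_comm[OF bim_T]\<close>)
  show "\<epsilon>Q (ract (Q 0) x b) = ract T (\<epsilon>Q x) b"
    by (rule Q_ext[OF add_hom_compose[OF QQ.ract_hom[OF b] \<epsilon>Q_hom] add_hom_compose[OF \<epsilon>Q_hom ract_add_hom[OF rT b]] agT _ x])
       (use b e in \<open>simp add: Q_act \<epsilon>Q_qt \<epsilon>_closed ract_mult[OF rT] lact_closed[OF lT]\<close>)
qed

lemma \<epsilon>Q_onto: "\<epsilon>Q ` carrier (Q 0) = carrier T"
proof (intro subset_antisym subsetI)
  fix t assume "t \<in> carrier T"
  then obtain u where u: "u \<in> carrier U" "t = \<tau> u" using e(3) by (auto simp: bij_betw_def)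
  from u(1) have "\<tau> u \<in> \<epsilon>Q ` carrier (Q 0)"
  proof (induction rule: UU.tensor_induct)
    case (ptens a a')
    then have a: "a \<in> carrier A" "a' \<in> carrier A" by simp_all
    have "\<tau> (ptens (carrier B) (regular A) (regular A) a a') = \<epsilon>Q (qt 0 a p a')"
      using a p by (simp add: \<tau>_ut \<epsilon>Q_qt)
    then show ?case using qt_closed[OF a(1) p(1) a(2)] by (rule image_eqI[where f = \<epsilon>Q])
  next
    case (add x y)
    from add.IH(1) obtain x' where x': "\<tau> x = \<epsilon>Q x'" "x' \<in> carrier (Q 0)" by (rule imageE)
    from add.IH(2) obtain y' where y': "\<tau> y = \<epsilon>Q y'" "y' \<in> carrier (Q 0)" by (rule imageE)
    note xy = x' y'
    then have "\<tau> (x \<oplus>\<^bsub>U\<^esub> y) = \<epsilon>Q (x' \<oplus>\<^bsub>Q 0\<^esub> y')"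
      using add.hyps by (simp add: add_hom_add[OF \<tau>_hom] add_hom_add[OF \<epsilon>Q_hom])
    moreover have "x' \<oplus>\<^bsub>Q 0\<^esub> y' \<in> carrier (Q 0)" using xy by simp
    ultimately show ?case by (rule image_eqI[where f = \<epsilon>Q])
  qed
  then show "t \<in> \<epsilon>Q ` carrier (Q 0)" using u by simp
qed (use add_hom_closed[OF \<epsilon>Q_hom] in auto)

text \<open>Right exactness, applied to A \<otimes>_B P_1 \<rightarrow> A \<otimes>_B P_0
  \<rightarrow> A \<rightarrow> 0, describes the kernel of the map to A \<otimes>_B A, and \<tau> is
  injective there.\<close>

lemma Q_exact_0:
  assumes t: "t \<in> carrier (Q 0)" and z: "\<epsilon>Q t = \<zero>\<^bsub>T\<^esub>"
  shows "t \<in> dQ 0 ` carrier (Q (Suc 0))"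
proof -
  have "\<epsilon>U t \<in> carrier U" using t by (rule add_hom_closed[OF tens_map.map_hom[OF \<epsilon>U_map]])
  moreover have "\<tau> (\<epsilon>U t) = \<tau> \<zero>\<^bsub>U\<^esub>"
    using z add_hom_zero[OF \<tau>_hom UU.P.abelian_group agT] by (simp add: \<epsilon>Q_def)
  ultimately have "\<epsilon>U t = \<zero>\<^bsub>U\<^esub>" using e(3) by (auto simp: bij_betw_def dest: inj_onD)
  then show ?thesis
  proof (intro tensor_right_exact[OF dQ_map \<epsilon>U_map _ _ t])
    show "\<epsilon>E ` carrier (E 0) = carrier (regular A)"
    proof (intro subset_antisym subsetI)
      fix a assume "a \<in> carrier (regular A)"
      then have a: "a \<in> carrier A" by simp
      then have "a = \<epsilon>E (et 0 a p)" using p by (simp add: \<epsilon>E_et)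
      then show "a \<in> \<epsilon>E ` carrier (E 0)" using et_closed[OF a p(1)] by (rule image_eqI[where f = \<epsilon>E])
    qed (use add_hom_closed[OF \<epsilon>E_hom] in auto)
  qed (use E_exact_0 in auto)
qed

section \<open>The universal property of the induced complex\<close>

definition j :: "nat \<Rightarrow> 'p \<Rightarrow> (('a, 'p) tens, 'a) tens" where
  "j n x = qt n \<one>\<^bsub>A\<^esub> x \<one>\<^bsub>A\<^esub>"

lemma j_hom: "j n \<in> bimod_hom B (P n) (Q n)"
proof (rule bimod_homI)
  show "j n \<in> add_hom (P n) (Q n)"
    unfolding j_def[abs_def]
    by (rule add_hom_compose[OF EE.ptens_right_hom QQ.ptens_left_hom]) simp_all
  fix b x assume b: "b \<in> carrier B" and x: "x \<in> carrier (P n)"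
  have bA: "b \<in> carrier A" using b by (rule B_A)
  show "j n (lact (P n) b x) = lact (Q n) b (j n x)"
    using qt_swap(1)[of "\<one>\<^bsub>A\<^esub>" x n "\<one>\<^bsub>A\<^esub>" b] b bA x by (simp add: j_def Q_act)
  show "j n (ract (P n) x b) = ract (Q n) (j n x) b"
    using qt_swap(2)[of "\<one>\<^bsub>A\<^esub>" x n "\<one>\<^bsub>A\<^esub>" b] b bA x by (simp add: j_def Q_act)
qed

lemma qt_j: "a \<in> carrier A ==> x \<in> carrier (P n) ==> a' \<in> carrier A ==>
    qt n a x a' = ract (Q n) (lact (Q n) a (j n x)) a'"
  by (simp add: j_def Q_act)

lemma j_generates: "generated_by A (Q n) (j n ` carrier (P n))"
  unfolding generated_by_def
proof (intro allI impI subsetI)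
  fix D t assume D: "D \<subseteq> carrier (Q n) \<and> j n ` carrier (P n) \<subseteq> D \<and> (\<forall>u\<in>D. \<forall>v\<in>D. u \<oplus>\<^bsub>Q n\<^esub> v \<in> D) \<and>
      (\<forall>a\<in>carrier A. \<forall>u\<in>D. lact (Q n) a u \<in> D \<and> ract (Q n) u a \<in> D)" and t: "t \<in> carrier (Q n)"
  have q: "qt n a x a' \<in> D" if "a \<in> carrier A" "x \<in> carrier (P n)" "a' \<in> carrier A" for a x a'
    using D that by (simp add: qt_j image_subset_iff)
  from t show "t \<in> D"
  proof (induction rule: QQ.tensor_induct)
    case (ptens y a')
    then have a': "a' \<in> carrier A" by simp
    from ptens(1) show ?case
    proof (induction rule: EE.tensor_induct)
      case (ptens a x)
      then show ?case using q a' by simp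
    next
      case (add y z)
      then show ?case using D a' QQ.ptens_add_left[of y n z a'] by simp
    qed
  next
    case (add u v)
    then show ?case using D by simp
  qed
qed

text \<open>The extension is a \<otimes> x \<otimes> a' \<mapsto> a u(x) a'. It is built one tensor
  product at a time, and the first stage must be right B-linear before the second can be
  balanced.\<close>

lemma j_extends:
  assumes M: "bim K A A M"
  shows "extends A B (P n) (Q n) (j n) M"
  unfolding extends_def
proof
  fix u assume u: "u \<in> bimod_hom B (P n) M"
  note uD = bimod_homD[OF u] and lM = bim_left[OF M] and rM = bim_right[OF M] and agM = bim_abelian_group[OF M]
  let ?f = "lift_hom M (\<lambda>(a, x). lact M a (u x))"
  have b1: "balanced (carrier B) (regular A) (P n) M (\<lambda>a x. lact M a (u x))"
    by (rule balancedI) (auto simp: uD lact_closed[OF lM] lact_add_left[OF lM] lact_add[OF lM] lact_mult[OF lM] B_A)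
  note f = EE.lift[OF agM b1, simplified]
  have fr: "?f (ract (E n) y b) = ract M (?f y) b" if "y \<in> carrier (E n)" "b \<in> carrier B" for y b
    by (rule E_ext[OF add_hom_compose[OF EE.ract_hom f(1)] add_hom_compose[OF f(1) ract_add_hom[OF rM]] agM _ that(1)])
       (use that(2) in \<open>simp_all add: f EE.ract_ptens ract_closed[OF bim_right[OF bP]] uD B_A bim_comm[OF M]\<close>)
  let ?g = "lift_hom M (\<lambda>(y, a'). ract M (?f y) a')"
  have b2: "balanced (carrier B) (E n) (regular A) M (\<lambda>y a'. ract M (?f y) a')"
    by (rule balancedI) (auto simp: add_hom_closed[OF f(1)] add_hom_add[OF f(1)] ract_closed[OF rM] ract_add[OF rM]
        ract_add_right[OF rM] fr ract_mult[OF rM] B_A)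
  note g = QQ.lift[OF agM b2, simplified]
  have gq: "?g (qt n a x a') = ract M (lact M a (u x)) a'" if "a \<in> carrier A" "x \<in> carrier (P n)" "a' \<in> carrier A" for a x a'
    using that by (simp add: g et_closed f)
  have "?g \<in> bimod_hom A (Q n) M"
  proof (rule bimod_homI[OF g(1)])
    fix b x assume b: "b \<in> carrier A" and x: "x \<in> carrier (Q n)"
    show "?g (lact (Q n) b x) = lact M b (?g x)"
      by (rule Q_ext[OF add_hom_compose[OF QQ.lact_hom[OF b] g(1)] add_hom_compose[OF g(1) lact_add_hom[OF lM b]] agM _ x])
         (use b in \<open>simp add: Q_act gq uD lact_mult[OF lM] lact_closed[OF lM] bim_comm[OF M]\<close>)
    show "?g (ract (Q n) x b) = ract M (?g x) b"
      by (rule Q_ext[OF add_hom_compose[OF QQ.ract_hom[OF b] g(1)] add_hom_compose[OF g(1) ract_add_hom[OF rM b]] agM _ x])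
         (use b in \<open>simp add: Q_act gq uD ract_mult[OF rM] lact_closed[OF lM]\<close>)
  qed
  moreover have "?g (j n x) = u x" if "x \<in> carrier (P n)" for x
    using that by (simp add: j_def gq uD lact_one[OF lM] ract_one[OF rM])
  ultimately show "\<exists>v\<in>bimod_hom A (Q n) M. \<forall>x\<in>carrier (P n). v (j n x) = u x" by blast
qed

lemma induced_resolution_left:
  assumes "left_flat TYPE('a chain) K B (regular A)"
  shows "induced_resolution K A B P d \<epsilon> T e Q dQ \<epsilon>Q j"
  unfolding induced_resolution_def
proof (intro conjI allI ballI impI)
  show "\<epsilon>Q (j 0 x) = lact T (\<epsilon> x) e" if "x \<in> carrier (P 0)" for x
    using that e by (simp add: j_def \<epsilon>Q_qt \<epsilon>_closed ract_one[OF rT] lact_closed[OF lT])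
  show "dQ n (j (Suc n) x) = j n (d n x)" if "x \<in> carrier (P (Suc n))" for n x
    using that by (simp add: j_def dQ_qt)
qed (intro Q_bicomplex Q_exact_pos assms \<epsilon>Q_bimod_hom \<epsilon>Q_onto Q_exact_0 j_hom j_generates | assumption)+

end

section \<open>The induced resolution over the opposite algebras\<close>

lemma bicomplex_opb: "bicomplex K (opa R) (\<lambda>n. opb (X n)) d \<longleftrightarrow> bicomplex K R X d"
  by (simp add: bicomplex_def bim_opb bimod_hom_opb)

lemma exact_pos_opb: "exact_pos (\<lambda>n. opb (X n)) d \<longleftrightarrow> exact_pos X d"
  by (simp add: exact_pos_def)

lemma resolves_opb:
  assumes "resolves K B P d \<epsilon>"
  shows "resolves K (opa B) (\<lambda>n. opb (P n)) d \<epsilon>"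
proof -
  have "bimod_hom (opa B) (opb (P 0)) (regular (opa B)) = bimod_hom (opa B) (opb (P 0)) (opb (regular B))"
    by (simp add: bimod_hom_def left_hom_def right_hom_def)
  then show ?thesis
    using assms by (simp add: resolves_def bicomplex_opb exact_pos_opb bimod_hom_opb)
qed

lemma leftlift_opb: "leftlift (opa B) (opb P) (opb Y) (opb Z) \<longleftrightarrow> rightlift B P Y Z"
  by (simp add: leftlift_def rightlift_def left_hom_opb)

lemma generated_by_opb: "generated_by (opa A) (opb Q) G \<longleftrightarrow> generated_by A Q G"
  by (simp add: generated_by_def conj_commute)

lemma extends_opb: "extends (opa A) (opa B) (opb P) (opb Q) j (opb M) \<longleftrightarrow> extends A B P Q j M"
  by (simp add: extends_def bimod_hom_opb)

lemma regular_opa: "lact (regular (opa A)) = lact (opb (regular A))" "ract (regular (opa A)) = ract (opb (regular A))"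
  by (rule ext, rule ext, simp)+

text \<open>Over the opposite algebras a \<otimes> a' is sent to a' e a, so the new map is the old
  one after a flip. Associativity of the two actions on e makes both orders of bracketing
  agree.\<close>

lemma central_bij_opb:
  assumes sub: "subalg K A B" and T: "bim K A A T" and c: "central_bij A B T e"
  shows "central_bij (opa A) (opa B) (opb T) e"
proof -
  note A = bim_regular[OF subalgD(1)[OF sub]]
  let ?R = "regular A" and ?S = "carrier B"
  have t: "tens ?S ?R ?R"
    using tens_ok_modules[OF bim_right[OF bim_restrict_right[OF sub A]] bim_left[OF bim_restrict_left[OF sub A]]]
    by (simp add: tens_def)
  interpret T: tens ?S ?R ?R by (rule t)
  interpret T': tens ?S "opb ?R" "opb ?R" by (rule tens_opb[OF t])
  note agT = bim_abelian_group[OF T] and lT = bim_left[OF T] and rT = bim_right[OF T]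
  note B_A = subalgD(3)[OF sub]
  have e: "e \<in> carrier T" "\<And>b. b \<in> carrier B ==> lact T b e = ract T e b" using c by (auto simp: central_bij_def)
  let ?\<tau> = "lift_hom T (\<lambda>(a, a'). ract T (lact T a e) a')"
  let ?\<tau>' = "lift_hom (opb T) (\<lambda>(a, a'). ract (opb T) (lact (opb T) a e) a')"
  let ?U = "tensor ?S ?R ?R" and ?U' = "tensor ?S (opb ?R) (opb ?R)"
  have agT': "abelian_group (opb T)" by (rule abelian_group_cong[OF agT]) simp_all
  have b: "balanced ?S ?R ?R T (\<lambda>a a'. ract T (lact T a e) a')"
    using e by (intro balancedI) (simp_all add: lact_closed[OF lT] ract_closed[OF rT] lact_add_left[OF lT] ract_add[OF rT]
      ract_add_right[OF rT] lact_mult[OF lT] ract_mult[OF rT] bim_comm[OF T] B_A)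
  have b': "balanced ?S (opb ?R) (opb ?R) (opb T) (\<lambda>a a'. ract (opb T) (lact (opb T) a e) a')"
    using e by (intro balancedI) (simp_all add: lact_closed[OF lT] ract_closed[OF rT] lact_add_left[OF lT] lact_add[OF lT]
      ract_add_right[OF rT] lact_mult[OF lT] ract_mult[OF rT] bim_comm[OF T, symmetric] B_A)
  note l = T.lift[OF agT b] and l' = T'.lift[OF agT' b'] and fl = flip[OF t]
  have hT: "add_hom G (opb T) = add_hom G T" for G :: "('g, 'w) ring_scheme" by (simp add: add_hom_def)
  have eq: "?\<tau>' (flip ?S ?R ?R u) = ?\<tau> u" if "u \<in> carrier ?U" for u
    by (rule T.tensor_ext[OF add_hom_compose[OF fl(1) l'(1)[unfolded hT]] l(1) agT _ that])
       (use e in \<open>simp add: fl l l'[simplified] bim_comm[OF T]\<close>)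
  have bij: "bij_betw ?\<tau> (carrier ?U) (carrier T)" using c by (simp add: central_bij_def)
  have ff: "flip ?S (opb ?R) (opb ?R) (flip ?S ?R ?R u) = u" if "u \<in> carrier ?U" for u
    by (rule flip_flip[OF t that])
  have ff': "flip ?S ?R ?R (flip ?S (opb ?R) (opb ?R) u) = u" if "u \<in> carrier ?U'" for u
    using flip_flip[OF tens_opb[OF t] that] by simp
  have cl: "flip ?S (opb ?R) (opb ?R) u \<in> carrier ?U" if "u \<in> carrier ?U'" for u
    using add_hom_closed[OF flip_hom[OF tens_opb[OF t]] that] by simp
  have "bij_betw (flip ?S (opb ?R) (opb ?R)) (carrier ?U') (carrier ?U)"
    by (rule bij_betw_byWitness[where f' = "flip ?S ?R ?R"])
       (use ff ff' cl add_hom_closed[OF fl(1)] in auto)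
  from bij_betw_trans[OF this bij]
  have bb: "bij_betw (?\<tau> \<circ> flip ?S (opb ?R) (opb ?R)) (carrier ?U') (carrier T)" .
  have cc: "(?\<tau> \<circ> flip ?S (opb ?R) (opb ?R)) u = ?\<tau>' u" if "u \<in> carrier ?U'" for u
    using eq[OF cl[OF that]] ff'[OF that] by simp
  have bij': "bij_betw ?\<tau>' (carrier ?U') (carrier T)"
    by (rule iffD1[OF bij_betw_cong[OF cc] bb])
  note rl = regular_opa
  have "tensor ?S (regular (opa A)) (regular (opa A)) = tensor ?S (regular (opa A)) (opb ?R)"
    by (rule tensor_cong_right(1)) (rule rl | simp)+
  also have "\<dots> = ?U'" by (rule tensor_cong_left(1)) (rule rl | simp)+
  finally show ?thesis
    using bij' e by (simp add: central_bij_def)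
qed

text \<open>Turning everything around replaces \<epsilon>(x) e by e \<epsilon>(x) in the condition
  on the augmentation; the hypothesis on e restores the original side.\<close>

lemma induced_resolution_opb:
  assumes ir: "induced_resolution K (opa A) (opa B) (\<lambda>n. opb (P n)) d \<epsilon> (opb T) e Q dQ \<epsilon>Q j"
    and e: "\<And>x. x \<in> carrier (P 0) ==> lact T (\<epsilon> x) e = ract T e (\<epsilon> x)"
  shows "induced_resolution K A B P d \<epsilon> T e (\<lambda>n. opb (Q n)) dQ \<epsilon>Q j"
proof -
  have 1: "bicomplex K A (\<lambda>n. opb (Q n)) dQ \<longleftrightarrow> bicomplex K (opa A) Q dQ"
    using bicomplex_opb[of K "opa A" Q dQ] by simp
  have 2: "\<epsilon>Q \<in> bimod_hom A (opb (Q 0)) T \<longleftrightarrow> \<epsilon>Q \<in> bimod_hom (opa A) (Q 0) (opb T)"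
    using bimod_hom_opb[of "opa A" "Q 0" "opb T"] by simp
  have 3: "j n \<in> bimod_hom B (P n) (opb (Q n)) \<longleftrightarrow> j n \<in> bimod_hom (opa B) (opb (P n)) (Q n)" for n
    using bimod_hom_opb[of "opa B" "opb (P n)" "Q n"] by simp
  have 4: "generated_by A (opb (Q n)) G \<longleftrightarrow> generated_by (opa A) (Q n) G" for n G
    using generated_by_opb[of "opa A" "Q n" G] by simp
  show ?thesis
    using ir e unfolding induced_resolution_def 1 2 3 4 exact_pos_opb by simp
qed

text \<open>Opposites exchange the two kinds of flatness. \<open>extends\<close> is delivered for
  two carrier types: that of the coefficients, and that of the complex into which the comparison of
  resolutions has to be extended from P to Q.\<close>

lemma induced_resolution_exists:
  fixes K :: "'k ring" and A B :: "('k, 'a) module" and P :: "nat \<Rightarrow> ('k, 'a, 'a, 'p) bimod"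
    and T :: "('k, 'a, 'a, 't) bimod"
  assumes fK: "field K" and sub: "subalg K A B"
    and res: "projective_resolution TYPE('f) K B (regular B) P d \<epsilon>"
    and T: "bim K A A T" and Te: "central_bij A B T e"
    and flat: "left_flat TYPE('a chain) K B (regular A) \<or>
      right_flat TYPE('a chain) K B (regular A)"
  obtains Q :: "nat \<Rightarrow> ('k, 'a, 'a, (('a, 'p) tens, 'a) tens) bimod" and dQ \<epsilon>Q j
  where "induced_resolution K A B P d \<epsilon> T e Q dQ \<epsilon>Q j"
    "\<And>n (M :: ('k, 'a, 'a, 'm) bimod). bim K A A M ==> extends A B (P n) (Q n) (j n) M"
    "\<And>n (M :: ('k, 'a, 'a, 'x) bimod). bim K A A M ==> extends A B (P n) (Q n) (j n) M"
proof -
  note algB = subalgD(2)[OF sub]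
  have r: "resolves K B P d \<epsilon>" by (rule projective_resolution_resolves[OF res])
  have Pn: "projective_bimodule TYPE('f) K B (P n)" for n using res by (simp add: projective_resolution_def)
  have bP: "bim K B B (P n)" for n by (rule projective_bimod[OF Pn])
  from flat show thesis
  proof
    assume fl: "left_flat TYPE('a chain) K B (regular A)"
    obtain p s where c: "contraction B P d \<epsilon> p s"
      by (rule left_contraction_exists[OF r algB projective_leftlift[OF algB Pn fK bim_left[OF bP] bim_left[OF bP]]])
    interpret induced K A B P d \<epsilon> p s T e by unfold_locales (fact sub r c T Te)+
    show thesis by (rule that[OF induced_resolution_left[OF fl] j_extends j_extends])
  next
    assume fl: "right_flat TYPE('a chain) K B (regular A)"
    let ?P = "\<lambda>n. opb (P n)"
    note sub' = subalg_opa[OF sub]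
    note r' = resolves_opb[OF r]
    have lift': "leftlift (opa B) (?P n) (?P m) (?P m')" for n m m'
      unfolding leftlift_opb by (rule projective_rightlift[OF algB Pn fK bim_right[OF bP] bim_right[OF bP]])
    obtain p s where c: "contraction (opa B) ?P d \<epsilon> p s"
      by (rule left_contraction_exists[OF r' subalgD(2)[OF sub'] lift'])
    have fl': "left_flat TYPE('a chain) K (opa B) (regular (opa A))"
    proof (rule left_flat_cong[OF right_flat_opb[OF fl]])
      show "module K (regular (opa A))" by (rule bim_module[OF bim_regular[OF subalgD(1)[OF sub']]])
    qed (auto intro!: ext)
    have T': "bim K (opa A) (opa A) (opb T)" using T by (simp add: bim_opb)
    interpret O: induced K "opa A" "opa B" ?P d \<epsilon> p s "opb T" e
      by unfold_locales (fact sub' r' c T' central_bij_opb[OF sub T Te])+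
    have ir: "induced_resolution K (opa A) (opa B) ?P d \<epsilon> (opb T) e O.Q O.dQ O.\<epsilon>Q O.j"
      by (rule O.induced_resolution_left[OF fl'])
    let ?Q = "\<lambda>n. opb (O.Q n)"
    have e: "lact T (\<epsilon> x) e = ract T e (\<epsilon> x)" if "x \<in> carrier (P 0)" for x
      using Te r that by (auto simp: central_bij_def resolves_def)
    show thesis
    proof (rule that[of ?Q O.dQ O.\<epsilon>Q O.j])
      show "induced_resolution K A B P d \<epsilon> T e ?Q O.dQ O.\<epsilon>Q O.j"
        by (rule induced_resolution_opb[OF ir e])
    next
      fix n and M :: "('k, 'a, 'a, 'm) bimod" assume "bim K A A M"
      then have "extends (opa A) (opa B) (?P n) (O.Q n) (O.j n) (opb M)"
        by (intro O.j_extends) (simp add: bim_opb)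
      then show "extends A B (P n) (?Q n) (O.j n) M"
        using extends_opb[of A B "P n" "?Q n" "O.j n" M] by simp
    next
      fix n and M :: "('k, 'a, 'a, 'x) bimod" assume "bim K A A M"
      then have "extends (opa A) (opa B) (?P n) (O.Q n) (O.j n) (opb M)"
        by (intro O.j_extends) (simp add: bim_opb)
      then show "extends A B (P n) (?Q n) (O.j n) M"
        using extends_opb[of A B "P n" "?Q n" "O.j n" M] by simp
    qed
  qed
qed

section \<open>Maps between quotient modules\<close>

definition quot :: "('k, 'u) module \<Rightarrow> 'u set \<Rightarrow> ('k, 'u set) module" where
  "quot Z D = \<lparr>carrier = a_rcosets\<^bsub>Z\<^esub> D, mult = undefined, one = undefined, zero = D, add = set_add Z,
     smult = (\<lambda>c \<xi>. \<Union>z\<in>\<xi>. D +>\<^bsub>Z\<^esub> (c \<odot>\<^bsub>Z\<^esub> z))\<rparr>"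

text \<open>\<open>cohomology_map\<close> has this shape. The union runs over a coset, and when
  \<phi> respects the two submodules every member contributes the same coset.\<close>

definition qmap :: "('k, 'v) module \<Rightarrow> 'v set \<Rightarrow> ('u \<Rightarrow> 'v) \<Rightarrow> 'u set \<Rightarrow> 'v set" where
  "qmap Z' D' \<phi> \<xi> = (\<Union>z\<in>\<xi>. D' +>\<^bsub>Z'\<^esub> \<phi> z)"

lemma UN_const: "z \<in> S ==> (\<And>x. x \<in> S ==> f x = f z) ==> (\<Union>x\<in>S. f x) = f z"
  by blast

locale submod = Z: module K Z for K :: "'k ring" and Z :: "('k, 'u) module" and D :: "'u set" +
  assumes sub: "submodule D K Z"
begin

lemma D_closed: "x \<in> D ==> x \<in> carrier Z"
  and D_zero: "\<zero>\<^bsub>Z\<^esub> \<in> D"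
  and D_add: "x \<in> D ==> y \<in> D ==> x \<oplus>\<^bsub>Z\<^esub> y \<in> D"
  and D_neg: "x \<in> D ==> \<ominus>\<^bsub>Z\<^esub> x \<in> D"
  and D_smult: "c \<in> carrier K ==> x \<in> D ==> c \<odot>\<^bsub>Z\<^esub> x \<in> D"
  using Z.submoduleE[OF sub] subgroup.one_closed[OF submodule.axioms(1)[OF sub]] by auto

lemma D_minus: "x \<in> D ==> y \<in> D ==> x \<ominus>\<^bsub>Z\<^esub> y \<in> D"
  by (simp add: a_minus_def D_add D_neg)

lemma coset_mem: "z \<in> carrier Z ==> x \<in> D +>\<^bsub>Z\<^esub> z \<longleftrightarrow> x \<in> carrier Z \<and> x \<ominus>\<^bsub>Z\<^esub> z \<in> D"
proof -
  assume z: "z \<in> carrier Z"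
  show ?thesis
  proof
    assume "x \<in> D +>\<^bsub>Z\<^esub> z"
    then obtain h where h: "h \<in> D" "x = h \<oplus>\<^bsub>Z\<^esub> z" by (auto simp: a_r_coset_def')
    have "h \<oplus>\<^bsub>Z\<^esub> z \<ominus>\<^bsub>Z\<^esub> z = h" using h(1) D_closed z by (simp add: a_minus_def Z.a_assoc Z.r_neg)
    then show "x \<in> carrier Z \<and> x \<ominus>\<^bsub>Z\<^esub> z \<in> D" using h D_closed z by simp
  next
    assume x: "x \<in> carrier Z \<and> x \<ominus>\<^bsub>Z\<^esub> z \<in> D"
    then have "x = (x \<ominus>\<^bsub>Z\<^esub> z) \<oplus>\<^bsub>Z\<^esub> z" using z by (simp add: a_minus_def Z.a_assoc Z.l_neg)
    then show "x \<in> D +>\<^bsub>Z\<^esub> z" using x by (auto simp: a_r_coset_def')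
  qed
qed

lemma coset_self: "z \<in> carrier Z ==> z \<in> D +>\<^bsub>Z\<^esub> z"
  by (simp add: coset_mem Z.minus_self D_zero)

lemma coset_eq: "z \<in> carrier Z ==> w \<in> carrier Z ==> D +>\<^bsub>Z\<^esub> z = D +>\<^bsub>Z\<^esub> w \<longleftrightarrow> z \<ominus>\<^bsub>Z\<^esub> w \<in> D"
proof
  assume zw: "z \<in> carrier Z" "w \<in> carrier Z" and "D +>\<^bsub>Z\<^esub> z = D +>\<^bsub>Z\<^esub> w"
  then show "z \<ominus>\<^bsub>Z\<^esub> w \<in> D" using coset_self[OF zw(1)] coset_mem[OF zw(2)] by simp
next
  assume zw: "z \<in> carrier Z" "w \<in> carrier Z" and d: "z \<ominus>\<^bsub>Z\<^esub> w \<in> D"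
  have "x \<ominus>\<^bsub>Z\<^esub> z \<in> D \<longleftrightarrow> x \<ominus>\<^bsub>Z\<^esub> w \<in> D" if x: "x \<in> carrier Z" for x
  proof -
    have 1: "x \<ominus>\<^bsub>Z\<^esub> w = (x \<ominus>\<^bsub>Z\<^esub> z) \<oplus>\<^bsub>Z\<^esub> (z \<ominus>\<^bsub>Z\<^esub> w)"
      using x zw by (simp add: a_minus_def Z.a_assoc Z.r_neg1)
    have "(z \<ominus>\<^bsub>Z\<^esub> w) \<ominus>\<^bsub>Z\<^esub> (z \<ominus>\<^bsub>Z\<^esub> w) = \<zero>\<^bsub>Z\<^esub>" using zw by (simp add: Z.minus_self)
    then have 2: "x \<ominus>\<^bsub>Z\<^esub> z = (x \<ominus>\<^bsub>Z\<^esub> w) \<ominus>\<^bsub>Z\<^esub> (z \<ominus>\<^bsub>Z\<^esub> w)"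
      unfolding 1 using x zw by (simp add: a_minus_def Z.a_assoc)
    show ?thesis using D_add[OF _ d] D_minus[OF _ d] 1 2 by metis
  qed
  then show "D +>\<^bsub>Z\<^esub> z = D +>\<^bsub>Z\<^esub> w" using zw by (auto simp: coset_mem)
qed

lemma quot_carrier: "\<xi> \<in> carrier (quot Z D) \<longleftrightarrow> (\<exists>z\<in>carrier Z. \<xi> = D +>\<^bsub>Z\<^esub> z)"
  by (auto simp: quot_def A_RCOSETS_def')

lemma quot_add: "z \<in> carrier Z ==> w \<in> carrier Z ==>
    (D +>\<^bsub>Z\<^esub> z) \<oplus>\<^bsub>quot Z D\<^esub> (D +>\<^bsub>Z\<^esub> w) = D +>\<^bsub>Z\<^esub> (z \<oplus>\<^bsub>Z\<^esub> w)"
proof -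
  assume zw: "z \<in> carrier Z" "w \<in> carrier Z"
  have "abelian_subgroup D Z"
    by (rule abelian_subgroupI3) (auto intro!: additive_subgroupI submodule.axioms(1)[OF sub] Z.abelian_group_axioms)
  from abelian_subgroup.a_rcos_sum[OF this zw] show ?thesis by (simp add: quot_def)
qed

lemma quot_smult:
  assumes "c \<in> carrier K" "z \<in> carrier Z"
  shows "c \<odot>\<^bsub>quot Z D\<^esub> (D +>\<^bsub>Z\<^esub> z) = D +>\<^bsub>Z\<^esub> (c \<odot>\<^bsub>Z\<^esub> z)"
proof -
  have "D +>\<^bsub>Z\<^esub> (c \<odot>\<^bsub>Z\<^esub> x) = D +>\<^bsub>Z\<^esub> (c \<odot>\<^bsub>Z\<^esub> z)" if "x \<in> D +>\<^bsub>Z\<^esub> z" for x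
  proof -
    have x: "x \<in> carrier Z" "x \<ominus>\<^bsub>Z\<^esub> z \<in> D" using that coset_mem[OF assms(2)] by auto
    have "c \<odot>\<^bsub>Z\<^esub> x \<ominus>\<^bsub>Z\<^esub> c \<odot>\<^bsub>Z\<^esub> z = c \<odot>\<^bsub>Z\<^esub> (x \<ominus>\<^bsub>Z\<^esub> z)"
      using assms x by (simp add: a_minus_def Z.smult_r_distr Z.smult_r_minus)
    then show ?thesis using assms x D_smult[OF assms(1) x(2)] by (simp add: coset_eq)
  qed
  from UN_const[where f = "\<lambda>x. D +>\<^bsub>Z\<^esub> (c \<odot>\<^bsub>Z\<^esub> x)", OF coset_self[OF assms(2)] this] show ?thesis by (simp add: quot_def)
qed

end

locale submod_map = S: submod K Z D + S': submod K Z' D'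
  for K :: "'k ring" and Z :: "('k, 'u) module" and D and Z' :: "('k, 'v) module" and D' +
  fixes \<phi>
  assumes lin: "\<phi> \<in> k_linear K Z Z'" and map_D: "\<And>x. x \<in> D ==> \<phi> x \<in> D'"
begin

lemmas \<phi> = k_linearD[OF lin]

lemma \<phi>_minus: "x \<in> carrier Z ==> y \<in> carrier Z ==> \<phi> (x \<ominus>\<^bsub>Z\<^esub> y) = \<phi> x \<ominus>\<^bsub>Z'\<^esub> \<phi> y"
  by (rule add_hom_minus[OF \<phi>(4) S.Z.abelian_group_axioms S'.Z.abelian_group_axioms])

lemma qmap_coset: "z \<in> carrier Z ==> qmap Z' D' \<phi> (D +>\<^bsub>Z\<^esub> z) = D' +>\<^bsub>Z'\<^esub> \<phi> z"
proof -
  assume z: "z \<in> carrier Z"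
  have "D' +>\<^bsub>Z'\<^esub> \<phi> x = D' +>\<^bsub>Z'\<^esub> \<phi> z" if "x \<in> D +>\<^bsub>Z\<^esub> z" for x
    using that z by (simp add: S.coset_mem S'.coset_eq \<phi>(1) \<phi>_minus[symmetric] map_D)
  from UN_const[where f = "\<lambda>x. D' +>\<^bsub>Z'\<^esub> \<phi> x", OF S.coset_self[OF z] this] show ?thesis by (simp add: qmap_def)
qed

lemma qmap_linear: "qmap Z' D' \<phi> \<in> k_linear K (quot Z D) (quot Z' D')"
  unfolding k_linear_def
proof (intro CollectI conjI ballI funcsetI)
  fix \<xi> assume "\<xi> \<in> carrier (quot Z D)"
  then show "qmap Z' D' \<phi> \<xi> \<in> carrier (quot Z' D')"
    by (auto simp: S.quot_carrier S'.quot_carrier qmap_coset \<phi>(1))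
next
  fix \<xi> \<eta> assume "\<xi> \<in> carrier (quot Z D)" "\<eta> \<in> carrier (quot Z D)"
  then show "qmap Z' D' \<phi> (\<xi> \<oplus>\<^bsub>quot Z D\<^esub> \<eta>) = qmap Z' D' \<phi> \<xi> \<oplus>\<^bsub>quot Z' D'\<^esub> qmap Z' D' \<phi> \<eta>"
    by (auto simp: S.quot_carrier qmap_coset \<phi> S.quot_add S'.quot_add)
next
  fix c \<xi> assume "c \<in> carrier K" "\<xi> \<in> carrier (quot Z D)"
  then show "qmap Z' D' \<phi> (c \<odot>\<^bsub>quot Z D\<^esub> \<xi>) = c \<odot>\<^bsub>quot Z' D'\<^esub> qmap Z' D' \<phi> \<xi>"
    by (auto simp: S.quot_carrier qmap_coset \<phi> S.quot_smult S'.quot_smult)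
qed

lemma qmap_bij:
  assumes inj: "\<And>z. z \<in> carrier Z ==> \<phi> z \<in> D' ==> z \<in> D"
    and surj: "\<And>w. w \<in> carrier Z' ==> \<exists>z\<in>carrier Z. \<phi> z \<ominus>\<^bsub>Z'\<^esub> w \<in> D'"
  shows "bij_betw (qmap Z' D' \<phi>) (carrier (quot Z D)) (carrier (quot Z' D'))"
  unfolding bij_betw_def
proof (intro conjI inj_onI)
  fix \<xi> \<eta> assume "\<xi> \<in> carrier (quot Z D)" "\<eta> \<in> carrier (quot Z D)" "qmap Z' D' \<phi> \<xi> = qmap Z' D' \<phi> \<eta>"
  then obtain z w where zw: "z \<in> carrier Z" "\<xi> = D +>\<^bsub>Z\<^esub> z" "w \<in> carrier Z" "\<eta> = D +>\<^bsub>Z\<^esub> w"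
    "D' +>\<^bsub>Z'\<^esub> \<phi> z = D' +>\<^bsub>Z'\<^esub> \<phi> w" by (auto simp: S.quot_carrier qmap_coset)
  then have "\<phi> (z \<ominus>\<^bsub>Z\<^esub> w) \<in> D'" by (simp add: S'.coset_eq \<phi>(1) \<phi>_minus)
  then have "z \<ominus>\<^bsub>Z\<^esub> w \<in> D" using zw by (intro inj) auto
  then show "\<xi> = \<eta>" using zw by (simp add: S.coset_eq)
next
  show "qmap Z' D' \<phi> ` carrier (quot Z D) = carrier (quot Z' D')"
  proof (intro subset_antisym subsetI)
  fix \<xi> assume "\<xi> \<in> carrier (quot Z' D')"
  then obtain w where w: "w \<in> carrier Z'" "\<xi> = D' +>\<^bsub>Z'\<^esub> w" by (auto simp: S'.quot_carrier)
  then obtain z where z: "z \<in> carrier Z" "\<phi> z \<ominus>\<^bsub>Z'\<^esub> w \<in> D'" using surj by blast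
  then have "D' +>\<^bsub>Z'\<^esub> \<phi> z = \<xi>" using w by (simp add: S'.coset_eq \<phi>(1))
  then have "\<xi> = qmap Z' D' \<phi> (D +>\<^bsub>Z\<^esub> z)" using z by (simp add: qmap_coset)
  then show "\<xi> \<in> qmap Z' D' \<phi> ` carrier (quot Z D)"
    by (rule image_eqI) (use z in \<open>auto simp: S.quot_carrier\<close>)
next
  fix \<xi> assume "\<xi> \<in> qmap Z' D' \<phi> ` carrier (quot Z D)"
  then show "\<xi> \<in> carrier (quot Z' D')" using k_linearD(1)[OF qmap_linear] by blast
  qed
qed

end

section \<open>Modules of cochains\<close>

lemma cochains_simps [simp]:
  "zero (cochains R X M n) = (\<lambda>x\<in>carrier (X n). \<zero>\<^bsub>M\<^esub>)"
  "add (cochains R X M n) f g = (\<lambda>x\<in>carrier (X n). f x \<oplus>\<^bsub>M\<^esub> g x)"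
  "smult (cochains R X M n) c f = (\<lambda>x\<in>carrier (X n). c \<odot>\<^bsub>M\<^esub> f x)"
  by (simp_all add: cochains_def)

lemma cochains_carrier: "f \<in> carrier (cochains R X M n) \<longleftrightarrow> f \<in> bimod_hom R (X n) M \<and> f \<in> extensional (carrier (X n))"
  by (simp add: cochains_def)

lemma cochain_eqI:
  "f \<in> carrier (cochains R X M n) ==> g \<in> carrier (cochains R X M n) ==>
   (\<And>x. x \<in> carrier (X n) ==> f x = g x) ==> f = g"
  by (auto simp: cochains_carrier intro: extensionalityI)

lemma restrict_cochain:
  assumes "f \<in> bimod_hom R (X n) M" "bim K R R (X n)"
  shows "restrict f (carrier (X n)) \<in> carrier (cochains R X M n)"
  using bimod_hom_cong[OF assms(1) _ assms(2), of "restrict f (carrier (X n))"] by (simp add: cochains_carrier)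

lemma image_submodule:
  assumes Y: "module K Y" and Z: "module K Z" and f: "f \<in> k_linear K Y Z"
  shows "submodule (f ` carrier Y) K Z"
proof -
  interpret Y: module K Y by fact
  interpret Z: module K Z by fact
  note fD = k_linearD[OF f]
  show ?thesis
    by (rule Z.submoduleI)
       (auto simp: fD(1) fD(2,3)[symmetric]
         add_hom_neg[OF fD(4) Y.abelian_group_axioms Z.abelian_group_axioms, symmetric]
         add_hom_zero[OF fD(4) Y.abelian_group_axioms Z.abelian_group_axioms, symmetric])
qed

lemma bimod_hom_null:
  assumes M: "bim K R R M"
  shows "(\<lambda>_. \<zero>\<^bsub>M\<^esub>) \<in> bimod_hom R Y M"
proof -
  note agM = bim_abelian_group[OF M]
  show ?thesis
    using add_hom_zero[OF lact_add_hom[OF bim_left[OF M]] agM agM] add_hom_zero[OF ract_add_hom[OF bim_right[OF M]] agM agM]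
    by (intro bimod_homI add_hom_null agM) auto
qed

locale coch =
  fixes K :: "'k ring" and R :: "('k, 'a) module" and X :: "nat \<Rightarrow> ('k, 'a, 'a, 'x) bimod" and d
    and M :: "('k, 'a, 'a, 'm) bimod"
  assumes alg: "k_algebra K R" and cx: "bicomplex K R X d" and M: "bim K R R M"
begin

sublocale M: module K M by (rule bim_module[OF M])

lemmas bX = bicomplexD(1)[OF cx] and dX = bicomplexD(2)[OF cx] and dd = bicomplexD(3)[OF cx]
  and agX = bicomplexD(4)[OF cx] and d_closed = bicomplexD(5)[OF cx]

abbreviation "C n \<equiv> cochains R X M n"

lemma C_hom: "f \<in> carrier (C n) ==> f \<in> bimod_hom R (X n) M"
  by (simp add: cochains_carrier)

lemma C_closed: "f \<in> carrier (C n) ==> x \<in> carrier (X n) ==> f x \<in> carrier M"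
  using bimod_hom_closed[OF C_hom] .

lemma C_restrict: "f \<in> bimod_hom R (X n) M ==> restrict f (carrier (X n)) \<in> carrier (C n)"
  by (rule restrict_cochain[OF _ bX])

lemma C_zero: "\<zero>\<^bsub>C n\<^esub> \<in> carrier (C n)"
  unfolding cochains_simps by (rule C_restrict[OF bimod_hom_null[OF M]])

lemma C_smult: "c \<in> carrier K ==> f \<in> carrier (C n) ==> c \<odot>\<^bsub>C n\<^esub> f \<in> carrier (C n)"
  unfolding cochains_simps
  by (intro C_restrict bimod_homI add_homI)
     (auto simp: bimod_homD[OF C_hom] M.smult_r_distr smult_lact[OF alg bim_left[OF M]] smult_ract[OF alg bim_right[OF M]])

lemma C_add: "f \<in> carrier (C n) ==> g \<in> carrier (C n) ==> f \<oplus>\<^bsub>C n\<^esub> g \<in> carrier (C n)"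
  unfolding cochains_simps by (rule C_restrict[OF bimod_hom_plus[OF C_hom C_hom M]])

lemma module_C: "module K (C n)"
proof (rule moduleI[OF M.R.is_cring])
  interpret Xn: abelian_group "X n" by (rule agX)
  show "abelian_group (C n)"
  proof (rule abelian_groupI)
    fix f assume f: "f \<in> carrier (C n)"
    let ?g = "(\<ominus>\<^bsub>K\<^esub> \<one>\<^bsub>K\<^esub>) \<odot>\<^bsub>C n\<^esub> f"
    have g: "?g \<in> carrier (C n)" using f by (intro C_smult) auto
    have "?g \<oplus>\<^bsub>C n\<^esub> f = \<zero>\<^bsub>C n\<^esub>"
      by (rule cochain_eqI[OF C_add[OF g f] C_zero])
         (use f C_closed in \<open>simp add: M.smult_l_minus M.l_neg\<close>)
    with g show "\<exists>g\<in>carrier (C n). g \<oplus>\<^bsub>C n\<^esub> f = \<zero>\<^bsub>C n\<^esub>" by blast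
  next
    fix f g h assume *: "f \<in> carrier (C n)" "g \<in> carrier (C n)" "h \<in> carrier (C n)"
    show "f \<oplus>\<^bsub>C n\<^esub> g \<oplus>\<^bsub>C n\<^esub> h = f \<oplus>\<^bsub>C n\<^esub> (g \<oplus>\<^bsub>C n\<^esub> h)"
      by (rule cochain_eqI[OF C_add[OF C_add] C_add[OF _ C_add]]) (use * C_closed in \<open>auto simp: M.a_assoc\<close>)
  next
    fix f g assume *: "f \<in> carrier (C n)" "g \<in> carrier (C n)"
    show "f \<oplus>\<^bsub>C n\<^esub> g = g \<oplus>\<^bsub>C n\<^esub> f"
      by (rule cochain_eqI[OF C_add C_add]) (use * C_closed in \<open>auto simp: M.a_comm\<close>)
  next
    fix f assume *: "f \<in> carrier (C n)"
    show "\<zero>\<^bsub>C n\<^esub> \<oplus>\<^bsub>C n\<^esub> f = f"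
      by (rule cochain_eqI[OF C_add[OF C_zero]]) (use * C_closed in auto)
  qed (auto intro: C_add C_zero simp del: cochains_simps)
next
  fix a b f assume *: "a \<in> carrier K" "b \<in> carrier K" "f \<in> carrier (C n)"
  show "(a \<oplus>\<^bsub>K\<^esub> b) \<odot>\<^bsub>C n\<^esub> f = a \<odot>\<^bsub>C n\<^esub> f \<oplus>\<^bsub>C n\<^esub> b \<odot>\<^bsub>C n\<^esub> f"
    by (rule cochain_eqI[OF C_smult C_add[OF C_smult C_smult]]) (use * C_closed in \<open>auto simp: M.smult_l_distr\<close>)
  show "(a \<otimes>\<^bsub>K\<^esub> b) \<odot>\<^bsub>C n\<^esub> f = a \<odot>\<^bsub>C n\<^esub> (b \<odot>\<^bsub>C n\<^esub> f)"
    by (rule cochain_eqI[OF C_smult C_smult[OF _ C_smult]]) (use * C_closed in \<open>auto simp: M.smult_assoc1\<close>)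
next
  fix a f g assume *: "a \<in> carrier K" "f \<in> carrier (C n)" "g \<in> carrier (C n)"
  show "a \<odot>\<^bsub>C n\<^esub> (f \<oplus>\<^bsub>C n\<^esub> g) = a \<odot>\<^bsub>C n\<^esub> f \<oplus>\<^bsub>C n\<^esub> a \<odot>\<^bsub>C n\<^esub> g"
    by (rule cochain_eqI[OF C_smult[OF _ C_add] C_add[OF C_smult C_smult]]) (use * C_closed in \<open>auto simp: M.smult_r_distr\<close>)
next
  fix f assume *: "f \<in> carrier (C n)"
  show "\<one>\<^bsub>K\<^esub> \<odot>\<^bsub>C n\<^esub> f = f"
    by (rule cochain_eqI[OF C_smult]) (use * C_closed in auto)
qed (rule C_smult)

sublocale Cm: module K "C n" for n by (rule module_C)

lemma C_neg_apply:
  assumes "f \<in> carrier (C n)" "x \<in> carrier (X n)"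
  shows "(\<ominus>\<^bsub>C n\<^esub> f) x = \<ominus>\<^bsub>M\<^esub> f x"
proof -
  have "\<ominus>\<^bsub>C n\<^esub> f = (\<ominus>\<^bsub>K\<^esub> \<one>\<^bsub>K\<^esub>) \<odot>\<^bsub>C n\<^esub> f"
    using assms(1) Cm.smult_l_minus[of "\<one>\<^bsub>K\<^esub>" f n] Cm.smult_one[of f n] by simp
  then show ?thesis using assms C_closed by (simp add: M.smult_l_minus)
qed

lemma C_minus_apply:
  "f \<in> carrier (C n) ==> g \<in> carrier (C n) ==> x \<in> carrier (X n) ==> (f \<ominus>\<^bsub>C n\<^esub> g) x = f x \<ominus>\<^bsub>M\<^esub> g x"
  by (simp add: a_minus_def C_neg_apply)

lemma C_neg_zero: "\<ominus>\<^bsub>C n\<^esub> \<zero>\<^bsub>C n\<^esub> = \<zero>\<^bsub>C n\<^esub>"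
  by (rule Cm.minus_equality[OF Cm.l_zero[OF C_zero] C_zero C_zero])

section \<open>The coboundary operator\<close>

abbreviation "\<delta> n \<equiv> codiff X d n"

lemma \<delta>_closed: "f \<in> carrier (C n) ==> \<delta> n f \<in> carrier (C (Suc n))"
  unfolding codiff_def compose_def by (intro C_restrict bimod_hom_compose[OF dX C_hom])

lemma \<delta>_apply: "x \<in> carrier (X (Suc n)) ==> \<delta> n f x = f (d n x)"
  by (simp add: codiff_def compose_def)

lemma hom_zero: "f \<in> carrier (C n) ==> f \<zero>\<^bsub>X n\<^esub> = \<zero>\<^bsub>M\<^esub>"
  by (rule bimod_hom_zero[OF C_hom bX M])

lemma \<delta>\<delta>: "f \<in> carrier (C n) ==> \<delta> (Suc n) (\<delta> n f) = \<zero>\<^bsub>C (Suc (Suc n))\<^esub>"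
  by (rule cochain_eqI[OF \<delta>_closed[OF \<delta>_closed] C_zero])
     (simp_all add: \<delta>_apply d_closed dd hom_zero)

lemma \<delta>_linear: "\<delta> n \<in> k_linear K (C n) (C (Suc n))"
  unfolding k_linear_def
proof (intro CollectI conjI ballI funcsetI \<delta>_closed)
  fix f g assume *: "f \<in> carrier (C n)" "g \<in> carrier (C n)"
  show "\<delta> n (f \<oplus>\<^bsub>C n\<^esub> g) = \<delta> n f \<oplus>\<^bsub>C (Suc n)\<^esub> \<delta> n g"
    by (rule cochain_eqI[OF \<delta>_closed[OF C_add] C_add[OF \<delta>_closed \<delta>_closed]]) (use * in \<open>auto simp: \<delta>_apply d_closed\<close>)
next
  fix c f assume *: "c \<in> carrier K" "f \<in> carrier (C n)"
  show "\<delta> n (c \<odot>\<^bsub>C n\<^esub> f) = c \<odot>\<^bsub>C (Suc n)\<^esub> \<delta> n f"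
    by (rule cochain_eqI[OF \<delta>_closed[OF C_smult] C_smult[OF _ \<delta>_closed]]) (use * in \<open>auto simp: \<delta>_apply d_closed\<close>)
qed

lemmas \<delta>D = k_linearD[OF \<delta>_linear]

lemma \<delta>_neg: "f \<in> carrier (C n) ==> \<delta> n (\<ominus>\<^bsub>C n\<^esub> f) = \<ominus>\<^bsub>C (Suc n)\<^esub> \<delta> n f"
  by (rule add_hom_neg[OF \<delta>D(4) Cm.abelian_group_axioms Cm.abelian_group_axioms])

lemma \<delta>_zero: "\<delta> n \<zero>\<^bsub>C n\<^esub> = \<zero>\<^bsub>C (Suc n)\<^esub>"
  by (rule add_hom_zero[OF \<delta>D(4) Cm.abelian_group_axioms Cm.abelian_group_axioms])

section \<open>Cocycles, coboundaries and cohomology as a quotient\<close>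

abbreviation "ZZ n \<equiv> cocycles R X d M n"
abbreviation "DD n \<equiv> coboundaries R X d M n"

lemma ZZ_carrier: "f \<in> carrier (ZZ n) \<longleftrightarrow> f \<in> carrier (C n) \<and> \<delta> n f = \<zero>\<^bsub>C (Suc n)\<^esub>"
  by (simp add: cocycles_def)

lemma ZZ_ops: "ZZ n = (C n)\<lparr>carrier := carrier (ZZ n)\<rparr>"
  by (simp add: cocycles_def)

lemma ZZ_simps: "add (ZZ n) = add (C n)" "zero (ZZ n) = zero (C n)" "smult (ZZ n) = smult (C n)"
  by (simp_all add: cocycles_def)

lemma submodule_ZZ: "submodule (carrier (ZZ n)) K (C n)"
  by (rule Cm.submoduleI)
     (auto simp: ZZ_carrier \<delta>D \<delta>_neg \<delta>_zero C_add C_smult C_zero C_neg_zero simp del: cochains_simps)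

lemma module_ZZ: "module K (ZZ n)"
  by (subst ZZ_ops) (rule submodule.submodule_is_module[OF submodule_ZZ module_C])

lemma ZZ_neg: "f \<in> carrier (ZZ n) ==> \<ominus>\<^bsub>ZZ n\<^esub> f = \<ominus>\<^bsub>C n\<^esub> f"
proof -
  interpret Z: module K "ZZ n" by (rule module_ZZ)
  assume f: "f \<in> carrier (ZZ n)"
  have n: "\<ominus>\<^bsub>C n\<^esub> f \<in> carrier (ZZ n)" using Cm.submoduleE(3)[OF submodule_ZZ f] .
  have fC: "f \<in> carrier (C n)" using f by (simp add: ZZ_carrier)
  have "\<ominus>\<^bsub>C n\<^esub> f \<oplus>\<^bsub>ZZ n\<^esub> f = \<zero>\<^bsub>ZZ n\<^esub>" using Cm.l_neg[OF fC] by (simp only: ZZ_simps)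
  then show ?thesis using Z.minus_equality[OF _ f n] by simp
qed

lemma ZZ_minus: "f \<in> carrier (ZZ n) ==> g \<in> carrier (ZZ n) ==> f \<ominus>\<^bsub>ZZ n\<^esub> g = f \<ominus>\<^bsub>C n\<^esub> g"
  by (simp add: a_minus_def ZZ_neg ZZ_simps)

lemma DD_ZZ: "f \<in> DD n ==> f \<in> carrier (ZZ n)"
  by (cases n) (auto simp: coboundaries_def ZZ_carrier C_zero \<delta>_zero \<delta>_closed \<delta>\<delta> simp del: cochains_simps)

lemma submodule_DD: "submodule (DD n) K (ZZ n)"
proof (cases n)
  case 0
  have "(\<lambda>_. \<zero>\<^bsub>ZZ n\<^esub>) \<in> k_linear K (C 0) (ZZ n)"
    using module.smult_r_null[OF module_ZZ] abelian_group.axioms(1)[OF module_abelian_group[OF module_ZZ]]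
    by (auto simp: k_linear_def abelian_monoid.zero_closed abelian_monoid.l_zero simp del: cochains_simps)
  from image_submodule[OF module_C module_ZZ this] C_zero[of 0] show ?thesis
    using 0 by (simp add: coboundaries_def image_constant[OF C_zero] ZZ_simps del: cochains_simps)
next
  case (Suc m)
  have "\<delta> m \<in> k_linear K (C m) (ZZ n)"
    using Suc by (auto simp: k_linear_def ZZ_carrier ZZ_simps \<delta>D \<delta>\<delta> simp del: cochains_simps)
  from image_submodule[OF module_C module_ZZ this] show ?thesis using Suc by (simp add: coboundaries_def)
qed

lemma submod: "submod K (ZZ n) (DD n)"
  using module_ZZ submodule_DD by (simp add: submod_def submod_axioms_def)

lemma cohomology_quot: "cohomology R X d n M = quot (ZZ n) (DD n)"
  by (simp add: cohomology_def quot_def Let_def)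

end

section \<open>Maps of cochain complexes\<close>

text \<open>A single statement for both kinds of maps that occur: change of coefficients, and
  pulling back along a chain map over a smaller algebra.\<close>

lemma cochain_map_submod_map:
  assumes "coch K R X d M" and "coch K S Y d' N"
    and lin: "\<And>n. \<phi> n \<in> k_linear K (cochains R X M n) (cochains S Y N n)"
    and comm: "\<And>n z. z \<in> carrier (cochains R X M n) ==> \<phi> (Suc n) (codiff X d n z) = codiff Y d' n (\<phi> n z)"
  shows "submod_map K (cocycles R X d M n) (coboundaries R X d M n)
    (cocycles S Y d' N n) (coboundaries S Y d' N n) (\<phi> n)"
proof -
  interpret X: coch K R X d M by fact
  interpret Y: coch K S Y d' N by fact
  note \<phi> = k_linearD[OF lin]
  have zero: "\<phi> n \<zero>\<^bsub>X.C n\<^esub> = \<zero>\<^bsub>Y.C n\<^esub>" for n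
    by (rule add_hom_zero[OF \<phi>(4) X.Cm.abelian_group_axioms Y.Cm.abelian_group_axioms])
  have "\<phi> n \<in> k_linear K (X.ZZ n) (Y.ZZ n)"
    unfolding k_linear_def
    by (auto simp: X.ZZ_carrier Y.ZZ_carrier X.ZZ_simps Y.ZZ_simps \<phi> comm[symmetric] zero
        simp del: cochains_simps)
  moreover have "\<phi> n x \<in> Y.DD n" if x: "x \<in> X.DD n" for x
  proof (cases n)
    case 0
    then show ?thesis using x zero by (simp add: coboundaries_def del: cochains_simps)
  next
    case (Suc m)
    then obtain u where u: "u \<in> carrier (X.C m)" "x = codiff X d m u" using x by (auto simp: coboundaries_def)
    then have "\<phi> n x = codiff Y d' m (\<phi> m u)" using Suc by (simp add: comm)
    then show ?thesis using Suc \<phi>(1)[OF u(1)] by (simp add: coboundaries_def)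
  qed
  ultimately show ?thesis
    by (intro submod_map.intro X.submod Y.submod submod_map_axioms.intro)
qed

lemma coefficient_linear:
  assumes "coch K R X d M" "coch K R X d N" "f \<in> bimod_hom R M N"
  shows "(\<lambda>z. compose (carrier (X n)) f z) \<in> k_linear K (cochains R X M n) (cochains R X N n)"
    and "z \<in> carrier (cochains R X M n) ==>
      compose (carrier (X (Suc n))) f (codiff X d n z) = codiff X d n (compose (carrier (X n)) f z)"
proof -
  interpret M: coch K R X d M by fact
  interpret N: coch K R X d N by fact
  have c: "compose (carrier (X n)) f z \<in> carrier (N.C n)" if "z \<in> carrier (M.C n)" for z n
    unfolding compose_def by (rule N.C_restrict[OF bimod_hom_compose[OF M.C_hom[OF that] assms(3)]])
  show "(\<lambda>z. compose (carrier (X n)) f z) \<in> k_linear K (M.C n) (N.C n)"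
    unfolding k_linear_def
  proof (intro CollectI conjI ballI funcsetI c)
    fix u v assume *: "u \<in> carrier (M.C n)" "v \<in> carrier (M.C n)"
    show "compose (carrier (X n)) f (u \<oplus>\<^bsub>M.C n\<^esub> v) = compose (carrier (X n)) f u \<oplus>\<^bsub>N.C n\<^esub> compose (carrier (X n)) f v"
      by (rule cochain_eqI[OF c[OF M.C_add] N.C_add[OF c c]])
         (use * in \<open>auto simp: compose_eq bimod_hom_add[OF assms(3)] M.C_closed\<close>)
  next
    fix a u assume *: "a \<in> carrier K" "u \<in> carrier (M.C n)"
    show "compose (carrier (X n)) f (a \<odot>\<^bsub>M.C n\<^esub> u) = a \<odot>\<^bsub>N.C n\<^esub> compose (carrier (X n)) f u"
      by (rule cochain_eqI[OF c[OF M.C_smult] N.C_smult[OF _ c]])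
         (use * in \<open>auto simp: compose_eq bimod_hom_smult[OF assms(3) M.alg M.M N.M] M.C_closed\<close>)
  qed
  show "compose (carrier (X (Suc n))) f (codiff X d n z) = codiff X d n (compose (carrier (X n)) f z)"
    if z: "z \<in> carrier (M.C n)"
    by (rule cochain_eqI[OF c[OF M.\<delta>_closed] N.\<delta>_closed[OF c]])
       (use z in \<open>auto simp: compose_eq M.\<delta>_apply N.\<delta>_apply M.d_closed\<close>)
qed

lemma cohomology_map_qmap: "cohomology_map R X d n M N f =
    qmap (cocycles R X d N n) (coboundaries R X d N n) (\<lambda>z. compose (carrier (X n)) f z)"
  by (intro ext) (simp add: cohomology_map_def qmap_def)

lemma coefficient_submod_map:
  assumes "coch K R X d M" "coch K R X d N" "f \<in> bimod_hom R M N"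
  shows "submod_map K (cocycles R X d M n) (coboundaries R X d M n)
    (cocycles R X d N n) (coboundaries R X d N n) (\<lambda>z. compose (carrier (X n)) f z)"
  by (rule cochain_map_submod_map[OF assms(1,2), where \<phi> = "\<lambda>n z. compose (carrier (X n)) f z"])
     (rule coefficient_linear[OF assms], assumption?)+

section \<open>The connecting map\<close>

text \<open>Values of s lie in the kernel of g, which is the image of f; since f is injective the
  preimages are unique, and uniqueness makes them bilinear.\<close>

lemma short_exact_factor:
  assumes se: "short_exact R L f M g N" and L: "bim K R R L" and Y: "bim K R R Y"
    and s: "s \<in> bimod_hom R Y M" and z: "\<And>x. x \<in> carrier Y ==> g (s x) = \<zero>\<^bsub>N\<^esub>"
  obtains v where "v \<in> bimod_hom R Y L" "\<And>x. x \<in> carrier Y ==> f (v x) = s x"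
proof -
  interpret L: abelian_group L by (rule bim_abelian_group[OF L])
  interpret Y: abelian_group Y by (rule bim_abelian_group[OF Y])
  have f: "f \<in> bimod_hom R L M" and inj: "inj_on f (carrier L)"
    and im: "f ` carrier L = {x \<in> carrier M. g x = \<zero>\<^bsub>N\<^esub>}" using se by (auto simp: short_exact_def)
  note fD = bimod_homD[OF f] and sD = bimod_homD[OF s]
  have "\<exists>v. v \<in> carrier L \<and> f v = s x" if "x \<in> carrier Y" for x
  proof -
    have "s x \<in> f ` carrier L" unfolding im using that sD(2) z by simp
    then show ?thesis by auto
  qed
  then obtain v where v: "v x \<in> carrier L" "f (v x) = s x" if "x \<in> carrier Y" for x by metis
  have eq: "v x = y" if "x \<in> carrier Y" "y \<in> carrier L" "f y = s x" for x y
    using inj_onD[OF inj _ v(1)[OF that(1)] that(2)] v(2)[OF that(1)] that(3) by simp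
  have vh: "v \<in> bimod_hom R Y L"
    by (intro bimod_homI add_homI eq)
       (simp_all add: v fD sD lact_closed[OF bim_left[OF L]] lact_closed[OF bim_left[OF Y]]
         ract_closed[OF bim_right[OF L]] ract_closed[OF bim_right[OF Y]])
  show thesis by (rule that[OF vh v(2)])
qed

context
  fixes K :: "'k ring" and R :: "('k, 'a) module" and X :: "nat \<Rightarrow> ('k, 'a, 'a, 'x) bimod" and d
    and L :: "('k, 'a, 'a, 'l) bimod" and M :: "('k, 'a, 'a, 'm) bimod" and N :: "('k, 'a, 'a, 'n) bimod"
    and f g
  assumes L: "coch K R X d L" and M: "coch K R X d M" and N: "coch K R X d N"
    and se: "short_exact R L f M g N" and lift: "\<And>n. bilift R (X n) M N"
begin

interpretation L: coch K R X d L by (rule L)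
interpretation M: coch K R X d M by (rule M)
interpretation N: coch K R X d N by (rule N)

lemma f: "f \<in> bimod_hom R L M" and g: "g \<in> bimod_hom R M N" and inj_f: "inj_on f (carrier L)"
  and g_onto: "g ` carrier M = carrier N" and gf: "x \<in> carrier L ==> g (f x) = \<zero>\<^bsub>N\<^esub>"
  using se by (auto simp: short_exact_def)

lemma cochain_lift:
  assumes y: "y \<in> carrier (N.C n)"
  obtains u where "u \<in> carrier (M.C n)" "compose (carrier (X n)) g u = y"
proof -
  have "y x \<in> g ` carrier M" if "x \<in> carrier (X n)" for x
    using N.C_closed[OF y that] g_onto by simp
  from bilift_obtain[OF lift N.C_hom[OF y] g this]
  obtain u where u: "u \<in> bimod_hom R (X n) M" "\<And>x. x \<in> carrier (X n) ==> g (u x) = y x" by blast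
  have "compose (carrier (X n)) g (restrict u (carrier (X n))) = y"
    by (rule cochain_eqI[OF k_linearD(1)[OF coefficient_linear(1)[OF M N g] M.C_restrict[OF u(1)]] y])
       (simp add: compose_eq u(2))
  with M.C_restrict[OF u(1)] show thesis by (rule that)
qed

lemma cochain_factor:
  assumes s: "s \<in> carrier (M.C n)" and z: "\<And>x. x \<in> carrier (X n) ==> g (s x) = \<zero>\<^bsub>N\<^esub>"
  obtains v where "v \<in> carrier (L.C n)" "\<And>x. x \<in> carrier (X n) ==> f (v x) = s x"
proof -
  obtain v where v: "v \<in> bimod_hom R (X n) L" "\<And>x. x \<in> carrier (X n) ==> f (v x) = s x"
    using short_exact_factor[OF se L.M L.bX M.C_hom[OF s] z] by blast
  show thesis
    by (rule that[OF L.C_restrict[OF v(1)]]) (simp add: v(2))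
qed

text \<open>The usual diagram chase: lift a representative z to u through g; as z is a cocycle, the
  coboundary of u is killed by g and factors through f. Injectivity of f makes the factor w a
  cocycle.\<close>

lemma connecting_witness:
  assumes \<xi>: "\<xi> \<in> carrier (cohomology R X d n N)"
  obtains u w where "u \<in> carrier (M.C n)" "w \<in> carrier (L.ZZ (Suc n))" "compose (carrier (X n)) g u \<in> \<xi>"
    "compose (carrier (X (Suc n))) f w = M.\<delta> n u"
proof -
  interpret S: submod K "N.ZZ n" "N.DD n" by (rule N.submod)
  obtain z where z: "z \<in> carrier (N.ZZ n)" "\<xi> = N.DD n +>\<^bsub>N.ZZ n\<^esub> z"
    using \<xi> by (auto simp: N.cohomology_quot S.quot_carrier)
  have zC: "z \<in> carrier (N.C n)" and dz: "N.\<delta> n z = \<zero>\<^bsub>N.C (Suc n)\<^esub>" using z(1) by (auto simp: N.ZZ_carrier)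
  obtain u where u: "u \<in> carrier (M.C n)" "compose (carrier (X n)) g u = z" by (rule cochain_lift[OF zC])
  have "g (M.\<delta> n u x) = \<zero>\<^bsub>N\<^esub>" if "x \<in> carrier (X (Suc n))" for x
  proof -
    have "g (M.\<delta> n u x) = z (d n x)"
      using that M.d_closed[OF that] by (simp add: M.\<delta>_apply u(2)[symmetric] compose_eq)
    also have "\<dots> = N.\<delta> n z x" using that by (simp add: N.\<delta>_apply)
    finally show ?thesis using dz that by simp
  qed
  then obtain w where w: "w \<in> carrier (L.C (Suc n))" "\<And>x. x \<in> carrier (X (Suc n)) ==> f (w x) = M.\<delta> n u x"
    using cochain_factor[OF M.\<delta>_closed[OF u(1)]] by blast
  have "L.\<delta> (Suc n) w = \<zero>\<^bsub>L.C (Suc (Suc n))\<^esub>"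
  proof (rule cochain_eqI[OF L.\<delta>_closed[OF w(1)] L.C_zero])
    fix x assume x: "x \<in> carrier (X (Suc (Suc n)))"
    have "f (L.\<delta> (Suc n) w x) = M.\<delta> (Suc n) (M.\<delta> n u) x"
      using x by (simp add: L.\<delta>_apply M.\<delta>_apply w(2) L.d_closed)
    also have "\<dots> = f \<zero>\<^bsub>L\<^esub>" using x bimod_hom_zero[OF f L.M M.M] by (simp add: M.\<delta>\<delta>[OF u(1)])
    finally have "L.\<delta> (Suc n) w x = \<zero>\<^bsub>L\<^esub>"
      by (rule inj_onD[OF inj_f]) (use L.C_closed[OF L.\<delta>_closed[OF w(1)] x] in simp_all)
    then show "L.\<delta> (Suc n) w x = \<zero>\<^bsub>L.C (Suc (Suc n))\<^esub> x" using x by simp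
  qed
  then have "w \<in> carrier (L.ZZ (Suc n))" using w(1) by (simp add: L.ZZ_carrier del: cochains_simps)
  moreover have "compose (carrier (X (Suc n))) f w = M.\<delta> n u"
    by (rule cochain_eqI[OF k_linearD(1)[OF coefficient_linear(1)[OF L M f] w(1)] M.\<delta>_closed[OF u(1)]])
       (simp add: compose_eq w(2))
  moreover have "compose (carrier (X n)) g u \<in> \<xi>" using u(2) z S.coset_self by simp
  ultimately show thesis using u(1) by (intro that)
qed

text \<open>One pair (u, w) determines the whole set. Naturality of connecting maps therefore
  reduces to following a single pair.\<close>

lemma connecting_eq:
  assumes \<xi>: "\<xi> \<in> carrier (cohomology R X d n N)"
    and u: "u \<in> carrier (M.C n)" and w: "w \<in> carrier (L.ZZ (Suc n))" and gu: "compose (carrier (X n)) g u \<in> \<xi>"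
    and fw: "compose (carrier (X (Suc n))) f w = M.\<delta> n u"
  shows "connecting R X d n L f M g N \<xi> = L.DD (Suc n) +>\<^bsub>L.ZZ (Suc n)\<^esub> w"
proof (intro subset_antisym subsetI)
  interpret S: submod K "N.ZZ n" "N.DD n" by (rule N.submod)
  interpret S': submod K "L.ZZ (Suc n)" "L.DD (Suc n)" by (rule L.submod)
  have wC: "w \<in> carrier (L.C (Suc n))" using w by (simp add: L.ZZ_carrier)
  have fw': "f (w x) = u (d n x)" if "x \<in> carrier (X (Suc n))" for x
    using fun_cong[OF fw, of x] that by (simp add: compose_eq M.\<delta>_apply)
  note fL = add_hom_minus[OF bimod_hom_add_hom[OF f] L.M.abelian_group_axioms M.M.abelian_group_axioms]
    and gM = add_hom_minus[OF bimod_hom_add_hom[OF g] M.M.abelian_group_axioms N.M.abelian_group_axioms]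
  {
    fix w' assume "w' \<in> connecting R X d n L f M g N \<xi>"
    then obtain u' where w': "w' \<in> carrier (L.ZZ (Suc n))" and u': "u' \<in> carrier (M.C n)"
      and gu': "compose (carrier (X n)) g u' \<in> \<xi>" and fw1: "compose (carrier (X (Suc n))) f w' = M.\<delta> n u'"
      by (auto simp: connecting_def)
    have w'C: "w' \<in> carrier (L.C (Suc n))" using w' by (simp add: L.ZZ_carrier)
    have fw1': "f (w' x) = u' (d n x)" if "x \<in> carrier (X (Suc n))" for x
      using fun_cong[OF fw1, of x] that by (simp add: compose_eq M.\<delta>_apply)
    let ?gu = "compose (carrier (X n)) g u" and ?gu' = "compose (carrier (X n)) g u'"
    obtain z where z: "z \<in> carrier (N.ZZ n)" "\<xi> = N.DD n +>\<^bsub>N.ZZ n\<^esub> z"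
      using \<xi> by (auto simp: N.cohomology_quot S.quot_carrier)
    have Z: "?gu \<in> carrier (N.ZZ n)" "?gu' \<in> carrier (N.ZZ n)" using gu gu' z S.coset_mem by auto
    have CC: "?gu \<in> carrier (N.C n)" "?gu' \<in> carrier (N.C n)" using Z by (auto simp: N.ZZ_carrier)
    have "N.DD n +>\<^bsub>N.ZZ n\<^esub> ?gu = \<xi>" using S.coset_eq[OF Z(1) z(1)] gu z S.coset_mem[OF z(1)] by simp
    then have D: "?gu' \<ominus>\<^bsub>N.C n\<^esub> ?gu \<in> N.DD n" using S.coset_mem[OF Z(1)] gu' N.ZZ_minus[OF Z(2,1)] by auto
    \<comment> \<open>A correction for having two lifts of cohomologous cocycles: if they differ by
      the coboundary of y, take t to be the coboundary of a lift of y. In degree 0 cohomologous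
      means equal, and t = 0.\<close>
    have "\<exists>t\<in>carrier (M.C n). (\<forall>x\<in>carrier (X n). g (t x) = g (u' x) \<ominus>\<^bsub>N\<^esub> g (u x)) \<and>
        (\<forall>x\<in>carrier (X (Suc n)). t (d n x) = \<zero>\<^bsub>M\<^esub>)"
    proof (cases n)
      case 0
      have "?gu' \<ominus>\<^bsub>N.C n\<^esub> ?gu = \<zero>\<^bsub>N.C n\<^esub>" using D 0 by (simp add: coboundaries_def del: cochains_simps)
      then have "g (u' x) \<ominus>\<^bsub>N\<^esub> g (u x) = \<zero>\<^bsub>N\<^esub>" if "x \<in> carrier (X n)" for x
        using N.C_minus_apply[OF CC(2,1) that] that by (simp add: compose_eq)
      then show ?thesis
        using bimod_hom_zero[OF g M.M N.M] M.d_closed by (intro bexI[OF _ M.C_zero]) simp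
    next
      case (Suc m)
      then obtain y where y: "y \<in> carrier (N.C m)" "?gu' \<ominus>\<^bsub>N.C n\<^esub> ?gu = N.\<delta> m y" using D by (auto simp: coboundaries_def)
      obtain y' where y': "y' \<in> carrier (M.C m)" "compose (carrier (X m)) g y' = y" by (rule cochain_lift[OF y(1)])
      have "g (M.\<delta> m y' x) = g (u' x) \<ominus>\<^bsub>N\<^esub> g (u x)" if x: "x \<in> carrier (X n)" for x
      proof -
        have x': "x \<in> carrier (X (Suc m))" using x Suc by simp
        have "g (M.\<delta> m y' x) = N.\<delta> m y x"
          using x' M.d_closed[OF x'] by (simp add: M.\<delta>_apply N.\<delta>_apply y'(2)[symmetric] compose_eq)
        then show ?thesis using N.C_minus_apply[OF CC(2,1) x] x by (simp add: y(2)[symmetric] compose_eq)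
      qed
      moreover have "M.\<delta> m y' (d n x) = \<zero>\<^bsub>M\<^esub>" if "x \<in> carrier (X (Suc n))" for x
        using fun_cong[OF M.\<delta>\<delta>[OF y'(1)], of x] that Suc by (simp add: M.\<delta>_apply)
      ultimately show ?thesis using M.\<delta>_closed[OF y'(1)] Suc by blast
    qed
    then obtain t where t: "t \<in> carrier (M.C n)" "\<And>x. x \<in> carrier (X n) ==> g (t x) = g (u' x) \<ominus>\<^bsub>N\<^esub> g (u x)"
      "\<And>x. x \<in> carrier (X (Suc n)) ==> t (d n x) = \<zero>\<^bsub>M\<^esub>" by blast
    \<comment> \<open>Killed by g, so it equals f v for some v; as t vanishes on boundaries, w' - w
      is the coboundary of v.\<close>
    let ?s = "(u' \<ominus>\<^bsub>M.C n\<^esub> u) \<ominus>\<^bsub>M.C n\<^esub> t"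
    have uu: "u' \<ominus>\<^bsub>M.C n\<^esub> u \<in> carrier (M.C n)" using u u' by simp
    have s: "?s \<in> carrier (M.C n)" using uu t(1) by simp
    have sx: "?s x = (u' x \<ominus>\<^bsub>M\<^esub> u x) \<ominus>\<^bsub>M\<^esub> t x" if "x \<in> carrier (X n)" for x
      using that u u' t(1) uu by (simp add: M.C_minus_apply)
    have "g (?s x) = \<zero>\<^bsub>N\<^esub>" if "x \<in> carrier (X n)" for x
      using that by (simp add: sx gM t(2) M.C_closed[OF u] M.C_closed[OF u'] M.C_closed[OF t(1)] bimod_hom_closed[OF g] N.M.minus_self)
    then obtain v where v: "v \<in> carrier (L.C n)" "\<And>x. x \<in> carrier (X n) ==> f (v x) = ?s x"
      using cochain_factor[OF s] by blast
    have "w' \<ominus>\<^bsub>L.C (Suc n)\<^esub> w = L.\<delta> n v"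
    proof (rule cochain_eqI[OF _ L.\<delta>_closed[OF v(1)]])
      show "w' \<ominus>\<^bsub>L.C (Suc n)\<^esub> w \<in> carrier (L.C (Suc n))" using w'C wC by simp
      fix x assume x: "x \<in> carrier (X (Suc n))"
      note dx = M.d_closed[OF x]
      have "f ((w' \<ominus>\<^bsub>L.C (Suc n)\<^esub> w) x) = f (L.\<delta> n v x)"
        using x dx by (simp add: L.C_minus_apply[OF w'C wC] fL L.C_closed[OF wC] L.C_closed[OF w'C] fw' fw1' L.\<delta>_apply v(2) sx t(3)
          M.C_closed[OF u] M.C_closed[OF u'] a_minus_def[of M _ "\<zero>\<^bsub>M\<^esub>"])
      then show "(w' \<ominus>\<^bsub>L.C (Suc n)\<^esub> w) x = L.\<delta> n v x"
        by (rule inj_onD[OF inj_f]) (use x L.C_closed[OF _ x] w'C wC L.\<delta>_closed[OF v(1)] in simp_all)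
    qed
    then have "w' \<ominus>\<^bsub>L.ZZ (Suc n)\<^esub> w \<in> L.DD (Suc n)"
      using v(1) by (simp add: L.ZZ_minus[OF w' w] coboundaries_def)
    then show "w' \<in> L.DD (Suc n) +>\<^bsub>L.ZZ (Suc n)\<^esub> w" using w' by (simp add: S'.coset_mem[OF w])
  next
    fix w' assume "w' \<in> L.DD (Suc n) +>\<^bsub>L.ZZ (Suc n)\<^esub> w"
    then have w': "w' \<in> carrier (L.ZZ (Suc n))" and D: "w' \<ominus>\<^bsub>L.ZZ (Suc n)\<^esub> w \<in> L.DD (Suc n)"
      using S'.coset_mem[OF w] by auto
    have w'C: "w' \<in> carrier (L.C (Suc n))" using w' by (simp add: L.ZZ_carrier)
    obtain v where v: "v \<in> carrier (L.C n)" "w' \<ominus>\<^bsub>L.C (Suc n)\<^esub> w = L.\<delta> n v"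
      using D by (auto simp: L.ZZ_minus[OF w' w] coboundaries_def)
    let ?fv = "compose (carrier (X n)) f v"
    have fv: "?fv \<in> carrier (M.C n)" by (rule k_linearD(1)[OF coefficient_linear(1)[OF L M f] v(1)])
    \<comment> \<open>Adding f v does not change the image under g and changes the coboundary by
      exactly f (w' - w).\<close>
    let ?u' = "u \<oplus>\<^bsub>M.C n\<^esub> ?fv"
    have u': "?u' \<in> carrier (M.C n)" by (rule M.C_add[OF u fv])
    have "compose (carrier (X n)) g ?u' = compose (carrier (X n)) g u"
      by (rule cochain_eqI[OF k_linearD(1)[OF coefficient_linear(1)[OF M N g] u'] k_linearD(1)[OF coefficient_linear(1)[OF M N g] u]])
         (simp add: compose_eq bimod_hom_add[OF g] bimod_hom_closed[OF f] bimod_hom_closed[OF g] gf M.C_closed[OF u] L.C_closed[OF v(1)])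
    moreover have "compose (carrier (X (Suc n))) f w' = M.\<delta> n ?u'"
    proof (rule cochain_eqI[OF k_linearD(1)[OF coefficient_linear(1)[OF L M f] w'C] M.\<delta>_closed[OF u']])
      fix x assume x: "x \<in> carrier (X (Suc n))"
      note dx = M.d_closed[OF x]
      have cl: "w' x \<in> carrier L" "w x \<in> carrier L" "v (d n x) \<in> carrier L"
        using L.C_closed[OF w'C x] L.C_closed[OF wC x] L.C_closed[OF v(1) dx] by auto
      have "w' x \<ominus>\<^bsub>L\<^esub> w x = v (d n x)"
        using fun_cong[OF v(2), of x] x by (simp add: L.C_minus_apply[OF w'C wC] L.\<delta>_apply)
      then have eq: "f (v (d n x)) = f (w' x) \<ominus>\<^bsub>M\<^esub> f (w x)" using cl by (simp add: fL[symmetric])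
      have "f (w' x) = f (w x) \<oplus>\<^bsub>M\<^esub> f (v (d n x))"
        unfolding eq a_minus_def using cl bimod_hom_closed[OF f]
        by (simp add: M.M.a_comm[of "f (w' x)" "\<ominus>\<^bsub>M\<^esub> f (w x)"] M.M.r_neg2)
      then show "compose (carrier (X (Suc n))) f w' x = M.\<delta> n ?u' x"
        using x dx by (simp add: compose_eq M.\<delta>_apply fw')
    qed
    ultimately show "w' \<in> connecting R X d n L f M g N \<xi>"
      using w' gu unfolding connecting_def by (intro CollectI conjI bexI[OF _ u']) (simp_all only:)
  }
qed

end

section \<open>Pulling cochains back along a map of complexes\<close>

text \<open>X lives over A and P over B, and F is linear over B only. Pulling back thus takes
  A-bilinear cochains on X to B-bilinear cochains on P with the same coefficients.\<close>

locale comparison =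
  fixes K :: "'k ring" and A B :: "('k, 'a) module"
    and X :: "nat \<Rightarrow> ('k, 'a, 'a, 'x) bimod" and dX
    and P :: "nat \<Rightarrow> ('k, 'a, 'a, 'p) bimod" and dP and F
  assumes sub: "subalg K A B" and X: "bicomplex K A X dX" and P: "bicomplex K B P dP"
    and F: "\<And>n. F n \<in> bimod_hom B (P n) (X n)"
    and Fd: "\<And>n x. x \<in> carrier (P (Suc n)) ==> dX n (F (Suc n) x) = F n (dP n x)"
begin

lemma coch_X: "bim K A A M ==> coch K A X dX M"
  using subalgD(1)[OF sub] X by (simp add: coch_def)

lemma bim_B: "bim K A A M ==> bim K B B M"
  by (rule bim_restrict_left[OF sub bim_restrict_right[OF sub]])

lemma coch_P: "bim K A A M ==> coch K B P dP M"
  using subalgD(2)[OF sub] P by (simp add: coch_def bim_B)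

abbreviation "pull n z \<equiv> compose (carrier (P n)) z (F n)"

lemma F_closed: "x \<in> carrier (P n) ==> F n x \<in> carrier (X n)"
  by (rule bimod_hom_closed[OF F])

lemma pull_closed:
  assumes "bim K A A M" "z \<in> carrier (cochains A X M n)"
  shows "pull n z \<in> carrier (cochains B P M n)"
  unfolding compose_def
  by (rule coch.C_restrict[OF coch_P[OF assms(1)] bimod_hom_compose[OF F bimod_hom_restrict[OF sub coch.C_hom[OF coch_X[OF assms(1)] assms(2)]]]])

lemma pull_linear:
  assumes M: "bim K A A M"
  shows "pull n \<in> k_linear K (cochains A X M n) (cochains B P M n)"
proof -
  interpret X: coch K A X dX M by (rule coch_X[OF M])
  interpret P: coch K B P dP M by (rule coch_P[OF M])
  note c = pull_closed[OF M]
  show ?thesis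
    unfolding k_linear_def
  proof (intro CollectI conjI ballI funcsetI c)
    fix u v assume *: "u \<in> carrier (X.C n)" "v \<in> carrier (X.C n)"
    show "pull n (u \<oplus>\<^bsub>X.C n\<^esub> v) = pull n u \<oplus>\<^bsub>P.C n\<^esub> pull n v"
      by (rule cochain_eqI[OF c[OF X.C_add] P.C_add[OF c c]]) (use * in \<open>auto simp: compose_eq F_closed\<close>)
  next
    fix a u assume *: "a \<in> carrier K" "u \<in> carrier (X.C n)"
    show "pull n (a \<odot>\<^bsub>X.C n\<^esub> u) = a \<odot>\<^bsub>P.C n\<^esub> pull n u"
      by (rule cochain_eqI[OF c[OF X.C_smult] P.C_smult[OF _ c]]) (use * in \<open>auto simp: compose_eq F_closed\<close>)
  qed
qed

lemma pull_codiff: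
  assumes M: "bim K A A M" and z: "z \<in> carrier (cochains A X M n)"
  shows "pull (Suc n) (codiff X dX n z) = codiff P dP n (pull n z)"
proof -
  interpret X: coch K A X dX M by (rule coch_X[OF M])
  interpret P: coch K B P dP M by (rule coch_P[OF M])
  show ?thesis
    by (rule cochain_eqI[OF pull_closed[OF M X.\<delta>_closed[OF z]] P.\<delta>_closed[OF pull_closed[OF M z]]])
       (simp add: compose_eq X.\<delta>_apply P.\<delta>_apply F_closed P.d_closed Fd)
qed

lemma pull_submod_map:
  assumes M: "bim K A A M"
  shows "submod_map K (cocycles A X dX M n) (coboundaries A X dX M n)
    (cocycles B P dP M n) (coboundaries B P dP M n) (pull n)"
  by (rule cochain_map_submod_map[OF coch_X[OF M] coch_P[OF M], where \<phi> = pull])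
     (rule pull_linear[OF M] pull_codiff[OF M], assumption?)+

definition \<Phi> :: "nat \<Rightarrow> ('k, 'a, 'a, 'm) bimod \<Rightarrow> ('x \<Rightarrow> 'm) set \<Rightarrow> ('p \<Rightarrow> 'm) set" where
  "\<Phi> n M = qmap (cocycles B P dP M n) (coboundaries B P dP M n) (pull n)"

lemma \<Phi>_linear: "bim K A A M ==> \<Phi> n M \<in> k_linear K (cohomology A X dX n M) (cohomology B P dP n M)"
  unfolding \<Phi>_def coch.cohomology_quot[OF coch_X] coch.cohomology_quot[OF coch_P]
  by (rule submod_map.qmap_linear[OF pull_submod_map])

lemma \<Phi>_coset: "bim K A A M ==> z \<in> carrier (cocycles A X dX M n) ==>
    \<Phi> n M (coboundaries A X dX M n +>\<^bsub>cocycles A X dX M n\<^esub> z) =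
    coboundaries B P dP M n +>\<^bsub>cocycles B P dP M n\<^esub> pull n z"
  unfolding \<Phi>_def by (rule submod_map.qmap_coset[OF pull_submod_map])

lemma cohomology_X_cases:
  assumes "bim K A A M" "\<xi> \<in> carrier (cohomology A X dX n M)"
  obtains z where "z \<in> carrier (cocycles A X dX M n)" "\<xi> = coboundaries A X dX M n +>\<^bsub>cocycles A X dX M n\<^esub> z"
  using assms(2) unfolding coch.cohomology_quot[OF coch_X[OF assms(1)]]
    submod.quot_carrier[OF coch.submod[OF coch_X[OF assms(1)]]] by blast

lemma \<Phi>_natural:
  assumes M: "bim K A A M" and N: "bim K A A N" and f: "f \<in> bimod_hom A M N"
    and \<xi>: "\<xi> \<in> carrier (cohomology A X dX n M)"
  shows "\<Phi> n N (cohomology_map A X dX n M N f \<xi>) = cohomology_map B P dP n M N f (\<Phi> n M \<xi>)"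
proof -
  interpret X: submod_map K "cocycles A X dX M n" "coboundaries A X dX M n" "cocycles A X dX N n" "coboundaries A X dX N n"
    "\<lambda>z. compose (carrier (X n)) f z" by (rule coefficient_submod_map[OF coch_X[OF M] coch_X[OF N] f])
  interpret P: submod_map K "cocycles B P dP M n" "coboundaries B P dP M n" "cocycles B P dP N n" "coboundaries B P dP N n"
    "\<lambda>z. compose (carrier (P n)) f z"
    by (rule coefficient_submod_map[OF coch_P[OF M] coch_P[OF N] bimod_hom_restrict[OF sub f]])
  obtain z where z: "z \<in> carrier (cocycles A X dX M n)" "\<xi> = coboundaries A X dX M n +>\<^bsub>cocycles A X dX M n\<^esub> z"
    by (rule cohomology_X_cases[OF M \<xi>])
  have "pull n (compose (carrier (X n)) f z) = compose (carrier (P n)) f (pull n z)"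
    by (intro ext) (simp add: compose_def F_closed)
  then show ?thesis
    using z X.\<phi>(1)[OF z(1)] k_linearD(1)[OF submod_map.lin[OF pull_submod_map[OF M]] z(1)]
    by (simp add: cohomology_map_qmap X.qmap_coset P.qmap_coset \<Phi>_coset[OF M] \<Phi>_coset[OF N])
qed

text \<open>Pulling back a pair that computes the connecting map for X gives such a pair for P,
  because composition with F commutes with composition with f and g. The lifting hypotheses make
  both connecting maps well defined.\<close>

lemma \<Phi>_connecting:
  assumes L: "bim K A A L" and M: "bim K A A M" and N: "bim K A A N" and se: "short_exact A L f M g N"
    and liftX: "\<And>n. bilift A (X n) M N" and liftP: "\<And>n. bilift B (P n) M N"
    and \<xi>: "\<xi> \<in> carrier (cohomology A X dX n N)"
  shows "\<Phi> (Suc n) L (connecting A X dX n L f M g N \<xi>) = connecting B P dP n L f M g N (\<Phi> n N \<xi>)"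
proof -
  have seB: "short_exact B L f M g N"
    using se by (simp add: short_exact_def bimod_hom_restrict[OF sub])
  note ctX = coch_X[OF L] coch_X[OF M] coch_X[OF N] se liftX
  note ctP = coch_P[OF L] coch_P[OF M] coch_P[OF N] seB liftP
  interpret XL: coch K A X dX L by (rule coch_X[OF L])
  interpret XM: coch K A X dX M by (rule coch_X[OF M])
  interpret PM: coch K B P dP M by (rule coch_P[OF M])
  interpret S: submod_map K "cocycles A X dX N n" "coboundaries A X dX N n" "cocycles B P dP N n" "coboundaries B P dP N n" "pull n"
    by (rule pull_submod_map[OF N])
  obtain u w where u: "u \<in> carrier (cochains A X M n)" and w: "w \<in> carrier (cocycles A X dX L (Suc n))"
    and gu: "compose (carrier (X n)) g u \<in> \<xi>" and fw: "compose (carrier (X (Suc n))) f w = codiff X dX n u"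
    by (rule connecting_witness[OF ctX \<xi>])
  have wC: "w \<in> carrier (cochains A X L (Suc n))" using w by (simp add: XL.ZZ_carrier)
  obtain z where z: "z \<in> carrier (cocycles A X dX N n)" "\<xi> = coboundaries A X dX N n +>\<^bsub>cocycles A X dX N n\<^esub> z"
    by (rule cohomology_X_cases[OF N \<xi>])
  have gZ: "compose (carrier (X n)) g u \<in> carrier (cocycles A X dX N n)"
    "compose (carrier (X n)) g u \<ominus>\<^bsub>cocycles A X dX N n\<^esub> z \<in> coboundaries A X dX N n"
    using gu z S.S.coset_mem[OF z(1)] by auto
  then have \<xi>': "\<xi> = coboundaries A X dX N n +>\<^bsub>cocycles A X dX N n\<^esub> compose (carrier (X n)) g u"
    using z S.S.coset_eq[OF gZ(1) z(1)] by simp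
  have "compose (carrier (P n)) g (pull n u) = pull n (compose (carrier (X n)) g u)"
    by (intro ext) (simp add: compose_def F_closed)
  then have gu': "compose (carrier (P n)) g (pull n u) \<in> \<Phi> n N \<xi>"
    using S.S'.coset_self[OF S.\<phi>(1)[OF gZ(1)]] by (simp add: \<xi>' \<Phi>_coset[OF N gZ(1)])
  have "compose (carrier (P (Suc n))) f (pull (Suc n) w) = pull (Suc n) (compose (carrier (X (Suc n))) f w)"
    by (intro ext) (simp add: compose_def F_closed)
  also have "\<dots> = codiff P dP n (pull n u)" by (simp add: fw pull_codiff[OF M u])
  finally have fw': "compose (carrier (P (Suc n))) f (pull (Suc n) w) = codiff P dP n (pull n u)" .
  have w': "pull (Suc n) w \<in> carrier (cocycles B P dP L (Suc n))"
    by (rule k_linearD(1)[OF submod_map.lin[OF pull_submod_map[OF L]] w])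
  show ?thesis
    unfolding connecting_eq[OF ctX \<xi> u w gu fw] \<Phi>_coset[OF L w]
    by (rule connecting_eq[OF ctP k_linearD(1)[OF \<Phi>_linear[OF N] \<xi>] pull_closed[OF M u] w' gu' fw', symmetric])
qed

lemma \<Phi>_bij:
  assumes M: "bim K A A M"
    and inj: "\<And>z. z \<in> carrier (cocycles A X dX M n) ==> pull n z \<in> coboundaries B P dP M n ==> z \<in> coboundaries A X dX M n"
    and surj: "\<And>w. w \<in> carrier (cocycles B P dP M n) ==> \<exists>z\<in>carrier (cocycles A X dX M n).
      pull n z \<ominus>\<^bsub>cochains B P M n\<^esub> w \<in> coboundaries B P dP M n"
  shows "bij_betw (\<Phi> n M) (carrier (cohomology A X dX n M)) (carrier (cohomology B P dP n M))"
  unfolding \<Phi>_def coch.cohomology_quot[OF coch_X[OF M]] coch.cohomology_quot[OF coch_P[OF M]]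
proof (rule submod_map.qmap_bij[OF pull_submod_map[OF M] inj])
  fix w assume w: "w \<in> carrier (cocycles B P dP M n)"
  obtain z where z: "z \<in> carrier (cocycles A X dX M n)"
    "pull n z \<ominus>\<^bsub>cochains B P M n\<^esub> w \<in> coboundaries B P dP M n" using surj[OF w] by blast
  then have "pull n z \<ominus>\<^bsub>cocycles B P dP M n\<^esub> w \<in> coboundaries B P dP M n"
    by (simp only: coch.ZZ_minus[OF coch_P[OF M] k_linearD(1)[OF submod_map.lin[OF pull_submod_map[OF M]] z(1)] w])
  with z(1) show "\<exists>z\<in>carrier (cocycles A X dX M n). pull n z \<ominus>\<^bsub>cocycles B P dP M n\<^esub> w \<in> coboundaries B P dP M n"
    by (intro bexI[of _ z])
qed

end

section \<open>From homotopies to isomorphisms in cohomology\<close>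

lemma (in abelian_group) minus_zero_eq:
  assumes "a \<ominus> b = \<zero>" "a \<in> carrier G" "b \<in> carrier G"
  shows "a = b"
proof -
  have "a = (a \<ominus> b) \<oplus> b" using assms(2,3) by (simp add: a_minus_def a_assoc l_neg)
  then show ?thesis using assms by simp
qed

text \<open>A cocycle of degree 0 kills boundaries, so it depends on the value of the augmentation
  \<alpha> only.\<close>

lemma (in coch) cocycle_cong:
  assumes w: "w \<in> carrier (ZZ 0)" and \<alpha>: "\<alpha> \<in> add_hom (X 0) T" and T: "abelian_group T"
    and ex: "\<And>x. x \<in> carrier (X 0) ==> \<alpha> x = \<zero>\<^bsub>T\<^esub> ==> x \<in> d 0 ` carrier (X (Suc 0))"
    and xy: "x \<in> carrier (X 0)" "y \<in> carrier (X 0)" "\<alpha> x = \<alpha> y"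
  shows "w x = w y"
proof -
  interpret X0: abelian_group "X 0" by (rule agX)
  have wC: "w \<in> carrier (C 0)" and dw: "\<delta> 0 w = \<zero>\<^bsub>C (Suc 0)\<^esub>" using w by (auto simp: ZZ_carrier)
  have "\<alpha> (x \<ominus>\<^bsub>X 0\<^esub> y) = \<zero>\<^bsub>T\<^esub>"
    using xy add_hom_minus[OF \<alpha> agX T xy(1,2)] abelian_group.minus_self[OF T add_hom_closed[OF \<alpha> xy(2)]] by simp
  then have "x \<ominus>\<^bsub>X 0\<^esub> y \<in> d 0 ` carrier (X (Suc 0))" using xy by (intro ex) auto
  then obtain q where q: "q \<in> carrier (X (Suc 0))" "x \<ominus>\<^bsub>X 0\<^esub> y = d 0 q" by auto
  have "w x \<ominus>\<^bsub>M\<^esub> w y = w (x \<ominus>\<^bsub>X 0\<^esub> y)"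
    by (rule add_hom_minus[OF bimod_hom_add_hom[OF C_hom[OF wC]] agX M.abelian_group_axioms xy(1,2), symmetric])
  also have "\<dots> = \<zero>\<^bsub>M\<^esub>" using fun_cong[OF dw, of q] q by (simp add: \<delta>_apply)
  finally show ?thesis by (rule M.minus_zero_eq) (use C_closed[OF wC] xy in simp_all)
qed

text \<open>With h = d s + s d and y vanishing on boundaries, y h = (y s) d. It is used for
  homotopies into X itself and into the induced complex, hence the second complex Y. In degree 0 the
  composite is zero, which is the only coboundary there.\<close>

lemma (in coch) null_homotopic_coboundary:
  assumes v: "v \<in> carrier (C n)" and y: "y \<in> bimod_hom R (Y n) M" and bY: "\<And>n. bim K R R (Y n)"
    and yd: "\<And>q. q \<in> carrier (Y (Suc n)) ==> y (dY n q) = \<zero>\<^bsub>M\<^esub>"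
    and dY: "\<And>n. dY n \<in> bimod_hom R (Y (Suc n)) (Y n)"
    and s: "\<And>n. s n \<in> bimod_hom R (X n) (Y (Suc n))"
    and h0: "\<And>x. x \<in> carrier (X 0) ==> h 0 x = dY 0 (s 0 x)"
    and hS: "\<And>n x. x \<in> carrier (X (Suc n)) ==> h (Suc n) x = dY (Suc n) (s (Suc n) x) \<oplus>\<^bsub>Y (Suc n)\<^esub> s n (d n x)"
    and eq: "\<And>x. x \<in> carrier (X n) ==> v x = y (h n x)"
  shows "v \<in> DD n"
proof (cases n)
  case 0
  have "v = \<zero>\<^bsub>C 0\<^esub>"
  proof (rule cochain_eqI[OF _ C_zero])
    show "v \<in> carrier (C 0)" using v 0 by simp
    fix x assume x: "x \<in> carrier (X 0)"
    then show "v x = \<zero>\<^bsub>C 0\<^esub> x" using 0 eq[of x] yd[of "s 0 x"] bimod_hom_closed[OF s x] by (simp add: h0)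
  qed
  then show ?thesis using 0 by (simp add: coboundaries_def)
next
  case (Suc m)
  let ?u = "restrict (\<lambda>x. y (s m x)) (carrier (X m))"
  have y': "y \<in> bimod_hom R (Y (Suc m)) M" using y Suc by simp
  have u: "?u \<in> carrier (C m)" by (rule C_restrict[OF bimod_hom_compose[OF s y']])
  have "v = \<delta> m ?u"
  proof (rule cochain_eqI[OF _ \<delta>_closed[OF u]])
    show "v \<in> carrier (C (Suc m))" using v Suc by simp
    fix x assume x: "x \<in> carrier (X (Suc m))"
    have cl: "s (Suc m) x \<in> carrier (Y (Suc (Suc m)))" "s m (d m x) \<in> carrier (Y (Suc m))"
      "dY (Suc m) (s (Suc m) x) \<in> carrier (Y (Suc m))" "d m x \<in> carrier (X m)"
      using bimod_hom_closed[OF s x] bimod_hom_closed[OF s d_closed[OF x]] bimod_hom_closed[OF dY] d_closed[OF x] by auto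
    have "v x = y (dY (Suc m) (s (Suc m) x)) \<oplus>\<^bsub>M\<^esub> y (s m (d m x))"
      using eq[of x] x Suc cl by (simp add: hS bimod_hom_add[OF y'])
    then show "v x = \<delta> m ?u x"
      using yd[of "s (Suc m) x"] Suc cl x bimod_hom_closed[OF y'] by (simp add: \<delta>_apply)
  qed
  then show ?thesis using Suc u by (auto simp: coboundaries_def)
qed

text \<open>Besides F there are A-bilinear chain maps G from X to Q and H from Q to X over the
  identity of T, with H j = F. Over B the map G F is homotopic to j, over A the map H G is homotopic
  to the identity. The first homotopy gives surjectivity, with preimage w' G where w' extends w to
  Q; the second gives injectivity.\<close>

lemma (in comparison) induced_bij:
  fixes Q :: "nat \<Rightarrow> ('k, 'a, 'a, 'q) bimod" and T :: "('k, 'a, 'a, 't) bimod" and M :: "('k, 'a, 'a, 'm) bimod"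
  assumes T: "bim K A A T" and M: "bim K A A M" and ir: "induced_resolution K A B P dP \<epsilon> T e Q dQ \<epsilon>Q j"
    and exX: "exact_pos X dX" and \<alpha>: "\<alpha> \<in> bimod_hom A (X 0) T"
    and \<alpha>d: "\<And>x. x \<in> carrier (X (Suc 0)) ==> \<alpha> (dX 0 x) = \<zero>\<^bsub>T\<^esub>"
    and ex0: "\<And>x. x \<in> carrier (X 0) ==> \<alpha> x = \<zero>\<^bsub>T\<^esub> ==> x \<in> dX 0 ` carrier (X (Suc 0))"
    and \<alpha>F: "\<And>x. x \<in> carrier (P 0) ==> \<alpha> (F 0 x) = lact T (\<epsilon> x) e"
    and lift0: "bilift A (X 0) (Q 0) T" and liftQ: "\<And>n. bilift A (X (Suc n)) (Q (Suc n)) (Q n)"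
    and liftX: "\<And>n. bilift A (X n) (X (Suc n)) (X n)" and liftP: "\<And>n. bilift B (P n) (Q (Suc n)) (Q n)"
    and extM: "\<And>n. extends A B (P n) (Q n) (j n) M" and extX: "\<And>n. extends A B (P n) (Q n) (j n) (X n)"
  shows "bij_betw (\<Phi> n M) (carrier (cohomology A X dX n M)) (carrier (cohomology B P dP n M))"
proof -
  have Q: "bicomplex K A Q dQ" and exQ: "exact_pos Q dQ" and \<epsilon>Q: "\<epsilon>Q \<in> bimod_hom A (Q 0) T"
    and onto: "\<epsilon>Q ` carrier (Q 0) = carrier T"
    and exQ0: "\<And>x. x \<in> carrier (Q 0) ==> \<epsilon>Q x = \<zero>\<^bsub>T\<^esub> ==> x \<in> dQ 0 ` carrier (Q (Suc 0))"
    and j: "\<And>n. j n \<in> bimod_hom B (P n) (Q n)"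
    and jd: "\<And>n x. x \<in> carrier (P (Suc n)) ==> dQ n (j (Suc n) x) = j n (dP n x)"
    and \<epsilon>j: "\<And>x. x \<in> carrier (P 0) ==> \<epsilon>Q (j 0 x) = lact T (\<epsilon> x) e"
    and gen: "\<And>n. generated_by A (Q n) (j n ` carrier (P n))"
    using ir by (auto simp: induced_resolution_def)
  interpret MX: coch K A X dX M by (rule coch_X[OF M])
  interpret MP: coch K B P dP M by (rule coch_P[OF M])
  note Xh = bimod_hom_closed[OF bicomplexD(2)[OF X]] and bX = bicomplexD(1)[OF X] and bQ = bicomplexD(1)[OF Q]
    and dQ = bicomplexD(2)[OF Q] and dQ_cl = bicomplexD(5)[OF Q] and j_cl = bimod_hom_closed[OF j]
  note agT = bim_abelian_group[OF T] and agQ = bicomplexD(4)[OF Q]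
  have QB: "bicomplex K B Q dQ"
    using Q by (simp add: bicomplex_def bim_B bimod_hom_restrict[OF sub])
  have T0: "lact T a \<zero>\<^bsub>T\<^esub> = \<zero>\<^bsub>T\<^esub>" if "a \<in> carrier A" for a
    by (rule add_hom_zero[OF lact_add_hom[OF bim_left[OF T] that] agT agT])
  have eqQ: "g q = h q" if "g \<in> bimod_hom A (Q n) N" "h \<in> bimod_hom A (Q n) N"
      "\<And>x. x \<in> carrier (P n) ==> g (j n x) = h (j n x)" "q \<in> carrier (Q n)"
    for g h n q and N :: "('k, 'a, 'a, 'w) bimod"
    by (rule generated_by_eq[OF gen bQ that(1,2) j_cl that(3,4)])
  obtain G0 where G0: "G0 \<in> bimod_hom A (X 0) (Q 0)" "\<And>x. x \<in> carrier (X 0) ==> \<epsilon>Q (G0 x) = \<alpha> x"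
    by (rule bilift_obtain[OF lift0 \<alpha> \<epsilon>Q]) (use bimod_hom_closed[OF \<alpha>] onto in auto)
  have st: "G0 (dX 0 x) \<in> dQ 0 ` carrier (Q (Suc 0))" if "x \<in> carrier (X (Suc 0))" for x
    by (rule exQ0) (use that in \<open>simp_all add: G0(2) \<alpha>d Xh bimod_hom_closed[OF G0(1)]\<close>)
  obtain G where G: "G 0 = G0" "\<And>n. G n \<in> bimod_hom A (X n) (Q n)"
    "\<And>n x. x \<in> carrier (X (Suc n)) ==> dQ n (G (Suc n) x) = G n (dX n x)"
    by (rule chain_map_exists[OF X Q exQ liftQ G0(1) st]) (assumption | (rule that; assumption))+
  note G_cl = bimod_hom_closed[OF G(2)]
  \<comment> \<open>Both maps induce x \<mapsto> \<epsilon>(x) e on augmentations, so their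
    difference is null-homotopic over B.\<close>
  let ?h = "\<lambda>n x. G n (F n x) \<ominus>\<^bsub>Q n\<^esub> j n x"
  have hh: "?h n \<in> bimod_hom B (P n) (Q n)" for n
    by (rule bimod_hom_minus[OF bimod_hom_compose[OF F bimod_hom_restrict[OF sub G(2)]] j bim_B[OF bQ]])
  have hd: "dQ n (?h (Suc n) x) = ?h n (dP n x)" if "x \<in> carrier (P (Suc n))" for n x
    using that by (simp add: add_hom_minus[OF bimod_hom_add_hom[OF dQ] agQ agQ] F_closed G_cl j_cl G(3) Fd jd)
  have h0: "?h 0 x \<in> dQ 0 ` carrier (Q (Suc 0))" if x: "x \<in> carrier (P 0)" for x
  proof (rule exQ0)
    show "?h 0 x \<in> carrier (Q 0)" using bimod_hom_closed[OF hh x] .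
    have "\<epsilon>Q (?h 0 x) = \<epsilon>Q (G0 (F 0 x)) \<ominus>\<^bsub>T\<^esub> \<epsilon>Q (j 0 x)"
      using add_hom_minus[OF bimod_hom_add_hom[OF \<epsilon>Q] agQ agT bimod_hom_closed[OF G0(1) F_closed[OF x]] j_cl[OF x]] by (simp add: G(1))
    then show "\<epsilon>Q (?h 0 x) = \<zero>\<^bsub>T\<^esub>"
      using x abelian_group.minus_self[OF agT bimod_hom_closed[OF \<epsilon>Q j_cl[OF x]]] by (simp add: G0(2) F_closed \<alpha>F \<epsilon>j)
  qed
  obtain s where s: "\<And>n. s n \<in> bimod_hom B (P n) (Q (Suc n))"
    "\<And>x. x \<in> carrier (P 0) ==> ?h 0 x = dQ 0 (s 0 x)"
    "\<And>n x. x \<in> carrier (P (Suc n)) ==> ?h (Suc n) x = dQ (Suc n) (s (Suc n) x) \<oplus>\<^bsub>Q (Suc n)\<^esub> s n (dP n x)"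
    by (rule chain_homotopy_exists[where P = P and dP = dP and Y = Q and dY = dQ and h = ?h, OF P QB exQ liftP hh hd h0]) (assumption | (rule that; assumption))+
  \<comment> \<open>H is found degree by degree without lifting. It is a chain map because both
    composites with the differentials are A-bilinear and agree on the generators j x.\<close>
  have "\<exists>v\<in>bimod_hom A (Q n) (X n). \<forall>x\<in>carrier (P n). v (j n x) = F n x" for n
    using extX[of n] F[of n] unfolding extends_def by blast
  then obtain H where H: "\<And>n. H n \<in> bimod_hom A (Q n) (X n)" "\<And>n x. x \<in> carrier (P n) ==> H n (j n x) = F n x"
    by metis
  note H_cl = bimod_hom_closed[OF H(1)]
  have Hd: "dX n (H (Suc n) q) = H n (dQ n q)" if "q \<in> carrier (Q (Suc n))" for n q
    by (rule eqQ[OF bimod_hom_compose[OF H(1) bicomplexD(2)[OF X]] bimod_hom_compose[OF dQ H(1)] _ that])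
       (simp add: H(2) Fd jd MP.d_closed)
  have \<alpha>H: "\<alpha> (H 0 q) = \<epsilon>Q q" if "q \<in> carrier (Q 0)" for q
    by (rule eqQ[OF bimod_hom_compose[OF H(1) \<alpha>] \<epsilon>Q _ that]) (simp add: H(2) \<alpha>F \<epsilon>j)
  \<comment> \<open>H G and the identity both cover the identity of T, so the difference is
    null-homotopic over A.\<close>
  let ?k = "\<lambda>n x. H n (G n x) \<ominus>\<^bsub>X n\<^esub> x"
  have kh: "?k n \<in> bimod_hom A (X n) (X n)" for n
    by (rule bimod_hom_minus[OF bimod_hom_compose[OF G(2) H(1)] bimod_hom_id bX])
  have kd: "dX n (?k (Suc n) x) = ?k n (dX n x)" if "x \<in> carrier (X (Suc n))" for n x
    using that by (simp add: add_hom_minus[OF bimod_hom_add_hom[OF bicomplexD(2)[OF X]] MX.agX MX.agX] H_cl G_cl Hd G(3))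
  have k0: "?k 0 x \<in> dX 0 ` carrier (X (Suc 0))" if x: "x \<in> carrier (X 0)" for x
  proof (rule ex0)
    show "?k 0 x \<in> carrier (X 0)" using bimod_hom_closed[OF kh x] .
    have "\<alpha> (?k 0 x) = \<alpha> (H 0 (G0 x)) \<ominus>\<^bsub>T\<^esub> \<alpha> x"
      using add_hom_minus[OF bimod_hom_add_hom[OF \<alpha>] MX.agX agT H_cl[OF G_cl[OF x]] x] by (simp add: G(1))
    then show "\<alpha> (?k 0 x) = \<zero>\<^bsub>T\<^esub>"
      using x abelian_group.minus_self[OF agT bimod_hom_closed[OF \<alpha> x]] bimod_hom_closed[OF G0(1) x] by (simp add: \<alpha>H G0(2))
  qed
  obtain r where r: "\<And>n. r n \<in> bimod_hom A (X n) (X (Suc n))"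
    "\<And>x. x \<in> carrier (X 0) ==> ?k 0 x = dX 0 (r 0 x)"
    "\<And>n x. x \<in> carrier (X (Suc n)) ==> ?k (Suc n) x = dX (Suc n) (r (Suc n) x) \<oplus>\<^bsub>X (Suc n)\<^esub> r n (dX n x)"
    by (rule chain_homotopy_exists[where P = X and dP = dX and Y = X and dY = dX and h = ?k, OF X X exX liftX kh kd k0]) (assumption | (rule that; assumption))+
  show ?thesis
  proof (rule \<Phi>_bij[OF M])
    fix z assume z: "z \<in> carrier (MX.ZZ n)" and pz: "pull n z \<in> MP.DD n"
    have zC: "z \<in> carrier (MX.C n)" and dz: "MX.\<delta> n z = \<zero>\<^bsub>MX.C (Suc n)\<^esub>" using z by (auto simp: MX.ZZ_carrier)
    note zh = MX.C_hom[OF zC]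
    have zd: "z (dX n q) = \<zero>\<^bsub>M\<^esub>" if "q \<in> carrier (X (Suc n))" for q
      using fun_cong[OF dz, of q] that by (simp add: MX.\<delta>_apply)
    let ?zk = "restrict (\<lambda>x. z (?k n x)) (carrier (X n))" and ?zG = "restrict (\<lambda>x. z (H n (G n x))) (carrier (X n))"
    have zkC: "?zk \<in> carrier (MX.C n)" by (rule MX.C_restrict[OF bimod_hom_compose[OF kh zh]])
    have zGC: "?zG \<in> carrier (MX.C n)"
      by (rule MX.C_restrict[OF bimod_hom_compose[OF G(2) bimod_hom_compose[OF H(1) zh]]])
    have zk: "?zk \<in> MX.DD n"
      by (rule MX.null_homotopic_coboundary[where Y = X and dY = dX and s = r and h = ?k and y = z])
         (use zkC zh zd r bX bicomplexD(2)[OF X] in simp_all)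
    have zG: "?zG \<in> MX.DD n"
    proof (cases n)
      case 0
      have "z (H n q) = \<zero>\<^bsub>M\<^esub>" if q: "q \<in> carrier (Q n)" for q
      proof (rule eqQ[OF bimod_hom_compose[OF H(1) zh] _ _ q])
        show "(\<lambda>q. \<zero>\<^bsub>M\<^esub>) \<in> bimod_hom A (Q n) M" by (rule bimod_hom_null[OF M])
        fix x assume x: "x \<in> carrier (P n)"
        have "pull n z = \<zero>\<^bsub>MP.C 0\<^esub>" using pz 0 by (simp add: coboundaries_def del: cochains_simps)
        from fun_cong[OF this, of x] show "z (H n (j n x)) = \<zero>\<^bsub>M\<^esub>" using x 0 by (simp add: compose_eq H(2))
      qed
      then have "?zG = \<zero>\<^bsub>MX.C n\<^esub>" using G_cl by (auto simp: fun_eq_iff)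
      then show ?thesis using 0 by (simp add: coboundaries_def)
    next
      case (Suc m)
      obtain w where w: "w \<in> carrier (MP.C m)" "pull n z = MP.\<delta> m w" using pz Suc by (auto simp: coboundaries_def)
      obtain w' where w': "w' \<in> bimod_hom A (Q m) M" "\<And>x. x \<in> carrier (P m) ==> w' (j m x) = w x"
        using extM[of m] MP.C_hom[OF w(1)] unfolding extends_def by blast
      \<comment> \<open>On generators this is z F = w d, the assumption that the pullback is a
        coboundary; both sides are A-bilinear.\<close>
      have zH: "z (H n q) = w' (dQ m q)" if q: "q \<in> carrier (Q n)" for q
      proof (rule eqQ[OF bimod_hom_compose[OF H(1) zh] _ _ q])
        show "(\<lambda>q. w' (dQ m q)) \<in> bimod_hom A (Q n) M" unfolding Suc by (rule bimod_hom_compose[OF dQ w'(1)])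
        fix x assume x: "x \<in> carrier (P n)"
        then have x': "x \<in> carrier (P (Suc m))" using Suc by simp
        have "z (F n x) = MP.\<delta> m w x" using fun_cong[OF w(2), of x] x by (simp add: compose_eq)
        then show "z (H n (j n x)) = w' (dQ m (j n x))"
          using x x' Suc MP.d_closed[OF x'] by (simp add: H(2) jd w'(2) MP.\<delta>_apply)
      qed
      let ?u = "restrict (\<lambda>x. w' (G m x)) (carrier (X m))"
      have u: "?u \<in> carrier (MX.C m)" by (rule MX.C_restrict[OF bimod_hom_compose[OF G(2) w'(1)]])
      have "?zG = MX.\<delta> m ?u"
      proof (rule cochain_eqI[OF zGC])
        show "MX.\<delta> m ?u \<in> carrier (MX.C n)" using MX.\<delta>_closed[OF u] Suc by simp
        fix x assume x: "x \<in> carrier (X n)"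
        then show "?zG x = MX.\<delta> m ?u x"
          using Suc zH[OF G_cl[OF x]] G(3)[of x m] MX.d_closed[of x m] by (simp add: MX.\<delta>_apply)
      qed
      then show ?thesis using Suc u by (auto simp: coboundaries_def)
    qed
    interpret D: submod K "MX.ZZ n" "MX.DD n" by (rule MX.submod)
    \<comment> \<open>z = z H G - z (H G - id), and both terms are coboundaries.\<close>
    have "z = ?zG \<ominus>\<^bsub>MX.C n\<^esub> ?zk"
    proof (rule cochain_eqI[OF zC MX.Cm.minus_closed[OF zGC zkC]])
      fix x assume x: "x \<in> carrier (X n)"
      have zx: "z (H n (G n x)) \<in> carrier M" "z x \<in> carrier M"
        using x by (simp_all add: MX.C_closed[OF zC] H_cl G_cl)
      have "z (?k n x) = z (H n (G n x)) \<ominus>\<^bsub>M\<^esub> z x"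
        by (rule add_hom_minus[OF bimod_hom_add_hom[OF zh] MX.agX MX.M.abelian_group_axioms H_cl[OF G_cl[OF x]] x])
      moreover have aux: "z (H n (G n x)) \<ominus>\<^bsub>M\<^esub> (z (H n (G n x)) \<ominus>\<^bsub>M\<^esub> z x) = z x"
        using zx by (simp add: a_minus_def MX.M.minus_add MX.M.r_neg2)
      ultimately show "z x = (?zG \<ominus>\<^bsub>MX.C n\<^esub> ?zk) x"
        using x aux by (simp add: MX.C_minus_apply[OF zGC zkC x])
    qed
    then have "z = ?zG \<ominus>\<^bsub>MX.ZZ n\<^esub> ?zk" using MX.ZZ_minus[OF MX.DD_ZZ[OF zG] MX.DD_ZZ[OF zk]] by simp
    then show "z \<in> MX.DD n" using D.D_minus[OF zG zk] by simp
  next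
    fix w assume w: "w \<in> carrier (MP.ZZ n)"
    have wC: "w \<in> carrier (MP.C n)" and dw: "MP.\<delta> n w = \<zero>\<^bsub>MP.C (Suc n)\<^esub>" using w by (auto simp: MP.ZZ_carrier)
    obtain w' where w': "w' \<in> bimod_hom A (Q n) M" "\<And>x. x \<in> carrier (P n) ==> w' (j n x) = w x"
      using extM[of n] MP.C_hom[OF wC] unfolding extends_def by blast
    have w'd: "w' (dQ n q) = \<zero>\<^bsub>M\<^esub>" if q: "q \<in> carrier (Q (Suc n))" for q
    proof (rule eqQ[OF bimod_hom_compose[OF dQ w'(1)] _ _ q])
      show "(\<lambda>q. \<zero>\<^bsub>M\<^esub>) \<in> bimod_hom A (Q (Suc n)) M" by (rule bimod_hom_null[OF M])
      fix x assume x: "x \<in> carrier (P (Suc n))"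
      then show "w' (dQ n (j (Suc n) x)) = \<zero>\<^bsub>M\<^esub>"
        using fun_cong[OF dw, of x] by (simp add: jd w'(2) MP.d_closed MP.\<delta>_apply)
    qed
    \<comment> \<open>Its pullback w' G F differs from w = w' j by w' composed with the
      null-homotopic map \<open>?h\<close>.\<close>
    let ?z = "restrict (\<lambda>x. w' (G n x)) (carrier (X n))"
    have zC: "?z \<in> carrier (MX.C n)" by (rule MX.C_restrict[OF bimod_hom_compose[OF G(2) w'(1)]])
    have "MX.\<delta> n ?z = \<zero>\<^bsub>MX.C (Suc n)\<^esub>"
    proof (rule cochain_eqI[OF MX.\<delta>_closed[OF zC] MX.C_zero])
      fix x assume x: "x \<in> carrier (X (Suc n))"
      then show "MX.\<delta> n ?z x = \<zero>\<^bsub>MX.C (Suc n)\<^esub> x"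
        using w'd[OF G_cl[OF x]] MX.d_closed[OF x] by (simp add: MX.\<delta>_apply G(3)[symmetric])
    qed
    with zC have zZ: "?z \<in> carrier (MX.ZZ n)" by (simp add: MX.ZZ_carrier del: cochains_simps)
    have pC: "pull n ?z \<in> carrier (MP.C n)" by (rule pull_closed[OF M zC])
    have "pull n ?z \<ominus>\<^bsub>MP.C n\<^esub> w \<in> MP.DD n"
    proof (rule MP.null_homotopic_coboundary[where Y = Q and dY = dQ and s = s and h = ?h and y = w'])
      fix x assume x: "x \<in> carrier (P n)"
      have "w' (?h n x) = w' (G n (F n x)) \<ominus>\<^bsub>M\<^esub> w x"
        using add_hom_minus[OF bimod_hom_add_hom[OF w'(1)] agQ MX.M.abelian_group_axioms G_cl[OF F_closed[OF x]] j_cl[OF x]]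
        by (simp add: w'(2)[OF x])
      then show "(pull n ?z \<ominus>\<^bsub>MP.C n\<^esub> w) x = w' (?h n x)"
        using x by (simp add: MP.C_minus_apply[OF pC wC x] compose_eq F_closed)
    next
      show "dQ i \<in> bimod_hom B (Q (Suc i)) (Q i)" for i by (rule bimod_hom_restrict[OF sub dQ])
    qed (use pC wC w'd s bim_B[OF bQ] bimod_hom_restrict[OF sub w'(1)] in simp_all)
    then show "\<exists>z\<in>carrier (MX.ZZ n). pull n z \<ominus>\<^bsub>MP.C n\<^esub> w \<in> MP.DD n"
      using zZ by (intro bexI[of _ ?z])
  qed
qed

section \<open>Entwined and Hochschild cohomology\<close>

locale galois_resolution = galois K C A B \<rho>
  for K :: "'k ring" and C :: "('k, 'c) coalg" and A B :: "('k, 'a) module"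
    and \<rho> :: "'a \<Rightarrow> ('a, 'c) tens" +
  fixes P :: "nat \<Rightarrow> ('k, 'a, 'a, 'p) bimod" and d :: "nat \<Rightarrow> 'p \<Rightarrow> 'p" and \<epsilon> :: "'p \<Rightarrow> 'a"
  assumes res: "projective_resolution TYPE('f) K B (regular B) P d \<epsilon>"
begin

abbreviation "XX \<equiv> entwined_bar K A C \<psi>"
abbreviation "Xd \<equiv> entwined_bar_diff K A C \<psi>"

lemma X_eq: "X.X n = XX n" "X.Xd n = Xd n"
  by (simp_all add: entwined_bar_def entwined_bar_diff_def)

lemmas X_bicomplex = X.X_bicomplex[unfolded X_eq] and X_exact_pos = X.X_exact_pos[unfolded X_eq]
  and X_bilift = X.X_bilift[unfolded X_eq] and X_exact_0 = X.X_exact_0[unfolded X_eq]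
  and X_aug_hom = X.X_aug_bimod_hom[unfolded X_eq] and X_aug_Xd = X.X_aug_Xd[unfolded X_eq]
  and X_unit_hom = X.X_unit_hom[unfolded X_eq]

lemma resolves_P: "resolves K B P d \<epsilon>"
  by (rule projective_resolution_resolves[OF res])

lemma P_bicomplex: "bicomplex K B P d" and \<epsilon>_hom: "\<epsilon> \<in> bimod_hom B (P 0) (regular B)"
  and \<epsilon>_onto: "\<epsilon> ` carrier (P 0) = carrier B"
  and P_exact_0: "d 0 ` carrier (P 1) = {x \<in> carrier (P 0). \<epsilon> x = \<zero>\<^bsub>B\<^esub>}"
  using resolves_P by (auto simp: resolves_def)

lemma P_bilift:
  fixes Y :: "('k, 'a, 'a, 'y) bimod" and Z :: "('k, 'a, 'a, 'z) bimod"
  assumes "bim K B B Y" "bim K B B Z"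
  shows "bilift B (P n) Y Z"
proof -
  have "projective_bimodule TYPE('f) K B (P n)" using res by (simp add: projective_resolution_def)
  from projective_bilift[OF algB this assms] show ?thesis .
qed

lemma bim_B: "bim K A A M ==> bim K B B M"
  by (rule bim_restrict_left[OF subalg_B bim_restrict_right[OF subalg_B]])

lemma \<epsilon>_closed: "x \<in> carrier (P 0) ==> \<epsilon> x \<in> carrier B"
  using bimod_hom_closed[OF \<epsilon>_hom] by simp

lemmas lT = bim_left[OF bim_T] and rT = bim_right[OF bim_T] and agT = bim_abelian_group[OF bim_T]

text \<open>Since e commutes with B, x \<mapsto> \<epsilon>(x) e is B-bilinear and can be lifted
  through \<open>X_aug\<close>, which is onto by its section \<open>X_unit\<close>. Regarded over B,
  the entwined complex remains exact, so the lift continues to a chain map.\<close>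

lemma comparison_exists:
  obtains F where "comparison K A B XX Xd P d F"
    "\<And>x. x \<in> carrier (P 0) ==> X.X_aug (F 0 x) = lact T (\<epsilon> x) unit_T"
proof -
  note XB = X_bicomplex and bX = bicomplexD(1)[OF X_bicomplex]
  have XB: "bicomplex K B XX Xd"
    using X_bicomplex by (simp add: bicomplex_def bim_B bimod_hom_restrict[OF subalg_B])
  have e: "(\<lambda>x. lact T (\<epsilon> x) unit_T) \<in> bimod_hom B (P 0) T"
    using bimod_homD[OF \<epsilon>_hom] \<epsilon>_closed unit_T_closed B_A
    by (intro bimod_homI add_homI) (simp_all add: lact_closed[OF lT] lact_add_left[OF lT] lact_mult[OF lT] unit_T_central[symmetric]
      bim_comm[OF bim_T] B_simps)
  have on: "lact T (\<epsilon> x) unit_T \<in> X.X_aug ` carrier (XX 0)" if "x \<in> carrier (P 0)" for x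
  proof -
    have t: "lact T (\<epsilon> x) unit_T \<in> carrier T" using bimod_hom_closed[OF e that] .
    show ?thesis
      by (rule image_eqI[of _ _ "X.X_unit (lact T (\<epsilon> x) unit_T)"])
         (use t X.X_aug_unit add_hom_closed[OF X_unit_hom t] in simp_all)
  qed
  obtain f0 where f0: "f0 \<in> bimod_hom B (P 0) (XX 0)"
    "\<And>x. x \<in> carrier (P 0) ==> X.X_aug (f0 x) = lact T (\<epsilon> x) unit_T"
    by (rule bilift_obtain[OF P_bilift[OF bim_B[OF bX] bim_B[OF bim_T]] e bimod_hom_restrict[OF subalg_B X_aug_hom] on])
      (assumption | (rule that; assumption))+
  have st: "f0 (d 0 x) \<in> Xd 0 ` carrier (XX (Suc 0))" if x: "x \<in> carrier (P (Suc 0))" for x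
  proof (rule X_exact_0)
    have dx: "d 0 x \<in> carrier (P 0)" "\<epsilon> (d 0 x) = \<zero>\<^bsub>A\<^esub>" using P_exact_0 x by (auto simp: B_simps)
    then show "f0 (d 0 x) \<in> carrier (XX 0)" using bimod_hom_closed[OF f0(1)] by simp
    have "lact T \<zero>\<^bsub>A\<^esub> unit_T = \<zero>\<^bsub>T\<^esub>"
      by (rule add_hom_zero[where f = "\<lambda>a. lact T a unit_T", OF _ A.abelian_group_axioms agT])
         (auto intro!: add_homI simp: unit_T_closed lact_closed[OF lT] lact_add_left[OF lT])
    then show "X.X_aug (f0 (d 0 x)) = \<zero>\<^bsub>T\<^esub>" using dx by (simp add: f0(2))
  qed
  obtain F where F: "F 0 = f0" "\<And>n. F n \<in> bimod_hom B (P n) (XX n)"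
    "\<And>n x. x \<in> carrier (P (Suc n)) ==> Xd n (F (Suc n) x) = F n (d n x)"
    by (rule chain_map_exists[OF P_bicomplex XB X_exact_pos P_bilift[OF bim_B[OF bX] bim_B[OF bX]] f0(1) st])
      (assumption | (rule that; assumption))+
  show thesis
  proof (rule that)
    show "comparison K A B XX Xd P d F"
      using subalg_B X_bicomplex P_bicomplex F(2,3) by (simp add: comparison_def)
    show "X.X_aug (F 0 x) = lact T (\<epsilon> x) unit_T" if "x \<in> carrier (P 0)" for x
      using that by (simp add: F(1) f0(2))
  qed
qed

section \<open>Degree 0: elements commuting with B\<close>

lemma unit_T_generates:
  assumes M: "bim K A A M" and z: "z \<in> bimod_hom A T M" and z0: "z unit_T = \<zero>\<^bsub>M\<^esub>" and t: "t \<in> carrier T"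
  shows "z t = \<zero>\<^bsub>M\<^esub>"
proof -
  note agM = bim_abelian_group[OF M] and zD = bimod_homD[OF z]
  have \<beta>T: "\<beta> \<in> add_hom U T" using \<beta>_hom by (simp add: add_hom_def T_simps(1,2))
  have "lact M a \<zero>\<^bsub>M\<^esub> = \<zero>\<^bsub>M\<^esub>" "ract M \<zero>\<^bsub>M\<^esub> a = \<zero>\<^bsub>M\<^esub>" if "a \<in> carrier A" for a
    using add_hom_zero[OF lact_add_hom[OF bim_left[OF M] that] agM agM] add_hom_zero[OF ract_add_hom[OF bim_right[OF M] that] agM agM]
    by auto
  then have "z (\<beta> u) = \<zero>\<^bsub>M\<^esub>" if "u \<in> carrier U" for u
    by (intro U.tensor_ext[OF add_hom_compose[OF \<beta>T zD(1)] add_hom_null[OF agM] agM _ that])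
       (use z0 in \<open>simp add: \<beta>_unit zD unit_T_closed lact_closed[OF lT]\<close>)
  from this[of "\<beta>' t"] show ?thesis using \<beta>'(1,2)[of t] t by (simp add: T_simps(1))
qed

text \<open>Evaluation at \<open>unit_T\<close> identifies the bimodule maps from T to M with the
  elements of M commuting with B. Under \<beta> the element is 1 \<otimes> 1, and a \<otimes> a'
  \<mapsto> a m a' is balanced because m commutes with B; \<open>unit_T_generates\<close> gives
  uniqueness.\<close>

lemma extend_central:
  assumes M: "bim K A A M" and m: "m \<in> carrier M" and c: "\<And>b. b \<in> carrier B ==> lact M b m = ract M m b"
  obtains z where "z \<in> bimod_hom A T M" "z unit_T = m"
proof -
  note agM = bim_abelian_group[OF M] and lM = bim_left[OF M] and rM = bim_right[OF M]
  have bal: "balanced (carrier B) (regular A) (regular A) M (\<lambda>a a'. ract M (lact M a m) a')"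
    using m c by (intro balancedI) (simp_all add: lact_closed[OF lM] ract_closed[OF rM] lact_add_left[OF lM] ract_add[OF rM]
      ract_add_right[OF rM] lact_mult[OF lM] ract_mult[OF rM] bim_comm[OF M] B_A)
  let ?\<zeta> = "lift_hom M (\<lambda>(a, a'). ract M (lact M a m) a')"
  note \<zeta> = U.lift[OF agM bal, simplified]
  have \<zeta>l: "?\<zeta> (lact U b u) = lact M b (?\<zeta> u)" if b: "b \<in> carrier A" and u: "u \<in> carrier U" for b u
    by (rule U.tensor_ext[OF add_hom_compose[OF U.lact_hom[OF b] \<zeta>(1)] add_hom_compose[OF \<zeta>(1) lact_add_hom[OF lM b]] agM _ u])
       (use b m in \<open>simp add: U.lact_ptens \<zeta> lact_mult[OF lM] lact_closed[OF lM] bim_comm[OF M]\<close>)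
  have \<zeta>r: "?\<zeta> (ract U u b) = ract M (?\<zeta> u) b" if b: "b \<in> carrier A" and u: "u \<in> carrier U" for b u
    by (rule U.tensor_ext[OF add_hom_compose[OF U.ract_hom[OF b] \<zeta>(1)] add_hom_compose[OF \<zeta>(1) ract_add_hom[OF rM b]] agM _ u])
       (use b m in \<open>simp add: U.ract_ptens \<zeta> ract_mult[OF rM] lact_closed[OF lM]\<close>)
  have \<beta>'T: "\<beta>' \<in> add_hom T U" using \<beta>'_hom by (simp add: add_hom_def T_simps(1,2))
  have \<beta>'r: "\<beta>' (ract T t b) = ract U (\<beta>' t) b" if "b \<in> carrier A" "t \<in> carrier T" for b t
    using that \<beta>'(1,2)[of t] by (intro \<beta>'_eq) (simp_all add: T_simps(1) \<beta>_ract ract_closed[OF rU])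
  have "(\<lambda>t. ?\<zeta> (\<beta>' t)) \<in> bimod_hom A T M"
    by (rule bimod_homI[OF add_hom_compose[OF \<beta>'T \<zeta>(1)]])
       (simp_all add: \<beta>'r \<zeta>l \<zeta>r \<beta>' \<beta>'_lact T_simps(1,5))
  moreover have "\<beta>' unit_T = ut \<one>\<^bsub>A\<^esub> \<one>\<^bsub>A\<^esub>"
    using \<beta>_unit[of "\<one>\<^bsub>A\<^esub>" "\<one>\<^bsub>A\<^esub>"] unit_T_closed
    by (intro \<beta>'_eq U.ptens_closed) (simp_all add: lact_one[OF lT] ract_one[OF rT])
  then have "?\<zeta> (\<beta>' unit_T) = m" using m by (simp add: \<zeta> lact_one[OF lM] ract_one[OF rM])
  ultimately show thesis by (rule that)
qed

text \<open>A cocycle on the entwined side is a bimodule map on T composed with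
  \<open>X_aug\<close>, a cocycle on P is x \<mapsto> \<epsilon>(x) m with m commuting with B. Both
  are thus determined by such an element m, the value at \<open>unit_T\<close> or at a preimage p of
  1.\<close>

lemma degree_0_bij:
  fixes M :: "('k, 'a, 'a, 'm) bimod"
  assumes F: "comparison K A B XX Xd P d F"
    and F0: "\<And>x. x \<in> carrier (P 0) ==> X.X_aug (F 0 x) = lact T (\<epsilon> x) unit_T" and M: "bim K A A M"
  shows "bij_betw (comparison.\<Phi> B P d F 0 M) (carrier (cohomology A XX Xd 0 M)) (carrier (cohomology B P d 0 M))"
proof -
  interpret F: comparison K A B XX Xd P d F by (rule F)
  interpret MX: coch K A XX Xd M by (rule F.coch_X[OF M])
  interpret MP: coch K B P d M by (rule F.coch_P[OF M])
  note agM = bim_abelian_group[OF M]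
  let ?\<alpha> = "X.X_aug"
  note \<alpha> = bimod_homD[OF X_aug_hom]
  obtain p where p: "p \<in> carrier (P 0)" "\<epsilon> p = \<one>\<^bsub>A\<^esub>"
  proof -
    interpret Br: ring B by (rule k_algebra_ring[OF algB])
    have "\<one>\<^bsub>B\<^esub> \<in> \<epsilon> ` carrier (P 0)" using \<epsilon>_onto by simp
    then show thesis using that by (auto simp: B_simps)
  qed
  note eps_cong = MP.cocycle_cong[OF _ bimod_hom_add_hom[OF \<epsilon>_hom] bim_abelian_group[OF bim_regular[OF algB]]]
  have exP: "x \<in> d 0 ` carrier (P (Suc 0))" if "x \<in> carrier (P 0)" "\<epsilon> x = \<zero>\<^bsub>regular B\<^esub>" for x
    using P_exact_0 that by simp
  show ?thesis
  proof (rule F.\<Phi>_bij[OF M])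
    fix z assume z: "z \<in> carrier (MX.ZZ 0)" and pz: "compose (carrier (P 0)) z (F 0) \<in> MP.DD 0"
    have zC: "z \<in> carrier (MX.C 0)" and dz: "MX.\<delta> 0 z = \<zero>\<^bsub>MX.C (Suc 0)\<^esub>" using z by (auto simp: MX.ZZ_carrier)
    note zh = bimod_homD[OF MX.C_hom[OF zC]]
    note cong = MX.cocycle_cong[OF z \<alpha>(1) agT X_exact_0]
    have ucl: "X.X_unit t \<in> carrier (XX 0)" if "t \<in> carrier T" for t using add_hom_closed[OF X_unit_hom that] .
    \<comment> \<open>\<open>X_unit\<close> is only additive here, but z does not distinguish points
      with the same augmentation, so the composite is bilinear.\<close>
    let ?z = "\<lambda>t. z (X.X_unit t)"
    have z': "?z \<in> bimod_hom A T M"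
    proof (rule bimod_homI[OF add_hom_compose[OF X_unit_hom zh(1)]])
      fix a t assume a: "a \<in> carrier A" and t: "t \<in> carrier T"
      have "?z (lact T a t) = z (lact (XX 0) a (X.X_unit t))"
        by (rule cong) (use a t ucl in \<open>simp_all add: lact_closed[OF lT] lact_closed[OF bim_left[OF MX.bX]] \<alpha> X.X_aug_unit\<close>)
      then show "?z (lact T a t) = lact M a (?z t)" using a ucl[OF t] by (simp add: zh)
      have "?z (ract T t a) = z (ract (XX 0) (X.X_unit t) a)"
        by (rule cong) (use a t ucl in \<open>simp_all add: ract_closed[OF rT] ract_closed[OF bim_right[OF MX.bX]] \<alpha> X.X_aug_unit\<close>)
      then show "?z (ract T t a) = ract M (?z t) a" using a ucl[OF t] by (simp add: zh)
    qed
    have "?z unit_T = z (F 0 p)"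
      by (rule cong) (use p unit_T_closed ucl in \<open>simp_all add: F.F_closed F0 X.X_aug_unit lact_one[OF lT]\<close>)
    also have "\<dots> = \<zero>\<^bsub>M\<^esub>"
    proof -
      have "compose (carrier (P 0)) z (F 0) = \<zero>\<^bsub>MP.C 0\<^esub>" using pz by (simp add: coboundaries_def del: cochains_simps)
      from fun_cong[OF this, of p] p show ?thesis by (simp add: compose_eq)
    qed
    finally have e0: "?z unit_T = \<zero>\<^bsub>M\<^esub>" .
    have "z x = \<zero>\<^bsub>M\<^esub>" if x: "x \<in> carrier (XX 0)" for x
    proof -
      have "z x = ?z (?\<alpha> x)" by (rule cong) (use x ucl \<alpha>(2) X.X_aug_unit in simp_all)
      then show ?thesis using unit_T_generates[OF M z' e0 \<alpha>(2)[OF x]] by simp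
    qed
    then have "z = \<zero>\<^bsub>MX.C 0\<^esub>" by (intro cochain_eqI[OF zC MX.C_zero]) simp
    then show "z \<in> MX.DD 0" by (simp add: coboundaries_def)
  next
    fix w assume w: "w \<in> carrier (MP.ZZ 0)"
    have wC: "w \<in> carrier (MP.C 0)" using w by (auto simp: MP.ZZ_carrier)
    note wh = bimod_homD[OF MP.C_hom[OF wC]] and bP = MP.bX[of 0] and \<epsilon>D = bimod_homD[OF \<epsilon>_hom]
    \<comment> \<open>b p and p b both have augmentation b, so the cocycle takes the same value on
      them.\<close>
    have "lact M b (w p) = ract M (w p) b" if b: "b \<in> carrier B" for b
    proof -
      have "w (lact (P 0) b p) = w (ract (P 0) p b)"
        by (rule eps_cong[OF w exP])
           (use b p B_A in \<open>simp_all add: lact_closed[OF bim_left[OF bP]] ract_closed[OF bim_right[OF bP]] \<epsilon>D B_simps\<close>)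
      then show ?thesis using b p by (simp add: wh)
    qed
    then obtain y where y: "y \<in> bimod_hom A T M" "y unit_T = w p"
      using extend_central[OF M wh(2)[OF p(1)]] by blast
    \<comment> \<open>A cocycle because \<open>X_aug\<close> vanishes on boundaries; its pullback is
      w, as both send x to \<epsilon>(x) w(p).\<close>
    let ?z = "restrict (\<lambda>x. y (?\<alpha> x)) (carrier (XX 0))"
    have zC: "?z \<in> carrier (MX.C 0)" by (rule MX.C_restrict[OF bimod_hom_compose[OF X_aug_hom y(1)]])
    have "MX.\<delta> 0 ?z = \<zero>\<^bsub>MX.C (Suc 0)\<^esub>"
      by (rule cochain_eqI[OF MX.\<delta>_closed[OF zC] MX.C_zero])
         (use bimod_hom_zero[OF y(1) bim_T M] in \<open>simp add: MX.\<delta>_apply MX.d_closed X_aug_Xd\<close>)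
    with zC have zZ: "?z \<in> carrier (MX.ZZ 0)" by (simp add: MX.ZZ_carrier del: cochains_simps)
    have "compose (carrier (P 0)) ?z (F 0) = w"
    proof (rule cochain_eqI[OF F.pull_closed[OF M zC] wC])
      fix x assume x: "x \<in> carrier (P 0)"
      have ex: "\<epsilon> x \<in> carrier B" "\<epsilon> x \<in> carrier A" using \<epsilon>_closed[OF x] B_A by auto
      have "w x = w (lact (P 0) (\<epsilon> x) p)"
        by (rule eps_cong[OF w exP x]) (use ex p in \<open>simp_all add: lact_closed[OF bim_left[OF bP]] \<epsilon>D B_simps\<close>)
      also have "\<dots> = y (?\<alpha> (F 0 x))" using ex p x by (simp add: wh F0 bimod_hom_lact[OF y(1)] unit_T_closed y(2))
      finally show "compose (carrier (P 0)) ?z (F 0) x = w x" using x by (simp add: compose_eq F.F_closed)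
    qed
    then have "compose (carrier (P 0)) ?z (F 0) \<ominus>\<^bsub>MP.C 0\<^esub> w = \<zero>\<^bsub>MP.C 0\<^esub>" using MP.Cm.minus_self[OF wC] by simp
    then show "\<exists>z\<in>carrier (MX.ZZ 0). compose (carrier (P 0)) z (F 0) \<ominus>\<^bsub>MP.C 0\<^esub> w \<in> MP.DD 0"
      using zZ by (intro bexI[of _ ?z]) (simp_all add: coboundaries_def del: cochains_simps)
  qed
qed

text \<open>Flatness enters through the induced resolution of T, with \<open>unit_T\<close> as its
  central element. The bilinear liftings come from the entwined bar complex, the B-bilinear ones
  from projectivity of P.\<close>

lemma flat_bij:
  fixes M :: "('k, 'a, 'a, 'm) bimod"
  assumes F: "comparison K A B XX Xd P d F"
    and F0: "\<And>x. x \<in> carrier (P 0) ==> X.X_aug (F 0 x) = lact T (\<epsilon> x) unit_T" and M: "bim K A A M"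
    and flat: "left_flat TYPE('a chain) K B (regular A) \<or>
      right_flat TYPE('a chain) K B (regular A)"
  shows "bij_betw (comparison.\<Phi> B P d F n M) (carrier (cohomology A XX Xd n M)) (carrier (cohomology B P d n M))"
proof -
  have c: "central_bij A B T unit_T"
    using unit_T_closed unit_T_central T_bij by (simp add: central_bij_def)
  note bX = bicomplexD(1)[OF X_bicomplex]
  obtain Q :: "nat \<Rightarrow> ('k, 'a, 'a, (('a, 'p) tens, 'a) tens) bimod" and dQ \<epsilon>Q j
    where ir: "induced_resolution K A B P d \<epsilon> T unit_T Q dQ \<epsilon>Q j"
      and ext: "\<And>n (M :: ('k, 'a, 'a, 'm) bimod). bim K A A M ==> extends A B (P n) (Q n) (j n) M"
        "\<And>n (M :: ('k, 'a, 'a, (('a, 'c) tens, 'a chain) tens) bimod).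
          bim K A A M ==> extends A B (P n) (Q n) (j n) M"
    apply (rule induced_resolution_exists[where 'm = 'm and 'x = "(('a, 'c) tens, 'a chain) tens", OF field_K subalg_B res bim_T c flat])
    apply (rule that; assumption)
    done
  have bQ: "bim K A A (Q n)" for n using ir by (simp add: induced_resolution_def bicomplex_def)
  show ?thesis
    by (rule comparison.induced_bij[OF F bim_T M ir X_exact_pos X_aug_hom X_aug_Xd X_exact_0 F0
          X_bilift[OF bQ bim_T] X_bilift[OF bQ bQ] X_bilift[OF bX bX] P_bilift[OF bim_B[OF bQ] bim_B[OF bQ]]
          ext(1)[OF M] ext(2)[OF bX]])
qed

end

theorem mainTheorem1:
  fixes K :: "'k ring"
    and C :: "('k, 'c) coalg"
    and A B :: "('k, 'a) module"
    and \<rho> :: "'a \<Rightarrow> ('a \<times> 'c \<Rightarrow>\<^sub>0 int) set"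
    and P :: "nat \<Rightarrow> ('k, 'a, 'a, 'p) bimod"
    and d :: "nat \<Rightarrow> 'p \<Rightarrow> 'p"
    and \<epsilon> :: "'p \<Rightarrow> 'a"
    and \<psi> :: "('c \<times> 'a \<Rightarrow>\<^sub>0 int) set \<Rightarrow> ('a \<times> 'c \<Rightarrow>\<^sub>0 int) set"
  assumes "field K"
    and "coalgebra K C"
    and "galois_extension K C A \<rho> B"
    and "\<psi> = canonical_entwining K C A \<rho> B"
    and "projective_resolution TYPE('f) K B (regular B) P d \<epsilon>"
  shows
    "(\<exists>\<Phi> :: ('k, 'a, 'a, 'm) bimod \<Rightarrow> _.
        natural_iso K A
          (cohomology A (entwined_bar K A C \<psi>) (entwined_bar_diff K A C \<psi>) 0)
          (cohomology_map A (entwined_bar K A C \<psi>) (entwined_bar_diff K A C \<psi>) 0)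
          (cohomology B P d 0)
          (cohomology_map B P d 0) \<Phi>)
     \<and>
     (left_flat TYPE(('a list \<Rightarrow>\<^sub>0 int) set) K B (regular A) \<or>
      right_flat TYPE(('a list \<Rightarrow>\<^sub>0 int) set) K B (regular A) \<longrightarrow>
      (\<exists>\<Phi> :: nat \<Rightarrow> ('k, 'a, 'a, 'm) bimod \<Rightarrow> _.
        delta_functor_iso K A
          (cohomology A (entwined_bar K A C \<psi>) (entwined_bar_diff K A C \<psi>))
          (cohomology_map A (entwined_bar K A C \<psi>) (entwined_bar_diff K A C \<psi>))
          (connecting A (entwined_bar K A C \<psi>) (entwined_bar_diff K A C \<psi>))
          (cohomology B P d)
          (cohomology_map B P d)
          (connecting B P d) \<Phi>))"
proof -
  interpret galois_resolution K C A B \<rho> P d \<epsilon>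
    using assms by (intro galois_resolution.intro galois.intro galois_resolution_axioms.intro)
  have \<psi>: "\<psi> = canonical_entwining K C A \<rho> B" by fact
  obtain F where F: "comparison K A B XX Xd P d F"
    and F0: "\<And>x. x \<in> carrier (P 0) \<Longrightarrow> X.X_aug (F 0 x) = lact T (\<epsilon> x) unit_T"
    by (rule comparison_exists) (rule that; assumption)
  interpret F: comparison K A B XX Xd P d F by (rule F)
  note bim = bimodule_bim[THEN iffD1]
  \<comment> \<open>Linearity and naturality of the comparison hold in every degree; bijectivity is
    the one input that distinguishes degree 0 from the flat case.\<close>
  have nat: "natural_iso K A (cohomology A XX Xd n) (cohomology_map A XX Xd n)
      (cohomology B P d n) (cohomology_map B P d n) (F.\<Phi> n :: ('k, 'a, 'a, 'm) bimod \<Rightarrow> _)"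
    if "\<And>M :: ('k, 'a, 'a, 'm) bimod. bim K A A M \<Longrightarrow>
      bij_betw (F.\<Phi> n M) (carrier (cohomology A XX Xd n M)) (carrier (cohomology B P d n M))" for n
    unfolding natural_iso_def bimodule_bim
    using that F.\<Phi>_linear F.\<Phi>_natural by blast
  have "delta_functor_iso K A (cohomology A XX Xd) (cohomology_map A XX Xd) (connecting A XX Xd)
      (cohomology B P d) (cohomology_map B P d) (connecting B P d)
      (F.\<Phi> :: nat \<Rightarrow> ('k, 'a, 'a, 'm) bimod \<Rightarrow> _)"
    if "left_flat TYPE(('a list \<Rightarrow>\<^sub>0 int) set) K B (regular A) \<or>
      right_flat TYPE(('a list \<Rightarrow>\<^sub>0 int) set) K B (regular A)"
    unfolding delta_functor_iso_def
  proof (intro conjI allI impI ballI)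
    show "natural_iso K A (cohomology A XX Xd n) (cohomology_map A XX Xd n)
      (cohomology B P d n) (cohomology_map B P d n) (F.\<Phi> n :: ('k, 'a, 'a, 'm) bimod \<Rightarrow> _)" for n
      by (rule nat[OF flat_bij[OF F F0 _ that]])
  next
    fix n f g and L M N :: "('k, 'a, 'a, 'm) bimod" and \<xi>
    assume *: "bimodule K A L \<and> bimodule K A M \<and> bimodule K A N \<and> short_exact A L f M g N"
      and \<xi>: "\<xi> \<in> carrier (cohomology A XX Xd n N)"
    then have b: "bim K A A L" "bim K A A M" "bim K A A N" by (simp_all add: bimodule_bim)
    show "F.\<Phi> (Suc n) L (connecting A XX Xd n L f M g N \<xi>) = connecting B P d n L f M g N (F.\<Phi> n N \<xi>)"
      by (rule F.\<Phi>_connecting[OF b _ X_bilift[OF b(2,3)] P_bilift[OF bim_B[OF b(2)] bim_B[OF b(3)]] \<xi>]) (use * in simp)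
  qed
  then show ?thesis
    unfolding \<psi> using nat[OF degree_0_bij[OF F F0]] by blast
qed

end
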